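(* Let $r>3$. There exists $\delta>0$ such that for all $(c,a)\in\mathcal{P}_{\lambda}$ with $0<|a|<\delta$ there is a homeomorphism $\Phi:J_{P}\times\mathbb{D}_{r}\to J^{+}\cap V$ with $H_{c,a}\circ\Phi=\Phi\circ\psi$, where $\psi(\zeta,z)=\left(P(\zeta),\ a\zeta-\frac{a^{2}z}{P'(\zeta)}\right)$, and $\Phi$ extends (via the natural inclusion $x\mapsto[(x,0)]$ of $J_{P}\times\mathbb{D}_{r}$ in the inductive limit) to a homeomorphism $$\check{\Phi}:\varinjlim(J_{P}\times\mathbb{D}_{r},\psi)\to J^{+}$$ such that $$H_{c,a}\circ\check{\Phi}=\check{\Phi}\circ\check{\psi}.$$
   Context: Let $p/q$ be a rational number in lowest terms ($q\ge 1$), $\lambda=e^{2\pi i p/q}$, and $c_{0}=\frac{\lambda}{2}-\frac{\lambda^{2}}{4}$; the polynomial $P(x)=x^{2}+c_{0}$ has the parabolic fixed point $\lambda/2$ of multiplier $\lambda$. $J_{P}$ denotes the Julia set of $P$. For $c,a\in\mathbb{C}$, $a\neq 0$, the complex Hénon map is $H_{c,a}(x,y)=(x^{2}+c+ay,\ ax)$, an automorphism of $\mathbb{C}^{2}$. $K^{+}$ is the set of points of $\mathbb{C}^{2}$ with bounded forward orbit under $H_{c,a}$, and $J^{+}=\partial K^{+}$. The curve $\mathcal{P}_{\lambda}\subset\mathbb{C}^{2}$ is the set of parameters $(c,a)$ for which $H_{c,a}$ has a fixed point at which the derivative has an eigenvalue $\lambda$; explicitly $$\mathcal{P}_{\lambda}=\left\{(c,a)\in\mathbb{C}^2:\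 c=(1-a^{2})\left(\tfrac{\lambda}{2}-\tfrac{a^{2}}{2\lambda}\right)-\left(\tfrac{\lambda}{2}-\tfrac{a^{2}}{2\lambda}\right)^{2}\right\}.$$ $\mathbb{D}_{r}=\{z\in\mathbb{C}:|z|<r\}$ and $V=\mathbb{D}_{r}\times\mathbb{D}_{r}$. For an open injective (continuous) map $f:X\to X$, the inductive limit is $\varinjlim(X,f)=(X\times\mathbb{N})/\sim$, where $\sim$ is the equivalence relation generated by $(x,n)\sim(f(x),n+1)$, with the quotient topology ($X$ being identified with the classes of points $(x,0)$). It carries the bijection $\check{f}:\varinjlim(X,f)\to\varinjlim(X,f)$, $[(x,n)]\mapsto[(f(x),n)]$. *)

theory Defs
  imports "HOL-Analysis.Analysis"
begin

definition bounded_orbits :: "('a::metric_space \<Rightarrow> 'a) \<Rightarrow> 'a set" where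
  "bounded_orbits f = {z. bounded (range (\<lambda>n. (f ^^ n) z))}"

text \<open>Meant for polynomials of degree at least two: their Julia set is the boundary of the
  filled Julia set.\<close>

definition julia_set :: "(complex \<Rightarrow> complex) \<Rightarrow> complex set" where
  "julia_set P = frontier (bounded_orbits P)"

definition parabolic_poly :: "complex \<Rightarrow> complex \<Rightarrow> complex" where
  "parabolic_poly l x = x^2 + (l / 2 - l^2 / 4)"

definition henon :: "complex \<Rightarrow> complex \<Rightarrow> complex \<times> complex \<Rightarrow> complex \<times> complex" where
  "henon c a = (\<lambda>(x, y). (x^2 + c + a * y, a * x))"

definition K_plus :: "complex \<Rightarrow> complex \<Rightarrow> (complex \<times> complex) set" where
  "K_plus c a = bounded_orbits (henon c a)"

definition J_plus :: "complex \<Rightarrow> complex \<Rightarrow> (complex \<times> complex) set" where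
  "J_plus c a = frontier (K_plus c a)"

text \<open>The derivative below is formally only real linear; as the Henon map is holomorphic it is the
  complex derivative, so the condition says that \<open>l\<close> is one of its complex eigenvalues.
  The explicit equation of the curve is lemma \<open>mem_param_curve_iff\<close>.\<close>

definition param_curve :: "complex \<Rightarrow> (complex \<times> complex) set" where
  "param_curve l = {(c, a). \<exists>w D. henon c a w = w \<and> (henon c a has_derivative D) (at w) \<and>
     (\<exists>v. v \<noteq> 0 \<and> D v = (l * fst v, l * snd v))}"

definition model_map :: "(complex \<Rightarrow> complex) \<Rightarrow> complex \<Rightarrow> complex \<times> complex \<Rightarrow> complex \<times> complex" where
  "model_map P a = (\<lambda>(\<zeta>, z). (P \<zeta>, a * \<zeta> - a^2 * z / deriv P \<zeta>))"

lemma deriv_parabolic_poly: "deriv (parabolic_poly l) x = 2 * x"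
  unfolding parabolic_poly_def
  by (rule DERIV_imp_deriv) (auto intro!: derivative_eq_intros)

lemma has_derivative_henon:
  "(henon c a has_derivative (\<lambda>v. (2 * x * fst v + a * snd v, a * fst v))) (at (x, y))"
proof -
  have "henon c a = (\<lambda>w. (fst w ^ 2 + c + a * snd w, a * fst w))"
    by (auto simp: henon_def)
  then show ?thesis
    by (auto intro!: derivative_eq_intros simp: algebra_simps)
qed

lemma mem_param_curve_iff:
  assumes "l \<noteq> 0"
  shows "(c, a) \<in> param_curve l \<longleftrightarrow>
    c = (1 - a^2) * (l / 2 - a^2 / (2 * l)) - (l / 2 - a^2 / (2 * l))^2"
    (is "?L \<longleftrightarrow> c = ?R")
proof
  assume ?L
  then obtain x y D v where fp: "henon c a (x, y) = (x, y)"
    and D: "(henon c a has_derivative D) (at (x, y))"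
    and v: "v \<noteq> 0" "D v = (l * fst v, l * snd v)"
    by (auto simp: param_curve_def)
  have "D = (\<lambda>v. (2 * x * fst v + a * snd v, a * fst v))"
    using D has_derivative_henon has_derivative_unique by blast
  then have e: "2 * x * fst v + a * snd v = l * fst v" "a * fst v = l * snd v"
    using v(2) by auto
  have nz: "fst v \<noteq> 0"
    using e(2) v(1) assms by (auto simp: prod_eq_iff)
  have "l * (2 * x * fst v + a * snd v) = l * (l * fst v)"
    using e(1) by simp
  then have "(2 * l * x + a^2) * fst v = l^2 * fst v"
    using e(2) by (simp add: power2_eq_square algebra_simps) 
  then have "2 * l * x + a^2 = l^2"
    using nz by simp
  then have x: "x = l / 2 - a^2 / (2 * l)"
    using assms by (simp add: field_simps power2_eq_square)
  have "x^2 + c + a * y = x" "a * x = y"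
    using fp by (auto simp: henon_def)
  then have "c = (1 - a^2) * x - x^2"
    by (auto simp: power2_eq_square algebra_simps)
  then show "c = ?R" using x by simp
next
  assume c: "c = ?R"
  define x where "x = l / 2 - a^2 / (2 * l)"
  have "henon c a (x, a * x) = (x, a * x)"
    unfolding c by (simp add: henon_def flip: x_def) (simp add: power2_eq_square algebra_simps)
  moreover have "(2 * x * fst v + a * snd v, a * fst v) = (l * fst v, l * snd v)" 
    if "v = (l, a)" for v
    using that assms by (simp add: x_def field_simps power2_eq_square)
  moreover have "(l, a) \<noteq> 0" using assms by (simp add: zero_prod_def)
  ultimately show ?L
    unfolding param_curve_def using has_derivative_henon[of c a x "a * x"] by blast
qed

definition quotient_topology :: "'a topology \<Rightarrow> ('a \<times> 'a) set \<Rightarrow> 'a set topology" where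
  "quotient_topology X r =
     topology (\<lambda>U. U \<subseteq> topspace X // r \<and> openin X {x \<in> topspace X. r `` {x} \<in> U})"

definition ind_lim_pre :: "'a topology \<Rightarrow> ('a \<times> nat) topology" where
  "ind_lim_pre X = prod_topology X (discrete_topology UNIV)"

definition ind_lim_rel :: "'a topology \<Rightarrow> ('a \<Rightarrow> 'a) \<Rightarrow> (('a \<times> nat) \<times> ('a \<times> nat)) set" where
  "ind_lim_rel X f = {(p, q). p \<in> topspace X \<times> UNIV \<and> q \<in> topspace X \<times> UNIV \<and>
     equivclp (\<lambda>(x, n) (y, m). x \<in> topspace X \<and> y = f x \<and> m = Suc n) p q}"

definition ind_lim :: "'a topology \<Rightarrow> ('a \<Rightarrow> 'a) \<Rightarrow> ('a \<times> nat) set topology" where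
  "ind_lim X f = quotient_topology (ind_lim_pre X) (ind_lim_rel X f)"

definition ind_lim_class :: "'a topology \<Rightarrow> ('a \<Rightarrow> 'a) \<Rightarrow> 'a \<times> nat \<Rightarrow> ('a \<times> nat) set" where
  "ind_lim_class X f p = ind_lim_rel X f `` {p}"

text \<open>The induced self-map of the inductive limit, with the usual union idiom for functions on a
  quotient; see lemma \<open>ind_lim_map_class\<close>.\<close>

definition ind_lim_map :: "'a topology \<Rightarrow> ('a \<Rightarrow> 'a) \<Rightarrow> ('a \<times> nat) set \<Rightarrow> ('a \<times> nat) set" where
  "ind_lim_map X f C = (\<Union>(x, n)\<in>C. ind_lim_class X f (f x, n))"

lemma openin_quotient_topology:
  "openin (quotient_topology X r) U \<longleftrightarrow>
     U \<subseteq> topspace X // r \<and> openin X {x \<in> topspace X. r `` {x} \<in> U}"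
proof -
  have "istopology (\<lambda>U. U \<subseteq> topspace X // r \<and> openin X {x \<in> topspace X. r `` {x} \<in> U})"
    unfolding istopology_def
  proof (intro conjI allI impI; (elim conjE)?)
    fix S T
    assume "openin X {x \<in> topspace X. r `` {x} \<in> S}" "openin X {x \<in> topspace X. r `` {x} \<in> T}"
    then have "openin X ({x \<in> topspace X. r `` {x} \<in> S} \<inter> {x \<in> topspace X. r `` {x} \<in> T})"
      by (rule openin_Int)
    then show "openin X {x \<in> topspace X. r `` {x} \<in> S \<inter> T}"
      by (rule back_subst[of "openin X"]) auto
  next
    fix K
    assume "\<forall>S\<in>K. S \<subseteq> topspace X // r \<and> openin X {x \<in> topspace X. r `` {x} \<in> S}"
    then have "openin X (\<Union>S\<in>K. {x \<in> topspace X. r `` {x} \<in> S})"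
      by blast
    then show "openin X {x \<in> topspace X. r `` {x} \<in> \<Union> K}"
      by (rule back_subst[of "openin X"]) auto
  qed auto
  then show ?thesis
    by (simp add: quotient_topology_def)
qed

lemma topspace_quotient_topology: "topspace (quotient_topology X r) = topspace X // r"
proof
  have "{x \<in> topspace X. r `` {x} \<in> topspace X // r} = topspace X"
    by (auto intro: quotientI)
  then have "openin (quotient_topology X r) (topspace X // r)"
    by (simp add: openin_quotient_topology)
  then show "topspace X // r \<subseteq> topspace (quotient_topology X r)"
    by (rule openin_subset)
  show "topspace (quotient_topology X r) \<subseteq> topspace X // r"
    by (auto simp: topspace_def openin_quotient_topology)
qed

lemma quotient_map_quotient_topology:
  "quotient_map X (quotient_topology X r) (\<lambda>x. r `` {x})"
  by (auto simp: quotient_map_def topspace_quotient_topology openin_quotient_topology quotient_def)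

lemma topspace_ind_lim_pre: "topspace (ind_lim_pre X) = topspace X \<times> UNIV"
  by (simp add: ind_lim_pre_def)

lemma quotient_map_ind_lim: "quotient_map (ind_lim_pre X) (ind_lim X f) (ind_lim_class X f)"
  unfolding ind_lim_def ind_lim_class_def by (rule quotient_map_quotient_topology)

lemma equiv_ind_lim_rel: "equiv (topspace (ind_lim_pre X)) (ind_lim_rel X f)"
proof (rule equivI)
  show "ind_lim_rel X f \<subseteq> topspace (ind_lim_pre X) \<times> topspace (ind_lim_pre X)"
    unfolding ind_lim_rel_def topspace_ind_lim_pre by blast
  show "refl_on (topspace (ind_lim_pre X)) (ind_lim_rel X f)"
    unfolding ind_lim_rel_def topspace_ind_lim_pre by (rule refl_onI) simp
  show "sym (ind_lim_rel X f)"
    unfolding ind_lim_rel_def by (rule symI) (simp add: equivclp_sym)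
  show "trans (ind_lim_rel X f)"
  proof (rule transI)
    fix u v w assume "(u, v) \<in> ind_lim_rel X f" "(v, w) \<in> ind_lim_rel X f"
    then show "(u, w) \<in> ind_lim_rel X f"
      unfolding ind_lim_rel_def mem_Collect_eq case_prod_conv
      by (elim conjE, intro conjI) (assumption | erule (1) equivclp_trans)+
  qed
qed

lemma ind_lim_class_shift:
  assumes "f ` topspace X \<subseteq> topspace X" "x \<in> topspace X"
  shows "ind_lim_class X f (f x, Suc n) = ind_lim_class X f (x, n)"
proof -
  have "((x, n), (f x, Suc n)) \<in> ind_lim_rel X f"
    using assms by (auto simp: ind_lim_rel_def)
  then show ?thesis
    unfolding ind_lim_class_def using equiv_class_eq[OF equiv_ind_lim_rel] by metis
qed

lemma ind_lim_map_class:
  assumes f: "f ` topspace X \<subseteq> topspace X" and x: "x \<in> topspace X"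
  shows "ind_lim_map X f (ind_lim_class X f (x, n)) = ind_lim_class X f (f x, n)"
proof -
  let ?F = "\<lambda>(x, n). ind_lim_class X f (f x, n)"
  let ?b = "\<lambda>(x, n) (y, m). x \<in> topspace X \<and> y = f x \<and> m = Suc n"
  have *: "?F p = ?F q" if "equivclp ?b p q" for p q
    using that
  proof (induction rule: equivclp_induct)
    case (step y z)
    have b: "?F u = ?F v" if "?b u v" for u v
    proof -
      obtain x n where u: "u = (x, n)" by (cases u)
      with that have v: "v = (f x, Suc n)" and x: "x \<in> topspace X"
        by (auto split: prod.splits)
      then have "f x \<in> topspace X"
        using f by blast
      then show ?thesis
        unfolding u v prod.case by (rule ind_lim_class_shift[OF f, symmetric])
    qed
    from step(2) have "?F y = ?F z"
      using b[of y z] b[of z y] by argo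
    then show ?case using step(3) by simp
  qed simp
  have "?F q = ?F (x, n)" if "q \<in> ind_lim_class X f (x, n)" for q
  proof -
    have "equivclp ?b (x, n) q"
      using that unfolding ind_lim_class_def ind_lim_rel_def by simp
    then have "?F (x, n) = ?F q"
      by (rule *)
    then show ?thesis by simp
  qed
  moreover have "(x, n) \<in> ind_lim_class X f (x, n)"
    using x unfolding ind_lim_class_def ind_lim_rel_def by simp
  ultimately have "(\<Union>q\<in>ind_lim_class X f (x, n). ?F q) = ?F (x, n)"
    by blast
  then show ?thesis
    by (simp add: ind_lim_map_def)
qed

end

theory Submission
  imports Defs "HOL-Complex_Analysis.Complex_Analysis" "HOL-Real_Asymp.Real_Asymp" "HOL-Computational_Algebra.Fundamental_Theorem_Algebra"
begin

text \<open>
  Put \<open>e = a\<^sup>2\<close> and \<open>t = a y\<close>: the first coordinates of a Henon orbit satisfy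
  \<open>x\<^sub>n\<^sub>+\<^sub>1 = x\<^sub>n\<^sup>2 + c + e x\<^sub>n\<^sub>-\<^sub>1\<close>, a perturbation of the iteration of \<open>P\<close>.

  For \<open>e = 0\<close> the critical orbit is attracted to the parabolic point, and the attracting petals persist
  along the parameter curve, because the slow direction carries a center curve on which the multiplier
  stays \<open>l\<close>. Hence all orbits with small \<open>e\<close>, \<open>x\<close>, \<open>t\<close> are bounded, so a point that escapes has never
  come close to the critical point \<open>x = 0\<close> before. Therefore the curves \<open>x\<^sub>n = T\<close> with \<open>\<bar>T\<bar> = 2\<close>
  are unions of disjoint graphs over the \<open>y\<close>-disc that move holomorphically with \<open>a\<close>. By Harnack's inequality the
  motion is Hoelder continuous, and its limits are graphs \<open>x = phi a \<zeta> y\<close>, \<open>\<zeta> \<in> J\<close>, that make up \<open>J\<^sup>+\<close> in \<open>V\<close>.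

  On these graphs the Henon map is \<open>\<psi>'(\<zeta>, z) = (P \<zeta>, a phi a \<zeta> z)\<close>, which agrees to first order with the
  model \<open>\<psi>\<close>. Both contract the fibres, so a fibred homeomorphism that matches the images of the two
  maps extends along the dynamics to a conjugacy. Since every point of \<open>J\<^sup>+\<close> eventually enters \<open>V\<close>, pulling
  back by the Henon map gives the extension to the inductive limit.
\<close>

section \<open>Resonant iterates of polynomials\<close>

text \<open>\<open>P\<close> is not expanding near its parabolic point, so a graph transform over
  \<open>J\<close> is not at hand. Expansion is replaced by one uniform fact: escaping orbits keep
  distance \<open>\<kappa>\<close> from the critical point. It makes the roots of
  \<open>x_n = T\<close> simple for all \<open>(y, a)\<close> at once, hence a covering over a
  simply connected base, and holomorphic dependence on \<open>a\<close> and \<open>y\<close> then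
  supplies the estimates. The petals must keep a uniform size. Along the parameter curve resonance
  excludes nonlinear terms of order below \<open>q + 1\<close> in the \<open>q\<close>-th iterate,
  but if the coefficient of order \<open>q + 1\<close> vanished at \<open>a = 0\<close>, the petals
  could break up under perturbation. This is why it has to be shown that the quadratic polynomial
  has a single cycle of petals. In the comparison with the model, the image of a fibre is a disc
  with radius of order \<open>cmod a ^ 2\<close>. A crude bound suffices for positions, since discs
  of different roots are far apart on the scale of \<open>a\<close>, but differences along a fibre
  must agree up to an error of order \<open>cmod a ^ 2\<close>. The functional equation of the
  graphs yields this.\<close>

definition poly_iter :: "complex poly \<Rightarrow> nat \<Rightarrow> complex poly" where
  "poly_iter p n = ((\<lambda>r. pcompose p r) ^^ n) [:0, 1:]"

lemma poly_iter_0 [simp]: "poly_iter p 0 = [:0, 1:]"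
  by (simp add: poly_iter_def)

lemma poly_iter_Suc: "poly_iter p (Suc n) = pcompose p (poly_iter p n)"
  by (simp add: poly_iter_def)

lemma poly_poly_iter: "poly (poly_iter p n) u = (poly p ^^ n) u"
  by (induction n) (simp_all add: poly_iter_Suc poly_pcompose)

lemma poly_iter_commute: "pcompose (poly_iter p n) p = pcompose p (poly_iter p n)"
proof (induction n)
  case (Suc n)
  then show ?case
    by (metis pcompose_assoc poly_iter_Suc)
qed (simp add: pcompose_pCons pcompose_idR)

lemma pcompose_power: "pcompose (p ^ n) r = pcompose p r ^ n" for p r :: "'a::comm_semiring_1 poly"
  by (induction n) (simp_all add: pcompose_mult pcompose_1)

text \<open>A mean value theorem for polynomials: the cofactor of \<open>F - H\<close> has value
  \<open>p'(0)\<close> at 0 because \<open>F\<close> and \<open>H\<close> vanish there. It transfers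
  lowest order terms through a composition.\<close>

lemma pcompose_diff_factor:
  fixes p F H :: "complex poly"
  assumes "poly F 0 = 0" "poly H 0 = 0"
  shows "\<exists>S. pcompose p F - pcompose p H = (F - H) * S \<and> poly S 0 = coeff p 1"
proof (induction p)
  case 0
  show ?case by (rule exI[of _ 0]) simp
next
  case (pCons a p)
  then obtain S where S: "pcompose p F - pcompose p H = (F - H) * S" by blast
  have "pcompose (pCons a p) F - pcompose (pCons a p) H = (F - H) * pcompose p F + H * (pcompose p F - pcompose p H)"
    by (simp add: pcompose_pCons algebra_simps)
  also have "\<dots> = (F - H) * (pcompose p F + H * S)"
    unfolding S by (simp add: algebra_simps)
  finally show ?case
    by (intro exI[of _ "pcompose p F + H * S"]) (simp add: assms poly_pcompose flip: poly_0_coeff_0)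
qed

lemma poly_iter_fixpoint:
  assumes "coeff p 0 = 0"
  shows "poly (poly_iter p n) 0 = 0" "coeff (poly_iter p n) 1 = coeff p 1 ^ n"
proof -
  have p0: "poly p 0 = 0" using assms by (simp add: poly_0_coeff_0)
  show z: "poly (poly_iter p n) 0 = 0" for n
    by (induction n) (simp_all add: poly_iter_Suc poly_pcompose p0)
  have *: "coeff f 1 = poly (pderiv f) 0" for f :: "complex poly"
    by (simp add: poly_0_coeff_0 coeff_pderiv)
  show "coeff (poly_iter p n) 1 = coeff p 1 ^ n"
  proof (induction n)
    case (Suc n)
    then show ?case
      unfolding * poly_iter_Suc pderiv_pcompose using z[of n]
      by (simp add: poly_pcompose)
  qed simp
qed

text \<open>Comparing lowest order terms in \<open>p \<circ> F = F \<circ> p\<close> for \<open>F = p\<^sup>q\<close> shows that only resonant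
  exponents occur.\<close>

lemma poly_iter_resonant:
  assumes p0: "coeff p 0 = 0" and l: "\<And>k. coeff p 1 ^ k = 1 \<longleftrightarrow> q dvd k"
    and ne: "poly_iter p q \<noteq> [:0, 1:]"
  shows "\<exists>m G. m \<ge> 1 \<and> q dvd m \<and> poly G 0 \<noteq> 0 \<and> poly_iter p q = [:0, 1:] + [:0, 1:] ^ Suc m * G"
proof -
  let ?X = "[:0, 1:] :: complex poly"
  define F where "F = poly_iter p q"
  define l where "l = coeff p 1"
  define k where "k = order 0 (F - ?X)"
  have nz: "F - ?X \<noteq> 0" using ne F_def by simp
  obtain G where G: "F - ?X = ?X ^ k * G" and Gnz: "\<not> ?X dvd G"
    using order_decomp[OF nz, of 0] by (auto simp: k_def)
  have G0: "poly G 0 \<noteq> 0"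
    using Gnz by (simp add: poly_eq_0_iff_dvd)
  have F0: "poly F 0 = 0" and F1: "coeff F 1 = 1"
    using poly_iter_fixpoint[OF p0] l[of q] by (simp_all add: F_def)
  have "poly (F - ?X) 0 = 0" using F0 by simp
  then have "k \<noteq> 0" using G G0 by (metis mult_1 power_0)
  moreover have "k \<noteq> 1"
  proof
    assume "k = 1"
    with G have "coeff (F - ?X) 1 = coeff (?X * G) 1" by simp
    then have "coeff G 0 = 0" using F1 by simp
    then show False using G0 by (simp add: poly_0_coeff_0)
  qed
  ultimately obtain m where m: "k = Suc m" "m \<ge> 1"
    by (cases k) auto
  obtain S where S: "pcompose p F - pcompose p ?X = (F - ?X) * S" and S0: "poly S 0 = l"
    using pcompose_diff_factor[of F ?X p] F0 by (auto simp: l_def)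
  obtain r where r: "p = ?X * r"
    using p0 by (metis dvd_def poly_0_coeff_0 poly_eq_0_iff_dvd minus_zero)
  have r0: "poly r 0 = l"
    unfolding l_def by (subst r) (simp add: poly_0_coeff_0)
  have "pcompose p F - p = pcompose (F - ?X) p"
    using poly_iter_commute[of p q] by (simp add: F_def pcompose_diff pcompose_pCons)
  then have "(F - ?X) * S = pcompose (?X ^ k * G) p"
    using S G by simp
  then have "?X ^ k * (G * S) = p ^ k * pcompose G p"
    by (simp add: G pcompose_mult pcompose_power pcompose_pCons mult.assoc)
  also have "\<dots> = ?X ^ k * (r ^ k * pcompose G p)"
    by (subst r) (simp only: power_mult_distrib mult.assoc)
  \<comment> \<open>After cancelling the common power of the variable, evaluation at 0 compares the
    lowest coefficients of \<open>p \<circ> F\<close> and \<open>F \<circ> p\<close>.\<close>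
  finally have "G * S = r ^ k * pcompose G p"
    by (subst (asm) mult_cancel_left) auto
  then have "poly (G * S) 0 = poly (r ^ k * pcompose G p) 0" by simp
  then have "poly G 0 * l = l ^ k * poly G 0"
    using p0 by (simp add: S0 r0 poly_pcompose flip: poly_0_coeff_0)
  then have "l = l ^ k" using G0 by simp
  \<comment> \<open>The iterate differs from the identity, so \<open>q > 0\<close>, and
    \<open>l ^ q = 1\<close> excludes \<open>l = 0\<close>.\<close>
  moreover have "l \<noteq> 0"
  proof
    assume "l = 0"
    moreover have "q \<noteq> 0" using ne by (metis poly_iter_0)
    ultimately show False using l[of q] by (simp add: l_def power_0_left)
  qed
  ultimately have "l ^ m = 1" unfolding m by simp
  then have "q dvd m" using l by (simp add: l_def)
  moreover have "poly_iter p q = ?X + ?X ^ Suc m * G" using G m by (metis F_def add.commute diff_add_cancel)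
  ultimately show ?thesis using m(2) G0 unfolding F_def by (intro exI[of _ m] exI[of _ G]) auto
qed

section \<open>Parabolic petals of quadratic polynomials\<close>

text \<open>\<open>1 - m z\<close> is the first order part of \<open>(1 + z)^(-m)\<close>, so the
  product is 1 up to second order. The constant is crude; only its independence of \<open>z\<close>
  matters.\<close>

lemma one_plus_power_bound:
  fixes z :: complex
  assumes "cmod z \<le> 1"
  shows "cmod ((1 + z) ^ m * (1 - of_nat m * z) - 1) \<le> of_nat m * of_nat m * 2 ^ m * (cmod z)\<^sup>2"
proof (induction m)
  case (Suc m)
  have "(1 + z) ^ Suc m * (1 - of_nat (Suc m) * z) - 1
      = ((1 + z) ^ m * (1 - of_nat m * z) - 1) - of_nat (Suc m) * z^2 * (1 + z) ^ m"
    by (simp add: algebra_simps power2_eq_square)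
  also have "cmod \<dots> \<le> of_nat m * of_nat m * 2 ^ m * (cmod z)\<^sup>2 + of_nat (Suc m) * (cmod z)^2 * 2 ^ m"
  proof (rule order_trans[OF norm_triangle_ineq4 add_mono[OF Suc]])
    have "cmod (1 + z) \<le> 2"
      using norm_triangle_ineq[of 1 z] assms by simp
    then have "cmod (1 + z) ^ m \<le> 2 ^ m" by (rule power_mono) simp
    moreover have "cmod (1 + of_nat m) = 1 + real m"
      by (metis norm_of_nat of_nat_Suc)
    ultimately show "cmod (of_nat (Suc m) * z^2 * (1 + z) ^ m) \<le> of_nat (Suc m) * (cmod z)^2 * 2 ^ m"
      by (simp add: norm_mult norm_power mult_left_mono)
  qed
  also have "\<dots> \<le> of_nat (Suc m) * of_nat (Suc m) * 2 ^ Suc m * (cmod z)\<^sup>2"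
  proof -
    have "(real m * real m + real (Suc m)) \<le> real (Suc m) * real (Suc m) * 2"
      by (simp add: algebra_simps)
    then have "(real m * real m + real (Suc m)) * (2 ^ m * (cmod z)\<^sup>2) \<le> (real (Suc m) * real (Suc m) * 2) * (2 ^ m * (cmod z)\<^sup>2)"
      by (rule mult_right_mono) simp
    then show ?thesis by (simp add: algebra_simps)
  qed
  finally show ?case .
qed simp

text \<open>In the coordinate \<open>w = -1 / (m A u^m)\<close> the map
  \<open>u + A u^(m+1) + O(u^(m+2))\<close> is the translation by 1 up to \<open>O(u)\<close>. The
  constants depend only on bounds for \<open>cmod A\<close>, because the perturbed maps have an
  \<open>A\<close> that varies with the parameter.\<close>

lemma petal_coordinate_step:
  fixes m :: nat and A1 A2 C :: real
  assumes m: "m \<ge> 1" and A1: "A1 > 0" and C: "C \<ge> 0"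
  shows "\<exists>B \<tau>. B \<ge> 0 \<and> \<tau> > 0 \<and> (\<forall>A u u' :: complex. A1 \<le> cmod A \<and> cmod A \<le> A2 \<and> u \<noteq> 0 \<and> cmod u < \<tau>
     \<and> cmod (u' - u - A * u ^ Suc m) \<le> C * cmod u ^ Suc (Suc m) \<longrightarrow>
     cmod (u' / u - 1) \<le> B * cmod u ^ m \<and> cmod (u' / u - 1) \<le> 1 / 2 \<and>
     cmod (-1 / (of_nat m * A * u' ^ m) - (-1 / (of_nat m * A * u ^ m)) - 1) \<le> B * cmod u)"
proof (cases "A1 \<le> A2")
  case False
  then show ?thesis by (intro exI[of _ 1]) auto
next
  case A12: True
  define D where "D = A2 + C"
  have D: "D > 0" using A1 A12 C by (simp add: D_def)
  define K where "K = real m * real m * 2 ^ m * 2 ^ m * (D * D) / (real m * A1) + C / A1"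
  define B where "B = K + D"
  define \<tau> where "\<tau> = min 1 (1 / (2 * D))"
  have "K \<ge> 0" using D A1 C by (simp add: K_def)
  then have B: "B \<ge> 0" using D by (simp add: B_def)
  have \<tau>: "\<tau> > 0" using D by (simp add: \<tau>_def)
  have "cmod (u' / u - 1) \<le> B * cmod u ^ m \<and> cmod (u' / u - 1) \<le> 1 / 2 \<and>
     cmod (-1 / (of_nat m * A * u' ^ m) - (-1 / (of_nat m * A * u ^ m)) - 1) \<le> B * cmod u"
    if A: "A1 \<le> cmod A" "cmod A \<le> A2" and u: "u \<noteq> 0" "cmod u < \<tau>"
      and u': "cmod (u' - u - A * u ^ Suc m) \<le> C * cmod u ^ Suc (Suc m)" for A u u' :: complex
  proof -
    define E where "E = u' - u - A * u ^ Suc m"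
    define z where "z = u' / u - 1"
    have Anz: "A \<noteq> 0" using A A1 by auto
    have cu: "0 < cmod u" "cmod u \<le> 1" "D * cmod u \<le> 1 / 2"
      using u D by (auto simp: \<tau>_def field_simps)
    have um: "cmod u ^ m \<le> cmod u"
      using power_decreasing[of 1 m "cmod u"] m cu by simp
    have u'z: "u' = u * (1 + z)" using u by (simp add: z_def field_simps)
    have Ez: "E = u * z - A * u ^ Suc m" by (simp add: E_def u'z algebra_simps)
    have z_eq: "z = A * u ^ m + E / u" using u by (simp add: Ez field_simps)
    have "cmod (E / u) \<le> C * cmod u ^ Suc m"
      using u' cu(1) by (simp add: E_def norm_divide field_simps)
    also have "\<dots> \<le> C * cmod u ^ m"
      using cu C by (intro mult_left_mono power_decreasing) auto
    finally have "cmod z \<le> A2 * cmod u ^ m + C * cmod u ^ m"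
      unfolding z_eq using A(2)
      by (intro order_trans[OF norm_triangle_ineq] add_mono) (auto simp: norm_mult norm_power intro!: mult_right_mono)
    then have z1: "cmod z \<le> D * cmod u ^ m" by (simp add: D_def algebra_simps)
    also have "\<dots> \<le> D * cmod u" using um D by (simp add: mult_left_mono)
    finally have z2: "cmod z \<le> 1 / 2" using cu by simp
    have "1 / 2 \<le> cmod (1 + z)"
      using norm_triangle_ineq2[of 1 "- z"] z2 by simp
    then have zp: "(1 / 2) ^ m \<le> cmod ((1 + z) ^ m)"
      unfolding norm_power by (rule power_mono) simp
    have znz: "1 + z \<noteq> 0" using \<open>1 / 2 \<le> cmod (1 + z)\<close> by auto
    define N where "N = (1 + z) ^ m * (1 - of_nat m * z) - 1"
    have N: "cmod N \<le> real m * real m * 2 ^ m * (cmod z)\<^sup>2"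
      unfolding N_def using z2 by (intro one_plus_power_bound) simp
    have mnz: "(of_nat m :: complex) \<noteq> 0" using m by simp
    \<comment> \<open>As \<open>u' = u (1 + z)\<close>, the new coordinate is
      \<open>w / (1 + z)^m\<close>. Replacing \<open>1 / (1 + z)^m\<close> by \<open>1 - m z\<close>
      costs the \<open>N\<close> term, and \<open>- m z w\<close> equals 1 plus the \<open>E\<close>
      term.\<close>
    have "-1 / (of_nat m * A * u' ^ m) - (-1 / (of_nat m * A * u ^ m)) - 1
       = (N / (1 + z) ^ m) / (of_nat m * A * u ^ m) + E / (A * u ^ Suc m)"
    proof -
      have "E / (A * u ^ Suc m) = z / (A * u ^ m) - 1"
        using Anz u(1) by (simp add: Ez diff_divide_distrib)
      moreover have "(N / (1 + z) ^ m) / (of_nat m * A * u ^ m) = (1 - of_nat m * z) / (of_nat m * A * u ^ m) - 1 / (of_nat m * A * u' ^ m)"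
        using znz by (simp add: N_def u'z diff_divide_distrib power_mult_distrib)
      moreover have "(1 - of_nat m * z) / (of_nat m * A * u ^ m) = 1 / (of_nat m * A * u ^ m) - z / (A * u ^ m)"
        using mnz by (simp add: diff_divide_distrib)
      ultimately show ?thesis by simp
    qed
    also have "cmod \<dots> \<le> real m * real m * 2 ^ m * 2 ^ m * (D * D) / (real m * A1) * cmod u + C / A1 * cmod u"
    proof (rule order_trans[OF norm_triangle_ineq add_mono])
      have "cmod (E / (A * u ^ Suc m)) \<le> (C * cmod u ^ Suc (Suc m)) / (A1 * cmod u ^ Suc m)"
        unfolding norm_divide norm_mult norm_power using u' A cu A1
        by (intro frac_le mult_right_mono) (auto simp: E_def C)
      then show "cmod (E / (A * u ^ Suc m)) \<le> C / A1 * cmod u"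
        using cu A1 by (simp add: field_simps)
      have "cmod ((N / (1 + z) ^ m) / (of_nat m * A * u ^ m)) = cmod N / cmod ((1 + z) ^ m) / (real m * cmod A * cmod u ^ m)"
        by (simp add: norm_divide norm_mult norm_power)
      also have "\<dots> \<le> (real m * real m * 2 ^ m * (D * cmod u ^ m)\<^sup>2 / (1 / 2) ^ m) / (real m * A1 * cmod u ^ m)"
        using N z1 zp A A1 m cu D
        by (intro frac_le mult_right_mono mult_left_mono order_trans[OF N] power_mono) auto
      also have "\<dots> = real m * real m * 2 ^ m * 2 ^ m * (D * D) / (real m * A1) * cmod u ^ m"
        using cu by (simp add: power2_eq_square power_one_over field_simps)
      also have "\<dots> \<le> real m * real m * 2 ^ m * 2 ^ m * (D * D) / (real m * A1) * cmod u"
        using um A1 D by (intro mult_left_mono) auto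
      finally show "cmod ((N / (1 + z) ^ m) / (of_nat m * A * u ^ m)) \<le> real m * real m * 2 ^ m * 2 ^ m * (D * D) / (real m * A1) * cmod u" .
    qed
    also have "\<dots> = K * cmod u" by (simp add: K_def algebra_simps)
    also have "\<dots> \<le> B * cmod u" using cu D by (simp add: B_def mult_right_mono)
    finally have "cmod (-1 / (of_nat m * A * u' ^ m) - (-1 / (of_nat m * A * u ^ m)) - 1) \<le> B * cmod u" .
    moreover have "D * cmod u ^ m \<le> B * cmod u ^ m"
      using \<open>K \<ge> 0\<close> by (intro mult_right_mono) (auto simp: B_def)
    ultimately show ?thesis using z1 z2 unfolding z_def by linarith
  qed
  then show ?thesis using B \<tau> by blast
qed

text \<open>The \<open>m\<close> solutions \<open>b\<close> of \<open>b ^ m = -1 / (m A)\<close>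
  give the \<open>m\<close> attracting petals.\<close>

definition petal_param :: "nat \<Rightarrow> complex \<Rightarrow> complex \<Rightarrow> complex" where
  "petal_param m b w = b * exp (- Ln w / of_nat m)"

lemma petal_param_nonzero: "b \<noteq> 0 \<Longrightarrow> petal_param m b w \<noteq> 0"
  by (simp add: petal_param_def)

lemma petal_param_power:
  assumes "m \<ge> 1" "w \<noteq> 0"
  shows "petal_param m b w ^ m = b ^ m / w"
proof -
  have "exp (- Ln w / of_nat m) ^ m = exp (- Ln w)"
    using assms by (simp flip: exp_of_nat_mult)
  then show ?thesis using assms by (simp add: petal_param_def power_mult_distrib exp_minus field_simps)
qed

lemma norm_petal_param:
  assumes "m \<ge> 1" "w \<noteq> 0"
  shows "cmod (petal_param m b w) ^ m = cmod b ^ m / cmod w"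
  by (metis assms petal_param_power norm_divide norm_power)

lemma petal_param_less:
  assumes m: "m \<ge> 1" and w: "w \<noteq> 0" and "\<epsilon> > 0" "cmod b ^ m < \<epsilon> ^ m * cmod w"
  shows "cmod (petal_param m b w) < \<epsilon>"
proof (rule power_less_imp_less_base)
  show "cmod (petal_param m b w) ^ m < \<epsilon> ^ m"
    using assms by (simp add: norm_petal_param field_simps)
qed (use assms in auto)

lemma holomorphic_on_petal_param: "petal_param m b holomorphic_on {w. Re w > R}" if "R \<ge> 0"
  unfolding petal_param_def using that
  by (intro holomorphic_intros) (auto simp: complex_nonpos_Reals_iff)

lemma petal_param_inj:
  assumes "petal_param m b w = petal_param m b w'" "m \<ge> 1" "b \<noteq> 0" "w \<noteq> 0" "w' \<noteq> 0"
  shows "w = w'"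
proof -
  have "b ^ m / w = b ^ m / w'"
    using petal_param_power[of m w b] petal_param_power[of m w' b] assms(1,2,4,5) by argo
  then show ?thesis using assms(3-5) by (simp add: field_simps)
qed

text \<open>\<open>petal_param\<close> inverts the coordinate \<open>w = -1 / (m A u^m)\<close>; the image of a half plane is an attracting
  petal, on which \<open>F\<close> becomes a perturbation \<open>G\<close> of the translation by one.\<close>

lemma petal_conjugacy:
  fixes F :: "complex \<Rightarrow> complex"
  assumes m: "m \<ge> 1" and A: "A \<noteq> 0" and C: "C \<ge> 0" and b: "b ^ m = -1 / (of_nat m * A)"
    and hF: "F holomorphic_on UNIV"
    and F: "\<And>u. cmod u \<le> 1 \<Longrightarrow> cmod (F u - u - A * u ^ Suc m) \<le> C * cmod u ^ Suc (Suc m)"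
  shows "\<exists>R0>0. \<exists>G. G holomorphic_on {w. Re w > R0} \<and>
     (\<forall>w. Re w > R0 \<longrightarrow> cmod (G w - w - 1) \<le> 1 / 2 \<and> F (petal_param m b w) = petal_param m b (G w)
         \<and> cmod (petal_param m b w) < 1) \<and>
     (\<forall>e>0. \<exists>R1. \<forall>w. Re w > R0 \<and> Re w > R1 \<longrightarrow> cmod (G w - w - 1) \<le> e)"
proof -
  let ?k = "petal_param m b"
  have mnz: "(of_nat m :: complex) \<noteq> 0" using m by simp
  have bnz: "b \<noteq> 0" using b A mnz m by (auto simp: power_0_left split: if_splits)
  have "0 < cmod A" using A by simp
  then obtain B \<tau> where B: "B \<ge> 0" "\<tau> > 0" and **: "\<forall>A' u u' :: complex. cmod A \<le> cmod A' \<and> cmod A' \<le> cmod A \<and> u \<noteq> 0 \<and> cmod u < \<tau>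
     \<and> cmod (u' - u - A' * u ^ Suc m) \<le> C * cmod u ^ Suc (Suc m) \<longrightarrow>
     cmod (u' / u - 1) \<le> B * cmod u ^ m \<and> cmod (u' / u - 1) \<le> 1 / 2 \<and>
     cmod (-1 / (of_nat m * A' * u' ^ m) - (-1 / (of_nat m * A' * u ^ m)) - 1) \<le> B * cmod u"
    using petal_coordinate_step[OF m _ C, of "cmod A" "cmod A"] by blast
  \<comment> \<open>The last entry is there for the logarithm: it will give
    \<open>m * cmod (Ln \<zeta>) \<le> 1 / 4\<close>, which pins down the branch.\<close>
  define e0 where "e0 = min (min \<tau> 1) (min (1 / (2 * (B + 1))) (1 / (8 * real m * (B + 1))))"
  have e0: "e0 > 0" "e0 \<le> \<tau>" "e0 \<le> 1" "B * e0 \<le> 1/2" "B * e0 \<le> 1 / (8 * real m)"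
  proof -
    show "e0 > 0" "e0 \<le> \<tau>" "e0 \<le> 1" using B m by (auto simp: e0_def)
    have "B * e0 \<le> B * (1 / (2 * (B + 1)))" using B by (intro mult_left_mono) (auto simp: e0_def)
    also have "\<dots> \<le> 1/2" using B by (simp add: field_simps)
    finally show "B * e0 \<le> 1/2" .
    have "B * e0 \<le> B * (1 / (8 * real m * (B + 1)))" using B by (intro mult_left_mono) (auto simp: e0_def)
    also have "\<dots> = (B / (B + 1)) * (1 / (8 * real m))" by simp
    also have "\<dots> \<le> 1 * (1 / (8 * real m))" using B by (intro mult_right_mono) (auto simp: field_simps)
    finally show "B * e0 \<le> 1 / (8 * real m)" by simp
  qed
  have small: "\<exists>R>0. \<forall>w. Re w > R \<longrightarrow> cmod (?k w) < e" if "e > 0" for e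
  proof (intro exI conjI allI impI)
    define R where "R = cmod b ^ m / e ^ m"
    show "R > 0" using bnz that by (simp add: R_def)
    fix w :: complex assume w: "Re w > R"
    then have "R < cmod w" using complex_Re_le_cmod order_less_le_trans by blast
    then show "cmod (?k w) < e"
      using m that \<open>R > 0\<close> by (intro petal_param_less) (auto simp: R_def field_simps)
  qed
  obtain R0 where R0: "R0 > 0" and k_small: "\<And>w. Re w > R0 \<Longrightarrow> cmod (?k w) < e0"
    using small[OF e0(1)] by blast
  define G where "G = (\<lambda>w. -1 / (of_nat m * A * F (?k w) ^ m))"
  have w_eq: "-1 / (of_nat m * A * ?k w ^ m) = w" if "Re w > R0" for w
  proof -
    have wnz: "w \<noteq> 0" using that R0 by auto
    have "of_nat m * A * ?k w ^ m = -1 / w"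
      using wnz m b A mnz by (simp add: petal_param_power)
    then show ?thesis using wnz by simp
  qed
  have step: "cmod (F (?k w) / ?k w - 1) \<le> B * cmod (?k w) ^ m" "cmod (F (?k w) / ?k w - 1) \<le> 1 / 2"
     "cmod (G w - w - 1) \<le> B * cmod (?k w)" if "Re w > R0" for w
  proof -
    have 1: "cmod (?k w) < e0" using k_small[OF that] .
    have "?k w \<noteq> 0" "cmod (?k w) < \<tau>"
      "cmod (F (?k w) - ?k w - A * ?k w ^ Suc m) \<le> C * cmod (?k w) ^ Suc (Suc m)"
      using 1 e0 bnz F[of "?k w"] by (simp_all add: petal_param_nonzero)
    then have "cmod (F (?k w) / ?k w - 1) \<le> B * cmod (?k w) ^ m \<and> cmod (F (?k w) / ?k w - 1) \<le> 1 / 2 \<and>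
     cmod (-1 / (of_nat m * A * F (?k w) ^ m) - (-1 / (of_nat m * A * ?k w ^ m)) - 1) \<le> B * cmod (?k w)"
      using **[rule_format, of A "?k w" "F (?k w)"] by blast
    then show "cmod (F (?k w) / ?k w - 1) \<le> B * cmod (?k w) ^ m" "cmod (F (?k w) / ?k w - 1) \<le> 1 / 2"
      "cmod (G w - w - 1) \<le> B * cmod (?k w)"
      unfolding w_eq[OF that] G_def by blast+
  qed
  have Fnz: "F (?k w) \<noteq> 0" if "Re w > R0" for w
    using step(2)[OF that] by auto
  show ?thesis
  proof (rule exI[of _ R0], rule conjI[OF R0], rule exI[of _ G], intro conjI allI impI)
    have "(F \<circ> ?k) holomorphic_on {w. R0 < Re w}"
      using R0 by (intro holomorphic_on_compose holomorphic_on_petal_param holomorphic_on_subset[OF hF]) auto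
    then show "G holomorphic_on {w. R0 < Re w}"
      unfolding G_def o_def using Fnz mnz A by (intro holomorphic_intros) auto
  next
    fix w assume w: "Re w > R0"
    show "cmod (?k w) < 1" using k_small[OF w] e0 by simp
    show G1: "cmod (G w - w - 1) \<le> 1 / 2"
      using step(3)[OF w] e0(4) mult_left_mono[OF less_imp_le[OF k_small[OF w]] B(1)] by linarith
    define \<zeta> where "\<zeta> = F (?k w) / ?k w"
    have kz: "cmod (\<zeta> - 1) \<le> B * e0"
    proof -
      have "cmod (?k w) ^ m \<le> cmod (?k w)"
        using power_decreasing[of 1 m "cmod (?k w)"] m k_small[OF w] e0 by simp
      then show ?thesis
        using step(1)[OF w] mult_left_mono[OF less_imp_le[OF k_small[OF w]] B(1)]
          mult_left_mono[of "cmod (?k w) ^ m" "cmod (?k w)" B] B unfolding \<zeta>_def by linarith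
    qed
    have \<zeta>nz: "\<zeta> \<noteq> 0" using Fnz[OF w] bnz by (simp add: \<zeta>_def petal_param_nonzero)
    have "1 / (8 * real m) < 1/2" using m by (simp add: field_simps)
    then have "cmod (Ln (1 + (\<zeta> - 1))) \<le> 2 * cmod (\<zeta> - 1)"
      using kz e0(5) by (intro norm_Ln_le) linarith
    then have "cmod (Ln \<zeta>) \<le> 2 * (1 / (8 * real m))" using kz e0(5) by simp
    then have "real m * cmod (Ln \<zeta>) \<le> real m * (2 * (1 / (8 * real m)))"
      by (rule mult_left_mono) simp
    then have "cmod (of_nat m * Ln \<zeta>) \<le> 1 / 4"
      using m by (simp add: norm_mult)
    then have im1: "\<bar>Im (of_nat m * Ln \<zeta>)\<bar> < pi / 2"
      using abs_Im_le_cmod[of "of_nat m * Ln \<zeta>"] pi_gt3 by linarith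
    have im2: "\<bar>Im (Ln w)\<bar> < pi / 2"
      using w R0 by (intro Re_Ln_pos_lt_imp) auto
    have wnz: "w \<noteq> 0" using w R0 by auto
    have "G w = w / \<zeta> ^ m"
    proof -
      have "G w = -1 / (of_nat m * A * (?k w * \<zeta>) ^ m)"
        using bnz by (simp add: G_def \<zeta>_def petal_param_nonzero)
      also have "\<dots> = (-1 / (of_nat m * A * ?k w ^ m)) / \<zeta> ^ m"
        by (simp add: power_mult_distrib)
      finally show ?thesis unfolding w_eq[OF w] .
    qed
    also have "\<dots> = exp (Ln w - of_nat m * Ln \<zeta>)"
      using wnz \<zeta>nz by (simp add: exp_diff exp_of_nat_mult)
    \<comment> \<open>\<open>Ln w\<close> has imaginary part below \<open>pi / 2\<close> and
      \<open>m Ln \<zeta>\<close> is small, so the difference stays in the strip of the principal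
      branch. Without this \<open>F\<close> could send the petal to another one.\<close>
    finally have "Ln (G w) = Ln w - of_nat m * Ln \<zeta>"
      using im1 im2 by (intro Ln_unique) auto
    then have "?k (G w) = b * exp (- Ln w / of_nat m + Ln \<zeta>)"
      using mnz by (simp add: petal_param_def diff_divide_distrib)
    also have "\<dots> = ?k w * \<zeta>"
      using \<zeta>nz unfolding exp_add petal_param_def by simp
    finally show "F (?k w) = ?k (G w)"
      using bnz by (simp add: \<zeta>_def petal_param_nonzero)
  next
    fix e :: real assume e: "e > 0"
    obtain R1 where R1: "\<And>w. Re w > R1 \<Longrightarrow> cmod (?k w) < e / (B + 1)"
      using small[of "e / (B + 1)"] e B by auto
    show "\<exists>R1. \<forall>w. Re w > R0 \<and> Re w > R1 \<longrightarrow> cmod (G w - w - 1) \<le> e"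
    proof (intro exI[of _ R1] allI impI)
      fix w assume w: "Re w > R0 \<and> Re w > R1"
      have "cmod (G w - w - 1) \<le> B * (e / (B + 1))"
        using step(3)[of w] mult_left_mono[OF less_imp_le[OF R1[of w]] B(1)] w by linarith
      also have "\<dots> \<le> e" using e B by (simp add: field_simps)
      finally show "cmod (G w - w - 1) \<le> e" .
    qed
  qed
qed

text \<open>The polynomial \<open>P\<close> after the translation \<open>x = l / 2 + u\<close>: the
  parabolic point becomes 0 and the critical point \<open>- l / 2\<close>.\<close>

definition qmap :: "complex \<Rightarrow> complex \<Rightarrow> complex" where
  "qmap l u = l * u + u\<^sup>2"

lemma holomorphic_on_qmap_iter: "(qmap l ^^ n) holomorphic_on S"
proof (induction n)
  case (Suc n)
  have "(\<lambda>u. l * (qmap l ^^ n) u + ((qmap l ^^ n) u)\<^sup>2) holomorphic_on S"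
    by (intro holomorphic_intros Suc)
  moreover have "qmap l ^^ Suc n = (\<lambda>u. qmap l ((qmap l ^^ n) u))" by auto
  ultimately show ?case by (simp only: qmap_def[of l "(qmap l ^^ n) u" for u])
qed (simp add: holomorphic_on_id[unfolded id_def])

lemma qmap_escape:
  assumes "cmod l = 1" "cmod u \<ge> 4"
  shows "cmod ((qmap l ^^ n) u) \<ge> 4"
proof (induction n)
  case (Suc n)
  let ?v = "(qmap l ^^ n) u"
  have "cmod (qmap l ?v) = cmod ?v * cmod (l + ?v)"
    by (simp add: qmap_def norm_mult[symmetric] algebra_simps power2_eq_square)
  also have "\<dots> \<ge> 4 * 1"
    using Suc norm_triangle_ineq2[of ?v "-l"] assms by (intro mult_mono) (auto simp: add.commute)
  finally show ?case by simp
qed (use assms in simp)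

text \<open>Fatou's theorem that a petal attracts a critical orbit. Otherwise inverse branches
  \<open>g\<close> of all iterates exist on the half plane \<open>H\<close> and can be chosen to
  undo \<open>G ^^ n\<close>. They are bounded by 4, since points of larger modulus never come back,
  so at depth of order \<open>n\<close> their derivative is \<open>O(1 / n)\<close>. As
  \<open>g\<close> maps \<open>G ^^ n\<close> of two points to two fixed distinct points, the orbits
  under \<open>G\<close> separate linearly. But \<open>G\<close> is asymptotically a translation,
  which makes the separation sublinear.\<close>

lemma critical_orbit_enters_petal:
  fixes q m :: nat
  assumes l: "cmod l = 1" and q: "q \<ge> 1" and m: "m \<ge> 1" and A: "A \<noteq> 0" and C: "C \<ge> 0"
    and b: "b ^ m = -1 / (of_nat m * A)"
    and F: "\<And>u. cmod u \<le> 1 \<Longrightarrow> cmod ((qmap l ^^ q) u - u - A * u ^ Suc m) \<le> C * cmod u ^ Suc (Suc m)"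
  shows "\<exists>n w. Re w > R \<and> (qmap l ^^ n) (- l / 2) = petal_param m b w"
proof (rule ccontr)
  let ?k = "petal_param m b" and ?f = "qmap l"
  assume no: "\<not> ?thesis"
  obtain R0 G where R0: "R0 > 0" and hG: "G holomorphic_on {w. Re w > R0}"
    and G: "\<And>w. Re w > R0 \<Longrightarrow> cmod (G w - w - 1) \<le> 1 / 2"
      "\<And>w. Re w > R0 \<Longrightarrow> (?f ^^ q) (?k w) = ?k (G w)" "\<And>w. Re w > R0 \<Longrightarrow> cmod (?k w) < 1"
    and Gas: "\<forall>e>0. \<exists>R1. \<forall>w. Re w > R0 \<and> Re w > R1 \<longrightarrow> cmod (G w - w - 1) \<le> e"
    using petal_conjugacy[OF m A C b holomorphic_on_qmap_iter F] by blast
  define R1 where "R1 = max R0 R"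
  define H where "H = {w :: complex. Re w > R1}"
  have H: "w \<in> H \<longleftrightarrow> Re w > R1" for w by (simp add: H_def)
  have HR0: "w \<in> H \<Longrightarrow> Re w > R0" for w by (simp add: H_def R1_def)
  have "convex H" unfolding H_def by (rule convex_halfspace_Re_gt)
  have openH: "open H" unfolding H_def by (rule open_halfspace_Re_gt)
  have Re_G: "Re (G w) \<ge> Re w + 1 / 2" if "w \<in> H" for w
    using G(1)[OF HR0[OF that]] abs_Re_le_cmod[of "G w - w - 1"] by (simp add: abs_le_iff)
  have Gn: "(G ^^ n) w \<in> H \<and> Re ((G ^^ n) w) \<ge> Re w + n / 2" if "w \<in> H" for w n
  proof (induction n)
    case (Suc n)
    then show ?case using Re_G[of "(G ^^ n) w"] by (auto simp: H field_simps)
  qed (use that in simp)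
  have conj: "(?f ^^ (q * i)) (?k w) = ?k ((G ^^ i) w)" if "w \<in> H" for w i
  proof (induction i)
    case (Suc i)
    have "(?f ^^ (q * Suc i)) (?k w) = (?f ^^ q) ((?f ^^ (q * i)) (?k w))"
      by (simp only: mult_Suc_right funpow_add o_apply)
    also have "\<dots> = ?k ((G ^^ Suc i) w)"
      using Suc G(2) HR0 Gn[OF that] by simp
    finally show ?case .
  qed simp
  have hGn: "(G ^^ n) holomorphic_on H" for n
  proof (induction n)
    case (Suc n)
    have "(G \<circ> (G ^^ n)) holomorphic_on H"
      using Gn HR0 by (intro holomorphic_on_compose_gen[OF Suc, of _ "{w. Re w > R0}"] hG) auto
    then show ?case by (simp only: funpow.simps)
  qed (simp add: holomorphic_on_id[unfolded id_def])
  \<comment> \<open>The last clause normalises the branch: on the image of \<open>G ^^ n\<close> it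
    runs back along the forward orbit inside the petal.\<close>
  have branch: "\<exists>g. g holomorphic_on H \<and> (\<forall>w\<in>H. (?f ^^ j) (g w) = ?k w) \<and>
      (\<forall>n. \<forall>w\<in>H. q * n \<ge> j \<longrightarrow> g ((G ^^ n) w) = (?f ^^ (q * n - j)) (?k w))" for j
  proof (induction j)
    case 0
    have "?k holomorphic_on H"
      using R0 unfolding H_def by (intro holomorphic_on_petal_param) (simp add: R1_def)
    then show ?case using conj by (intro exI[of _ ?k]) auto
  next
    case (Suc j)
    then obtain g where hg: "g holomorphic_on H" and fg: "\<And>w. w \<in> H \<Longrightarrow> (?f ^^ j) (g w) = ?k w"
      and gG: "\<And>n w. w \<in> H \<Longrightarrow> q * n \<ge> j \<Longrightarrow> g ((G ^^ n) w) = (?f ^^ (q * n - j)) (?k w)" by blast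
    \<comment> \<open>The two preimages of \<open>v\<close> coincide only for the critical value
      \<open>- l^2 / 4\<close>; it would put the critical orbit into the petal.\<close>
    have nz: "g w + l\<^sup>2 / 4 \<noteq> 0" if w: "w \<in> H" for w
    proof
      assume "g w + l\<^sup>2 / 4 = 0"
      then have "g w = - l\<^sup>2 / 4" by (simp add: add_eq_0_iff)
      moreover have "?f (- l / 2) = - l\<^sup>2 / 4" by (simp add: qmap_def power2_eq_square field_simps)
      ultimately have "g w = ?f (- l / 2)" by simp
      then have "?k w = (?f ^^ Suc j) (- l / 2)" using fg[OF w] by (simp add: funpow_swap1)
      moreover have "Re w > R" using w by (simp add: H R1_def)
      ultimately show False using no by metis
    qed
    have "(\<lambda>w. g w + l\<^sup>2 / 4) holomorphic_on H" by (intro holomorphic_intros hg)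
    then obtain s where hs: "s holomorphic_on H" and s: "\<And>w. w \<in> H \<Longrightarrow> g w + l\<^sup>2 / 4 = s w ^ 2"
      by (rule contractible_imp_holomorphic_sqrt) (use nz convex_imp_contractible[OF \<open>convex H\<close>] in auto)
    have snz: "s w \<noteq> 0" if "w \<in> H" for w using s[OF that] nz[OF that] by auto
    define n1 where "n1 = (LEAST n. q * n \<ge> Suc j)"
    have n1: "q * n1 \<ge> Suc j"
      unfolding n1_def using mult_le_mono1[OF q, of "Suc j"] by (intro LeastI[of "\<lambda>n. q * n \<ge> Suc j" "Suc j"]) simp
    have n1_le: "n1 \<le> n" if "q * n \<ge> Suc j" for n unfolding n1_def by (rule Least_le) fact
    define t where "t = (\<lambda>w. (?f ^^ (q * n1 - Suc j)) (?k w) + l / 2)"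
    have ht: "t holomorphic_on H"
    proof -
      have "((?f ^^ (q * n1 - Suc j)) \<circ> ?k) holomorphic_on H"
        using R0 unfolding H_def
        by (intro holomorphic_on_compose holomorphic_on_petal_param holomorphic_on_qmap_iter) (simp add: R1_def)
      then show ?thesis unfolding t_def o_def by (intro holomorphic_intros)
    qed
    have t2: "t w ^ 2 = s ((G ^^ n1) w) ^ 2" if w: "w \<in> H" for w
    proof -
      have *: "q * n1 - j = Suc (q * n1 - Suc j)" using n1 by simp
      have "s ((G ^^ n1) w) ^ 2 = (?f ^^ (q * n1 - j)) (?k w) + l\<^sup>2 / 4"
        using s[of "(G ^^ n1) w"] Gn[OF w] gG[OF w] n1 by simp
      also have "\<dots> = ?f ((?f ^^ (q * n1 - Suc j)) (?k w)) + l\<^sup>2 / 4" by (simp add: *)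
      also have "\<dots> = t w ^ 2" by (simp add: t_def qmap_def power2_eq_square field_simps)
      finally show ?thesis by simp
    qed
    \<comment> \<open>Both functions are square roots of the same nonvanishing function, so their
      quotient is a constant sign. This sign selects the normalised branch. It is read off at the
      least admissible \<open>n1\<close>; larger \<open>n\<close> follow from
      \<open>conj\<close>.\<close>
    have "(\<lambda>w. t w / s ((G ^^ n1) w)) constant_on H"
    proof (rule continuous_finite_range_constant)
      show "connected H" using \<open>convex H\<close> by (rule convex_connected)
      have "continuous_on H (s \<circ> (G ^^ n1))"
        using Gn by (intro continuous_on_compose holomorphic_on_imp_continuous_on hGn
          continuous_on_subset[OF holomorphic_on_imp_continuous_on[OF hs]]) auto
      then show "continuous_on H (\<lambda>w. t w / s ((G ^^ n1) w))"
        using snz Gn holomorphic_on_imp_continuous_on[OF ht] by (intro continuous_intros) (auto simp: o_def)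
      have "t w / s ((G ^^ n1) w) \<in> {1, -1}" if "w \<in> H" for w
        using t2[OF that] snz Gn[OF that] by (auto simp: power2_eq_iff)
      then have "(\<lambda>w. t w / s ((G ^^ n1) w)) ` H \<subseteq> {1, -1}" by blast
      then show "finite ((\<lambda>w. t w / s ((G ^^ n1) w)) ` H)"
        by (rule finite_subset) simp
    qed
    then obtain \<sigma> where \<sigma>: "\<And>w. w \<in> H \<Longrightarrow> t w / s ((G ^^ n1) w) = \<sigma>"
      by (auto simp: constant_on_def)
    have t_eq: "t w = \<sigma> * s ((G ^^ n1) w)" if "w \<in> H" for w
      using \<sigma>[OF that] snz Gn[OF that] by (auto simp: field_simps)
    have wH: "complex_of_real (R1 + 1) \<in> H" by (simp add: H)
    have \<sigma>2: "\<sigma> ^ 2 = 1"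
      using t_eq[OF wH] t2[OF wH] snz Gn[OF wH] by (auto simp: power_mult_distrib)
    define g' where "g' = (\<lambda>w. - l / 2 + \<sigma> * s w)"
    have "g' holomorphic_on H" unfolding g'_def by (intro holomorphic_intros hs)
    moreover have "(?f ^^ Suc j) (g' w) = ?k w" if w: "w \<in> H" for w
    proof -
      have "?f (g' w) = \<sigma>\<^sup>2 * s w ^ 2 - l\<^sup>2 / 4"
        by (simp add: qmap_def g'_def power2_eq_square field_simps)
      also have "\<dots> = g w" using s[OF w] by (simp add: \<sigma>2 algebra_simps)
      finally show ?thesis using fg[OF w] by (simp add: funpow_swap1)
    qed
    moreover have "g' ((G ^^ n) w) = (?f ^^ (q * n - Suc j)) (?k w)" if w: "w \<in> H" and n: "q * n \<ge> Suc j" for n w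
    proof -
      obtain i where i: "n = n1 + i" using n1_le[OF n] le_Suc_ex by blast
      have 1: "g' ((G ^^ n1) v) = (?f ^^ (q * n1 - Suc j)) (?k v)" if "v \<in> H" for v
        using t_eq[OF that] by (simp add: g'_def t_def algebra_simps)
      have "g' ((G ^^ n) w) = g' ((G ^^ n1) ((G ^^ i) w))" by (simp add: i funpow_add)
      also have "\<dots> = (?f ^^ (q * n1 - Suc j)) ((?f ^^ (q * i)) (?k w))"
        using 1[of "(G ^^ i) w"] Gn[OF w] conj[OF w] by simp
      also have "\<dots> = (?f ^^ ((q * n1 - Suc j) + q * i)) (?k w)" by (simp add: funpow_add)
      also have "(q * n1 - Suc j) + q * i = q * n - Suc j" using n1 by (simp add: i algebra_simps)
      finally show ?thesis .
    qed
    ultimately show ?case by blast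
  qed
  have bounded: "cmod (g w) \<le> 4" if "(?f ^^ j) (g w) = ?k w" "w \<in> H" for g :: "complex \<Rightarrow> complex" and j w
    using qmap_escape[OF l, of "g w" j] that G(3)[OF HR0[of w]] by fastforce
  define w0 w1 where "w0 = complex_of_real (R1 + 1)" and "w1 = complex_of_real (R1 + 2)"
  have w01: "w0 \<in> H" "w1 \<in> H" "w0 \<noteq> w1" by (auto simp: H w0_def w1_def simp del: of_real_add)
  define d where "d = cmod (?k w0 - ?k w1)"
  have "R1 > 0" using R0 by (simp add: R1_def)
  then have "w0 \<noteq> 0" "w1 \<noteq> 0" by (auto simp: w0_def w1_def simp del: of_real_add)
  moreover have "b \<noteq> 0" using b A m by (auto simp: power_0_left split: if_splits)
  ultimately have d: "d > 0" using petal_param_inj[of m b w0 w1] w01 m by (auto simp: d_def)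
  \<comment> \<open>Discs of radius \<open>n / 4\<close> around points at depth \<open>n / 2\<close>
    stay in \<open>H\<close>, and Cauchy's inequality with the bound 4 gives the derivative bound
    \<open>16 / n\<close>.\<close>
  have bound: "d * real n \<le> 16 * cmod ((G ^^ n) w0 - (G ^^ n) w1)" for n
  proof (cases "n = 0")
    case False
    obtain g where hg: "g holomorphic_on H" and fg: "\<And>w. w \<in> H \<Longrightarrow> (?f ^^ (q * n)) (g w) = ?k w"
      and gG: "\<And>w. w \<in> H \<Longrightarrow> g ((G ^^ n) w) = ?k w" using branch[of "q * n"] by fastforce
    let ?S = "{w. Re w \<ge> R1 + n / 2}"
    have "cmod (g ((G ^^ n) w0) - g ((G ^^ n) w1)) \<le> (16 / real n) * cmod ((G ^^ n) w0 - (G ^^ n) w1)"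
    proof (rule field_differentiable_bound)
      show "convex ?S" using convex_halfspace_Re_ge[of "R1 + n / 2"] by simp
      show "(G ^^ n) w0 \<in> ?S" "(G ^^ n) w1 \<in> ?S"
        using Gn[OF w01(1), of n] Gn[OF w01(2), of n] w01 by (auto simp: H)
      fix z assume z: "z \<in> ?S"
      then have zH: "z \<in> H" using False by (auto simp: H)
      have cb: "cball z (real n / 4) \<subseteq> H"
      proof
        fix w assume "w \<in> cball z (real n / 4)"
        then have "\<bar>Re z - Re w\<bar> \<le> real n / 4"
          using abs_Re_le_cmod[of "z - w"] by (simp add: dist_norm)
        moreover have "R1 + real n / 2 \<le> Re z" "real n > 0" using z False by auto
        ultimately show "w \<in> H" unfolding H by argo
      qed
      show "(g has_field_derivative deriv g z) (at z within ?S)"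
        using hg openH zH by (meson holomorphic_derivI has_field_derivative_at_within)
      have "cmod ((deriv ^^ 1) g z) \<le> fact 1 * 4 / (real n / 4) ^ 1"
      proof (rule Cauchy_inequality)
        show "g holomorphic_on ball z (real n / 4)"
          using cb by (intro holomorphic_on_subset[OF hg]) auto
        show "continuous_on (cball z (real n / 4)) g"
          using cb by (intro continuous_on_subset[OF holomorphic_on_imp_continuous_on[OF hg]]) auto
        fix x assume "cmod (z - x) = real n / 4"
        then have "x \<in> H" using cb by (auto simp: dist_norm)
        then show "cmod (g x) \<le> 4" using bounded fg by blast
      qed (use False in auto)
      then show "cmod (deriv g z) \<le> 16 / real n" by simp
    qed
    then have "d \<le> (16 / real n) * cmod ((G ^^ n) w0 - (G ^^ n) w1)"
      using gG w01 by (simp add: d_def)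
    then show ?thesis using False by (simp add: field_simps)
  qed simp
  \<comment> \<open>With \<open>d / 64\<close> the two orbits separate by at most
    \<open>d / 32\<close> per step, whereas \<open>bound\<close> asks for \<open>d / 16\<close> on
    average.\<close>
  obtain R2 where R2: "\<And>w. Re w > R0 \<and> Re w > R2 \<Longrightarrow> cmod (G w - w - 1) \<le> d / 64"
    using Gas[rule_format, of "d / 64"] d by auto
  obtain N :: nat where N: "real N > 2 * R2" using reals_Archimedean2 by blast
  define v0 v1 where "v0 = (G ^^ N) w0" and "v1 = (G ^^ N) w1"
  have drift: "cmod ((G ^^ i) v - v - of_nat i) \<le> i * (d / 64)" if v: "v \<in> H" "Re v > R2" for v i
  proof (induction i)
    case (Suc i)
    have "cmod (G ((G ^^ i) v) - (G ^^ i) v - 1) \<le> d / 64"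
      using Gn[OF v(1), of i] v(2) HR0 by (intro R2) auto
    moreover have "(G ^^ Suc i) v - v - of_nat (Suc i) = (G ((G ^^ i) v) - (G ^^ i) v - 1) + ((G ^^ i) v - v - of_nat i)"
      by simp
    ultimately have "cmod ((G ^^ Suc i) v - v - of_nat (Suc i)) \<le> d / 64 + i * (d / 64)"
      using Suc by (metis add_mono norm_triangle_le)
    then show ?case by (simp add: algebra_simps)
  qed simp
  have v: "v0 \<in> H" "Re v0 > R2" "v1 \<in> H" "Re v1 > R2"
    using Gn[OF w01(1), of N] Gn[OF w01(2), of N] N \<open>R1 > 0\<close> by (auto simp: v0_def v1_def w0_def w1_def)
  have le: "d * real (i + N) \<le> 16 * (cmod (v0 - v1) + 2 * (i * (d / 64)))" for i
  proof -
    have "cmod ((G ^^ i) v0 - (G ^^ i) v1) = cmod (((G ^^ i) v0 - v0 - of_nat i) - ((G ^^ i) v1 - v1 - of_nat i) + (v0 - v1))"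
      by simp
    also have "\<dots> \<le> i * (d / 64) + i * (d / 64) + cmod (v0 - v1)"
      by (intro norm_triangle_le add_mono norm_triangle_le_diff drift v order_refl)
    finally show ?thesis using bound[of "i + N"] by (simp add: v0_def v1_def funpow_add)
  qed
  obtain i :: nat where "real i * (d / 2) > 16 * cmod (v0 - v1)"
    using reals_Archimedean3[of "d / 2"] d half_gt_zero by blast
  moreover have "d * real i \<le> d * real (i + N)" using d by simp
  ultimately show False using le[of i] by (simp add: algebra_simps)
qed

lemma poly_quadratic: "poly [:0, l, 1:] = qmap l"
  by (auto simp: fun_eq_iff qmap_def algebra_simps power2_eq_square)

lemma poly_bounded_unit_disc:
  fixes G :: "complex poly"
  obtains C where "C \<ge> 0" "\<And>u. cmod u \<le> 1 \<Longrightarrow> cmod (poly G u) \<le> C"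
proof -
  have "compact (poly G ` cball 0 1)"
    by (intro compact_continuous_image continuous_intros) auto
  then have "bounded (poly G ` cball 0 1)" by (rule compact_imp_bounded)
  then obtain C where "C > 0" "\<And>u. u \<in> cball 0 1 \<Longrightarrow> cmod (poly G u) \<le> C"
    by (auto simp: bounded_pos)
  then show ?thesis by (intro that[of C]) auto
qed

lemma poly_remainder_bound:
  fixes F G :: "complex poly"
  assumes F: "F = [:0, 1:] + [:0, 1:] ^ Suc m * G"
  obtains C where "C \<ge> 0"
    "\<And>u. cmod u \<le> 1 \<Longrightarrow> cmod (poly F u - u - poly G 0 * u ^ Suc m) \<le> C * cmod u ^ Suc (Suc m)"
proof -
  obtain g where g: "G = pCons (poly G 0) g" by (cases G) simp
  obtain C where C: "C \<ge> 0" "\<And>u. cmod u \<le> 1 \<Longrightarrow> cmod (poly g u) \<le> C"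
    using poly_bounded_unit_disc by blast
  have "cmod (poly F u - u - poly G 0 * u ^ Suc m) \<le> C * cmod u ^ Suc (Suc m)" if "cmod u \<le> 1" for u
  proof -
    have "poly F u - u - poly G 0 * u ^ Suc m = u ^ Suc m * (poly G u - poly G 0)"
      by (simp add: F algebra_simps)
    also have "poly G u = poly G 0 + u * poly g u" by (subst g) simp
    finally have "poly F u - u - poly G 0 * u ^ Suc m = poly g u * u ^ Suc (Suc m)" by simp
    then show ?thesis
      using C(2)[OF that] by (simp only: norm_mult norm_power mult_right_mono zero_le_power norm_ge_zero)
  qed
  then show ?thesis using C that by blast
qed

lemma qmap_iter_quotient_tendsto: "((\<lambda>u. (qmap l ^^ n) u / u) \<longlongrightarrow> l ^ n) (at 0)"
proof -
  have "poly (poly_iter [:0, l, 1:] n) 0 = 0" "poly (pderiv (poly_iter [:0, l, 1:] n)) 0 = l ^ n"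
    using poly_iter_fixpoint[of "[:0, l, 1:]" n] by (simp_all add: poly_0_coeff_0 coeff_pderiv)
  moreover have "((\<lambda>u. (poly (poly_iter [:0, l, 1:] n) u - poly (poly_iter [:0, l, 1:] n) 0) / (u - 0)) \<longlongrightarrow>
    poly (pderiv (poly_iter [:0, l, 1:] n)) 0) (at 0)"
    using poly_DERIV[of "poly_iter [:0, l, 1:] n" 0] by (simp add: has_field_derivative_iff)
  ultimately show ?thesis by (simp add: poly_poly_iter poly_quadratic)
qed

text \<open>A second cycle of petals would have to attract the critical orbit as well; so there is only one cycle.\<close>

theorem quadratic_petals:
  assumes q: "q \<ge> 1" and l: "\<And>k. l ^ k = 1 \<longleftrightarrow> q dvd k"
  shows "\<exists>G. poly G 0 \<noteq> 0 \<and> poly_iter [:0, l, 1:] q = [:0, 1:] + [:0, 1:] ^ Suc q * G \<and>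
    (\<forall>R. \<exists>n. Re (-1 / (of_nat q * poly G 0 * ((qmap l ^^ n) (- l / 2)) ^ q)) > R)"
proof -
  let ?p = "[:0, l, 1:]" and ?c = "- l / 2" and ?f = "qmap l"
  have "l ^ q = 1" using l by simp
  then have "cmod l ^ q = 1" by (metis norm_one norm_power)
  then have cl: "cmod l = 1" using q power_eq_1_iff[of "cmod l" q] by (simp add: power_eq_1_iff)
  have "degree (poly_iter ?p n) = 2 ^ n" for n
    by (induction n) (auto simp: poly_iter_Suc degree_pcompose)
  then have "degree (poly_iter ?p q) \<noteq> degree [:0, 1 :: complex:]" using q by simp
  then have "poly_iter ?p q \<noteq> [:0, 1:]" by metis
  then obtain m G where m: "m \<ge> 1" "q dvd m" and A: "poly G 0 \<noteq> 0"
    and F: "poly_iter ?p q = [:0, 1:] + [:0, 1:] ^ Suc m * G"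
    using poly_iter_resonant[of ?p q] l by auto
  define A where "A = poly G 0"
  have Anz: "A \<noteq> 0" using A by (simp add: A_def)
  have mnz: "(of_nat m :: complex) \<noteq> 0" using m by simp
  obtain C where C: "C \<ge> 0"
    and FC: "\<And>u. cmod u \<le> 1 \<Longrightarrow> cmod ((?f ^^ q) u - u - A * u ^ Suc m) \<le> C * cmod u ^ Suc (Suc m)"
    using poly_remainder_bound[OF F] unfolding A_def by (metis poly_poly_iter poly_quadratic)
  define b where "b = exp (Ln (-1 / (of_nat m * A)) / of_nat m)"
  \<comment> \<open>\<open>b\<close> and \<open>b * \<omega>\<close> parametrise neighbouring
    petals. The critical orbit enters both, so some \<open>f ^^ s\<close> carries points of the
    first into the second arbitrarily close to 0. Its derivative \<open>l ^ s\<close> must rotate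
    one direction into the other, whence \<open>l ^ s = \<omega>\<close> and
    \<open>m dvd q\<close>.\<close>
  define \<omega> where "\<omega> = exp (2 * of_real pi * \<i> / of_nat m)"
  have b: "b ^ m = -1 / (of_nat m * A)"
    using m Anz by (simp add: b_def flip: exp_of_nat_mult)
  have \<omega>: "\<omega> ^ m = 1"
    using m by (simp add: \<omega>_def flip: exp_of_nat_mult)
  have b': "(b * \<omega>) ^ m = -1 / (of_nat m * A)" using b \<omega> by (simp add: power_mult_distrib)
  have bnz: "b \<noteq> 0" "\<omega> \<noteq> 0" by (simp_all add: b_def \<omega>_def)
  have orbit: "\<exists>n w. (\<forall>i. Re (w i) > 0) \<and> filterlim (\<lambda>i. cmod (w i)) at_top sequentially
      \<and> (\<forall>i. (?f ^^ (n + q * i)) ?c = petal_param m \<beta> (w i))" if \<beta>: "\<beta> ^ m = -1 / (of_nat m * A)" for \<beta>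
  proof -
    obtain R0 G where R0: "R0 > 0"
      and G: "\<And>w. Re w > R0 \<Longrightarrow> cmod (G w - w - 1) \<le> 1 / 2"
        "\<And>w. Re w > R0 \<Longrightarrow> (?f ^^ q) (petal_param m \<beta> w) = petal_param m \<beta> (G w)"
      using petal_conjugacy[OF m(1) Anz C \<beta> holomorphic_on_qmap_iter FC] by blast
    obtain n w0 where w0: "Re w0 > R0" "(?f ^^ n) ?c = petal_param m \<beta> w0"
      using critical_orbit_enters_petal[OF cl q m(1) Anz C \<beta> FC] by blast
    have *: "Re ((G ^^ i) w0) \<ge> Re w0 + i / 2 \<and> (?f ^^ (n + q * i)) ?c = petal_param m \<beta> ((G ^^ i) w0)" for i
    proof (induction i)
      case (Suc i)
      then have R: "Re ((G ^^ i) w0) > R0" using w0 by auto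
      have "\<bar>Re (G ((G ^^ i) w0) - (G ^^ i) w0 - 1)\<bar> \<le> 1 / 2"
        using G(1)[OF R] abs_Re_le_cmod order_trans by blast
      then have "Re (G ((G ^^ i) w0)) \<ge> Re ((G ^^ i) w0) + 1 / 2"
        unfolding minus_complex.sel one_complex.sel by linarith
      moreover have "(?f ^^ (n + q * Suc i)) ?c = (?f ^^ q) ((?f ^^ (n + q * i)) ?c)"
        by (metis add.commute add.assoc mult_Suc_right funpow_add o_apply)
      ultimately show ?case using Suc G(2)[OF R] by (auto simp: add_divide_distrib)
    qed (use w0 in simp)
    have "filterlim (\<lambda>i. Re w0 + real i / 2) at_top sequentially" by real_asymp
    then have "filterlim (\<lambda>i. cmod ((G ^^ i) w0)) at_top sequentially"
    proof (rule filterlim_at_top_mono, intro always_eventually allI)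
      show "Re w0 + real i / 2 \<le> cmod ((G ^^ i) w0)" for i
        using *[of i] complex_Re_le_cmod order_trans by blast
    qed
    moreover have "Re ((G ^^ i) w0) > 0" for i
    proof -
      have "Re w0 + real i / 2 \<ge> Re w0" by simp
      with *[of i] w0 R0 show ?thesis by linarith
    qed
    ultimately show ?thesis using * by (intro exI[of _ n] exI[of _ "\<lambda>i. (G ^^ i) w0"]) blast
  qed
  obtain n w where w: "\<And>i. Re (w i) > 0" "filterlim (\<lambda>i. cmod (w i)) at_top sequentially"
    "\<And>i. (?f ^^ (n + q * i)) ?c = petal_param m b (w i)" using orbit[OF b] by blast
  obtain n' w' where w': "\<And>i. Re (w' i) > 0" "filterlim (\<lambda>i. cmod (w' i)) at_top sequentially"
    "\<And>i. (?f ^^ (n' + q * i)) ?c = petal_param m (b * \<omega>) (w' i)" using orbit[OF b'] by blast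
  \<comment> \<open>The two entry times differ by \<open>t\<close> full periods and \<open>s\<close>
    further steps; the summand \<open>q * n\<close> keeps the subtraction of naturals
    honest.\<close>
  define t s where "t = (n' + q * n - n) div q" and "s = (n' + q * n - n) mod q"
  have "n \<le> q * n" using mult_le_mono1[OF q, of n] by simp
  then have "n' + q * n = n + (n' + q * n - n)" by (simp only: le_add_diff_inverse trans_le_add2)
  also have "n' + q * n - n = q * t + s" by (simp add: t_def s_def)
  finally have ts: "n' + q * n = n + q * t + s" by simp
  define u where "u = (\<lambda>i. petal_param m b (w (t + i)))"
  have fs: "(?f ^^ s) (u i) = petal_param m (b * \<omega>) (w' (n + i))" for i
  proof -
    have "(?f ^^ (n' + q * (n + i))) ?c = (?f ^^ (s + (n + q * (t + i)))) ?c"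
    proof -
      have "n' + q * (n + i) = (n' + q * n) + q * i" by (simp add: distrib_left)
      also have "\<dots> = s + (n + q * (t + i))" unfolding ts by (simp add: distrib_left)
      finally show ?thesis by simp
    qed
    then show ?thesis using w(3)[of "t + i"] w'(3)[of "n + i"] by (simp only: funpow_add[of s] o_apply u_def)
  qed
  have unz: "u i \<noteq> 0" for i using bnz by (simp add: u_def petal_param_nonzero)
  have wnz: "w i \<noteq> 0" "w' i \<noteq> 0" for i using w(1)[of i] w'(1)[of i] by auto
  have "(\<lambda>i. cmod b ^ m / cmod (w (t + i))) \<longlonglongrightarrow> 0"
    by (intro tendsto_divide_0[OF tendsto_const] filterlim_at_top_imp_at_infinity filterlim_compose[OF w(2)] filterlim_add_const_nat_at_top)
      (simp add: add.commute[of t] filterlim_add_const_nat_at_top)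
  then have "(\<lambda>i. cmod (u i) ^ m) \<longlonglongrightarrow> 0"
    using m wnz by (simp add: u_def norm_petal_param)
  then have "(\<lambda>i. root m (cmod (u i) ^ m)) \<longlonglongrightarrow> root m 0" by (rule tendsto_real_root)
  then have u0: "u \<longlonglongrightarrow> 0" using m by (simp add: real_root_power_cancel tendsto_norm_zero_iff)
  have "filterlim u (at 0) sequentially"
    using u0 unz by (simp add: filterlim_at)
  then have quot: "(\<lambda>i. (?f ^^ s) (u i) / u i) \<longlonglongrightarrow> l ^ s"
    by (rule filterlim_compose[OF qmap_iter_quotient_tendsto])
  \<comment> \<open>\<open>\<rho>\<close> is the \<open>m\<close>-th power of the quotient
    \<open>f^s(u) / u\<close> and tends to 1. Since both petal coordinates have positive real part,
    no branch is lost in the \<open>m\<close>-th root and the quotient tends to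
    \<open>\<omega>\<close>.\<close>
  define \<rho> where "\<rho> = (\<lambda>i. w (t + i) / w' (n + i))"
  have "((?f ^^ s) (u i) / u i) ^ m = \<rho> i" for i
  proof -
    have "((?f ^^ s) (u i)) ^ m = b ^ m / w' (n + i)"
      unfolding fs using m(1) wnz \<omega> by (simp add: petal_param_power power_mult_distrib)
    moreover have "u i ^ m = b ^ m / w (t + i)"
      unfolding u_def using m(1) wnz by (simp add: petal_param_power)
    ultimately show ?thesis using bnz by (simp add: power_divide \<rho>_def)
  qed
  moreover have "(\<lambda>i. ((?f ^^ s) (u i) / u i) ^ m) \<longlonglongrightarrow> (l ^ s) ^ m"
    by (intro tendsto_power quot)
  moreover have "(l ^ s) ^ m = 1"
    using l[of m] m by (metis power_mult mult.commute power_one)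
  ultimately have "\<rho> \<longlonglongrightarrow> 1" by simp
  then have "(\<lambda>i. exp (Ln (\<rho> i) / of_nat m)) \<longlonglongrightarrow> exp (Ln 1 / of_nat m)"
    using mnz by (intro tendsto_intros) auto
  then have lim2: "(\<lambda>i. \<omega> * exp (Ln (\<rho> i) / of_nat m)) \<longlonglongrightarrow> \<omega> * exp (Ln 1 / of_nat m)"
    by (rule tendsto_mult[OF tendsto_const])
  have "(?f ^^ s) (u i) / u i = \<omega> * exp (Ln (\<rho> i) / of_nat m)" for i
  proof -
    have "\<bar>Im (Ln (w (t + i)))\<bar> < pi / 2" "\<bar>Im (Ln (w' (n + i)))\<bar> < pi / 2"
      using Re_Ln_pos_lt_imp[OF w(1)[of "t + i"]] Re_Ln_pos_lt_imp[OF w'(1)[of "n + i"]] by blast+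
    then have "Ln (\<rho> i) = Ln (w (t + i)) - Ln (w' (n + i))"
      using wnz by (intro Ln_unique) (auto simp: \<rho>_def exp_diff)
    then have e: "exp (Ln (\<rho> i) / of_nat m) = exp (- Ln (w' (n + i)) / of_nat m) / exp (- Ln (w (t + i)) / of_nat m)"
      by (simp add: diff_divide_distrib flip: exp_diff)
    show ?thesis unfolding e fs unfolding u_def petal_param_def using bnz by simp
  qed
  with lim2 quot have "l ^ s = \<omega>"
    using LIMSEQ_unique by fastforce
  then have "\<omega> ^ q = 1" using \<open>l ^ q = 1\<close> by (metis mult.commute power_mult power_one)
  then have "exp (2 * of_real pi * \<i> * (of_nat q / of_nat m)) = (1 :: complex)"
    by (simp add: \<omega>_def flip: exp_of_nat_mult) (simp add: field_simps)
  then obtain j :: int where "2 * pi * (real q / real m) = of_int (2 * j) * pi"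
    unfolding exp_eq_1 by auto
  then have "real q = of_int j * real m" using m by (simp add: field_simps)
  then have "int q = j * int m" by (metis of_int_eq_iff of_int_mult of_int_of_nat_eq)
  then have "m dvd q" by (metis dvd_triv_right int_dvd_int_iff)
  then have mq: "m = q" using m by (simp add: dvd_antisym)
  show ?thesis
  proof (rule exI[of _ G], intro conjI allI)
    show "poly G 0 \<noteq> 0" by (rule A)
    show "poly_iter ?p q = [:0, 1:] + [:0, 1:] ^ Suc q * G" using F by (simp add: mq)
    fix R
    obtain n v where v: "Re v > max R 0" "(?f ^^ n) ?c = petal_param m b v"
      using critical_orbit_enters_petal[OF cl q m(1) Anz C b FC] by blast
    then have "v \<noteq> 0" by auto
    then have "-1 / (of_nat m * A * ((?f ^^ n) ?c) ^ m) = v"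
      unfolding v(2) using m(1) Anz mnz by (simp add: petal_param_power b)
    then have "Re (-1 / (of_nat q * poly G 0 * ((?f ^^ n) ?c) ^ q)) = Re v"
      by (simp only: mq A_def)
    then show "\<exists>n. R < Re (-1 / (of_nat q * poly G 0 * ((?f ^^ n) ?c) ^ q))"
      using v(1) by (intro exI[of _ n]) simp
  qed
qed

section \<open>A uniform semiparabolic petal\<close>

definition pnorm :: "complex poly \<Rightarrow> real" where
  "pnorm p = sum_list (map cmod (coeffs p))"

lemma pnorm_0 [simp]: "pnorm 0 = 0"
  by (simp add: pnorm_def)

lemma pnorm_pCons [simp]: "pnorm (pCons a p) = cmod a + pnorm p"
  by (simp add: pnorm_def coeffs_pCons_eq_cCons cCons_def)

lemma pnorm_nonneg [simp]: "pnorm p \<ge> 0"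
  by (auto simp: pnorm_def intro!: sum_list_nonneg)

lemma pnorm_add: "pnorm (p + r) \<le> pnorm p + pnorm r"
proof (induction p r rule: poly_induct2)
  case (pCons a p b q)
  then show ?case using norm_triangle_ineq[of a b] by simp
qed simp

lemma pnorm_smult [simp]: "pnorm (smult a p) = cmod a * pnorm p"
  by (induction p) (simp_all add: norm_mult distrib_left)

lemma pnorm_mult: "pnorm (p * r) \<le> pnorm p * pnorm r"
proof (induction p)
  case (pCons a p)
  have "pnorm (pCons a p * r) \<le> cmod a * pnorm r + pnorm (p * r)"
    using pnorm_add[of "smult a r" "pCons 0 (p * r)"] by simp
  also have "\<dots> \<le> pnorm (pCons a p) * pnorm r" using pCons by (simp add: distrib_right)
  finally show ?case .
qed simp

lemma pnorm_pcompose: "pnorm (pcompose p r) \<le> pnorm p * (1 + pnorm r) ^ degree p"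
proof (induction p)
  case (pCons a p)
  show ?case
  proof (cases "p = 0")
    case False
    have "pnorm (pcompose (pCons a p) r) \<le> cmod a + pnorm r * pnorm (pcompose p r)"
      using pnorm_add[of "[:a:]" "r * pcompose p r"] pnorm_mult[of r "pcompose p r"]
      by (simp add: pcompose_pCons)
    also have "\<dots> \<le> cmod a * (1 + pnorm r) ^ Suc (degree p) + (1 + pnorm r) * (pnorm p * (1 + pnorm r) ^ degree p)"
    proof (rule add_mono)
      have "1 \<le> (1 + pnorm r) ^ Suc (degree p)" by (rule one_le_power) simp
      then show "cmod a \<le> cmod a * (1 + pnorm r) ^ Suc (degree p)"
        using mult_left_mono[of 1 "(1 + pnorm r) ^ Suc (degree p)" "cmod a"] by simp
      show "pnorm r * pnorm (pcompose p r) \<le> (1 + pnorm r) * (pnorm p * (1 + pnorm r) ^ degree p)"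
        using pCons by (intro mult_mono) auto
    qed
    also have "\<dots> = pnorm (pCons a p) * (1 + pnorm r) ^ degree (pCons a p)"
      using False by (simp add: algebra_simps)
    finally show ?thesis .
  qed simp
qed simp

lemma norm_poly_le_pnorm: "cmod (poly p u) \<le> pnorm p * (1 + cmod u) ^ degree p"
proof -
  have "pcompose p [:u:] = [:poly p u:]"
    by (induction p) (simp_all add: pcompose_pCons)
  then show ?thesis using pnorm_pcompose[of p "[:u:]"] by simp
qed

lemma norm_poly_le_pnorm_disc:
  assumes "cmod u \<le> 1"
  shows "cmod (poly p u) \<le> pnorm p"
proof (induction p)
  case (pCons a p)
  have "cmod u * cmod (poly p u) \<le> 1 * pnorm p" using pCons assms by (intro mult_mono) auto
  then show ?case using norm_triangle_ineq[of a "u * poly p u"] by (simp add: norm_mult)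
qed simp

lemma poly_lipschitz_disc:
  assumes "cmod u \<le> 1" "cmod v \<le> 1"
  shows "cmod (poly p u - poly p v) \<le> real (degree p) * pnorm p * cmod (u - v)"
proof (induction p)
  case (pCons a p)
  show ?case
  proof (cases "p = 0")
    case False
    have "poly (pCons a p) u - poly (pCons a p) v = u * (poly p u - poly p v) + (u - v) * poly p v"
      by (simp add: algebra_simps)
    then have "cmod (poly (pCons a p) u - poly (pCons a p) v) \<le> cmod u * cmod (poly p u - poly p v) + cmod (u - v) * cmod (poly p v)"
      by (metis norm_mult norm_triangle_ineq)
    also have "\<dots> \<le> 1 * (real (degree p) * pnorm p * cmod (u - v)) + cmod (u - v) * pnorm p"
      using assms by (intro add_mono mult_mono pCons norm_poly_le_pnorm_disc) auto
    also have "\<dots> \<le> real (degree (pCons a p)) * pnorm (pCons a p) * cmod (u - v)"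
      using False by (simp add: algebra_simps)
    finally show ?thesis .
  qed simp
qed simp

text \<open>Only bounds uniform in the parameter are recorded. Continuity in the parameter is needed
  just at 0, where it follows from these bounds, because the family enters the dynamics multiplied
  by \<open>\<eta>\<close>.\<close>

definition ufam :: "'i set \<Rightarrow> ('i \<Rightarrow> complex poly) \<Rightarrow> bool" where
  "ufam I f \<longleftrightarrow> (\<exists>D B. \<forall>i\<in>I. degree (f i) \<le> D \<and> pnorm (f i) \<le> B)"

lemma ufamI: "(\<And>i. i \<in> I \<Longrightarrow> degree (f i) \<le> D \<and> pnorm (f i) \<le> B) \<Longrightarrow> ufam I f"
  by (auto simp: ufam_def)

lemma ufamE:
  assumes "ufam I f"
  obtains D B where "B \<ge> 1" "\<And>i. i \<in> I \<Longrightarrow> degree (f i) \<le> D" "\<And>i. i \<in> I \<Longrightarrow> pnorm (f i) \<le> B"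
proof -
  obtain D B where "\<forall>i\<in>I. degree (f i) \<le> D \<and> pnorm (f i) \<le> B" using assms by (auto simp: ufam_def)
  then show ?thesis by (intro that[of "max 1 B" D]) auto
qed

lemma ufam_const: "ufam I (\<lambda>i. p)"
  by (rule ufamI[of _ _ "degree p" "pnorm p"]) simp

lemma ufam_add:
  assumes "ufam I f" "ufam I g"
  shows "ufam I (\<lambda>i. f i + g i)"
proof -
  obtain D B where f: "\<And>i. i \<in> I \<Longrightarrow> degree (f i) \<le> D" "\<And>i. i \<in> I \<Longrightarrow> pnorm (f i) \<le> B"
    using assms(1) by (rule ufamE) blast
  obtain D' B' where g: "\<And>i. i \<in> I \<Longrightarrow> degree (g i) \<le> D'" "\<And>i. i \<in> I \<Longrightarrow> pnorm (g i) \<le> B'"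
    using assms(2) by (rule ufamE) blast
  show ?thesis
  proof (rule ufamI[of _ _ "max D D'" "B + B'"], intro conjI)
    fix i assume "i \<in> I"
    then have *: "degree (f i) \<le> D" "pnorm (f i) \<le> B" "degree (g i) \<le> D'" "pnorm (g i) \<le> B'"
      using f g by auto
    then show "degree (f i + g i) \<le> max D D'"
      using degree_add_le_max[of "f i" "g i"] by linarith
    show "pnorm (f i + g i) \<le> B + B'"
      using pnorm_add[of "f i" "g i"] * by linarith
  qed
qed

lemma ufam_mult:
  assumes "ufam I f" "ufam I g"
  shows "ufam I (\<lambda>i. f i * g i)"
proof -
  obtain D B where f: "B \<ge> 1" "\<And>i. i \<in> I \<Longrightarrow> degree (f i) \<le> D" "\<And>i. i \<in> I \<Longrightarrow> pnorm (f i) \<le> B"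
    using assms(1) by (rule ufamE) blast
  obtain D' B' where g: "\<And>i. i \<in> I \<Longrightarrow> degree (g i) \<le> D'" "\<And>i. i \<in> I \<Longrightarrow> pnorm (g i) \<le> B'"
    using assms(2) by (rule ufamE) blast
  show ?thesis
  proof (rule ufamI[of _ _ "D + D'" "B * B'"], intro conjI)
    fix i assume "i \<in> I"
    then show "degree (f i * g i) \<le> D + D'" "pnorm (f i * g i) \<le> B * B'"
      using f g by (auto intro!: order_trans[OF degree_mult_le] order_trans[OF pnorm_mult] add_mono mult_mono)
  qed
qed

lemma ufam_smult:
  assumes "\<And>i. i \<in> I \<Longrightarrow> cmod (a i) \<le> M" "ufam I f"
  shows "ufam I (\<lambda>i. smult (a i) (f i))"
proof -
  have "ufam I (\<lambda>i. [:a i:])" by (rule ufamI[of _ _ 0 M]) (use assms in auto)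
  from ufam_mult[OF this assms(2)] show ?thesis by simp
qed

lemma ufam_pcompose:
  assumes "ufam I f" "ufam I g"
  shows "ufam I (\<lambda>i. pcompose (f i) (g i))"
proof -
  obtain D B where f: "B \<ge> 1" "\<And>i. i \<in> I \<Longrightarrow> degree (f i) \<le> D" "\<And>i. i \<in> I \<Longrightarrow> pnorm (f i) \<le> B"
    using assms(1) by (rule ufamE) blast
  obtain D' B' where g: "\<And>i. i \<in> I \<Longrightarrow> degree (g i) \<le> D'" "\<And>i. i \<in> I \<Longrightarrow> pnorm (g i) \<le> B'"
    using assms(2) by (rule ufamE) blast
  show ?thesis
  proof (rule ufamI[of _ _ "D * D'" "B * (1 + B') ^ D"], intro conjI)
    fix i assume i: "i \<in> I"
    show "degree (pcompose (f i) (g i)) \<le> D * D'"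
      using f g i by (auto simp: degree_pcompose intro!: mult_mono)
    have "pnorm (pcompose (f i) (g i)) \<le> pnorm (f i) * (1 + pnorm (g i)) ^ degree (f i)"
      by (rule pnorm_pcompose)
    also have "\<dots> \<le> B * (1 + B') ^ D"
    proof (intro mult_mono)
      have "0 \<le> B'" using g(2)[OF i] pnorm_nonneg[of "g i"] by linarith
      then show "(1 + pnorm (g i)) ^ degree (f i) \<le> (1 + B') ^ D"
        using f(2)[OF i] g(2)[OF i]
        by (intro order_trans[OF power_mono[of _ "1 + B'"] power_increasing]) auto
    qed (use f i in auto)
    finally show "pnorm (pcompose (f i) (g i)) \<le> B * (1 + B') ^ D" .
  qed
qed

lemma ufam_poly_iter: "ufam I f \<Longrightarrow> ufam I (\<lambda>i. poly_iter (f i) n)"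
  by (induction n) (simp_all add: poly_iter_Suc ufam_pcompose ufam_const)

lemma ufam_diff: "ufam I f \<Longrightarrow> ufam I g \<Longrightarrow> ufam I (\<lambda>i. f i - g i)"
  using ufam_add[of I f "\<lambda>i. smult (-1) (g i)"] ufam_smult[of I "\<lambda>_. -1" 1 g] by simp

lemma ufam_power: "ufam I f \<Longrightarrow> ufam I (\<lambda>i. f i ^ n)"
  by (induction n) (auto intro: ufam_const ufam_mult)

lemma pnorm_X_power_mult: "pnorm ([:0, 1:] ^ k * p) = pnorm p"
  by (induction k arbitrary: p) (simp_all add: mult.assoc)

lemma ufam_X_power_quotient:
  assumes "ufam I f" "\<And>i. i \<in> I \<Longrightarrow> f i = [:0, 1:] ^ k * g i"
  shows "ufam I g"
proof -
  obtain D B where f: "\<And>i. i \<in> I \<Longrightarrow> degree (f i) \<le> D" "\<And>i. i \<in> I \<Longrightarrow> pnorm (f i) \<le> B"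
    using assms(1) by (rule ufamE) blast
  show ?thesis
  proof (rule ufamI[of _ _ D B], intro conjI)
    fix i assume i: "i \<in> I"
    show "pnorm (g i) \<le> B" using f(2)[OF i] assms(2)[OF i] by (simp add: pnorm_X_power_mult)
    show "degree (g i) \<le> D"
    proof (cases "g i = 0")
      case False
      then have "degree (f i) = k + degree (g i)"
        by (simp add: assms(2)[OF i] degree_mult_eq degree_power_eq)
      then show ?thesis using f(1)[OF i] by simp
    qed simp
  qed
qed

section \<open>Approximate center curves and their attraction\<close>

definition slow_map :: "complex \<Rightarrow> complex \<Rightarrow> complex poly \<Rightarrow> complex poly" where
  "slow_map l \<eta> h = [:0, l:] + ([:0, 1:] + smult \<eta> h)\<^sup>2"

text \<open>The defect of invariance of the curve \<open>s = h u\<close>: on it the map acts by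
  \<open>slow_map\<close> in the first coordinate, and its second coordinate after one step is
  \<open>u + \<eta> h u\<close>.\<close>

definition slow_err :: "complex \<Rightarrow> complex \<Rightarrow> complex poly \<Rightarrow> complex poly" where
  "slow_err l \<eta> h = pcompose h (slow_map l \<eta> h) - [:0, 1:] - smult \<eta> h"

lemma ufam_slow_map:
  assumes "\<And>\<eta>. \<eta> \<in> I \<Longrightarrow> cmod \<eta> \<le> 1 / 2" "ufam I h"
  shows "ufam I (\<lambda>\<eta>. slow_map l \<eta> (h \<eta>))"
  unfolding slow_map_def using assms by (intro ufam_add ufam_const ufam_power ufam_smult[of _ _ "1 / 2"]) auto

lemma ufam_slow_err:
  assumes "\<And>\<eta>. \<eta> \<in> I \<Longrightarrow> cmod \<eta> \<le> 1 / 2" "ufam I h"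
  shows "ufam I (\<lambda>\<eta>. slow_err l \<eta> (h \<eta>))"
  unfolding slow_err_def using assms
  by (intro ufam_diff ufam_const ufam_pcompose ufam_slow_map ufam_smult[of _ _ "1 / 2"]) auto

text \<open>The graph \<open>s = h u\<close> is a center curve up to order \<open>N\<close> of the map
  \<open>(u, s) \<mapsto> (l u + (u + \<eta> s)\<^sup>2, u + \<eta> s)\<close>; the next coefficient is found by dividing by \<open>l\<^sup>N - \<eta>\<close>.\<close>

lemma center_curve:
  assumes l: "cmod l = 1"
  shows "\<exists>h. ufam {\<eta>. cmod \<eta> \<le> 1 / 2} h \<and>
     (\<forall>\<eta>. cmod \<eta> \<le> 1 / 2 \<longrightarrow> poly (h \<eta>) 0 = 0 \<and> [:0, 1:] ^ Suc N dvd slow_err l \<eta> (h \<eta>))"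
proof (induction N)
  case 0
  have "slow_err l \<eta> 0 = [:0, 1:] ^ Suc 0 * [:-1:]" for \<eta>
    by (simp add: slow_err_def)
  then have "[:0, 1:] ^ Suc 0 dvd slow_err l \<eta> 0" for \<eta>
    by (metis dvd_triv_left)
  then show ?case
    using ufam_const[of _ 0] by (intro exI[of _ "\<lambda>_. 0"] conjI allI impI poly_0)
next
  case (Suc N)
  let ?X = "[:0, 1:] :: complex poly" and ?I = "{\<eta>. cmod \<eta> \<le> 1 / 2}"
  define M where "M = Suc N"
  obtain h where uh: "ufam ?I h" and h0: "\<And>\<eta>. \<eta> \<in> ?I \<Longrightarrow> poly (h \<eta>) 0 = 0"
    and dvd: "\<And>\<eta>. \<eta> \<in> ?I \<Longrightarrow> ?X ^ M dvd slow_err l \<eta> (h \<eta>)" using Suc unfolding M_def by auto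
  have "\<forall>\<eta>. \<exists>E. \<eta> \<in> ?I \<longrightarrow> slow_err l \<eta> (h \<eta>) = ?X ^ M * E" using dvd by (auto simp: dvd_def)
  then obtain E where E: "\<And>\<eta>. \<eta> \<in> ?I \<Longrightarrow> slow_err l \<eta> (h \<eta>) = ?X ^ M * E \<eta>" by metis
  have uE: "ufam ?I E"
    by (rule ufam_X_power_quotient[OF ufam_slow_err[OF _ uh] E]) auto
  obtain D B where B: "B \<ge> 1" "\<And>\<eta>. \<eta> \<in> ?I \<Longrightarrow> pnorm (E \<eta>) \<le> B" using uE by (rule ufamE) blast
  \<comment> \<open>Adding \<open>b u^M\<close> to \<open>h\<close> changes \<open>slow_map\<close>
    only at order \<open>M + 1\<close>, so the defect changes at order \<open>M\<close> by
    \<open>b (l^M - \<eta>)\<close>. The divisor stays away from 0 because \<open>cmod l = 1\<close>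
    and \<open>cmod \<eta> \<le> 1 / 2\<close>, which keeps the family bounded.\<close>
  define b where "b = (\<lambda>\<eta>. - poly (E \<eta>) 0 / (l ^ M - \<eta>))"
  have den: "cmod (l ^ M - \<eta>) \<ge> 1 / 2" if "\<eta> \<in> ?I" for \<eta>
    using norm_triangle_ineq2[of "l ^ M" \<eta>] that l by (simp add: norm_power)
  have b: "cmod (b \<eta>) \<le> 2 * B" if "\<eta> \<in> ?I" for \<eta>
  proof -
    have "cmod (poly (E \<eta>) 0) \<le> B" using norm_poly_le_pnorm_disc[of 0 "E \<eta>"] B(2)[OF that] by simp
    then have "cmod (b \<eta>) \<le> B / (1 / 2)" unfolding b_def norm_divide norm_minus_cancel
      using den[OF that] B(1) by (intro frac_le) auto
    then show ?thesis by simp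
  qed
  define h' where "h' = (\<lambda>\<eta>. h \<eta> + smult (b \<eta>) (?X ^ M))"
  have "ufam ?I h'" unfolding h'_def using b by (intro ufam_add uh ufam_smult[of _ _ "2 * B"] ufam_const) auto
  moreover have "poly (h' \<eta>) 0 = 0 \<and> ?X ^ Suc M dvd slow_err l \<eta> (h' \<eta>)" if \<eta>: "\<eta> \<in> ?I" for \<eta>
  proof
    show h'0: "poly (h' \<eta>) 0 = 0" using h0[OF \<eta>] by (simp add: h'_def M_def)
    define f f' where "f = slow_map l \<eta> (h \<eta>)" and "f' = slow_map l \<eta> (h' \<eta>)"
    obtain g where g: "h \<eta> = ?X * g" using h0[OF \<eta>] poly_eq_0_iff_dvd[of "h \<eta>" 0] by (auto simp: dvd_def)
    obtain g' where g': "h' \<eta> = ?X * g'" using h'0 poly_eq_0_iff_dvd[of "h' \<eta>" 0] by (auto simp: dvd_def)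
    define r where "r = [:l:] + ?X * ([:1:] + smult \<eta> g')\<^sup>2"
    have f'r: "f' = ?X * r"
    proof -
      have "?X + smult \<eta> (h' \<eta>) = ?X * ([:1:] + smult \<eta> g')" by (simp add: g')
      moreover have "[:0, l:] + (?X * k)\<^sup>2 = ?X * ([:l:] + ?X * k\<^sup>2)" for k
        by (simp add: power2_eq_square)
      ultimately show ?thesis by (simp only: f'_def slow_map_def r_def)
    qed
    have r0: "poly r 0 = l" by (simp add: r_def)
    have "f' - f = ?X ^ Suc M * (smult (\<eta> * b \<eta>) ([:2:] + smult \<eta> (g + g')))"
    proof -
      have "f' - f = (smult \<eta> (h' \<eta>) - smult \<eta> (h \<eta>)) * (?X + ?X + smult \<eta> (h \<eta>) + smult \<eta> (h' \<eta>))"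
      proof -
        have "([:0, l:] + (x + b)\<^sup>2) - ([:0, l:] + (x + a)\<^sup>2) = (b - a) * (x + x + a + b)" for x a b :: "complex poly"
          by (simp add: power2_eq_square algebra_simps)
        then show ?thesis by (simp only: f_def f'_def slow_map_def)
      qed
      also have "smult \<eta> (h' \<eta>) - smult \<eta> (h \<eta>) = smult (\<eta> * b \<eta>) (?X ^ M)"
        by (simp add: h'_def smult_add_right)
      also have "?X + ?X + smult \<eta> (h \<eta>) + smult \<eta> (h' \<eta>) = ?X * ([:2:] + smult \<eta> (g + g'))"
        unfolding g g' by (simp add: algebra_simps smult_add_right)
      finally show ?thesis by (simp add: algebra_simps)
    qed
    then have d1: "?X ^ Suc M dvd f' - f" by (metis dvd_triv_left)
    have f0: "poly f 0 = 0" "poly f' 0 = 0"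
      using h0[OF \<eta>] h'0 by (simp_all add: f_def f'_def slow_map_def)
    have d2: "?X ^ Suc M dvd pcompose (h \<eta>) f' - pcompose (h \<eta>) f"
      using pcompose_diff_factor[OF f0(2) f0(1), of "h \<eta>"] d1 by (metis dvd_mult2)
    have "poly (E \<eta> + smult (b \<eta>) (r ^ M) - [:\<eta> * b \<eta>:]) 0 = poly (E \<eta>) 0 + b \<eta> * (l ^ M - \<eta>)"
      by (simp add: r0 algebra_simps)
    also have "l ^ M - \<eta> \<noteq> 0" using den[OF \<eta>] by auto
    then have "poly (E \<eta>) 0 + b \<eta> * (l ^ M - \<eta>) = 0" by (simp add: b_def)
    finally have "[:- 0, 1:] dvd E \<eta> + smult (b \<eta>) (r ^ M) - [:\<eta> * b \<eta>:]"
      by (simp only: poly_eq_0_iff_dvd)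
    then have "?X dvd E \<eta> + smult (b \<eta>) (r ^ M) - [:\<eta> * b \<eta>:]" by simp
    then have d3: "?X ^ Suc M dvd ?X ^ M * (E \<eta> + smult (b \<eta>) (r ^ M) - [:\<eta> * b \<eta>:])"
      unfolding power_Suc2 by (rule mult_dvd_mono[OF dvd_refl])
    have "slow_err l \<eta> (h' \<eta>) = (pcompose (h \<eta>) f' - pcompose (h \<eta>) f) + slow_err l \<eta> (h \<eta>)
        + smult (b \<eta>) (f' ^ M) - smult (\<eta> * b \<eta>) (?X ^ M)"
      unfolding slow_err_def f_def[symmetric] f'_def[symmetric]
      by (simp add: h'_def pcompose_add pcompose_smult pcompose_power pcompose_pCons smult_add_right algebra_simps)
    also have "\<dots> = (pcompose (h \<eta>) f' - pcompose (h \<eta>) f) + ?X ^ M * (E \<eta> + smult (b \<eta>) (r ^ M) - [:\<eta> * b \<eta>:])"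
      unfolding E[OF \<eta>] f'r power_mult_distrib by (simp add: algebra_simps)
    finally show "?X ^ Suc M dvd slow_err l \<eta> (h' \<eta>)" using d2 d3 by (simp add: dvd_add)
  qed
  ultimately show ?case unfolding M_def by (intro exI[of _ h']) auto
qed

text \<open>The transverse multiplier is about \<open>\<eta>\<close>, so the cusp
  \<open>cmod (s - h u) \<le> C * cmod u ^ N\<close> around the center curve maps into itself while
  \<open>u\<close> is small: the old deviation contributes at most a quarter, the defect of the
  curve at most \<open>K * cmod u ^ N\<close>.\<close>

lemma near_center_curve_step:
  assumes l: "cmod l = 1" and N: "N \<ge> 1"
    and uh: "ufam {\<eta>. cmod \<eta> \<le> 1 / 2} h"
    and h0': "\<forall>\<eta>. cmod \<eta> \<le> 1 / 2 \<longrightarrow> poly (h \<eta>) 0 = 0"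
    and dvd': "\<forall>\<eta>. cmod \<eta> \<le> 1 / 2 \<longrightarrow> [:0, 1:] ^ N dvd slow_err l \<eta> (h \<eta>)"
  shows "\<exists>C K \<tau> \<eta>0. C \<ge> 1 \<and> K \<ge> 0 \<and> 4 * K + 1 \<le> C \<and> \<tau> > 0 \<and> \<eta>0 > 0 \<and> \<tau> \<le> 1 / 2 \<and> \<eta>0 \<le> 1 / 2 \<and>
    (\<forall>\<eta> u. cmod \<eta> \<le> 1 / 2 \<and> cmod u \<le> 1 \<longrightarrow> cmod (poly (slow_err l \<eta> (h \<eta>)) u) \<le> K * cmod u ^ N) \<and>
    (\<forall>\<eta> u. cmod \<eta> \<le> 1 / 2 \<and> cmod u \<le> 1 \<longrightarrow> cmod (poly (h \<eta>) u) \<le> C) \<and>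
    (\<forall>\<eta> u v. cmod \<eta> \<le> 1 / 2 \<and> cmod u \<le> 1 \<and> cmod v \<le> 1 \<longrightarrow> cmod (poly (h \<eta>) u - poly (h \<eta>) v) \<le> C * cmod (u - v)) \<and>
    (\<forall>\<eta> u s v u'. cmod \<eta> < \<eta>0 \<and> u \<noteq> 0 \<and> cmod u < \<tau> \<and> cmod (s - poly (h \<eta>) u) \<le> C * cmod u ^ N \<and>
       v = u + \<eta> * s \<and> u' = l * u + v\<^sup>2 \<longrightarrow>
       u' \<noteq> 0 \<and> cmod u' \<le> 2 * cmod u \<and> cmod v \<le> 1 \<and> cmod u ^ N \<le> 2 * cmod u' ^ N \<and>
       cmod (v - poly (h \<eta>) u') \<le> C * cmod u' ^ N \<and>
       cmod (u' - poly (slow_map l \<eta> (h \<eta>)) u) \<le> C * cmod u ^ N)"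
proof -
  let ?I = "{\<eta> :: complex. cmod \<eta> \<le> 1 / 2}"
  note h0 = h0'[rule_format] and dvd = dvd'[rule_format]
  obtain D B where B: "B \<ge> 1" "\<And>\<eta>. \<eta> \<in> ?I \<Longrightarrow> degree (h \<eta>) \<le> D" "\<And>\<eta>. \<eta> \<in> ?I \<Longrightarrow> pnorm (h \<eta>) \<le> B"
    using uh by (rule ufamE) blast
  define L where "L = real D * B + B"
  have L: "L \<ge> 1" using B(1) by (simp add: L_def add_increasing)
  have lip: "cmod (poly (h \<eta>) u - poly (h \<eta>) v) \<le> L * cmod (u - v)"
    if "cmod \<eta> \<le> 1 / 2" "cmod u \<le> 1" "cmod v \<le> 1" for \<eta> u v
  proof -
    have "real (degree (h \<eta>)) * pnorm (h \<eta>) \<le> real D * B"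
      using B that by (intro mult_mono) auto
    then have "real (degree (h \<eta>)) * pnorm (h \<eta>) \<le> L" using B(1) by (simp add: L_def)
    then show ?thesis
      by (rule order_trans[OF poly_lipschitz_disc[OF that(2,3)] mult_right_mono]) simp
  qed
  have hb: "cmod (poly (h \<eta>) u) \<le> L * cmod u" if "cmod \<eta> \<le> 1 / 2" "cmod u \<le> 1" for \<eta> u
    using lip[OF that, of 0] h0[OF that(1)] by simp
  have "\<forall>\<eta>. \<exists>E. \<eta> \<in> ?I \<longrightarrow> slow_err l \<eta> (h \<eta>) = [:0, 1:] ^ N * E" using dvd by (auto simp: dvd_def)
  then obtain E where E: "\<And>\<eta>. \<eta> \<in> ?I \<Longrightarrow> slow_err l \<eta> (h \<eta>) = [:0, 1:] ^ N * E \<eta>" by metis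
  have uE: "ufam ?I E"
    by (rule ufam_X_power_quotient[OF ufam_slow_err[OF _ uh] E]) auto
  obtain D' K where K: "K \<ge> 1" "\<And>\<eta>. \<eta> \<in> ?I \<Longrightarrow> pnorm (E \<eta>) \<le> K" using uE by (rule ufamE) blast
  have err: "cmod (poly (slow_err l \<eta> (h \<eta>)) u) \<le> K * cmod u ^ N" if "cmod \<eta> \<le> 1 / 2" "cmod u \<le> 1" for \<eta> u
  proof -
    have "cmod (poly (E \<eta>) u) \<le> K"
      using norm_poly_le_pnorm_disc[OF that(2), of "E \<eta>"] K(2)[of \<eta>] that(1) by simp
    then have "cmod u ^ N * cmod (poly (E \<eta>) u) \<le> cmod u ^ N * K" by (intro mult_left_mono) auto
    moreover have "poly (slow_err l \<eta> (h \<eta>)) u = u ^ N * poly (E \<eta>) u" using E[of \<eta>] that(1) by simp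
    ultimately show ?thesis by (simp add: norm_mult norm_power mult.commute)
  qed
  \<comment> \<open>\<open>4 K \<le> C\<close> bounds the new deviation by
    \<open>C / 2 * cmod u ^ N\<close>, which pays for the factor 2 in
    \<open>cmod u ^ N \<le> 2 * cmod u' ^ N\<close>. The summand \<open>L\<close> lets
    \<open>C\<close> also bound \<open>h\<close> and its Lipschitz constant.\<close>
  define C where "C = 4 * K + 1 + L"
  define M where "M = 1 + L + C"
  define K0 where "K0 = 2 * (1 + L) + 1"
  define K1 where "K1 = 1 + L * K0"
  define \<tau> where "\<tau> = min (1 / (2 * (real N + 1) * M\<^sup>2)) (1 / (4 * C))"
  define \<eta>0 where "\<eta>0 = 1 / (4 * (K1 + K0))"
  have C: "C \<ge> 1" "4 * K + 1 \<le> C" "L \<le> C" using K L by (auto simp: C_def)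
  have M: "M \<ge> 1" using C L by (simp add: M_def)
  have K0: "K0 \<ge> 1" using L by (simp add: K0_def)
  have K1: "K1 \<ge> 1" using L K0 by (simp add: K1_def)
  have MM: "M\<^sup>2 \<ge> 1" using M by (simp add: one_le_power)
  have \<tau>: "\<tau> > 0" "\<tau> \<le> 1 / (4 * C)" "\<tau> \<le> 1 / (2 * (real N + 1) * M\<^sup>2)" using C M by (auto simp: \<tau>_def)
  have "1 / (4 * C) \<le> 1 / 4" using C(1) by (simp add: field_simps)
  then have \<tau>2: "\<tau> \<le> 1 / 4" using \<tau>(2) by linarith
  have \<eta>0: "\<eta>0 > 0" "\<eta>0 \<le> 1 / 4" "\<eta>0 * K1 \<le> 1 / 4" "\<eta>0 * K0 \<le> 1 / 4" using K0 K1 by (auto simp: \<eta>0_def field_simps)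
  have step: "u' \<noteq> 0 \<and> cmod u' \<le> 2 * cmod u \<and> cmod v \<le> 1 \<and> cmod u ^ N \<le> 2 * cmod u' ^ N \<and>
       cmod (v - poly (h \<eta>) u') \<le> C * cmod u' ^ N \<and>
       cmod (u' - poly (slow_map l \<eta> (h \<eta>)) u) \<le> C * cmod u ^ N"
    if \<eta>: "cmod \<eta> < \<eta>0" and u: "u \<noteq> 0" "cmod u < \<tau>" and d: "cmod (s - poly (h \<eta>) u) \<le> C * cmod u ^ N"
      and v: "v = u + \<eta> * s" and u': "u' = l * u + v\<^sup>2" for \<eta> u s v u'
  proof -
    have \<eta>h: "cmod \<eta> \<le> 1 / 2" and \<eta>1: "cmod \<eta> \<le> 1" using \<eta> \<eta>0 by auto
    have u1: "cmod u \<le> 1 / 4" "cmod u \<le> 1" using u \<tau>2 by auto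
    define d where "d = s - poly (h \<eta>) u"
    define w where "w = u + \<eta> * poly (h \<eta>) u"
    have uN: "cmod u ^ N \<le> cmod u" using power_decreasing[of 1 N "cmod u"] N u1 by simp
    have dN: "cmod d \<le> C * cmod u ^ N" using d by (simp add: d_def)
    also have "\<dots> \<le> C * cmod u" using uN C by simp
    finally have du: "cmod d \<le> C * cmod u" .
    also have "\<dots> \<le> C * (1 / (4 * C))" using u \<tau>(2) C by (intro mult_left_mono) auto
    finally have d1: "cmod d \<le> 1" using C by simp
    have vw: "v = w + \<eta> * d" by (simp add: v w_def d_def algebra_simps)
    have w1: "cmod w \<le> (1 + L) * cmod u"
    proof -
      have "cmod w \<le> cmod u + cmod \<eta> * cmod (poly (h \<eta>) u)"
        unfolding w_def by (metis norm_mult norm_triangle_ineq)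
      also have "\<dots> \<le> cmod u + 1 * (L * cmod u)"
        using hb[OF \<eta>h u1(2)] \<eta>1 L by (intro add_mono mult_mono) auto
      finally show ?thesis by (simp add: algebra_simps)
    qed
    have "cmod v \<le> cmod w + cmod \<eta> * cmod d" unfolding vw by (metis norm_mult norm_triangle_ineq)
    also have "\<dots> \<le> (1 + L) * cmod u + 1 * (C * cmod u)"
      using w1 du \<eta>1 by (intro add_mono mult_mono) auto
    finally have vM: "cmod v \<le> M * cmod u" by (simp add: M_def algebra_simps)
    have Mu: "M\<^sup>2 * cmod u \<le> 1 / (2 * (real N + 1))"
    proof -
      have "M\<^sup>2 * cmod u \<le> M\<^sup>2 * (1 / (2 * (real N + 1) * M\<^sup>2))" using u \<tau>(3) by (intro mult_left_mono) auto
      also have "\<dots> = 1 / (2 * (real N + 1))" using M by simp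
      finally show ?thesis .
    qed
    also have "\<dots> \<le> 1 / 2" by (simp add: field_simps)
    finally have Mu2: "M\<^sup>2 * cmod u \<le> 1 / 2" .
    have "cmod (v\<^sup>2) \<le> (M * cmod u)\<^sup>2" unfolding norm_power using vM by (intro power_mono) auto
    then have v2: "cmod (v\<^sup>2) \<le> (M\<^sup>2 * cmod u) * cmod u" by (simp add: power2_eq_square algebra_simps)
    have "M * cmod u \<le> M\<^sup>2 * cmod u" using M by (intro mult_right_mono) (auto simp: power2_eq_square)
    then have v1: "cmod v \<le> 1" using vM Mu2 by linarith
    have ul: "cmod (l * u) = cmod u" using l by (simp add: norm_mult)
    have "cmod u' \<ge> cmod u - (M\<^sup>2 * cmod u) * cmod u"
      using norm_triangle_ineq2[of "l * u" "- v\<^sup>2"] v2 ul unfolding u' by simp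
    moreover have "(M\<^sup>2 * cmod u) * cmod u \<le> 1 / (2 * (real N + 1)) * cmod u"
      using Mu by (intro mult_right_mono) auto
    ultimately have u'low: "cmod u' \<ge> (1 - 1 / (2 * (real N + 1))) * cmod u" by (simp add: algebra_simps)
    \<comment> \<open>Since \<open>\<tau>\<close> is small compared with \<open>1 / N\<close>, one
      step shrinks \<open>cmod u\<close> so little that its \<open>N\<close>-th power is at most
      halved.\<close>
    have th: "(1 - 1 / (2 * (real N + 1))) ^ N \<ge> 1 / 2"
    proof -
      have "1 / 2 \<le> 1 + real N * (- (1 / (2 * (real N + 1))))" by (simp add: field_simps)
      also have "\<dots> \<le> (1 + (- (1 / (2 * (real N + 1))))) ^ N"
        by (rule Bernoulli_inequality) (simp add: field_simps)
      finally show ?thesis by simp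
    qed
    have "1 / 2 * cmod u ^ N \<le> (1 - 1 / (2 * (real N + 1))) ^ N * cmod u ^ N"
      using th by (intro mult_right_mono) auto
    also have "\<dots> = ((1 - 1 / (2 * (real N + 1))) * cmod u) ^ N" by (simp add: power_mult_distrib)
    also have "\<dots> \<le> cmod u' ^ N" using u'low by (intro power_mono) (auto simp: field_simps)
    finally have uu': "cmod u ^ N \<le> 2 * cmod u' ^ N" by simp
    moreover have "cmod u ^ N > 0" using u by simp
    ultimately have u'nz: "u' \<noteq> 0" using N by (auto simp: power_0_left)
    have "cmod u' \<le> cmod u + (M\<^sup>2 * cmod u) * cmod u"
      using norm_triangle_ineq[of "l * u" "v\<^sup>2"] v2 ul unfolding u' by simp
    also have "\<dots> \<le> cmod u + 1 * cmod u" using Mu2 by (intro add_mono mult_right_mono) auto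
    finally have u'2: "cmod u' \<le> 2 * cmod u" by simp
    have u'1: "cmod u' \<le> 1" using u'2 u1 by simp
    let ?f = "poly (slow_map l \<eta> (h \<eta>)) u"
    have fw: "?f = l * u + w\<^sup>2" by (simp add: slow_map_def w_def mult.commute)
    have "u' - ?f = (\<eta> * d) * (2 * w + \<eta> * d)"
      unfolding fw u' vw by (simp add: power2_eq_square algebra_simps)
    then have "cmod (u' - ?f) = (cmod \<eta> * cmod d) * cmod (2 * w + \<eta> * d)" by (simp add: norm_mult)
    also have "\<dots> \<le> (cmod \<eta> * cmod d) * K0"
    proof (rule mult_left_mono)
      have "cmod (2 * w + \<eta> * d) \<le> 2 * cmod w + cmod \<eta> * cmod d"
        using norm_triangle_ineq[of "2 * w" "\<eta> * d"] by (simp add: norm_mult)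
      also have "\<dots> \<le> 2 * ((1 + L) * 1) + 1 * 1"
        using w1 u1 \<eta>1 d1 L by (intro add_mono mult_mono order_trans[OF w1]) auto
      finally show "cmod (2 * w + \<eta> * d) \<le> K0" by (simp add: K0_def)
    qed simp
    finally have uf: "cmod (u' - ?f) \<le> cmod \<eta> * K0 * cmod d" by (simp add: algebra_simps)
    also have "\<dots> \<le> 1 / 4 * cmod d"
    proof (rule mult_right_mono)
      show "cmod \<eta> * K0 \<le> 1 / 4" using \<eta> \<eta>0(4) K0 mult_right_mono[of "cmod \<eta>" \<eta>0 K0] by linarith
    qed simp
    finally have uf2: "cmod (u' - ?f) \<le> C * cmod u ^ N" using dN norm_ge_zero[of d] by linarith
    have f1: "cmod ?f \<le> 1"
    proof -
      have "w\<^sup>2 = ?f - l * u" by (simp add: fw)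
      have "cmod w \<le> M * cmod u" using w1 C by (intro order_trans[OF w1] mult_right_mono) (auto simp: M_def)
      then have "cmod (w\<^sup>2) \<le> (M * cmod u)\<^sup>2" unfolding norm_power by (intro power_mono) auto
      then have "cmod (w\<^sup>2) \<le> (M\<^sup>2 * cmod u) * cmod u" by (simp add: power2_eq_square algebra_simps)
      also have "\<dots> \<le> 1 * cmod u" using Mu2 by (intro mult_right_mono) auto
      finally show ?thesis using norm_triangle_ineq[of "l * u" "w\<^sup>2"] ul u1 fw by simp
    qed
    have "v - poly (h \<eta>) u' = - poly (slow_err l \<eta> (h \<eta>)) u + \<eta> * d + (poly (h \<eta>) ?f - poly (h \<eta>) u')"
      by (simp add: slow_err_def poly_pcompose vw w_def)
    also have "cmod \<dots> \<le> K * cmod u ^ N + cmod \<eta> * cmod d + L * (cmod \<eta> * K0 * cmod d)"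
    proof (intro norm_triangle_le[OF add_mono] norm_triangle_le add_mono)
      show "cmod (- poly (slow_err l \<eta> (h \<eta>)) u) \<le> K * cmod u ^ N" using err[OF \<eta>h u1(2)] by simp
      have "cmod (poly (h \<eta>) ?f - poly (h \<eta>) u') \<le> L * cmod (?f - u')" by (rule lip[OF \<eta>h f1 u'1])
      also have "\<dots> \<le> L * (cmod \<eta> * K0 * cmod d)" using uf L by (intro mult_left_mono) (auto simp: norm_minus_commute)
      finally show "cmod (poly (h \<eta>) ?f - poly (h \<eta>) u') \<le> L * (cmod \<eta> * K0 * cmod d)" .
    qed (simp_all add: norm_mult)
    also have "\<dots> = K * cmod u ^ N + cmod \<eta> * K1 * cmod d" by (simp add: K1_def algebra_simps)
    also have "\<dots> \<le> K * cmod u ^ N + 1 / 4 * (C * cmod u ^ N)"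
    proof (intro add_mono mult_mono dN)
      show "cmod \<eta> * K1 \<le> 1 / 4" using \<eta> \<eta>0(3) K1 mult_right_mono[of "cmod \<eta>" \<eta>0 K1] by linarith
    qed (use K in auto)
    also have "\<dots> = (K + C / 4) * cmod u ^ N" by (simp add: algebra_simps)
    also have "\<dots> \<le> (C / 2) * (2 * cmod u' ^ N)"
      using uu' C K by (intro mult_mono) auto
    finally have "cmod (v - poly (h \<eta>) u') \<le> C * cmod u' ^ N" by simp
    then show ?thesis using u'nz u'2 v1 uu' uf2 by blast
  qed
  have hb2: "cmod (poly (h \<eta>) u) \<le> C" if "cmod \<eta> \<le> 1 / 2" "cmod u \<le> 1" for \<eta> u
  proof -
    have "L * cmod u \<le> L" using that L mult_left_mono[of "cmod u" 1 L] by simp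
    then show ?thesis using hb[OF that] C by linarith
  qed
  have lip2: "cmod (poly (h \<eta>) u - poly (h \<eta>) v) \<le> C * cmod (u - v)"
    if "cmod \<eta> \<le> 1 / 2" "cmod u \<le> 1" "cmod v \<le> 1" for \<eta> u v
    using lip[OF that] mult_right_mono[OF C(3), of "cmod (u - v)"] by simp
  show ?thesis
    by (rule exI[of _ C], rule exI[of _ K], rule exI[of _ \<tau>], rule exI[of _ \<eta>0])
      (use C K(1) \<tau>(1) \<tau>2 \<eta>0(1,2) err hb2 lip2 step in simp)
qed

lemma slow_map_0: "slow_map l 0 h = [:0, l, 1:]"
  by (simp add: slow_map_def power2_eq_square)

lemma coeff_slow_map:
  assumes "poly h 0 = 0"
  shows "coeff (slow_map l \<eta> h) 0 = 0" "coeff (slow_map l \<eta> h) 1 = l"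
proof -
  have "coeff (slow_map l \<eta> h) 1 = poly (pderiv (slow_map l \<eta> h)) 0"
    by (simp add: poly_0_coeff_0 coeff_pderiv)
  then show "coeff (slow_map l \<eta> h) 1 = l"
    using assms by (simp add: slow_map_def pderiv_add pderiv_power pderiv_smult pderiv_pCons power2_eq_square pderiv_mult)
  have "poly (slow_map l \<eta> h) 0 = 0" using assms by (simp add: slow_map_def)
  then show "coeff (slow_map l \<eta> h) 0 = 0" by (simp add: poly_0_coeff_0)
qed

text \<open>\<open>h\<close> occurs only in \<open>\<eta> h\<close> and is bounded uniformly on
  bounded sets, so it drops out in the limit whatever its dependence on
  \<open>\<eta>\<close>.\<close>

lemma slow_map_iter_tendsto:
  assumes uh: "ufam {\<eta>. cmod \<eta> \<le> 1 / 2} h"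
  shows "((\<lambda>\<eta>. poly (poly_iter (slow_map l \<eta> (h \<eta>)) n) u) \<longlongrightarrow> (qmap l ^^ n) u) (nhds 0)"
proof (induction n)
  case (Suc n)
  define z where "z = (\<lambda>\<eta>. poly (poly_iter (slow_map l \<eta> (h \<eta>)) n) u)"
  have z: "(z \<longlongrightarrow> (qmap l ^^ n) u) (nhds 0)" using Suc by (simp add: z_def)
  obtain D B where B: "B \<ge> 1" "\<And>\<eta>. cmod \<eta> \<le> 1 / 2 \<Longrightarrow> degree (h \<eta>) \<le> D" "\<And>\<eta>. cmod \<eta> \<le> 1 / 2 \<Longrightarrow> pnorm (h \<eta>) \<le> B"
    using uh by (rule ufamE) auto
  define M where "M = B * (2 + cmod ((qmap l ^^ n) u)) ^ D"
  have "eventually (\<lambda>\<eta>. dist (z \<eta>) ((qmap l ^^ n) u) < 1) (nhds 0)" by (rule tendstoD[OF z]) simp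
  moreover have "eventually (\<lambda>\<eta>. dist \<eta> (0 :: complex) < 1 / 2) (nhds 0)"
    by (rule eventually_nhds_metric[THEN iffD2]) (auto intro: exI[of _ "1/2"])
  ultimately have "eventually (\<lambda>\<eta>. cmod (\<eta> * poly (h \<eta>) (z \<eta>)) \<le> cmod \<eta> * M) (nhds 0)"
  proof eventually_elim
    case (elim \<eta>)
    then have \<eta>: "cmod \<eta> \<le> 1 / 2" by simp
    have "cmod (z \<eta>) \<le> 1 + cmod ((qmap l ^^ n) u)"
      using elim(1) norm_triangle_sub[of "z \<eta>" "(qmap l ^^ n) u"] by (simp add: dist_norm)
    then have "pnorm (h \<eta>) * (1 + cmod (z \<eta>)) ^ degree (h \<eta>) \<le> M"
      unfolding M_def using B \<eta>
      by (intro mult_mono order_trans[OF power_mono[of _ "2 + cmod ((qmap l ^^ n) u)"] power_increasing]) auto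
    then show ?case
      unfolding norm_mult by (intro mult_left_mono order_trans[OF norm_poly_le_pnorm]) auto
  qed
  moreover have "((\<lambda>\<eta>. cmod \<eta> * M) \<longlongrightarrow> cmod 0 * M) (nhds (0 :: complex))"
    by (intro tendsto_mult tendsto_norm tendsto_const filterlim_ident)
  then have "((\<lambda>\<eta>. cmod \<eta> * M) \<longlongrightarrow> 0) (nhds (0 :: complex))" by simp
  ultimately have "((\<lambda>\<eta>. \<eta> * poly (h \<eta>) (z \<eta>)) \<longlongrightarrow> 0) (nhds 0)"
    by (rule Lim_null_comparison)
  then have "((\<lambda>\<eta>. l * z \<eta> + (z \<eta> + \<eta> * poly (h \<eta>) (z \<eta>))\<^sup>2) \<longlongrightarrow> l * (qmap l ^^ n) u + ((qmap l ^^ n) u + 0)\<^sup>2) (nhds 0)"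
    by (intro tendsto_intros z)
  then show ?case
    by (simp add: poly_iter_Suc poly_pcompose slow_map_def qmap_def[of l "(qmap l ^^ n) u"] z_def mult.commute)
qed simp

text \<open>Resonance gives the \<open>q\<close>-th iterate on the center curve the form
  \<open>u + A u^(q+1) + ...\<close> for every \<open>\<eta>\<close>, and \<open>A\<close> tends to
  \<open>A0 \<noteq> 0\<close>; hence a petal whose size does not depend on \<open>\<eta>\<close>.
  With exponent \<open>q + 2\<close> the cusp around the curve is as thin as the remainder tolerated
  by the petal coordinate, so orbits in it behave as on the curve and stay bounded.\<close>

lemma uniform_semiparabolic_petal:
  fixes q :: nat
  assumes q: "q \<ge> 1" and l: "\<And>k. l ^ k = 1 \<longleftrightarrow> q dvd k" and A0: "A0 \<noteq> 0"
    and F0: "poly_iter [:0, l, 1:] q = [:0, 1:] + [:0, 1:] ^ Suc q * G0" "A0 = poly G0 0"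
  shows "\<exists>h C K \<tau> \<eta>0 A R. C \<ge> 1 \<and> K \<ge> 0 \<and> 4 * K + 1 \<le> C \<and> \<tau> > 0 \<and> \<tau> \<le> 1 / 2 \<and> \<eta>0 > 0 \<and> \<eta>0 \<le> 1 / 2 \<and>
    (\<forall>\<eta> u. cmod \<eta> \<le> 1 / 2 \<and> cmod u \<le> 1 \<longrightarrow> cmod (poly (slow_err l \<eta> (h \<eta>)) u) \<le> K * cmod u ^ (q + 2)) \<and>
    (\<forall>\<eta> u. cmod \<eta> \<le> 1 / 2 \<and> cmod u \<le> 1 \<longrightarrow> cmod (poly (h \<eta>) u) \<le> C) \<and>
    (\<forall>\<eta> u v. cmod \<eta> \<le> 1 / 2 \<and> cmod u \<le> 1 \<and> cmod v \<le> 1 \<longrightarrow> cmod (poly (h \<eta>) u - poly (h \<eta>) v) \<le> C * cmod (u - v)) \<and>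
    (\<forall>u. u \<noteq> 0 \<and> cmod u < \<tau> \<longrightarrow> cmod u ^ (q + 2) \<le> 2 * cmod (qmap l u) ^ (q + 2) \<and> qmap l u \<noteq> 0 \<and> cmod (qmap l u) \<le> 2 * cmod u) \<and>
    (A \<longlongrightarrow> A0) (nhds 0) \<and> A 0 = A0 \<and>
    (\<forall>u. Re (-1 / (of_nat q * A0 * u ^ q)) > R \<longrightarrow> cmod ((qmap l ^^ q) u - u) \<le> cmod u \<and>
       Re (-1 / (of_nat q * A0 * ((qmap l ^^ q) u) ^ q)) > R \<and> u \<noteq> 0 \<and> cmod u < \<tau> / 2 ^ q) \<and>
    (\<forall>\<eta> u s. cmod \<eta> < \<eta>0 \<and> (\<forall>j :: nat. u (Suc j) = l * u j + (u j + \<eta> * s j)\<^sup>2 \<and> s (Suc j) = u j + \<eta> * s j) \<and>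
       Re (-1 / (of_nat q * A \<eta> * u 0 ^ q)) > R \<and> cmod (s 0 - poly (h \<eta>) (u 0)) \<le> C * cmod (u 0) ^ (q + 2)
       \<longrightarrow> (\<forall>j. cmod (s (Suc j)) \<le> 1))"
proof -
  let ?I = "{\<eta> :: complex. cmod \<eta> \<le> 1 / 2}" and ?X = "[:0, 1:] :: complex poly"
  define N where "N = Suc (Suc q)"
  have "l ^ q = 1" using l by simp
  then have "cmod l ^ q = 1" by (metis norm_one norm_power)
  then have cl: "cmod l = 1" using q power_eq_1_iff[of "cmod l" q] by (simp add: power_eq_1_iff)
  obtain h where uh: "ufam ?I h"
    and h': "\<forall>\<eta>. cmod \<eta> \<le> 1 / 2 \<longrightarrow> poly (h \<eta>) 0 = 0" "\<forall>\<eta>. cmod \<eta> \<le> 1 / 2 \<longrightarrow> ?X ^ N dvd slow_err l \<eta> (h \<eta>)"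
    using center_curve[OF cl, of "Suc q"] unfolding N_def by blast
  note h = h'[rule_format]
  have "N \<ge> 1" by (simp add: N_def)
  obtain C K \<tau> \<eta>0 where C: "C \<ge> 1" "K \<ge> 0" "4 * K + 1 \<le> C" "\<tau> > 0" "\<eta>0 > 0" "\<tau> \<le> 1 / 2" "\<eta>0 \<le> 1 / 2"
    and err: "\<forall>\<eta> u. cmod \<eta> \<le> 1 / 2 \<and> cmod u \<le> 1 \<longrightarrow> cmod (poly (slow_err l \<eta> (h \<eta>)) u) \<le> K * cmod u ^ N"
    and hC: "\<forall>\<eta> u. cmod \<eta> \<le> 1 / 2 \<and> cmod u \<le> 1 \<longrightarrow> cmod (poly (h \<eta>) u) \<le> C"
    and hL: "\<forall>\<eta> u v. cmod \<eta> \<le> 1 / 2 \<and> cmod u \<le> 1 \<and> cmod v \<le> 1 \<longrightarrow> cmod (poly (h \<eta>) u - poly (h \<eta>) v) \<le> C * cmod (u - v)"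
    and step': "\<forall>\<eta> u s v u'. cmod \<eta> < \<eta>0 \<and> u \<noteq> 0 \<and> cmod u < \<tau> \<and> cmod (s - poly (h \<eta>) u) \<le> C * cmod u ^ N \<and>
       v = u + \<eta> * s \<and> u' = l * u + v\<^sup>2 \<longrightarrow>
       u' \<noteq> 0 \<and> cmod u' \<le> 2 * cmod u \<and> cmod v \<le> 1 \<and> cmod u ^ N \<le> 2 * cmod u' ^ N \<and>
       cmod (v - poly (h \<eta>) u') \<le> C * cmod u' ^ N \<and>
       cmod (u' - poly (slow_map l \<eta> (h \<eta>)) u) \<le> C * cmod u ^ N"
    using near_center_curve_step[OF cl \<open>N \<ge> 1\<close> uh h'] by (elim exE conjE) (rule that; assumption)
  have step: "l * u + (u + \<eta> * s)\<^sup>2 \<noteq> 0 \<and> cmod (l * u + (u + \<eta> * s)\<^sup>2) \<le> 2 * cmod u \<and> cmod (u + \<eta> * s) \<le> 1 \<and>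
       cmod u ^ N \<le> 2 * cmod (l * u + (u + \<eta> * s)\<^sup>2) ^ N \<and>
       cmod (u + \<eta> * s - poly (h \<eta>) (l * u + (u + \<eta> * s)\<^sup>2)) \<le> C * cmod (l * u + (u + \<eta> * s)\<^sup>2) ^ N \<and>
       cmod (l * u + (u + \<eta> * s)\<^sup>2 - poly (slow_map l \<eta> (h \<eta>)) u) \<le> C * cmod u ^ N"
    if "cmod \<eta> < \<eta>0 \<and> u \<noteq> 0 \<and> cmod u < \<tau> \<and> cmod (s - poly (h \<eta>) u) \<le> C * cmod u ^ N" for \<eta> u s
    using step'[rule_format, of \<eta> u s "u + \<eta> * s" "l * u + (u + \<eta> * s)\<^sup>2"] that by simp
  define f where "f = (\<lambda>\<eta>. slow_map l \<eta> (h \<eta>))"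
  have uf: "ufam ?I f" unfolding f_def by (intro ufam_slow_map uh) auto
  obtain D B where B: "B \<ge> 1" "\<And>\<eta>. \<eta> \<in> ?I \<Longrightarrow> degree (f \<eta>) \<le> D" "\<And>\<eta>. \<eta> \<in> ?I \<Longrightarrow> pnorm (f \<eta>) \<le> B"
    using uf by (rule ufamE) blast
  define Lf where "Lf = real D * B"
  have Lf: "Lf \<ge> 0" using B(1) by (simp add: Lf_def)
  have fL: "cmod (poly (f \<eta>) u - poly (f \<eta>) v) \<le> Lf * cmod (u - v)"
    if "cmod \<eta> \<le> 1 / 2" "cmod u \<le> 1" "cmod v \<le> 1" for \<eta> u v
  proof -
    have "real (degree (f \<eta>)) * pnorm (f \<eta>) \<le> Lf"
      using B that unfolding Lf_def by (intro mult_mono) auto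
    then show ?thesis
      by (rule order_trans[OF poly_lipschitz_disc[OF that(2,3)] mult_right_mono]) simp
  qed
  \<comment> \<open>A resonant exponent is a positive multiple of \<open>q\<close>, so at least
    \<open>q\<close>; the case where the iterate is the identity is covered by
    \<open>G = 0\<close>.\<close>
  have "\<exists>G. poly_iter (f \<eta>) q = ?X + ?X ^ Suc q * G" if "\<eta> \<in> ?I" for \<eta>
  proof (cases "poly_iter (f \<eta>) q = ?X")
    case True
    then show ?thesis by (intro exI[of _ 0]) simp
  next
    case False
    have c: "coeff (f \<eta>) 0 = 0" "coeff (f \<eta>) 1 = l"
      using coeff_slow_map[OF h(1)] that by (simp_all add: f_def)
    obtain m G where "m \<ge> 1" "q dvd m" "poly_iter (f \<eta>) q = ?X + ?X ^ Suc m * G"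
      using poly_iter_resonant[OF c(1) _ False] l c(2) by metis
    moreover have "q \<le> m" using \<open>m \<ge> 1\<close> \<open>q dvd m\<close> by (intro dvd_imp_le) auto
    then have "?X ^ Suc m * G = ?X ^ Suc q * (?X ^ (m - q) * G)"
      by (simp flip: power_add mult.assoc power_Suc)
    ultimately show ?thesis by metis
  qed
  then have "\<forall>\<eta>. \<exists>G. \<eta> \<in> ?I \<longrightarrow> poly_iter (f \<eta>) q = ?X + ?X ^ Suc q * G" by blast
  then obtain G where G: "\<And>\<eta>. \<eta> \<in> ?I \<Longrightarrow> poly_iter (f \<eta>) q = ?X + ?X ^ Suc q * G \<eta>" by metis
  have uG: "ufam ?I G"
    by (rule ufam_X_power_quotient[of _ "\<lambda>\<eta>. poly_iter (f \<eta>) q - ?X" "Suc q"])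
      (use G uf in \<open>auto intro!: ufam_diff ufam_const ufam_poly_iter\<close>)
  obtain DG BG where BG: "BG \<ge> 1" "\<And>\<eta>. \<eta> \<in> ?I \<Longrightarrow> degree (G \<eta>) \<le> DG" "\<And>\<eta>. \<eta> \<in> ?I \<Longrightarrow> pnorm (G \<eta>) \<le> BG"
    using uG by (rule ufamE) blast
  define A where "A = (\<lambda>\<eta>. poly (G \<eta>) 0)"
  define CG where "CG = real DG * BG"
  have CG: "CG \<ge> 0" using BG by (simp add: CG_def)
  have rem: "cmod (poly (poly_iter (f \<eta>) q) u - u - A \<eta> * u ^ Suc q) \<le> CG * cmod u ^ N"
    if \<eta>: "cmod \<eta> \<le> 1 / 2" and u: "cmod u \<le> 1" for \<eta> u
  proof -
    have "poly (poly_iter (f \<eta>) q) u - u - A \<eta> * u ^ Suc q = u ^ Suc q * (poly (G \<eta>) u - poly (G \<eta>) 0)"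
      using G[of \<eta>] \<eta> by (simp add: A_def algebra_simps)
    also have "cmod \<dots> \<le> cmod u ^ Suc q * (CG * cmod u)"
      unfolding norm_mult norm_power
    proof (rule mult_left_mono)
      have "real (degree (G \<eta>)) * pnorm (G \<eta>) \<le> CG"
        using BG \<eta> unfolding CG_def by (intro mult_mono) auto
      then have "real (degree (G \<eta>)) * pnorm (G \<eta>) * cmod (u - 0) \<le> CG * cmod u"
        by (simp add: mult_right_mono)
      then show "cmod (poly (G \<eta>) u - poly (G \<eta>) 0) \<le> CG * cmod u"
        using poly_lipschitz_disc[OF u, of 0 "G \<eta>"] by simp
    qed simp
    finally show ?thesis by (simp add: N_def algebra_simps)
  qed
  have A_0: "A 0 = A0"
  proof -
    have "?X + ?X ^ Suc q * G 0 = ?X + ?X ^ Suc q * G0"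
      using G[of 0] F0(1) by (simp add: f_def slow_map_0)
    then have "?X ^ Suc q * G 0 = ?X ^ Suc q * G0" by (rule add_left_imp_eq)
    then have "G 0 = G0" by (subst (asm) mult_cancel_left) auto
    then show ?thesis by (simp add: A_def F0(2))
  qed
  \<comment> \<open>\<open>A \<eta>\<close> is read off from the value of the iterate at one fixed
    small \<open>r\<close> up to an error \<open>CG * r\<close>; convergence at this single point
    then suffices.\<close>
  have A_lim: "(A \<longlongrightarrow> A0) (nhds 0)"
  proof (rule tendstoI)
    fix \<epsilon> :: real assume \<epsilon>: "\<epsilon> > 0"
    define r where "r = min 1 (\<epsilon> / (4 * (CG + 1)))"
    have r: "r > 0" "r \<le> 1" using \<epsilon> CG by (auto simp: r_def)
    have "2 * CG * r \<le> 2 * CG * (\<epsilon> / (4 * (CG + 1)))" using CG by (intro mult_left_mono) (auto simp: r_def)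
    also have "\<dots> = (CG / (CG + 1)) * (\<epsilon> / 2)" using CG by (simp add: divide_simps)
    also have "\<dots> \<le> 1 * (\<epsilon> / 2)" using CG \<epsilon> by (intro mult_right_mono) (auto simp: field_simps)
    finally have r3: "2 * CG * r \<le> \<epsilon> / 2" by simp
    have "((\<lambda>\<eta>. poly (poly_iter (f \<eta>) q) (of_real r)) \<longlongrightarrow> (qmap l ^^ q) (of_real r)) (nhds 0)"
      unfolding f_def by (rule slow_map_iter_tendsto[OF uh])
    then have "eventually (\<lambda>\<eta>. dist (poly (poly_iter (f \<eta>) q) (of_real r)) ((qmap l ^^ q) (of_real r)) < \<epsilon> / 2 * r ^ Suc q) (nhds 0)"
      using \<epsilon> r by (intro tendstoD) auto
    moreover have "eventually (\<lambda>\<eta>. dist \<eta> (0 :: complex) < 1 / 2) (nhds 0)"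
      by (rule eventually_nhds_metric[THEN iffD2]) (auto intro: exI[of _ "1/2"])
    ultimately show "eventually (\<lambda>\<eta>. dist (A \<eta>) A0 < \<epsilon>) (nhds 0)"
    proof eventually_elim
      case (elim \<eta>)
      then have \<eta>: "cmod \<eta> \<le> 1 / 2" by simp
      let ?r = "of_real r :: complex"
      have q0: "(qmap l ^^ q) ?r = poly (poly_iter (f 0) q) ?r"
        by (simp add: f_def slow_map_0 poly_poly_iter poly_quadratic)
      have "(A \<eta> - A0) * ?r ^ Suc q = (poly (poly_iter (f \<eta>) q) ?r - poly (poly_iter (f 0) q) ?r)
         - (poly (poly_iter (f \<eta>) q) ?r - ?r - A \<eta> * ?r ^ Suc q) + (poly (poly_iter (f 0) q) ?r - ?r - A 0 * ?r ^ Suc q)"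
        by (simp add: A_0 algebra_simps)
      also have "cmod \<dots> < \<epsilon> / 2 * r ^ Suc q + CG * r ^ N + CG * r ^ N"
      proof -
        have n3: "cmod (a - b + c) \<le> cmod a + cmod b + cmod c" for a b c
          by (intro norm_triangle_le add_mono norm_triangle_ineq4) simp
        have "cmod (poly (poly_iter (f \<eta>) q) ?r - poly (poly_iter (f 0) q) ?r) < \<epsilon> / 2 * r ^ Suc q"
          using elim(1) q0 by (simp add: dist_norm)
        moreover have "cmod (poly (poly_iter (f \<eta>) q) ?r - ?r - A \<eta> * ?r ^ Suc q) \<le> CG * r ^ N"
          using rem[OF \<eta>, of ?r] r by simp
        moreover have "cmod (poly (poly_iter (f 0) q) ?r - ?r - A 0 * ?r ^ Suc q) \<le> CG * r ^ N"
          using rem[of 0 ?r] r by simp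
        ultimately show ?thesis
          using n3[of "poly (poly_iter (f \<eta>) q) ?r - poly (poly_iter (f 0) q) ?r"
            "poly (poly_iter (f \<eta>) q) ?r - ?r - A \<eta> * ?r ^ Suc q"
            "poly (poly_iter (f 0) q) ?r - ?r - A 0 * ?r ^ Suc q"] by linarith
      qed
      also have "\<dots> = (\<epsilon> / 2 + 2 * CG * r) * r ^ Suc q" by (simp add: N_def algebra_simps)
      also have "\<dots> \<le> \<epsilon> * r ^ Suc q" using r3 r by (intro mult_right_mono) auto
      finally have "cmod (A \<eta> - A0) * r ^ Suc q < \<epsilon> * r ^ Suc q" using r by (simp add: norm_mult norm_power)
      then show ?case using r by (simp add: dist_norm)
    qed
  qed
  then have "eventually (\<lambda>\<eta>. dist (A \<eta>) A0 < cmod A0 / 2) (nhds 0)" using A0 by (intro tendstoD) auto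
  then obtain \<eta>1 where \<eta>1: "\<eta>1 > 0" "\<And>\<eta>. cmod \<eta> < \<eta>1 \<Longrightarrow> dist (A \<eta>) A0 < cmod A0 / 2"
    unfolding eventually_nhds_metric by auto
  define \<eta>2 where "\<eta>2 = min \<eta>0 \<eta>1"
  have \<eta>2: "\<eta>2 > 0" "\<eta>2 \<le> \<eta>0" "\<eta>2 \<le> 1 / 2" using C \<eta>1 by (auto simp: \<eta>2_def)
  have A1: "cmod (A \<eta>) \<ge> cmod A0 / 2" if "cmod \<eta> < \<eta>2" for \<eta>
  proof -
    have "dist (A \<eta>) A0 < cmod A0 / 2" using \<eta>1 that by (simp add: \<eta>2_def)
    then show ?thesis using norm_triangle_ineq3[of "A \<eta>" A0] by (simp add: dist_norm)
  qed
  have A2: "cmod (A \<eta>) \<le> BG" if "cmod \<eta> < \<eta>2" for \<eta>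
    using norm_poly_le_pnorm_disc[of 0 "G \<eta>"] BG(3)[of \<eta>] that \<eta>2 by (simp add: A_def)
  define orb where "orb = (\<lambda>\<eta> u s. \<forall>j :: nat. u (Suc j) = l * u j + (u j + \<eta> * s j)\<^sup>2 \<and> s (Suc j) = u j + \<eta> * s j)"
  \<comment> \<open>Over \<open>j\<close> steps the true orbit shadows the polynomial iterate of
    \<open>u 0\<close> with an error of order \<open>N\<close>, the order of the remainder in the
    petal coordinate.\<close>
  have iter: "\<exists>Cj \<tau>j. Cj \<ge> 0 \<and> \<tau>j > 0 \<and> \<tau>j \<le> \<tau> \<and> (\<forall>\<eta> u s. cmod \<eta> < \<eta>2 \<and> orb \<eta> u s \<and> u 0 \<noteq> 0 \<and> cmod (u 0) < \<tau>j \<and>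
      cmod (s 0 - poly (h \<eta>) (u 0)) \<le> C * cmod (u 0) ^ N \<longrightarrow>
      u j \<noteq> 0 \<and> cmod (u j) \<le> 2 ^ j * cmod (u 0) \<and> cmod (s j - poly (h \<eta>) (u j)) \<le> C * cmod (u j) ^ N \<and>
      (\<forall>i<j. cmod (s (Suc i)) \<le> 1) \<and>
      cmod (u j - poly (poly_iter (f \<eta>) j) (u 0)) \<le> Cj * cmod (u 0) ^ N)" for j
  proof (induction j)
    case 0
    show ?case by (intro exI[of _ 0] exI[of _ \<tau>]) (use C in auto)
  next
    case (Suc j)
    then obtain Cj \<tau>j where Cj: "Cj \<ge> 0" "\<tau>j > 0" "\<tau>j \<le> \<tau>" and *: "\<And>\<eta> u s. cmod \<eta> < \<eta>2 \<Longrightarrow> orb \<eta> u s \<Longrightarrow> u 0 \<noteq> 0 \<Longrightarrow> cmod (u 0) < \<tau>j \<Longrightarrow>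
      cmod (s 0 - poly (h \<eta>) (u 0)) \<le> C * cmod (u 0) ^ N \<Longrightarrow>
      u j \<noteq> 0 \<and> cmod (u j) \<le> 2 ^ j * cmod (u 0) \<and> cmod (s j - poly (h \<eta>) (u j)) \<le> C * cmod (u j) ^ N \<and>
      (\<forall>i<j. cmod (s (Suc i)) \<le> 1) \<and>
      cmod (u j - poly (poly_iter (f \<eta>) j) (u 0)) \<le> Cj * cmod (u 0) ^ N" by blast
    define C' where "C' = C * (2 ^ j) ^ N + Lf * Cj"
    define \<tau>' where "\<tau>' = min \<tau>j (min (\<tau> / 2 ^ j) (1 / (2 * (Cj + 1))))"
    have \<tau>': "\<tau>' > 0" "\<tau>' \<le> \<tau>" "\<tau>' \<le> \<tau>j" "\<tau>' \<le> \<tau> / 2 ^ j" "\<tau>' \<le> 1 / (2 * (Cj + 1))" using Cj C by (auto simp: \<tau>'_def)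
    have "u (Suc j) \<noteq> 0 \<and> cmod (u (Suc j)) \<le> 2 ^ Suc j * cmod (u 0) \<and> cmod (s (Suc j) - poly (h \<eta>) (u (Suc j))) \<le> C * cmod (u (Suc j)) ^ N \<and>
      (\<forall>i<Suc j. cmod (s (Suc i)) \<le> 1) \<and>
      cmod (u (Suc j) - poly (poly_iter (f \<eta>) (Suc j)) (u 0)) \<le> C' * cmod (u 0) ^ N"
      if \<eta>: "cmod \<eta> < \<eta>2" and o: "orb \<eta> u s" and u0: "u 0 \<noteq> 0" "cmod (u 0) < \<tau>'"
        and d: "cmod (s 0 - poly (h \<eta>) (u 0)) \<le> C * cmod (u 0) ^ N" for \<eta> u s
    proof -
      have u: "u j \<noteq> 0" "cmod (u j) \<le> 2 ^ j * cmod (u 0)" "cmod (s j - poly (h \<eta>) (u j)) \<le> C * cmod (u j) ^ N"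
        "\<forall>i<j. cmod (s (Suc i)) \<le> 1" "cmod (u j - poly (poly_iter (f \<eta>) j) (u 0)) \<le> Cj * cmod (u 0) ^ N"
        using *[OF \<eta> o u0(1) _ d] u0(2) \<tau>' by auto
      have "2 ^ j * cmod (u 0) < 2 ^ j * (\<tau> / 2 ^ j)" using u0 \<tau>' by (intro mult_strict_left_mono) auto
      then have uj: "cmod (u j) < \<tau>" using u(2) by simp
      have os: "u (Suc j) = l * u j + (u j + \<eta> * s j)\<^sup>2" "s (Suc j) = u j + \<eta> * s j" using o by (auto simp: orb_def)
      have st: "u (Suc j) \<noteq> 0" "cmod (u (Suc j)) \<le> 2 * cmod (u j)" "cmod (s (Suc j)) \<le> 1"
        "cmod (s (Suc j) - poly (h \<eta>) (u (Suc j))) \<le> C * cmod (u (Suc j)) ^ N"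
        "cmod (u (Suc j) - poly (f \<eta>) (u j)) \<le> C * cmod (u j) ^ N"
        using step[of \<eta> "u j" "s j"] \<eta> \<eta>2 u uj unfolding os f_def by auto
      have u01: "cmod (u 0) \<le> 1" using u0 \<tau>' C by auto
      have "cmod (u 0) ^ N \<le> cmod (u 0)" using power_decreasing[of 1 N "cmod (u 0)"] \<open>N \<ge> 1\<close> u01 by simp
      then have "Cj * cmod (u 0) ^ N \<le> Cj * (1 / (2 * (Cj + 1)))"
        using u0 \<tau>' Cj(1) by (intro mult_left_mono) auto
      also have "\<dots> \<le> 1 / 2" using Cj by (simp add: field_simps)
      finally have "cmod (poly (poly_iter (f \<eta>) j) (u 0)) \<le> cmod (u j) + 1 / 2"
        using u(5) norm_triangle_ineq3[of "u j" "poly (poly_iter (f \<eta>) j) (u 0)"] by linarith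
      then have F1: "cmod (poly (poly_iter (f \<eta>) j) (u 0)) \<le> 1" using uj C by linarith
      have "u (Suc j) - poly (poly_iter (f \<eta>) (Suc j)) (u 0) = (u (Suc j) - poly (f \<eta>) (u j))
         + (poly (f \<eta>) (u j) - poly (f \<eta>) (poly (poly_iter (f \<eta>) j) (u 0)))"
        by (simp add: poly_iter_Suc poly_pcompose)
      also have "cmod \<dots> \<le> C * (2 ^ j * cmod (u 0)) ^ N + Lf * (Cj * cmod (u 0) ^ N)"
      proof (intro norm_triangle_le add_mono)
        show "cmod (u (Suc j) - poly (f \<eta>) (u j)) \<le> C * (2 ^ j * cmod (u 0)) ^ N"
          using u(2) C(1) by (intro order_trans[OF st(5)] mult_left_mono power_mono) auto
        show "cmod (poly (f \<eta>) (u j) - poly (f \<eta>) (poly (poly_iter (f \<eta>) j) (u 0))) \<le> Lf * (Cj * cmod (u 0) ^ N)"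
          using \<eta> \<eta>2 uj C F1 u(5) Lf by (intro order_trans[OF fL] mult_left_mono) auto
      qed
      also have "\<dots> = C' * cmod (u 0) ^ N" by (simp add: C'_def power_mult_distrib algebra_simps)
      finally show ?thesis using st u(2,4) by (auto simp: less_Suc_eq)
    qed
    then show ?case using \<tau>'(1,2) C(1) Cj(1) Lf by (intro exI[of _ C'] exI[of _ \<tau>']) (auto simp: C'_def)
  qed
  obtain Cq \<tau>q where Cq: "Cq \<ge> 0" "\<tau>q > 0" "\<tau>q \<le> \<tau>" and iterq: "\<And>\<eta> u s. cmod \<eta> < \<eta>2 \<Longrightarrow> orb \<eta> u s \<Longrightarrow> u 0 \<noteq> 0 \<Longrightarrow> cmod (u 0) < \<tau>q \<Longrightarrow>
      cmod (s 0 - poly (h \<eta>) (u 0)) \<le> C * cmod (u 0) ^ N \<Longrightarrow>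
      cmod (s q - poly (h \<eta>) (u q)) \<le> C * cmod (u q) ^ N \<and> (\<forall>i<q. cmod (s (Suc i)) \<le> 1) \<and>
      cmod (u q - poly (poly_iter (f \<eta>) q) (u 0)) \<le> Cq * cmod (u 0) ^ N"
    using iter[of q] by blast
  have A0': "cmod A0 / 2 > 0" using A0 by simp
  obtain Bp \<tau>p where Bp: "Bp \<ge> 0" "\<tau>p > 0" and petal: "\<forall>A u u' :: complex. cmod A0 / 2 \<le> cmod A \<and> cmod A \<le> BG \<and> u \<noteq> 0 \<and> cmod u < \<tau>p
     \<and> cmod (u' - u - A * u ^ Suc q) \<le> (Cq + CG) * cmod u ^ Suc (Suc q) \<longrightarrow>
     cmod (u' / u - 1) \<le> Bp * cmod u ^ q \<and> cmod (u' / u - 1) \<le> 1 / 2 \<and>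
     cmod (-1 / (of_nat q * A * u' ^ q) - (-1 / (of_nat q * A * u ^ q)) - 1) \<le> Bp * cmod u"
    using petal_coordinate_step[OF q A0' add_nonneg_nonneg[OF Cq(1) CG], of BG]
    by (elim exE conjE) (rule that; assumption)
  define \<sigma> where "\<sigma> = min (min \<tau>q (\<tau> / 2 ^ q)) (min \<tau>p (1 / (2 * (Bp + 1))))"
  have \<sigma>: "\<sigma> > 0" "\<sigma> \<le> \<tau>q" "\<sigma> \<le> \<tau> / 2 ^ q" "\<sigma> \<le> \<tau>p" "\<sigma> \<le> 1 / (2 * (Bp + 1))"
    using Cq C(4) Bp by (auto simp: \<sigma>_def)
  have "Bp * \<sigma> \<le> Bp * (1 / (2 * (Bp + 1)))" using \<sigma> Bp by (intro mult_left_mono) auto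
  also have "\<dots> \<le> 1 / 2" using Bp by (simp add: field_simps)
  finally have Bp\<sigma>: "Bp * \<sigma> \<le> 1 / 2" .
  \<comment> \<open>With \<open>cmod (A \<eta>) \<ge> cmod A0 / 2\<close>, a real part above
    \<open>R\<close> forces \<open>cmod u < \<sigma>\<close> for all small \<open>\<eta>\<close> at
    once.\<close>
  define R where "R = 2 / (real q * cmod A0 * \<sigma> ^ q)"
  have R: "R > 0" using q A0 \<sigma> by (simp add: R_def)
  have close: "u \<noteq> 0 \<and> cmod u < \<sigma>" if \<eta>: "cmod \<eta> < \<eta>2" and w: "Re (-1 / (of_nat q * A \<eta> * u ^ q)) > R" for \<eta> u
  proof -
    have unz: "u \<noteq> 0" using w R q by (auto simp: power_0_left)
    have "R < cmod (-1 / (of_nat q * A \<eta> * u ^ q))" using w complex_Re_le_cmod order_less_le_trans by blast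
    also have "\<dots> = 1 / (real q * cmod (A \<eta>) * cmod u ^ q)" by (simp add: norm_divide norm_mult norm_power)
    also have "\<dots> \<le> 1 / (real q * (cmod A0 / 2) * cmod u ^ q)"
      using A1[OF \<eta>] q A0 unz by (intro divide_left_mono mult_right_mono mult_left_mono mult_pos_pos) auto
    finally have "2 / (real q * cmod A0 * \<sigma> ^ q) < 2 / (real q * cmod A0 * cmod u ^ q)"
      by (simp add: R_def)
    then have "cmod u ^ q < \<sigma> ^ q" using q A0 \<sigma> unz by (simp add: field_simps)
    then have "cmod u < \<sigma>" by (rule power_less_imp_less_base) (use \<sigma> in simp)
    then show ?thesis using unz by simp
  qed
  have next_petal: "Re (-1 / (of_nat q * A \<eta> * u' ^ q)) > R \<and> cmod (u' - u) \<le> cmod u"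
    if \<eta>: "cmod \<eta> < \<eta>2" and w: "Re (-1 / (of_nat q * A \<eta> * u ^ q)) > R"
      and u': "cmod (u' - u - A \<eta> * u ^ Suc q) \<le> (Cq + CG) * cmod u ^ N" for \<eta> u u'
  proof -
    have u: "u \<noteq> 0" "cmod u < \<sigma>" using close[OF \<eta> w] by auto
    have p: "cmod (u' / u - 1) \<le> 1 / 2"
      "cmod (-1 / (of_nat q * A \<eta> * u' ^ q) - (-1 / (of_nat q * A \<eta> * u ^ q)) - 1) \<le> Bp * cmod u"
      using petal[rule_format, of "A \<eta>" u u'] A1[OF \<eta>] A2[OF \<eta>] u \<sigma>(4) u' by (auto simp: N_def)
    have "Bp * cmod u \<le> 1 / 2" using u Bp Bp\<sigma> mult_left_mono[of "cmod u" \<sigma> Bp] by simp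
    then have "\<bar>Re (-1 / (of_nat q * A \<eta> * u' ^ q) - (-1 / (of_nat q * A \<eta> * u ^ q)) - 1)\<bar> \<le> 1 / 2"
      by (rule order_trans[OF abs_Re_le_cmod order_trans[OF p(2)]])
    then have "Re (-1 / (of_nat q * A \<eta> * u' ^ q)) > R"
      using w unfolding minus_complex.sel one_complex.sel by linarith
    moreover have "u' - u = (u' / u - 1) * u" using u by (simp add: field_simps)
    then have "cmod (u' - u) \<le> 1 * cmod u" using p(1) norm_ge_zero[of u]
      by (simp only: norm_mult) (intro mult_right_mono, auto)
    ultimately show ?thesis by simp
  qed
  have q1: "\<forall>u. u \<noteq> 0 \<and> cmod u < \<tau> \<longrightarrow> cmod u ^ N \<le> 2 * cmod (qmap l u) ^ N \<and> qmap l u \<noteq> 0 \<and> cmod (qmap l u) \<le> 2 * cmod u"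
  proof (intro allI impI)
    fix u assume "u \<noteq> 0 \<and> cmod u < \<tau>"
    then show "cmod u ^ N \<le> 2 * cmod (qmap l u) ^ N \<and> qmap l u \<noteq> 0 \<and> cmod (qmap l u) \<le> 2 * cmod u"
      using step[of 0 u "poly (h 0) u"] C by (simp add: qmap_def)
  qed
  have q2: "\<forall>u. Re (-1 / (of_nat q * A0 * u ^ q)) > R \<longrightarrow> cmod ((qmap l ^^ q) u - u) \<le> cmod u \<and>
       Re (-1 / (of_nat q * A0 * ((qmap l ^^ q) u) ^ q)) > R \<and> u \<noteq> 0 \<and> cmod u < \<tau> / 2 ^ q"
  proof (intro allI impI)
    fix u assume w: "Re (-1 / (of_nat q * A0 * u ^ q)) > R"
    have u: "u \<noteq> 0" "cmod u < \<sigma>" using close[of 0 u] w \<eta>2 by (auto simp: A_0)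
    have "\<tau> / 2 ^ q \<le> \<tau>" using C(4) by (simp add: divide_le_eq)
    then have "cmod u \<le> 1" using u \<sigma>(3) C(6) by linarith
    then have "cmod ((qmap l ^^ q) u - u - A 0 * u ^ Suc q) \<le> CG * cmod u ^ N"
      using rem[of 0 u] by (simp add: f_def slow_map_0 poly_poly_iter poly_quadratic)
    also have "\<dots> \<le> (Cq + CG) * cmod u ^ N" using Cq by (intro mult_right_mono) auto
    finally have "cmod ((qmap l ^^ q) u - u - A 0 * u ^ Suc q) \<le> (Cq + CG) * cmod u ^ N" .
    then show "cmod ((qmap l ^^ q) u - u) \<le> cmod u \<and>
       Re (-1 / (of_nat q * A0 * ((qmap l ^^ q) u) ^ q)) > R \<and> u \<noteq> 0 \<and> cmod u < \<tau> / 2 ^ q"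
      using next_petal[of 0 u "(qmap l ^^ q) u"] w \<eta>2 u \<sigma>(3) by (simp add: A_0)
  qed
  have q3: "\<forall>\<eta> u s. cmod \<eta> < \<eta>2 \<and> (\<forall>j :: nat. u (Suc j) = l * u j + (u j + \<eta> * s j)\<^sup>2 \<and> s (Suc j) = u j + \<eta> * s j) \<and>
       Re (-1 / (of_nat q * A \<eta> * u 0 ^ q)) > R \<and> cmod (s 0 - poly (h \<eta>) (u 0)) \<le> C * cmod (u 0) ^ N
       \<longrightarrow> (\<forall>j. cmod (s (Suc j)) \<le> 1)"
  proof (intro allI impI)
    fix \<eta> u s and j :: nat
    assume *: "cmod \<eta> < \<eta>2 \<and> (\<forall>j :: nat. u (Suc j) = l * u j + (u j + \<eta> * s j)\<^sup>2 \<and> s (Suc j) = u j + \<eta> * s j) \<and>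
       Re (-1 / (of_nat q * A \<eta> * u 0 ^ q)) > R \<and> cmod (s 0 - poly (h \<eta>) (u 0)) \<le> C * cmod (u 0) ^ N"
    then have \<eta>: "cmod \<eta> < \<eta>2" by blast
    have o: "orb \<eta> (\<lambda>i. u (k + i)) (\<lambda>i. s (k + i))" for k using * by (simp add: orb_def)
    have it: "cmod (s (q * k + q) - poly (h \<eta>) (u (q * k + q))) \<le> C * cmod (u (q * k + q)) ^ N \<and> (\<forall>i<q. cmod (s (Suc (q * k + i))) \<le> 1) \<and>
      Re (-1 / (of_nat q * A \<eta> * u (q * k + q) ^ q)) > R"
      if w: "Re (-1 / (of_nat q * A \<eta> * u (q * k) ^ q)) > R" and d: "cmod (s (q * k) - poly (h \<eta>) (u (q * k))) \<le> C * cmod (u (q * k)) ^ N" for k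
    proof -
      have u: "u (q * k) \<noteq> 0" "cmod (u (q * k)) < \<sigma>" using close[OF \<eta> w] by auto
      have I: "cmod (s (q * k + q) - poly (h \<eta>) (u (q * k + q))) \<le> C * cmod (u (q * k + q)) ^ N" "\<forall>i<q. cmod (s (Suc (q * k + i))) \<le> 1"
        "cmod (u (q * k + q) - poly (poly_iter (f \<eta>) q) (u (q * k))) \<le> Cq * cmod (u (q * k)) ^ N"
        using iterq[OF \<eta> o[of "q * k"]] u \<sigma>(2) d by simp_all
      have "\<tau> / 2 ^ q \<le> \<tau>" using C(4) by (simp add: divide_le_eq)
      then have u1: "cmod (u (q * k)) \<le> 1" using u \<sigma>(3) C(6) by linarith
      have "u (q * k + q) - u (q * k) - A \<eta> * u (q * k) ^ Suc q = (u (q * k + q) - poly (poly_iter (f \<eta>) q) (u (q * k)))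
         + (poly (poly_iter (f \<eta>) q) (u (q * k)) - u (q * k) - A \<eta> * u (q * k) ^ Suc q)" by simp
      also have "cmod \<dots> \<le> Cq * cmod (u (q * k)) ^ N + CG * cmod (u (q * k)) ^ N"
        using \<eta> \<eta>2 u1 by (intro norm_triangle_le add_mono I rem) auto
      finally show ?thesis using next_petal[OF \<eta> w, of "u (q * k + q)"] I(1,2) by (simp add: distrib_right)
    qed
    have inv: "Re (-1 / (of_nat q * A \<eta> * u (q * k) ^ q)) > R \<and> cmod (s (q * k) - poly (h \<eta>) (u (q * k))) \<le> C * cmod (u (q * k)) ^ N" for k
    proof (induction k)
      case (Suc k)
      then show ?case using it[of k] by (simp add: add.commute)
    qed (use * in simp)
    have "j mod q < q" using q by simp
    then have "cmod (s (Suc (q * (j div q) + j mod q))) \<le> 1" using it[of "j div q"] inv by blast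
    then show "cmod (s (Suc j)) \<le> 1" by simp
  qed
  have N2: "q + 2 = N" by (simp add: N_def)
  show ?thesis unfolding N2
    by (rule exI[of _ h], rule exI[of _ C], rule exI[of _ K], rule exI[of _ \<tau>], rule exI[of _ \<eta>2], rule exI[of _ A], rule exI[of _ R],
      intro conjI C \<eta>2 err hC hL q1 A_lim A_0 q2 q3)
qed

section \<open>The semiparabolic basin of the Henon recursion\<close>

text \<open>\<open>t\<close> plays the role of \<open>e x_(-1)\<close>. As an independent variable
  it lets the tail of an orbit count as an orbit of the same recursion.\<close>

fun henon_x :: "complex \<Rightarrow> complex \<Rightarrow> complex \<Rightarrow> complex \<Rightarrow> nat \<Rightarrow> complex" where
  "henon_x c e x t 0 = x"
| "henon_x c e x t (Suc 0) = x\<^sup>2 + c + t"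
| "henon_x c e x t (Suc (Suc n)) = (henon_x c e x t (Suc n))\<^sup>2 + c + e * henon_x c e x t n"

definition curve_c :: "complex \<Rightarrow> complex \<Rightarrow> complex" where
  "curve_c l e = (1 - e) * (l / 2 - e / (2 * l)) - (l / 2 - e / (2 * l))\<^sup>2"

lemma curve_c_0: "curve_c l 0 = l / 2 - l\<^sup>2 / 4"
  by (simp add: curve_c_def power2_eq_square)

text \<open>The coordinates \<open>u\<^sub>k = v\<^sub>k - \<eta> v\<^sub>k\<^sub>-\<^sub>1\<close> and \<open>s\<^sub>k = v\<^sub>k\<^sub>-\<^sub>1\<close> diagonalise the linear part at the fixed point.\<close>

lemma henon_x_fixpoint_coords:
  fixes l e x t :: complex
  assumes l: "l \<noteq> 0"
  defines "\<eta> \<equiv> - e / l"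
  defines "v \<equiv> \<lambda>n. henon_x (curve_c l e) e x t n - (l / 2 + \<eta> / 2)"
  shows "v (Suc (Suc n)) - \<eta> * v (Suc n) = l * (v (Suc n) - \<eta> * v n) + (v (Suc n))\<^sup>2"
proof -
  define X where "X = henon_x (curve_c l e) e x t"
  define z where "z = l / 2 + \<eta> / 2"
  have e: "e = - \<eta> * l" using l by (simp add: \<eta>_def)
  have "l / 2 - e / (2 * l) = z" using l by (simp add: z_def \<eta>_def field_simps)
  then have c: "curve_c l e = (1 - e) * z - z\<^sup>2" by (simp add: curve_c_def)
  have "X (Suc (Suc n)) = (X (Suc n))\<^sup>2 + ((1 - e) * z - z\<^sup>2) + e * X n"
    unfolding X_def by (simp add: c)
  moreover have "2 * z = l + \<eta>" by (simp add: z_def)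
  ultimately have "X (Suc (Suc n)) - z - \<eta> * (X (Suc n) - z) - (l * ((X (Suc n) - z) - \<eta> * (X n - z)) + (X (Suc n) - z)\<^sup>2)
      = (2 * z - (l + \<eta>)) * (X (Suc n) - z)"
    unfolding e by algebra
  with \<open>2 * z = l + \<eta>\<close> show ?thesis unfolding v_def X_def[symmetric] z_def[symmetric] by simp
qed

text \<open>For \<open>e = x = t = 0\<close> the recursion is the orbit of the critical point of
  \<open>P\<close>, and each single term is continuous in these data.\<close>

lemma henon_x_tendsto:
  assumes l: "l \<noteq> 0"
  shows "((\<lambda>(e, x, t). henon_x (curve_c l e) e x t n) \<longlongrightarrow> l / 2 + (qmap l ^^ n) (- l / 2)) (nhds (0, 0, 0))"
proof -
  define F where "F = nhds (0 :: complex, 0 :: complex, 0 :: complex)"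
  have id: "((\<lambda>p. p) \<longlongrightarrow> (0, 0, 0)) F" by (simp add: F_def filterlim_ident)
  have fst: "(fst \<longlongrightarrow> 0) F" using tendsto_fst[OF id] by simp
  have fst2: "((\<lambda>p. fst (snd p)) \<longlongrightarrow> 0) F" using tendsto_fst[OF tendsto_snd[OF id]] by simp
  have snd2: "((\<lambda>p. snd (snd p)) \<longlongrightarrow> 0) F" using tendsto_snd[OF tendsto_snd[OF id]] by simp
  have c: "((\<lambda>p. curve_c l (fst p)) \<longlongrightarrow> curve_c l 0) F"
    unfolding curve_c_def using l by (intro tendsto_intros fst) auto
  have rec: "l / 2 + qmap l u = (l / 2 + u)\<^sup>2 + curve_c l 0" for u
    by (simp add: curve_c_0 qmap_def power2_eq_square field_simps)
  define X where "X = (\<lambda>n p. henon_x (curve_c l (fst p)) (fst p) (fst (snd p)) (snd (snd p)) n)"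
  define L where "L = (\<lambda>n. l / 2 + (qmap l ^^ n) (- l / 2))"
  have L: "L (Suc n) = (L n)\<^sup>2 + curve_c l 0" for n by (simp add: L_def rec)
  have "(X n \<longlongrightarrow> L n) F \<and> (X (Suc n) \<longlongrightarrow> L (Suc n)) F" for n
  proof (induction n)
    case 0
    have "((\<lambda>p. (fst (snd p))\<^sup>2 + curve_c l (fst p) + snd (snd p)) \<longlongrightarrow> 0\<^sup>2 + curve_c l 0 + 0) F"
      by (intro tendsto_intros fst2 c snd2)
    moreover have "L (Suc 0) = 0\<^sup>2 + curve_c l 0 + 0" unfolding L by (simp add: L_def)
    ultimately show ?case using fst2 by (simp add: X_def L_def)
  next
    case (Suc n)
    have "((\<lambda>p. (X (Suc n) p)\<^sup>2 + curve_c l (fst p) + fst p * X n p) \<longlongrightarrow> (L (Suc n))\<^sup>2 + curve_c l 0 + 0 * L n) F"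
      using Suc by (intro tendsto_intros fst c) auto
    then show ?case using Suc by (simp add: X_def L[of "Suc n"])
  qed
  then show ?thesis by (simp add: X_def L_def F_def case_prod_unfold)
qed

text \<open>The unperturbed critical orbit reaches the petal in finitely many steps, and those steps
  vary continuously, so nearby orbits arrive there too. What needs care is arrival inside the thin
  cusp around the center curve: at \<open>\<eta> = 0\<close> the deviation is exactly the invariance
  defect of the curve, which satisfies the cusp inequality strictly, and strict inequalities
  persist.\<close>

theorem semiparabolic_basin:
  fixes q :: nat
  assumes q: "q \<ge> 1" and l: "\<And>k. l ^ k = 1 \<longleftrightarrow> q dvd k"
  shows "\<exists>\<kappa>>0. \<exists>B. \<forall>e x t n. cmod e < \<kappa> \<and> cmod x < \<kappa> \<and> cmod t < \<kappa> \<longrightarrow>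
    cmod (henon_x (curve_c l e) e x t n) \<le> B"
proof -
  have lq: "l ^ q = 1" using l by simp
  then have lnz: "l \<noteq> 0" using q by (auto simp: power_0_left)
  have "cmod l ^ q = 1" using lq by (metis norm_one norm_power)
  then have cl: "cmod l = 1" using q power_eq_1_iff[of "cmod l" q] by (simp add: power_eq_1_iff)
  obtain G0 where G0: "poly G0 0 \<noteq> 0" "poly_iter [:0, l, 1:] q = [:0, 1:] + [:0, 1:] ^ Suc q * G0"
    and enter: "\<forall>R. \<exists>n. Re (-1 / (of_nat q * poly G0 0 * ((qmap l ^^ n) (- l / 2)) ^ q)) > R"
    using quadratic_petals[OF q l] by blast
  define A0 where "A0 = poly G0 0"
  define N where "N = q + 2"
  have A0: "A0 \<noteq> 0" using G0 by (simp add: A0_def)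
  obtain h C K \<tau> \<eta>0 A R where C: "C \<ge> 1" "K \<ge> 0" "4 * K + 1 \<le> C" "\<tau> > 0" "\<tau> \<le> 1 / 2" "\<eta>0 > 0" "\<eta>0 \<le> 1 / 2"
    and err: "\<forall>\<eta> u. cmod \<eta> \<le> 1 / 2 \<and> cmod u \<le> 1 \<longrightarrow> cmod (poly (slow_err l \<eta> (h \<eta>)) u) \<le> K * cmod u ^ (q + 2)"
    and hC: "\<forall>\<eta> u. cmod \<eta> \<le> 1 / 2 \<and> cmod u \<le> 1 \<longrightarrow> cmod (poly (h \<eta>) u) \<le> C"
    and hL: "\<forall>\<eta> u v. cmod \<eta> \<le> 1 / 2 \<and> cmod u \<le> 1 \<and> cmod v \<le> 1 \<longrightarrow> cmod (poly (h \<eta>) u - poly (h \<eta>) v) \<le> C * cmod (u - v)"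
    and q1: "\<forall>u. u \<noteq> 0 \<and> cmod u < \<tau> \<longrightarrow> cmod u ^ (q + 2) \<le> 2 * cmod (qmap l u) ^ (q + 2) \<and> qmap l u \<noteq> 0 \<and> cmod (qmap l u) \<le> 2 * cmod u"
    and A: "(A \<longlongrightarrow> A0) (nhds 0)" "A 0 = A0"
    and q2: "\<forall>u. Re (-1 / (of_nat q * A0 * u ^ q)) > R \<longrightarrow> cmod ((qmap l ^^ q) u - u) \<le> cmod u \<and>
       Re (-1 / (of_nat q * A0 * ((qmap l ^^ q) u) ^ q)) > R \<and> u \<noteq> 0 \<and> cmod u < \<tau> / 2 ^ q"
    and q3: "\<forall>\<eta> u s. cmod \<eta> < \<eta>0 \<and> (\<forall>j :: nat. u (Suc j) = l * u j + (u j + \<eta> * s j)\<^sup>2 \<and> s (Suc j) = u j + \<eta> * s j) \<and>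
       Re (-1 / (of_nat q * A \<eta> * u 0 ^ q)) > R \<and> cmod (s 0 - poly (h \<eta>) (u 0)) \<le> C * cmod (u 0) ^ (q + 2)
       \<longrightarrow> (\<forall>j. cmod (s (Suc j)) \<le> 1)"
    using uniform_semiparabolic_petal[OF q l A0 G0(2) A0_def] by (elim exE conjE) (rule that; assumption)
  obtain n0 where n0: "Re (-1 / (of_nat q * A0 * ((qmap l ^^ n0) (- l / 2)) ^ q)) > R"
    using enter unfolding A0_def by blast
  define a where "a = (qmap l ^^ n0) (- l / 2)"
  have a: "a \<noteq> 0" "cmod a < \<tau> / 2 ^ q" "Re (-1 / (of_nat q * A0 * ((qmap l ^^ q) a) ^ q)) > R"
    using q2[rule_format, of a] n0 by (auto simp: a_def)
  have aj: "(qmap l ^^ j) a \<noteq> 0 \<and> cmod ((qmap l ^^ j) a) \<le> 2 ^ j * cmod a" if "j \<le> q" for j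
    using that
  proof (induction j)
    case (Suc j)
    let ?u = "(qmap l ^^ j) a"
    have u: "?u \<noteq> 0" "cmod ?u \<le> 2 ^ j * cmod a" using Suc by auto
    have "2 ^ j * cmod a \<le> 2 ^ q * cmod a" using Suc.prems by (intro mult_right_mono power_increasing) auto
    also have "\<dots> < \<tau>" using a(2) by (simp add: field_simps)
    finally show ?case using q1[rule_format, of ?u] u by auto
  qed (use a in simp)
  \<comment> \<open>The perturbed orbit starts close to the pair \<open>u = qmap l \<sigma>\<close>,
    \<open>s = \<sigma>\<close>, the end of one further period: \<open>qmap l \<sigma>\<close> lies
    in the petal and its predecessor \<open>\<sigma>\<close> still in the disc of radius
    \<open>\<tau>\<close>.\<close>
  define n2 where "n2 = n0 + (q - 1)"
  define \<sigma> where "\<sigma> = (qmap l ^^ n2) (- l / 2)"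
  have \<sigma>_eq: "\<sigma> = (qmap l ^^ (q - 1)) a"
    unfolding \<sigma>_def n2_def a_def by (metis add.commute funpow_add o_apply)
  have q\<sigma>: "qmap l \<sigma> = (qmap l ^^ q) a" unfolding \<sigma>_eq using q by (cases q) auto
  have \<sigma>nz: "\<sigma> \<noteq> 0" "qmap l \<sigma> \<noteq> 0" using aj[of "q - 1"] aj[of q] unfolding \<sigma>_eq[symmetric] q\<sigma> by auto
  have \<sigma>: "cmod \<sigma> < \<tau>"
  proof -
    have "cmod \<sigma> \<le> 2 ^ (q - 1) * cmod a" using aj[of "q - 1"] \<sigma>_eq by simp
    also have "\<dots> \<le> 2 ^ q * cmod a" by (intro mult_right_mono power_increasing) auto
    also have "\<dots> < \<tau>" using a(2) by (simp add: field_simps)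
    finally show ?thesis .
  qed
  have q\<sigma>1: "cmod (qmap l \<sigma>) < 1" using q1[rule_format, of \<sigma>] \<sigma> \<sigma>nz C by linarith
  \<comment> \<open>The strict cusp inequality at \<open>\<eta> = 0\<close>. It rests on
    \<open>4 K + 1 \<le> C\<close> and on \<open>cmod \<sigma> ^ N\<close> being at most twice
    \<open>cmod (qmap l \<sigma>) ^ N\<close>.\<close>
  have gap: "K * cmod \<sigma> ^ N < C * cmod (qmap l \<sigma>) ^ N"
  proof -
    have s: "cmod \<sigma> ^ N \<le> 2 * cmod (qmap l \<sigma>) ^ N" using q1[rule_format, of \<sigma>] \<sigma> \<sigma>nz by (simp add: N_def)
    have p: "0 < cmod (qmap l \<sigma>) ^ N" using \<sigma>nz by simp
    have "K * cmod \<sigma> ^ N \<le> K * (2 * cmod (qmap l \<sigma>) ^ N)" by (rule mult_left_mono[OF s C(2)])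
    also have "\<dots> = (2 * K) * cmod (qmap l \<sigma>) ^ N" by simp
    also have "\<dots> < C * cmod (qmap l \<sigma>) ^ N" using C(2,3) p by (intro mult_strict_right_mono) auto
    finally show ?thesis .
  qed
  define F where "F = nhds (0 :: complex, 0 :: complex, 0 :: complex)"
  define X where "X = (\<lambda>n (p :: complex \<times> complex \<times> complex). henon_x (curve_c l (fst p)) (fst p) (fst (snd p)) (snd (snd p)) n)"
  define L where "L = (\<lambda>n. (qmap l ^^ n) (- l / 2))"
  have X: "(X n \<longlongrightarrow> l / 2 + L n) F" for n
    using henon_x_tendsto[OF lnz, of n] by (simp add: X_def F_def L_def case_prod_unfold)
  define \<eta> where "\<eta> = (\<lambda>p :: complex \<times> complex \<times> complex. - fst p / l)"
  have "((\<lambda>p :: complex \<times> complex \<times> complex. p) \<longlongrightarrow> (0, 0, 0)) F" by (simp add: F_def filterlim_ident)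
  from tendsto_fst[OF this] have "(fst \<longlongrightarrow> (0 :: complex)) F" by simp
  then have "(\<eta> \<longlongrightarrow> - 0 / l) F" unfolding \<eta>_def by (intro tendsto_intros lnz)
  then have \<eta>: "(\<eta> \<longlongrightarrow> 0) F" by simp
  define V where "V = (\<lambda>n p. X n p - (l / 2 + \<eta> p / 2))"
  have "(V n \<longlongrightarrow> (l / 2 + L n) - (l / 2 + 0 / 2)) F" for n unfolding V_def by (intro tendsto_intros X \<eta>) auto
  then have V: "(V n \<longlongrightarrow> L n) F" for n by simp
  define u where "u = (\<lambda>p j. V (Suc (n2 + j)) p - \<eta> p * V (n2 + j) p)"
  define s where "s = (\<lambda>p j. V (n2 + j) p)"
  have us: "u p (Suc j) = l * u p j + (u p j + \<eta> p * s p j)\<^sup>2" "s p (Suc j) = u p j + \<eta> p * s p j" for p j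
    using henon_x_fixpoint_coords[OF lnz, of "fst p" "fst (snd p)" "snd (snd p)" "n2 + j"]
    by (simp_all add: u_def s_def V_def X_def \<eta>_def)
  have s0: "((\<lambda>p. s p 0) \<longlongrightarrow> \<sigma>) F" using V[of n2] by (simp add: s_def L_def \<sigma>_def)
  have "((\<lambda>p. u p 0) \<longlongrightarrow> L (Suc n2) - 0 * L n2) F" unfolding u_def by (simp only: add_0_right) (intro tendsto_intros V \<eta>)
  then have u0: "((\<lambda>p. u p 0) \<longlongrightarrow> qmap l \<sigma>) F" by (simp add: L_def \<sigma>_def)
  have A\<eta>: "((\<lambda>p. A (\<eta> p)) \<longlongrightarrow> A0) F" by (rule filterlim_compose[OF A(1) \<eta>])
  have small_\<eta>: "eventually (\<lambda>p. dist (\<eta> p) 0 < \<eta>0) F" by (rule tendstoD[OF \<eta> C(6)])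
  have e1: "eventually (\<lambda>p. Re (-1 / (of_nat q * A (\<eta> p) * u p 0 ^ q)) > R) F"
  proof (rule order_tendstoD(1))
    show "((\<lambda>p. Re (-1 / (of_nat q * A (\<eta> p) * u p 0 ^ q))) \<longlongrightarrow> Re (-1 / (of_nat q * A0 * (qmap l \<sigma>) ^ q))) F"
      using q A0 \<sigma>nz by (intro tendsto_intros A\<eta> u0) auto
    show "R < Re (-1 / (of_nat q * A0 * (qmap l \<sigma>) ^ q))" using a(3) unfolding q\<sigma> .
  qed
  have e2: "eventually (\<lambda>p. cmod (s p 0) < 1) F"
    using \<sigma> C by (intro order_tendstoD(2)[OF tendsto_norm[OF s0]]) auto
  have e3: "eventually (\<lambda>p. cmod (u p 0) < 1) F"
    using q\<sigma>1 by (intro order_tendstoD(2)[OF tendsto_norm[OF u0]]) auto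
  \<comment> \<open>The image of the curve point over \<open>s p 0\<close>. It converges to the same
    limit as \<open>u p 0\<close>, so \<open>h (u p 0)\<close> can be compared with the invariance
    defect at \<open>s p 0\<close>.\<close>
  define g where "g = (\<lambda>p. poly (slow_map l (\<eta> p) (h (\<eta> p))) (s p 0))"
  have "((\<lambda>p. \<eta> p * poly (h (\<eta> p)) (s p 0)) \<longlongrightarrow> 0) F"
  proof (rule Lim_null_comparison)
    show "eventually (\<lambda>p. norm (\<eta> p * poly (h (\<eta> p)) (s p 0)) \<le> cmod (\<eta> p) * C) F"
      using small_\<eta> e2
    proof eventually_elim
      case (elim p)
      then show ?case using hC[rule_format, of "\<eta> p" "s p 0"] C by (auto simp: norm_mult intro!: mult_left_mono)
    qed
    show "((\<lambda>p. cmod (\<eta> p) * C) \<longlongrightarrow> 0) F"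
      using tendsto_mult[OF tendsto_norm[OF \<eta>] tendsto_const[of C]] by simp
  qed
  then have "((\<lambda>p. l * s p 0 + (s p 0 + \<eta> p * poly (h (\<eta> p)) (s p 0))\<^sup>2) \<longlongrightarrow> l * \<sigma> + (\<sigma> + 0)\<^sup>2) F"
    by (intro tendsto_intros s0)
  then have g: "(g \<longlongrightarrow> qmap l \<sigma>) F"
    by (simp add: g_def slow_map_def qmap_def mult.commute)
  have e4: "eventually (\<lambda>p. cmod (g p) < 1) F"
    using q\<sigma>1 by (intro order_tendstoD(2)[OF tendsto_norm[OF g]]) auto
  have e5: "eventually (\<lambda>p. K * cmod (s p 0) ^ N + cmod (\<eta> p) * C + C * cmod (g p - u p 0) - C * cmod (u p 0) ^ N < 0) F"
  proof (rule order_tendstoD(2))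
    show "((\<lambda>p. K * cmod (s p 0) ^ N + cmod (\<eta> p) * C + C * cmod (g p - u p 0) - C * cmod (u p 0) ^ N)
       \<longlongrightarrow> K * cmod \<sigma> ^ N + cmod 0 * C + C * cmod (qmap l \<sigma> - qmap l \<sigma>) - C * cmod (qmap l \<sigma>) ^ N) F"
      by (intro tendsto_intros s0 u0 g \<eta>)
  qed (use gap in simp)
  have e6: "eventually (\<lambda>p. \<forall>n\<in>{..n2}. cmod (X n p) < cmod (l / 2 + L n) + 1) F"
    by (intro eventually_ball_finite ballI order_tendstoD(2)[OF tendsto_norm[OF X]]) auto
  define B where "B = 3 + (\<Sum>n\<le>n2. cmod (l / 2 + L n) + 1)"
  have "eventually (\<lambda>p. \<forall>n. cmod (X n p) \<le> B) F"
    using small_\<eta> e1 e2 e3 e4 e5 e6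
  proof eventually_elim
    case (elim p)
    have \<eta>h: "cmod (\<eta> p) < \<eta>0" "cmod (\<eta> p) \<le> 1 / 2" using elim(1) C by auto
    have "s p 0 - poly (h (\<eta> p)) (u p 0) = - poly (slow_err l (\<eta> p) (h (\<eta> p))) (s p 0)
       + (poly (h (\<eta> p)) (g p) - poly (h (\<eta> p)) (u p 0)) - \<eta> p * poly (h (\<eta> p)) (s p 0)"
      by (simp add: slow_err_def g_def poly_pcompose)
    also have "cmod \<dots> \<le> K * cmod (s p 0) ^ N + C * cmod (g p - u p 0) + cmod (\<eta> p) * C"
    proof (rule order_trans[OF norm_triangle_ineq4 add_mono[OF order_trans[OF norm_triangle_ineq add_mono]]])
      show "cmod (- poly (slow_err l (\<eta> p) (h (\<eta> p))) (s p 0)) \<le> K * cmod (s p 0) ^ N"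
        using err[rule_format, of "\<eta> p" "s p 0"] \<eta>h elim by (simp add: N_def)
      show "cmod (poly (h (\<eta> p)) (g p) - poly (h (\<eta> p)) (u p 0)) \<le> C * cmod (g p - u p 0)"
        using hL[rule_format, of "\<eta> p" "g p" "u p 0"] \<eta>h elim by simp
      show "cmod (\<eta> p * poly (h (\<eta> p)) (s p 0)) \<le> cmod (\<eta> p) * C"
        using hC[rule_format, of "\<eta> p" "s p 0"] \<eta>h elim by (auto simp: norm_mult intro!: mult_left_mono)
    qed
    also have "\<dots> \<le> C * cmod (u p 0) ^ N" using elim by simp
    finally have d: "cmod (s p 0 - poly (h (\<eta> p)) (u p 0)) \<le> C * cmod (u p 0) ^ (q + 2)" by (simp add: N_def)
    have "\<forall>j. cmod (s p (Suc j)) \<le> 1"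
      using q3[rule_format, of "\<eta> p" "u p" "s p"] \<eta>h(1) us elim(2) d by blast
    then have Vb: "cmod (V n p) \<le> 1" if "n > n2" for n
      using that by (auto simp: s_def dest!: less_imp_Suc_add)
    show ?case
    proof
      fix n
      have nn: "(\<Sum>n\<le>n2. cmod (l / 2 + L n) + 1) \<ge> 0" by (intro sum_nonneg) auto
      show "cmod (X n p) \<le> B"
      proof (cases "n \<le> n2")
        case True
        then have "cmod (X n p) \<le> cmod (l / 2 + L n) + 1" using elim by (auto intro: less_imp_le)
        also have "\<dots> \<le> (\<Sum>n\<le>n2. cmod (l / 2 + L n) + 1)"
          using True by (intro member_le_sum) auto
        finally show ?thesis by (simp add: B_def)
      next
        case False
        have "cmod (l / 2 + \<eta> p / 2) \<le> 1 / 2 + 1 / 2"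
          using cl \<eta>h by (intro norm_triangle_le) (auto simp: norm_divide)
        moreover have "X n p = V n p + (l / 2 + \<eta> p / 2)" by (simp add: V_def)
        ultimately have "cmod (X n p) \<le> 1 + 1" using Vb[of n] False norm_triangle_ineq[of "V n p" "l / 2 + \<eta> p / 2"] by simp
        then show ?thesis using nn by (simp add: B_def)
      qed
    qed
  qed
  then obtain d where d: "d > 0" "\<And>p n. dist p (0, 0, 0) < d \<Longrightarrow> cmod (X n p) \<le> B"
    unfolding F_def eventually_nhds_metric by blast
  have "cmod (henon_x (curve_c l e) e x t n) \<le> B" if "cmod e < d / 3" "cmod x < d / 3" "cmod t < d / 3" for e x t n
  proof -
    have "dist (e, x, t) (0, 0, 0) = norm (e, x, t)" by (simp add: dist_norm)
    also have "\<dots> \<le> cmod e + (cmod x + cmod t)"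
      by (intro order_trans[OF norm_Pair_le] add_left_mono norm_Pair_le)
    also have "\<dots> < d" using that by simp
    finally show ?thesis using d(2)[of "(e, x, t)" n] by (simp add: X_def)
  qed
  then have "\<forall>e x t n. cmod e < d / 3 \<and> cmod x < d / 3 \<and> cmod t < d / 3 \<longrightarrow> cmod (henon_x (curve_c l e) e x t n) \<le> B"
    by blast
  then show ?thesis using d(1) by (intro exI[of _ "d / 3"] conjI exI[of _ B]) auto
qed

section \<open>Covering spaces of roots and derivatives of the recursion\<close>

lemma card_roots_squarefree:
  fixes p :: "complex poly"
  assumes "rsquarefree p"
  shows "card {z. poly p z = 0} = degree p"
proof -
  have "p \<noteq> 0" using assms by (simp add: rsquarefree_def)
  then have "degree p = degree (\<Prod>z | poly p z = 0. [:- z, 1:])"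
    by (metis assms complex_poly_decompose_rsquarefree degree_smult_eq leading_coeff_0_iff)
  also have "\<dots> = (\<Sum>z | poly p z = 0. degree [:- z, 1:])"
    by (rule degree_prod_sum_eq) auto
  finally show ?thesis by simp
qed

text \<open>For a monic polynomial \<open>cmod (poly p x)\<close> is the product of the distances
  from \<open>x\<close> to the roots, hence at least \<open>r ^ degree p\<close> if none is within
  \<open>r\<close>.\<close>

lemma root_near:
  fixes p :: "complex poly"
  assumes sq: "rsquarefree p" and lead: "lead_coeff p = 1" and "r \<ge> 0" and small: "cmod (poly p x) < r ^ degree p"
  shows "\<exists>z. poly p z = 0 \<and> cmod (x - z) < r"
proof (rule ccontr)
  assume no: "\<not> ?thesis"
  let ?Z = "{z. poly p z = 0}"
  have "poly p x = poly (smult (lead_coeff p) (\<Prod>z | poly p z = 0. [:- z, 1:])) x"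
    by (simp only: complex_poly_decompose_rsquarefree[OF sq])
  also have "\<dots> = (\<Prod>z\<in>?Z. x - z)" by (simp add: lead poly_prod)
  finally have "cmod (poly p x) = (\<Prod>z\<in>?Z. cmod (x - z))" by (simp add: prod_norm)
  moreover have "(\<Prod>z\<in>?Z. r) \<le> (\<Prod>z\<in>?Z. cmod (x - z))"
    using no \<open>r \<ge> 0\<close> by (intro prod_mono) (auto simp: not_less)
  ultimately show False using small card_roots_squarefree[OF sq] by simp
qed

text \<open>Near a root of one polynomial of the family each nearby polynomial has a root; counting shows
  that there is exactly one.\<close>

lemma root_covering:
  fixes p :: "'u::real_normed_vector \<Rightarrow> complex poly"
  assumes sq: "\<And>u. u \<in> U \<Longrightarrow> rsquarefree (p u)" and lead: "\<And>u. u \<in> U \<Longrightarrow> lead_coeff (p u) = 1"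
    and deg: "\<And>u. u \<in> U \<Longrightarrow> degree (p u) = d" and d: "d \<ge> 1"
    and cont: "\<And>x. continuous_on U (\<lambda>u. poly (p u) x)"
  shows "covering_space {(u, x). u \<in> U \<and> poly (p u) x = 0} fst U"
proof
  let ?C = "{(u, x). u \<in> U \<and> poly (p u) x = 0}"
  show "continuous_on ?C fst" by (intro continuous_intros)
  have ex: "\<exists>x. poly (p u) x = 0" if "u \<in> U" for u
    using card_roots_squarefree[OF sq[OF that]] deg[OF that] d
    by (metis (mono_tags, lifting) card_eq_0_iff empty_Collect_eq not_one_le_zero)
  then show "fst ` ?C = U" by force
  fix u0 assume u0: "u0 \<in> U"
  define Z where "Z = {z. poly (p u0) z = 0}"
  have cardZ: "card Z = d" using card_roots_squarefree[OF sq[OF u0]] deg[OF u0] by (simp add: Z_def)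
  then have finZ: "finite Z" using d by (metis card.infinite not_one_le_zero)
  obtain r where r: "r > 0" "\<And>z z'. z \<in> Z \<Longrightarrow> z' \<in> Z \<Longrightarrow> z \<noteq> z' \<Longrightarrow> dist z z' \<ge> 2 * r"
  proof (cases "\<exists>z\<in>Z. \<exists>z'\<in>Z. z \<noteq> z'")
    case False
    then show ?thesis using that[of 1] by auto
  next
    case True
    define S where "S = (\<lambda>(z, z'). dist z z') ` (Z \<times> Z \<inter> {(z, z'). z \<noteq> z'})"
    have S: "finite S" "S \<noteq> {}" using finZ True unfolding S_def by auto
    have "Min S > 0" using S by (subst Min_gr_iff) (auto simp: S_def)
    moreover have "dist z z' \<ge> Min S" if "z \<in> Z" "z' \<in> Z" "z \<noteq> z'" for z z'
      using S that by (intro Min_le) (auto simp: S_def)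
    ultimately show ?thesis using that[of "Min S / 2"] by auto
  qed
  define T where "T = {u \<in> U. \<forall>z\<in>Z. cmod (poly (p u) z) < r ^ d}"
  have opT: "openin (top_of_set U) T"
  proof -
    have "T = (\<Inter>z\<in>Z. U \<inter> (\<lambda>u. cmod (poly (p u) z)) -` {..< r ^ d})"
      using cardZ d by (force simp: T_def)
    moreover have "openin (top_of_set U) (\<Inter>z\<in>Z. U \<inter> (\<lambda>u. cmod (poly (p u) z)) -` {..< r ^ d})"
    proof (rule openin_INT2)
      show "Z \<noteq> {}" using cardZ d by auto
      show "openin (top_of_set U) (U \<inter> (\<lambda>u. cmod (poly (p u) z)) -` {..< r ^ d})" for z
        by (intro continuous_openin_preimage_gen continuous_intros cont)
    qed (rule finZ)
    ultimately show ?thesis by simp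
  qed
  have TU: "u \<in> U" if "u \<in> T" for u using that by (simp add: T_def)
  have sheet: "\<exists>g. (\<forall>z\<in>Z. poly (p u) (g z) = 0 \<and> g z \<in> ball z r) \<and> (\<forall>x. poly (p u) x = 0 \<longrightarrow> x \<in> g ` Z)" if u: "u \<in> T" for u
  proof -
    have "\<exists>x. poly (p u) x = 0 \<and> cmod (z - x) < r" if "z \<in> Z" for z
      using u that r(1) deg[OF TU[OF u]] by (intro root_near sq lead TU) (auto simp: T_def)
    then obtain g where g: "\<And>z. z \<in> Z \<Longrightarrow> poly (p u) (g z) = 0 \<and> cmod (z - g z) < r" by metis
    have "inj_on g Z"
    proof (rule inj_onI)
      fix z z' assume z: "z \<in> Z" "z' \<in> Z" "g z = g z'"
      have "dist z z' \<le> dist z (g z) + dist z' (g z')" using dist_triangle2[of z z' "g z"] z(3) by simp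
      also have "\<dots> < 2 * r" using g[OF z(1)] g[OF z(2)] by (simp add: dist_norm)
      finally show "z = z'" using r(2)[OF z(1,2)] by fastforce
    qed
    then have "card (g ` Z) = card {x. poly (p u) x = 0}"
      using card_roots_squarefree[OF sq[OF TU[OF u]]] deg[OF TU[OF u]] by (simp add: card_image cardZ)
    moreover have "g ` Z \<subseteq> {x. poly (p u) x = 0}" using g by auto
    moreover have "p u \<noteq> 0" using sq[OF TU[OF u]] by (simp add: rsquarefree_def)
    then have "finite {x. poly (p u) x = 0}" by (rule poly_roots_finite)
    ultimately have "g ` Z = {x. poly (p u) x = 0}" by (simp add: card_subset_eq)
    then show ?thesis using g by (intro exI[of _ g]) (auto simp: dist_norm)
  qed
  have uniq: "\<exists>!x. poly (p u) x = 0 \<and> x \<in> ball z r" if u: "u \<in> T" and z: "z \<in> Z" for u z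
  proof -
    obtain g where g: "\<And>z. z \<in> Z \<Longrightarrow> poly (p u) (g z) = 0 \<and> g z \<in> ball z r" "\<And>x. poly (p u) x = 0 \<Longrightarrow> x \<in> g ` Z"
      using sheet[OF u] by blast
    show ?thesis
    proof (rule ex1I[of _ "g z"])
      fix x assume x: "poly (p u) x = 0 \<and> x \<in> ball z r"
      then obtain z' where z': "z' \<in> Z" "x = g z'" using g(2) by blast
      then have "x \<in> ball z' r" using g(1) by blast
      then have "dist z z' < 2 * r" using x dist_triangle2[of z z' x] by simp
      then show "x = g z" using r(2)[OF z z'(1)] z'(2) by fastforce
    qed (use g z in blast)
  qed
  define S where "S = (\<lambda>z. {(u, x). u \<in> T \<and> x \<in> ball z r \<and> poly (p u) x = 0})"
  have hom: "\<exists>q. homeomorphism (S z) T fst q" if z: "z \<in> Z" for z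
  proof -
    define \<phi> where "\<phi> = (\<lambda>u. THE x. poly (p u) x = 0 \<and> x \<in> ball z r)"
    have \<phi>: "poly (p u) (\<phi> u) = 0" "\<phi> u \<in> ball z r" if "u \<in> T" for u
      using theI'[OF uniq[OF that z]] by (auto simp: \<phi>_def)
    have \<phi>_eq: "x = \<phi> u" if "u \<in> T" "poly (p u) x = 0" "x \<in> ball z r" for u x
      using uniq[OF that(1) z] \<phi>[OF that(1)] that by blast
    have "continuous_on T \<phi>"
      \<comment> \<open>A small value of \<open>p u\<close> at the root over \<open>u1\<close>
        forces a root of \<open>p u\<close> nearby, and in the disc around \<open>z\<close> there is
        only one.\<close>
      unfolding continuous_on_iff
    proof (intro ballI allI impI)
      fix u1 and \<epsilon> :: real assume u1: "u1 \<in> T" and \<epsilon>: "\<epsilon> > 0"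
      obtain s where s: "s > 0" "ball (\<phi> u1) s \<subseteq> ball z r" "s \<le> \<epsilon>"
      proof -
        obtain s' where "s' > 0" "ball (\<phi> u1) s' \<subseteq> ball z r" using \<phi>(2)[OF u1] open_contains_ball by (metis open_ball)
        then show ?thesis using \<epsilon> by (intro that[of "min s' \<epsilon>"]) auto
      qed
      have "continuous_on U (\<lambda>u. cmod (poly (p u) (\<phi> u1)))" by (intro continuous_intros cont)
      moreover have "s ^ d > 0" using s(1) by simp
      ultimately have "\<exists>\<delta>>0. \<forall>u\<in>U. dist u u1 < \<delta> \<longrightarrow> dist (cmod (poly (p u) (\<phi> u1))) (cmod (poly (p u1) (\<phi> u1))) < s ^ d"
        using TU[OF u1] unfolding continuous_on_iff by blast
      then obtain \<delta> where \<delta>: "\<delta> > 0" "\<And>u. u \<in> U \<Longrightarrow> dist u u1 < \<delta> \<Longrightarrow> cmod (poly (p u) (\<phi> u1)) < s ^ d"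
        using \<phi>(1)[OF u1] by (auto simp: dist_norm)
      have "dist (\<phi> u) (\<phi> u1) < \<epsilon>" if u: "u \<in> T" "dist u u1 < \<delta>" for u
      proof -
        have "cmod (poly (p u) (\<phi> u1)) < s ^ degree (p u)" using \<delta>(2)[OF TU[OF u(1)] u(2)] deg[OF TU[OF u(1)]] by simp
        then obtain x where x: "poly (p u) x = 0" "cmod (\<phi> u1 - x) < s"
          using root_near[OF sq[OF TU[OF u(1)]] lead[OF TU[OF u(1)]] less_imp_le[OF s(1)]] by blast
        then have "x \<in> ball z r" using s(2) by (auto simp: dist_norm)
        then have "x = \<phi> u" by (rule \<phi>_eq[OF u(1) x(1)])
        then show ?thesis using x(2) s(3) by (simp add: dist_norm norm_minus_commute)
      qed
      then show "\<exists>\<delta>>0. \<forall>u\<in>T. dist u u1 < \<delta> \<longrightarrow> dist (\<phi> u) (\<phi> u1) < \<epsilon>" using \<delta>(1) by blast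
    qed
    then have "homeomorphism (S z) T fst (\<lambda>u. (u, \<phi> u))"
      using \<phi> \<phi>_eq by (intro homeomorphismI continuous_intros) (auto simp: S_def)
    then show ?thesis by blast
  qed
  show "\<exists>T. u0 \<in> T \<and> openin (top_of_set U) T \<and> (\<exists>v. \<Union> v = ?C \<inter> fst -` T \<and> (\<forall>u\<in>v. openin (top_of_set ?C) u) \<and>
      pairwise disjnt v \<and> (\<forall>u\<in>v. \<exists>q. homeomorphism u T fst q))"
  proof (intro exI[of _ T] conjI exI[of _ "S ` Z"] ballI opT)
    show "u0 \<in> T" using u0 r(1) by (auto simp: T_def Z_def)
    show "\<Union> (S ` Z) = ?C \<inter> fst -` T"
    proof -
      have "\<exists>z\<in>Z. x \<in> ball z r" if "u \<in> T" "poly (p u) x = 0" for u x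
        using sheet[OF that(1)] that(2) by blast
      then show ?thesis using TU by (fastforce simp: S_def)
    qed
    show "openin (top_of_set ?C) V" if V: "V \<in> S ` Z" for V
    proof -
      obtain z where z: "V = S z" using V by blast
      have "V = (?C \<inter> fst -` T) \<inter> (?C \<inter> snd -` ball z r)" using TU by (auto simp: z S_def)
      moreover have "openin (top_of_set ?C) (?C \<inter> fst -` T)"
        by (rule continuous_openin_preimage[OF _ _ opT]) (auto intro: continuous_intros)
      moreover have "openin (top_of_set ?C) (?C \<inter> snd -` ball z r)"
        by (intro continuous_openin_preimage_gen continuous_intros) auto
      ultimately show ?thesis by (simp add: openin_Int)
    qed
    show "pairwise disjnt (S ` Z)"
    proof (rule pairwiseI)
      fix V V' assume "V \<in> S ` Z" "V' \<in> S ` Z" "V \<noteq> V'"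
      then obtain z z' where z: "z \<in> Z" "z' \<in> Z" "z \<noteq> z'" "V = S z" "V' = S z'" by blast
      have False if "x \<in> ball z r" "x \<in> ball z' r" for x
        using that dist_triangle2[of z z' x] r(2)[OF z(1-3)] by simp
      then show "disjnt V V'" unfolding disjnt_def z S_def by fastforce
    qed
    show "\<exists>q. homeomorphism V T fst q" if "V \<in> S ` Z" for V using hom that by blast
  qed
qed

text \<open>Divided difference of the recursion in the initial value \<open>x\<close>; for
  \<open>s = s'\<close> it is the derivative of the \<open>n\<close>-th term.\<close>

fun diff_factor :: "(nat \<Rightarrow> complex) \<Rightarrow> (nat \<Rightarrow> complex) \<Rightarrow> complex \<Rightarrow> nat \<Rightarrow> complex" where
  "diff_factor s s' e 0 = 1"
| "diff_factor s s' e (Suc 0) = s 0 + s' 0"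
| "diff_factor s s' e (Suc (Suc n)) = (s (Suc n) + s' (Suc n)) * diff_factor s s' e (Suc n) + e * diff_factor s s' e n"

text \<open>The recursion \<open>D_(n+1) = 2 s_n D_n + e D_(n-1)\<close> admits no cancellation: by
  induction \<open>cmod (e D_(n-1)) \<le> \<kappa> * cmod D_n\<close>, which is at most half of the
  other term.\<close>

lemma diff_factor_diag_bound:
  assumes \<kappa>: "\<kappa> > 0" and e: "cmod e \<le> \<kappa>\<^sup>2" and s: "\<And>k. k < n \<Longrightarrow> cmod (s k) \<ge> \<kappa>"
  shows "diff_factor s s e n \<noteq> 0 \<and> (n \<ge> 1 \<longrightarrow> cmod (diff_factor s s e n) \<ge> \<kappa> * cmod (diff_factor s s e (n - 1)))"
  using s
proof (induction n)
  case (Suc n)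
  show ?case
  proof (cases n)
    case 0
    have "cmod (s 0 + s 0) = 2 * cmod (s 0)" by (simp flip: mult_2 add: norm_mult)
    then have "cmod (s 0 + s 0) \<ge> \<kappa>" using Suc.prems[of 0] \<kappa> by simp
    then show ?thesis using 0 \<kappa> by auto
  next
    case (Suc m)
    let ?D = "diff_factor s s e"
    have IH: "?D n \<noteq> 0" "cmod (?D n) \<ge> \<kappa> * cmod (?D m)" using Suc.IH Suc.prems Suc by auto
    have "2 * \<kappa> * cmod (?D n) \<le> 2 * cmod (s n) * cmod (?D n)"
      using Suc.prems[of n] by (intro mult_right_mono) auto
    also have "2 * cmod (s n) * cmod (?D n) = cmod ((s n + s n) * ?D n)"
      by (simp flip: mult_2 add: norm_mult)
    finally have 1: "2 * \<kappa> * cmod (?D n) \<le> cmod ((s n + s n) * ?D n)" .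
    have "cmod (e * ?D m) \<le> \<kappa>\<^sup>2 * cmod (?D m)" unfolding norm_mult by (rule mult_right_mono[OF e]) simp
    also have "\<dots> = \<kappa> * (\<kappa> * cmod (?D m))" by (simp add: power2_eq_square)
    also have "\<dots> \<le> \<kappa> * cmod (?D n)" using IH \<kappa> by (intro mult_left_mono) auto
    finally have 2: "cmod (e * ?D m) \<le> \<kappa> * cmod (?D n)" .
    have "cmod (?D (Suc n)) \<ge> cmod ((s n + s n) * ?D n) - cmod (e * ?D m)"
      using norm_triangle_ineq2[of "(s n + s n) * ?D n" "- (e * ?D m)"] by (simp add: Suc)
    then have "cmod (?D (Suc n)) \<ge> \<kappa> * cmod (?D n)" using 1 2 by linarith
    moreover have "\<kappa> * cmod (?D n) > 0" using \<kappa> IH by simp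
    ultimately show ?thesis by auto
  qed
qed simp

text \<open>The companion of \<open>diff_factor\<close> for the parameters: the divided difference
  along increments of \<open>c\<close>, \<open>e\<close>, \<open>t\<close> with slopes
  \<open>c1\<close>, \<open>e1\<close>, \<open>t1\<close>.\<close>

fun param_factor :: "complex \<Rightarrow> complex \<Rightarrow> complex \<Rightarrow> (nat \<Rightarrow> complex) \<Rightarrow> (nat \<Rightarrow> complex) \<Rightarrow> complex \<Rightarrow> nat \<Rightarrow> complex" where
  "param_factor c1 e1 t1 s s' e 0 = 0"
| "param_factor c1 e1 t1 s s' e (Suc 0) = c1 + t1"
| "param_factor c1 e1 t1 s s' e (Suc (Suc n)) = (s (Suc n) + s' (Suc n)) * param_factor c1 e1 t1 s s' e (Suc n)
     + e * param_factor c1 e1 t1 s s' e n + c1 + e1 * s' n"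

lemma henon_x_difference:
  fixes c c' e e' t t' x x' h c1 e1 t1 :: complex
  defines "s \<equiv> henon_x c e x t" and "s' \<equiv> henon_x c' e' x' t'"
  assumes "c - c' = h * c1" "e - e' = h * e1" "t - t' = h * t1"
  shows "s n - s' n = diff_factor s s' e n * (x - x') + h * param_factor c1 e1 t1 s s' e n"
proof -
  have "s n - s' n = diff_factor s s' e n * (x - x') + h * param_factor c1 e1 t1 s s' e n \<and>
    s (Suc n) - s' (Suc n) = diff_factor s s' e (Suc n) * (x - x') + h * param_factor c1 e1 t1 s s' e (Suc n)"
  proof (induction n)
    case 0
    have "s (Suc 0) - s' (Suc 0) = (x + x') * (x - x') + (c - c') + (t - t')"
      by (simp add: s_def s'_def power2_eq_square algebra_simps)
    then show ?case using assms(3-5) by (simp add: s_def s'_def algebra_simps)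
  next
    case (Suc n)
    have "s (Suc (Suc n)) - s' (Suc (Suc n)) = (s (Suc n) + s' (Suc n)) * (s (Suc n) - s' (Suc n))
       + e * (s n - s' n) + (c - c') + (e - e') * s' n"
      by (simp add: s_def s'_def power2_eq_square algebra_simps)
    then show ?case using Suc assms(3-5) by (simp add: algebra_simps)
  qed
  then show ?thesis ..
qed

lemma tendsto_diff_factor:
  assumes "\<And>k. ((\<lambda>p. s p k) \<longlongrightarrow> s0 k) F" "\<And>k. ((\<lambda>p. s' p k) \<longlongrightarrow> s0' k) F" "(e \<longlongrightarrow> e0) F"
  shows "((\<lambda>p. diff_factor (s p) (s' p) (e p) n) \<longlongrightarrow> diff_factor s0 s0' e0 n) F"
proof -
  have "((\<lambda>p. diff_factor (s p) (s' p) (e p) n) \<longlongrightarrow> diff_factor s0 s0' e0 n) F \<and>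
    ((\<lambda>p. diff_factor (s p) (s' p) (e p) (Suc n)) \<longlongrightarrow> diff_factor s0 s0' e0 (Suc n)) F"
    by (induction n) (auto intro!: tendsto_intros assms)
  then show ?thesis ..
qed

lemma tendsto_param_factor:
  assumes "\<And>k. ((\<lambda>p. s p k) \<longlongrightarrow> s0 k) F" "\<And>k. ((\<lambda>p. s' p k) \<longlongrightarrow> s0' k) F" "(e \<longlongrightarrow> e0) F"
    "(c1 \<longlongrightarrow> c10) F" "(e1 \<longlongrightarrow> e10) F" "(t1 \<longlongrightarrow> t10) F"
  shows "((\<lambda>p. param_factor (c1 p) (e1 p) (t1 p) (s p) (s' p) (e p) n) \<longlongrightarrow> param_factor c10 e10 t10 s0 s0' e0 n) F"
proof -
  have "((\<lambda>p. param_factor (c1 p) (e1 p) (t1 p) (s p) (s' p) (e p) n) \<longlongrightarrow> param_factor c10 e10 t10 s0 s0' e0 n) F \<and>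
    ((\<lambda>p. param_factor (c1 p) (e1 p) (t1 p) (s p) (s' p) (e p) (Suc n)) \<longlongrightarrow> param_factor c10 e10 t10 s0 s0' e0 (Suc n)) F"
    by (induction n) (auto intro!: tendsto_intros assms)
  then show ?thesis ..
qed

lemma tendsto_henon_x:
  assumes "(c \<longlongrightarrow> c0) F" "(e \<longlongrightarrow> e0) F" "(x \<longlongrightarrow> x0) F" "(t \<longlongrightarrow> t0) F"
  shows "((\<lambda>p. henon_x (c p) (e p) (x p) (t p) n) \<longlongrightarrow> henon_x c0 e0 x0 t0 n) F"
proof -
  have "((\<lambda>p. henon_x (c p) (e p) (x p) (t p) n) \<longlongrightarrow> henon_x c0 e0 x0 t0 n) F \<and>
    ((\<lambda>p. henon_x (c p) (e p) (x p) (t p) (Suc n)) \<longlongrightarrow> henon_x c0 e0 x0 t0 (Suc n)) F"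
    by (induction n) (auto intro!: tendsto_intros assms)
  then show ?thesis ..
qed

lemma continuous_on_henon_x:
  assumes "continuous_on S c" "continuous_on S e" "continuous_on S x" "continuous_on S t"
  shows "continuous_on S (\<lambda>p. henon_x (c p) (e p) (x p) (t p) n)"
  using assms unfolding continuous_on_def by (auto intro!: tendsto_henon_x)

text \<open>The implicit function theorem for a root known only to be continuous. The exact identity
  \<open>Q (\<phi> p - \<phi> p0) + (p - p0) B = 0\<close> gives the difference quotient
  \<open>- B / Q\<close>, and \<open>Q\<close> has a nonzero limit because the orbit avoids the disc
  of radius \<open>\<kappa>\<close>.\<close>

lemma henon_root_holomorphic:
  assumes S: "open S" and hol: "c holomorphic_on S" "e holomorphic_on S" "t holomorphic_on S"
    and \<phi>: "continuous_on S \<phi>" and \<kappa>: "\<kappa> > 0"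
    and root: "\<And>p. p \<in> S \<Longrightarrow> henon_x (c p) (e p) (\<phi> p) (t p) n = T"
    and low: "\<And>p k. p \<in> S \<Longrightarrow> k < n \<Longrightarrow> cmod (henon_x (c p) (e p) (\<phi> p) (t p) k) \<ge> \<kappa>"
    and e: "\<And>p. p \<in> S \<Longrightarrow> cmod (e p) \<le> \<kappa>\<^sup>2"
  shows "\<phi> holomorphic_on S"
proof -
  have "\<exists>D. (\<phi> has_field_derivative D) (at p0)" if p0: "p0 \<in> S" for p0
  proof -
    define s where "s = (\<lambda>p. henon_x (c p) (e p) (\<phi> p) (t p))"
    have d: "\<exists>D. ((\<lambda>p. (f p - f p0) / (p - p0)) \<longlongrightarrow> D) (at p0)" if "f holomorphic_on S" for f :: "complex \<Rightarrow> complex"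
      using that S p0 by (metis holomorphic_derivI has_field_derivative_iff)
    obtain c1 e1 t1 where d1: "((\<lambda>p. (c p - c p0) / (p - p0)) \<longlongrightarrow> c1) (at p0)"
      "((\<lambda>p. (e p - e p0) / (p - p0)) \<longlongrightarrow> e1) (at p0)" "((\<lambda>p. (t p - t p0) / (p - p0)) \<longlongrightarrow> t1) (at p0)"
      using d[OF hol(1)] d[OF hol(2)] d[OF hol(3)] by blast
    have cont: "(f \<longlongrightarrow> f p0) (at p0)" if "continuous_on S f" for f :: "complex \<Rightarrow> complex"
      using that S p0 by (metis continuous_on_eq_continuous_at isCont_def)
    note c = cont[OF holomorphic_on_imp_continuous_on[OF hol(1)]] and ee = cont[OF holomorphic_on_imp_continuous_on[OF hol(2)]]
      and t = cont[OF holomorphic_on_imp_continuous_on[OF hol(3)]] and ph = cont[OF \<phi>]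
    have s: "((\<lambda>p. s p k) \<longlongrightarrow> s p0 k) (at p0)" for k
      unfolding s_def by (intro tendsto_henon_x c ee t ph)
    define Q where "Q = (\<lambda>p. diff_factor (s p) (s p0) (e p) n)"
    define B where "B = (\<lambda>p. param_factor ((c p - c p0) / (p - p0)) ((e p - e p0) / (p - p0)) ((t p - t p0) / (p - p0)) (s p) (s p0) (e p) n)"
    have Q: "(Q \<longlongrightarrow> Q p0) (at p0)" unfolding Q_def by (intro tendsto_diff_factor s ee tendsto_const)
    define b where "b = param_factor c1 e1 t1 (s p0) (s p0) (e p0) n"
    have B: "(B \<longlongrightarrow> b) (at p0)"
      unfolding B_def b_def by (intro tendsto_param_factor s tendsto_const ee d1)
    have Q0: "Q p0 \<noteq> 0"
      using diff_factor_diag_bound[OF \<kappa> e[OF p0], of n "s p0"] low[OF p0] by (simp add: Q_def s_def)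
    have quot: "((\<lambda>p. - B p / Q p) \<longlongrightarrow> - b / Q p0) (at p0)"
      by (intro tendsto_intros B Q Q0)
    have "eventually (\<lambda>p. Q p \<noteq> 0) (at p0)" using tendsto_imp_eventually_ne[OF Q Q0] .
    moreover have "eventually (\<lambda>p. p \<in> S) (at p0)" using S p0 by (rule eventually_at_in_open')
    moreover have "eventually (\<lambda>p. p \<noteq> p0) (at p0)" by (simp add: eventually_at_filter)
    ultimately have "eventually (\<lambda>p. - B p / Q p = (\<phi> p - \<phi> p0) / (p - p0)) (at p0)"
    proof eventually_elim
      case (elim p)
      have h: "f p - f p0 = (p - p0) * ((f p - f p0) / (p - p0))" for f :: "complex \<Rightarrow> complex" using elim by simp
      have "s p n - s p0 n = Q p * (\<phi> p - \<phi> p0) + (p - p0) * B p"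
        unfolding s_def Q_def B_def by (rule henon_x_difference[OF h h h])
      then have "Q p * (\<phi> p - \<phi> p0) + (p - p0) * B p = 0" using root[OF p0] root[OF elim(2)] by (simp add: s_def)
      then have "(p - p0) * B p = - (Q p * (\<phi> p - \<phi> p0))" by (simp add: eq_neg_iff_add_eq_0 add.commute)
      then show ?case using elim by (simp add: field_simps)
    qed
    then have "((\<lambda>p. (\<phi> p - \<phi> p0) / (p - p0)) \<longlongrightarrow> - b / Q p0) (at p0)"
      using quot by (rule Lim_transform_eventually[rotated])
    then show ?thesis by (auto simp: has_field_derivative_iff)
  qed
  then show ?thesis using S by (auto simp: holomorphic_on_open)
qed

fun henon_poly :: "complex \<Rightarrow> complex \<Rightarrow> complex \<Rightarrow> nat \<Rightarrow> complex poly" where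
  "henon_poly c e t 0 = [:0, 1:]"
| "henon_poly c e t (Suc 0) = [:0, 1:]\<^sup>2 + [:c + t:]"
| "henon_poly c e t (Suc (Suc n)) = (henon_poly c e t (Suc n))\<^sup>2 + ([:c:] + smult e (henon_poly c e t n))"

lemma poly_henon_poly: "poly (henon_poly c e t n) x = henon_x c e x t n"
  by (induction c e t n rule: henon_poly.induct) auto

lemma pderiv_henon_poly:
  "poly (pderiv (henon_poly c e t n)) x = diff_factor (henon_x c e x t) (henon_x c e x t) e n"
  by (induction c e t n rule: henon_poly.induct)
    (auto simp: pderiv_add pderiv_smult pderiv_pCons power2_eq_square pderiv_mult poly_henon_poly algebra_simps)

lemma henon_poly_monic: "degree (henon_poly c e t n) = 2 ^ n \<and> lead_coeff (henon_poly c e t n) = 1"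
proof -
  have "degree (henon_poly c e t n) = 2 ^ n \<and> lead_coeff (henon_poly c e t n) = 1 \<and>
    degree (henon_poly c e t (Suc n)) = 2 ^ Suc n \<and> lead_coeff (henon_poly c e t (Suc n)) = 1"
  proof (induction n)
    case 0
    show ?case by (simp add: power2_eq_square)
  next
    case (Suc n)
    let ?p = "henon_poly c e t"
    have nz: "?p (Suc n) \<noteq> 0" using Suc by auto
    have d2: "degree ((?p (Suc n))\<^sup>2) = 2 ^ Suc (Suc n)"
      using Suc nz by (simp add: power2_eq_square degree_mult_eq)
    have "degree ([:c:] + smult e (?p n)) \<le> 2 ^ n"
      using Suc by (intro degree_add_le) (auto intro: order_trans[OF degree_smult_le])
    also have "(2 :: nat) ^ n < 2 ^ Suc (Suc n)" by (rule power_strict_increasing) auto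
    finally have lt: "degree ([:c:] + smult e (?p n)) < degree ((?p (Suc n))\<^sup>2)" using d2 by simp
    then have D: "degree (?p (Suc (Suc n))) = 2 ^ Suc (Suc n)" using d2 by (simp add: degree_add_eq_left del: power_Suc)
    have "lead_coeff (?p (Suc (Suc n))) = lead_coeff ((?p (Suc n))\<^sup>2)"
      using lead_coeff_add_le[OF lt] by (simp only: henon_poly.simps add.commute)
    also have "\<dots> = (lead_coeff (?p (Suc n)))\<^sup>2" by (rule lead_coeff_power)
    also have "lead_coeff (?p (Suc n)) = 1" using Suc by blast
    finally have "lead_coeff (?p (Suc (Suc n))) = 1" by simp
    from conjI[OF D this] Suc show ?case by blast
  qed
  then show ?thesis by blast
qed

section \<open>Leaves of escaping points\<close>

text \<open>The value of \<open>t\<close> with which the recursion restarts at time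
  \<open>n\<close>.\<close>

definition prev_term :: "complex \<Rightarrow> complex \<Rightarrow> complex \<Rightarrow> complex \<Rightarrow> nat \<Rightarrow> complex" where
  "prev_term c e x t n = (case n of 0 \<Rightarrow> t | Suc m \<Rightarrow> e * henon_x c e x t m)"

lemma henon_x_Suc: "henon_x c e x t (Suc n) = (henon_x c e x t n)\<^sup>2 + c + prev_term c e x t n"
  by (cases n) (simp_all add: prev_term_def)

lemma prev_term_Suc: "prev_term c e x t (Suc n) = e * henon_x c e x t n"
  by (simp add: prev_term_def)

lemma henon_x_shift:
  "henon_x c e x t (k + j) = henon_x c e (henon_x c e x t k) (prev_term c e x t k) j"
proof -
  have "henon_x c e x t (k + j) = henon_x c e (henon_x c e x t k) (prev_term c e x t k) j \<and>
    prev_term c e x t (k + j) = prev_term c e (henon_x c e x t k) (prev_term c e x t k) j"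
  proof (induction j)
    case 0
    show ?case by (simp add: prev_term_def)
  next
    case (Suc j)
    then show ?case by (simp add: henon_x_Suc prev_term_Suc)
  qed
  then show ?thesis ..
qed

lemma quadratic_growth:
  fixes z w p :: complex
  assumes z: "cmod z \<ge> 2" and w: "cmod w \<le> 1" and p: "cmod p \<le> cmod z / 8"
  shows "cmod (z\<^sup>2 + w + p) \<ge> 5 / 4 * cmod z"
proof -
  have "cmod (z\<^sup>2) - cmod (w + p) \<le> cmod (z\<^sup>2 + (w + p))" by (rule norm_diff_ineq)
  moreover have "cmod (w + p) \<le> 1 + cmod z / 8" using w p by (intro norm_triangle_le) simp
  moreover have "cmod (z\<^sup>2) \<ge> 2 * cmod z"
    unfolding power2_eq_square norm_mult using z by (intro mult_right_mono) auto
  ultimately show ?thesis using z by (simp add: add.assoc)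
qed

text \<open>Of the parameter curve only \<open>basin\<close> and a holomorphic bounded
  \<open>c\<close> are kept. \<open>4 * \<delta> < R\<close> keeps \<open>a x\<close> in the half
  disc when \<open>cmod x \<le> 2\<close>, and \<open>\<delta> * R \<le> 1 / 4\<close> makes
  \<open>a y\<close> harmless for escape at radius 2.\<close>

locale henon_leaves =
  fixes c :: "complex \<Rightarrow> complex" and \<kappa> \<delta> R :: real
  assumes \<kappa>: "0 < \<kappa>" "\<kappa> \<le> 1"
    and \<delta>: "0 < \<delta>" "\<delta> \<le> \<kappa>" "\<delta> \<le> 1 / 4" "4 * \<delta> < R" "\<delta> * R \<le> 1 / 4"
    and c_bound: "cmod a < \<delta> \<Longrightarrow> cmod (c a) \<le> 1"
    and c_hol: "c holomorphic_on ball 0 \<delta>"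
    and basin: "\<exists>B. \<forall>a x t n. cmod a < \<delta> \<and> cmod x < \<kappa> \<and> cmod t \<le> \<delta> * R \<longrightarrow>
      cmod (henon_x (c a) (a\<^sup>2) x t n) \<le> B"
begin

definition X :: "complex \<Rightarrow> complex \<Rightarrow> complex \<Rightarrow> nat \<Rightarrow> complex" where
  "X a y x = henon_x (c a) (a\<^sup>2) x (a * y)"

lemma X_0 [simp]: "X a y x 0 = x"
  by (simp add: X_def)

lemma R_pos: "R > 0" using \<delta> by linarith

lemma a2_bound:
  assumes "cmod a < \<delta>"
  shows "cmod (a\<^sup>2) \<le> 1 / 16"
proof -
  have "(cmod a)\<^sup>2 \<le> (1 / 4)\<^sup>2" using assms \<delta> by (intro power_mono) auto
  then show ?thesis by (simp add: norm_power power_divide)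
qed

lemma a2_\<kappa>:
  assumes "cmod a < \<delta>"
  shows "cmod (a\<^sup>2) \<le> \<kappa>\<^sup>2"
  unfolding norm_power using assms \<delta> by (intro power_mono) auto

lemma ay_bound:
  assumes "cmod a < \<delta>" "cmod y < R"
  shows "cmod (a * y) \<le> 1 / 4"
proof -
  have "cmod a * cmod y \<le> \<delta> * R" using assms \<delta> by (intro mult_mono) auto
  then show ?thesis using \<delta> by (simp add: norm_mult)
qed

lemma X_Suc: "X a y x (Suc n) = (X a y x n)\<^sup>2 + c a + prev_term (c a) (a\<^sup>2) x (a * y) n"
  by (simp add: X_def henon_x_Suc)

text \<open>Nothing is assumed about earlier terms: a preceding term below 2 is damped by
  \<open>1 / 16\<close>, and one above 2 is by induction smaller than the present one.\<close>

lemma X_growth_prev: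
  assumes a: "cmod a < \<delta>" and y: "cmod y < R"
  shows "cmod (X a y x n) \<ge> 2 \<longrightarrow> cmod (prev_term (c a) (a\<^sup>2) x (a * y) n) \<le> cmod (X a y x n) / 8 \<and>
    cmod (X a y x (Suc n)) \<ge> 5 / 4 * cmod (X a y x n)"
proof (induction n)
  case 0
  show ?case
  proof
    assume x: "cmod (X a y x 0) \<ge> 2"
    have p: "cmod (prev_term (c a) (a\<^sup>2) x (a * y) 0) \<le> cmod (X a y x 0) / 8"
      using ay_bound[OF a y] x by (simp add: prev_term_def)
    then show "cmod (prev_term (c a) (a\<^sup>2) x (a * y) 0) \<le> cmod (X a y x 0) / 8 \<and>
      cmod (X a y x (Suc 0)) \<ge> 5 / 4 * cmod (X a y x 0)"
      unfolding X_Suc using quadratic_growth[OF x c_bound[OF a]] by blast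
  qed
next
  case (Suc n)
  let ?X = "X a y x"
  show ?case
  proof
    assume x: "cmod (?X (Suc n)) \<ge> 2"
    have "cmod (prev_term (c a) (a\<^sup>2) x (a * y) (Suc n)) = cmod (a\<^sup>2) * cmod (?X n)"
      by (simp add: prev_term_Suc X_def norm_mult)
    also have "\<dots> \<le> 1 / 16 * cmod (?X n)" using a2_bound[OF a] by (rule mult_right_mono) simp
    finally have "cmod (prev_term (c a) (a\<^sup>2) x (a * y) (Suc n)) \<le> 1 / 16 * cmod (?X n)" .
    then have p: "cmod (prev_term (c a) (a\<^sup>2) x (a * y) (Suc n)) \<le> cmod (?X (Suc n)) / 8"
      using Suc x by (cases "cmod (?X n) \<ge> 2") auto
    then show "cmod (prev_term (c a) (a\<^sup>2) x (a * y) (Suc n)) \<le> cmod (?X (Suc n)) / 8 \<and>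
      cmod (?X (Suc (Suc n))) \<ge> 5 / 4 * cmod (?X (Suc n))"
      unfolding X_Suc[of a y x "Suc n"] using quadratic_growth[OF x c_bound[OF a]] by blast
  qed
qed

lemma X_growth:
  assumes "cmod a < \<delta>" "cmod y < R" "cmod (X a y x n) \<ge> 2"
  shows "cmod (X a y x (n + k)) \<ge> 2 * (5 / 4) ^ k"
proof (induction k)
  case (Suc k)
  have "2 * 1 \<le> (2 :: real) * (5 / 4) ^ k" by (intro mult_left_mono one_le_power) auto
  then have "cmod (X a y x (n + k)) \<ge> 2" using Suc by linarith
  then have "cmod (X a y x (n + Suc k)) \<ge> 5 / 4 * cmod (X a y x (n + k))"
    using X_growth_prev[OF assms(1,2), of x "n + k"] by simp
  then show ?case using Suc by simp
qed (use assms in simp)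

lemma X_escape: "cmod a < \<delta> \<Longrightarrow> cmod y < R \<Longrightarrow> cmod (X a y x n) \<ge> 2 \<Longrightarrow> n < m \<Longrightarrow> cmod (X a y x m) > 2"
proof -
  assume *: "cmod a < \<delta>" "cmod y < R" "cmod (X a y x n) \<ge> 2" "n < m"
  then obtain k where k: "m = n + Suc k" using less_imp_Suc_add by auto
  have "(1 :: real) < (5 / 4) ^ Suc k" by (rule one_less_power) auto
  then show ?thesis using X_growth[OF *(1-3), of "Suc k"] k by simp
qed

lemma X_escape_unbounded:
  assumes "cmod a < \<delta>" "cmod y < R" "cmod (X a y x n) \<ge> 2"
  shows "\<exists>m. cmod (X a y x m) > B"
proof -
  obtain k where "B < (5 / 4 :: real) ^ k" using real_arch_pow[of "5 / 4" B] by auto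
  then have "B < 2 * (5 / 4) ^ k" using zero_le_power[of "5 / 4 :: real" k] by linarith
  then show ?thesis using X_growth[OF assms, of k] by (intro exI[of _ "n + k"]) linarith
qed

text \<open>If \<open>x_k\<close> were within \<open>\<kappa>\<close> of 0, \<open>basin\<close>
  would bound the whole tail, while modulus 2 forces divergence. The restart value
  \<open>a^2 x_(k-1)\<close> is admissible because a predecessor of modulus at least 2 would have
  kept \<open>x_k\<close> above 2.\<close>

lemma X_lower:
  assumes a: "cmod a < \<delta>" and y: "cmod y < R" and n: "cmod (X a y x n) \<ge> 2" and k: "k \<le> n"
  shows "cmod (X a y x k) \<ge> \<kappa>"
proof (rule ccontr)
  assume "\<not> cmod (X a y x k) \<ge> \<kappa>"
  then have small: "cmod (X a y x k) < \<kappa>" by simp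
  obtain B where B: "\<And>a x t n. cmod a < \<delta> \<and> cmod x < \<kappa> \<and> cmod t \<le> \<delta> * R \<Longrightarrow> cmod (henon_x (c a) (a\<^sup>2) x t n) \<le> B"
    using basin by blast
  have t: "cmod (prev_term (c a) (a\<^sup>2) x (a * y) k) \<le> \<delta> * R"
  proof (cases k)
    case 0
    then show ?thesis using a y \<delta> by (auto simp: prev_term_def norm_mult intro!: mult_mono)
  next
    case (Suc m)
    have "cmod (X a y x m) < 2" using X_escape[OF a y, of x m k] small \<kappa> Suc by fastforce
    then have "cmod (a\<^sup>2) * cmod (X a y x m) \<le> (\<delta> * \<delta>) * 2"
      using a \<delta> unfolding power2_eq_square norm_mult by (intro mult_mono) auto
    also have "\<dots> \<le> \<delta> * R" using \<delta> by (simp add: mult.assoc mult_left_mono)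
    finally show ?thesis by (simp add: Suc prev_term_Suc X_def norm_mult)
  qed
  have 1: "cmod (X a y x (k + j)) \<le> B" for j
    unfolding X_def henon_x_shift using small t a by (intro B) (auto simp: X_def)
  obtain m where m: "cmod (X a y x m) > max B 2" using X_escape_unbounded[OF a y n] by blast
  have "m < k"
  proof (rule ccontr)
    assume "\<not> m < k"
    then have "m = k + (m - k)" by simp
    then have "cmod (X a y x m) \<le> B" using 1 by metis
    then show False using m by simp
  qed
  moreover have "cmod (X a y x m) \<ge> 2" using m by simp
  ultimately have "cmod (X a y x k) > 2" using X_escape[OF a y] by blast
  then show False using small \<kappa> by simp
qed

definition U :: "(complex \<times> complex) set" where
  "U = ball 0 R \<times> ball 0 \<delta>"

lemma mem_U: "(y, a) \<in> U \<longleftrightarrow> cmod y < R \<and> cmod a < \<delta>"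
  by (auto simp: U_def)

lemma continuous_on_X:
  assumes "continuous_on S a" "continuous_on S y" "continuous_on S x" "\<And>s. s \<in> S \<Longrightarrow> cmod (a s) < \<delta>"
  shows "continuous_on S (\<lambda>s. X (a s) (y s) (x s) n)"
proof -
  have "continuous_on S (\<lambda>s. c (a s))"
    using assms by (intro continuous_on_compose2[OF holomorphic_on_imp_continuous_on[OF c_hol]]) auto
  then show ?thesis unfolding X_def using assms by (intro continuous_on_henon_x continuous_intros)
qed

text \<open>At a root the orbit has modulus 2 at time \<open>n\<close>, so it has avoided the
  critical point and the derivative in \<open>x\<close> does not vanish: all roots are simple over
  the whole of \<open>U\<close>.\<close>

lemma X_root_covering:
  assumes T: "cmod T = 2"
  shows "covering_space {(u, x). u \<in> U \<and> X (snd u) (fst u) x n = T} fst U"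
proof -
  define p where "p = (\<lambda>u :: complex \<times> complex. henon_poly (c (snd u)) ((snd u)\<^sup>2) (snd u * fst u) n - [:T:])"
  have p: "poly (p u) x = X (snd u) (fst u) x n - T" for u x
    by (simp add: p_def poly_henon_poly X_def)
  have "covering_space {(u, x). u \<in> U \<and> poly (p u) x = 0} fst U"
  proof (rule root_covering)
    fix u assume "u \<in> U"
    then have u: "cmod (snd u) < \<delta>" "cmod (fst u) < R" by (auto simp: U_def)
    show "rsquarefree (p u)"
      unfolding rsquarefree_roots
    proof (intro allI notI, elim conjE)
      fix x assume 1: "poly (p u) x = 0" and 2: "poly (pderiv (p u)) x = 0"
      have Xn: "cmod (X (snd u) (fst u) x n) = 2" using 1 T by (simp add: p)
      have "diff_factor (X (snd u) (fst u) x) (X (snd u) (fst u) x) ((snd u)\<^sup>2) n \<noteq> 0"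
        using diff_factor_diag_bound[OF \<kappa>(1) a2_\<kappa>[OF u(1)], of n "X (snd u) (fst u) x"]
          X_lower[OF u, of x n] Xn by auto
      moreover have "poly (pderiv (p u)) x = diff_factor (X (snd u) (fst u) x) (X (snd u) (fst u) x) ((snd u)\<^sup>2) n"
        by (simp add: p_def pderiv_diff pderiv_henon_poly X_def pderiv_pCons)
      ultimately show False using 2 by simp
    qed
    have m: "degree (henon_poly (c (snd u)) ((snd u)\<^sup>2) (snd u * fst u) n) = 2 ^ n"
      "lead_coeff (henon_poly (c (snd u)) ((snd u)\<^sup>2) (snd u * fst u) n) = 1"
      using henon_poly_monic by blast+
    show deg: "degree (p u) = 2 ^ n"
      unfolding p_def diff_conv_add_uminus by (subst degree_add_eq_left) (use m in auto)
    show "lead_coeff (p u) = 1"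
      unfolding deg using m by (simp add: p_def coeff_pCons split: nat.splits)
  next
    show "continuous_on U (\<lambda>u. poly (p u) x)" for x
      unfolding p by (intro continuous_intros continuous_on_X) (auto simp: U_def)
  qed simp
  then show ?thesis by (simp add: p)
qed

text \<open>A leaf is a component of the curve of points whose \<open>n\<close>-th iterate has first coordinate \<open>T\<close>;
  the value \<open>2\<close> of the modulus makes leaves of different \<open>n\<close> disjoint.\<close>

definition leaf :: "nat \<Rightarrow> complex \<Rightarrow> (complex \<times> complex \<Rightarrow> complex) \<Rightarrow> bool" where
  "leaf n T f \<longleftrightarrow> cmod T = 2 \<and> continuous_on U f \<and> (\<forall>(y, a)\<in>U. X a y (f (y, a)) n = T)"

lemma leaf_root: "leaf n T f \<Longrightarrow> cmod y < R \<Longrightarrow> cmod a < \<delta> \<Longrightarrow> X a y (f (y, a)) n = T"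
  by (auto simp: leaf_def mem_U)

lemma convex_U: "convex U" unfolding U_def by (intro convex_Times convex_ball)

text \<open>Lift the identity of \<open>U\<close>, which is convex and hence simply connected,
  through the covering.\<close>

lemma leaf_exists:
  assumes T: "cmod T = 2" and u: "cmod y < R" "cmod a < \<delta>" and x: "X a y x n = T"
  shows "\<exists>f. leaf n T f \<and> f (y, a) = x"
proof -
  let ?C = "{(u, x). u \<in> U \<and> X (snd u) (fst u) x n = T}"
  have mem: "((y, a), x) \<in> ?C" "(y, a) \<in> U" using u x by (auto simp: mem_U)
  obtain g where g: "continuous_on U g" "g \<in> U \<rightarrow> ?C" "g (y, a) = ((y, a), x)" "\<And>v. v \<in> U \<Longrightarrow> fst (g v) = v"
    using covering_space_lift_strong[OF X_root_covering[OF T] mem convex_imp_simply_connected[OF convex_U]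
      convex_imp_locally_path_connected[OF convex_U] continuous_on_id] by auto
  have "leaf n T (\<lambda>v. snd (g v))"
    unfolding leaf_def
  proof (intro conjI T ballI)
    show "continuous_on U (\<lambda>v. snd (g v))" by (intro continuous_intros g(1))
    fix v assume v: "v \<in> U"
    have "g v \<in> ?C" by (rule funcset_mem[OF g(2) v])
    moreover have "fst (g v) = v" by (rule g(4)[OF v])
    ultimately show "case v of (y, a) \<Rightarrow> X a y (snd (g (y, a))) n = T" by (cases v) (auto simp: case_prod_unfold)
  qed
  then show ?thesis using g(3) by (intro exI[of _ "\<lambda>v. snd (g v)"]) auto
qed

text \<open>Sections over any connected \<open>S\<close> mapped into \<open>U\<close>, because
  leaves are also compared along slices of \<open>U\<close> and along images of slices.\<close>

lemma root_section_unique: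
  fixes u :: "'s::topological_space \<Rightarrow> complex \<times> complex"
  assumes T: "cmod T = 2" and S: "connected S" "r \<in> S" "s \<in> S" and u: "continuous_on S u" "u ` S \<subseteq> U"
    and f: "continuous_on S f" "\<And>s. s \<in> S \<Longrightarrow> X (snd (u s)) (fst (u s)) (f s) n = T"
    and g: "continuous_on S g" "\<And>s. s \<in> S \<Longrightarrow> X (snd (u s)) (fst (u s)) (g s) n = T"
    and eq: "f r = g r"
  shows "f s = g s"
proof -
  let ?C = "{(u, x). u \<in> U \<and> X (snd u) (fst u) x n = T}"
  have "(\<lambda>s. (u s, f s)) s = (\<lambda>s. (u s, g s)) s"
  proof (rule covering_space_lift_unique[OF X_root_covering[OF T], where T = S and a = r and f = u and x = s])
    show "continuous_on S (\<lambda>s. (u s, f s))" "continuous_on S (\<lambda>s. (u s, g s))"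
      by (intro continuous_intros u f g)+
  qed (use assms in auto)
  then show ?thesis by simp
qed

lemma leaf_unique:
  assumes f: "leaf n T f" and g: "leaf m T' g" and v: "cmod y0 < R" "cmod a0 < \<delta>" and eq: "f (y0, a0) = g (y0, a0)"
    and u: "cmod y < R" "cmod a < \<delta>"
  shows "f (y, a) = g (y, a)"
proof -
  let ?x = "f (y0, a0)"
  have T: "cmod T = 2" "cmod T' = 2" using f g by (auto simp: leaf_def)
  have 1: "X a0 y0 ?x n = T" "X a0 y0 ?x m = T'"
    using leaf_root[OF f v] leaf_root[OF g v] eq by auto
  have "n = m"
    using X_escape[OF v(2,1), of ?x n m] X_escape[OF v(2,1), of ?x m n] 1 T by (cases n m rule: linorder_cases) auto
  then have TT: "m = n" "T' = T" using 1 by auto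
  show ?thesis
  proof (rule root_section_unique[OF T(1), where S = U and u = id and r = "(y0, a0)" and s = "(y, a)" and f = f and g = g and n = n])
    show "connected U" using convex_U by (rule convex_connected)
    show "X (snd (id s)) (fst (id s)) (f s) n = T" "X (snd (id s)) (fst (id s)) (g s) n = T" if "s \<in> U" for s
      using that leaf_root[OF f] leaf_root[OF g] TT by (cases s; auto simp: mem_U)+
  qed (use f g eq u v in \<open>auto simp: leaf_def mem_U\<close>)
qed

lemma leaf_bound:
  assumes f: "leaf n T f" and u: "cmod y < R" "cmod a < \<delta>" and k: "k \<le> n"
  shows "cmod (X a y (f (y, a)) k) \<le> 2"
proof (rule ccontr)
  assume "\<not> ?thesis"
  then have gt: "cmod (X a y (f (y, a)) k) > 2" by simp
  have "cmod (X a y (f (y, a)) n) = 2" using leaf_root[OF f u] f by (simp add: leaf_def)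
  then show False using gt X_escape[OF u(2,1), of "f (y, a)" k n] k by (cases "k = n") auto
qed

lemma leaf_lower:
  assumes f: "leaf n T f" and u: "cmod y < R" "cmod a < \<delta>" and k: "k \<le> n"
  shows "cmod (X a y (f (y, a)) k) \<ge> \<kappa>"
proof (rule X_lower[OF u(2,1) _ k])
  show "2 \<le> cmod (X a y (f (y, a)) n)" using leaf_root[OF f u] f by (simp add: leaf_def)
qed

text \<open>At \<open>a = 0\<close> the recursion does not see \<open>y\<close>, so the constant
  function is a second section with the same value at 0.\<close>

lemma leaf_a0:
  assumes f: "leaf n T f" and y: "cmod y < R"
  shows "f (y, 0) = f (0, 0)"
proof -
  have T: "cmod T = 2" using f by (simp add: leaf_def)
  have y': "X 0 y' x n = X 0 0 x n" for y' x by (simp add: X_def)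
  show ?thesis
  proof (rule root_section_unique[OF T, where S = "ball 0 R" and u = "\<lambda>y. (y, 0)" and r = 0 and s = y
      and f = "\<lambda>y. f (y, 0)" and g = "\<lambda>_. f (0, 0)" and n = n])
    show "continuous_on (ball 0 R) (\<lambda>y. f (y, 0))"
    proof (rule continuous_on_compose2[of U f])
      show "continuous_on U f" using f by (simp add: leaf_def)
    qed (auto intro!: continuous_intros simp: mem_U \<delta>)
    show "X (snd (y, 0)) (fst (y, 0)) (f (y, 0)) n = T" if "y \<in> ball 0 R" for y
      using leaf_root[OF f, of y 0] that \<delta> by simp
    show "X (snd (y, 0)) (fst (y, 0)) (f (0, 0)) n = T" if "y \<in> ball 0 R" for y
      using leaf_root[OF f, of 0 0] that \<delta> y'[of y] R_pos by simp
  qed (use y \<delta> R_pos in \<open>auto simp: mem_U intro!: continuous_intros\<close>)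
qed

lemma leaf_holomorphic_a:
  assumes f: "leaf n T f" and y: "cmod y < R"
  shows "(\<lambda>a. f (y, a)) holomorphic_on ball 0 \<delta>"
proof (rule henon_root_holomorphic[where c = c and e = "\<lambda>a. a\<^sup>2" and t = "\<lambda>a. a * y" and \<kappa> = \<kappa> and n = n and T = T])
  show "continuous_on (ball 0 \<delta>) (\<lambda>a. f (y, a))"
  proof (rule continuous_on_compose2[of U f])
    show "continuous_on U f" using f by (simp add: leaf_def)
  qed (auto intro!: continuous_intros simp: mem_U y)
  fix a :: complex assume "a \<in> ball 0 \<delta>"
  then have a: "cmod a < \<delta>" by simp
  show "henon_x (c a) (a\<^sup>2) (f (y, a)) (a * y) n = T" using leaf_root[OF f y a] by (simp add: X_def)
  show "\<kappa> \<le> cmod (henon_x (c a) (a\<^sup>2) (f (y, a)) (a * y) k)" if "k < n" for k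
    using leaf_lower[OF f y a, of k] that by (simp add: X_def)
  show "cmod (a\<^sup>2) \<le> \<kappa>\<^sup>2" using a2_\<kappa>[OF a] .
qed (use \<kappa> c_hol in \<open>auto intro!: holomorphic_intros\<close>)

lemma leaf_holomorphic_y:
  assumes f: "leaf n T f" and a: "cmod a < \<delta>"
  shows "(\<lambda>y. f (y, a)) holomorphic_on ball 0 R"
proof (rule henon_root_holomorphic[where c = "\<lambda>_. c a" and e = "\<lambda>_. a\<^sup>2" and t = "\<lambda>y. a * y" and \<kappa> = \<kappa> and n = n and T = T])
  show "continuous_on (ball 0 R) (\<lambda>y. f (y, a))"
  proof (rule continuous_on_compose2[of U f])
    show "continuous_on U f" using f by (simp add: leaf_def)
  qed (auto intro!: continuous_intros simp: mem_U a)
  fix y :: complex assume "y \<in> ball 0 R"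
  then have y: "cmod y < R" by simp
  show "henon_x (c a) (a\<^sup>2) (f (y, a)) (a * y) n = T" using leaf_root[OF f y a] by (simp add: X_def)
  show "\<kappa> \<le> cmod (henon_x (c a) (a\<^sup>2) (f (y, a)) (a * y) k)" if "k < n" for k
    using leaf_lower[OF f y a, of k] that by (simp add: X_def)
  show "cmod (a\<^sup>2) \<le> \<kappa>\<^sup>2" using a2_\<kappa>[OF a] .
qed (use \<kappa> in \<open>auto intro!: holomorphic_intros\<close>)

end

section \<open>Hoelder continuity of the leaves\<close>

text \<open>\<open>- log (cmod d / M)\<close> is a positive harmonic function, and Harnack's
  inequality at a third of the radius has the factor \<open>(1 + 1/3) / (1 - 1/3) = 2\<close>;
  exponentiated, this is a Hoelder bound with exponent \<open>1 / 2\<close>. The proof applies the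
  Schwarz lemma to a logarithm of \<open>d / M\<close>.\<close>

lemma harnack_nonvanishing:
  fixes d :: "complex \<Rightarrow> complex"
  assumes r: "r > 0" and hol: "d holomorphic_on ball 0 r"
    and nz: "\<And>a. cmod a < r \<Longrightarrow> d a \<noteq> 0" and M: "\<And>a. cmod a < r \<Longrightarrow> cmod (d a) < M"
    and a: "cmod a \<le> r / 3"
  shows "(cmod (d a))\<^sup>2 \<le> M * cmod (d 0)" "(cmod (d 0))\<^sup>2 \<le> M * cmod (d a)"
proof -
  have Mpos: "M > 0" using order_le_less_trans[OF norm_ge_zero M[of 0]] r by simp
  have "(\<lambda>z. d z / of_real M) holomorphic_on ball 0 r" using Mpos by (intro holomorphic_intros hol) auto
  then obtain g where g: "g holomorphic_on ball 0 r" "\<And>z. z \<in> ball 0 r \<Longrightarrow> d z / of_real M = exp (g z)"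
    using contractible_imp_holomorphic_log[OF _ convex_imp_contractible[OF convex_ball], of "\<lambda>z. d z / of_real M" 0 r]
      nz Mpos by auto
  have dg: "cmod (d z) = M * exp (Re (g z))" if "cmod z < r" for z
  proof -
    have "d z = of_real M * exp (g z)" using g(2)[of z] that Mpos by (simp add: field_simps)
    then show ?thesis using Mpos by (simp add: norm_mult)
  qed
  have neg: "Re (g z) < 0" if "cmod z < r" for z
    using M[OF that] dg[OF that] Mpos by simp
  have ar: "cmod a < r" using a r by simp
  \<comment> \<open>The Moebius map of the left half plane onto the unit disc that sends
    \<open>g 0\<close> to 0.\<close>
  define f where "f = (\<lambda>z. (g (of_real r * z) - g 0) / (g (of_real r * z) + cnj (g 0)))"
  have in_r: "of_real r * z \<in> ball 0 r" if "cmod z < 1" for z :: complex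
    using that r by (simp add: norm_mult)
  have den: "g (of_real r * z) + cnj (g 0) \<noteq> 0" if "cmod z < 1" for z
  proof -
    have "Re (g (of_real r * z) + cnj (g 0)) < 0" using neg[of "of_real r * z"] neg[of 0] in_r[OF that] r by simp
    then show ?thesis by (metis less_irrefl zero_complex.sel(1))
  qed
  have lt: "cmod (f z) < 1" if z: "cmod z < 1" for z
  proof -
    define w where "w = g (of_real r * z)"
    have w: "Re w < 0" "Re (g 0) < 0" using neg[of "of_real r * z"] neg[of 0] in_r[OF z] r by (auto simp: w_def)
    have "(cmod (w - g 0))\<^sup>2 < (cmod (w + cnj (g 0)))\<^sup>2"
    proof -
      have "(cmod (w + cnj (g 0)))\<^sup>2 - (cmod (w - g 0))\<^sup>2 = 4 * (Re w * Re (g 0))"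
        unfolding cmod_power2 by (simp add: power2_eq_square algebra_simps)
      moreover have "Re w * Re (g 0) > 0" using w by (rule mult_neg_neg)
      ultimately show ?thesis by simp
    qed
    then have "cmod (w - g 0) < cmod (w + cnj (g 0))" by (rule power_less_imp_less_base) simp
    moreover have "cmod (w + cnj (g 0)) > 0" using den[OF z] by (simp add: w_def)
    ultimately show ?thesis by (simp add: f_def norm_divide w_def)
  qed
  have hf: "f holomorphic_on ball 0 1"
  proof -
    have "(g \<circ> (\<lambda>z. of_real r * z)) holomorphic_on ball 0 1"
      using in_r by (intro holomorphic_on_compose_gen[OF _ g(1)] holomorphic_intros) auto
    then show ?thesis unfolding f_def o_def using den by (intro holomorphic_intros) auto
  qed
  define z where "z = a / of_real r"
  have z: "cmod z \<le> 1 / 3" "of_real r * z = a" using a r by (auto simp: z_def norm_divide field_simps)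
  have "cmod (f z) \<le> cmod z"
    using z by (intro Schwarz_Lemma(1)[OF hf _ lt]) (auto simp: f_def)
  then have "cmod (g a - g 0) \<le> cmod z * cmod (g a + cnj (g 0))"
    using z den[of z] by (simp add: f_def norm_divide field_simps)
  also have "\<dots> \<le> 1 / 3 * cmod (g a + cnj (g 0))" using z by (intro mult_right_mono) auto
  finally have "cmod (g a - g 0) \<le> 1 / 3 * cmod (g a + cnj (g 0))" .
  then have "(cmod (g a - g 0))\<^sup>2 \<le> (1 / 3 * cmod (g a + cnj (g 0)))\<^sup>2" by (rule power_mono) simp
  then have "(Re (g a) - Re (g 0))\<^sup>2 + (Im (g a) - Im (g 0))\<^sup>2 \<le> 1 / 9 * ((Re (g a) + Re (g 0))\<^sup>2 + (Im (g a) - Im (g 0))\<^sup>2)"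
    by (simp add: power_mult_distrib cmod_power2 power_divide)
  moreover have "A \<le> 1 / 9 * B" if "A + Y \<le> 1 / 9 * (B + Y)" "0 \<le> Y" for A B Y :: real
    using that by (simp add: field_simps)
  ultimately have "(Re (g a) - Re (g 0))\<^sup>2 \<le> 1 / 9 * (Re (g a) + Re (g 0))\<^sup>2"
    using zero_le_power2[of "Im (g a) - Im (g 0)"] by blast
  then have "\<bar>Re (g a) - Re (g 0)\<bar>\<^sup>2 \<le> (1 / 3 * \<bar>Re (g a) + Re (g 0)\<bar>)\<^sup>2" by (simp add: power_mult_distrib power_divide)
  then have "\<bar>Re (g a) - Re (g 0)\<bar> \<le> 1 / 3 * \<bar>Re (g a) + Re (g 0)\<bar>" by (rule power2_le_imp_le) simp
  then have *: "2 * Re (g a) \<le> Re (g 0)" "2 * Re (g 0) \<le> Re (g a)"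
    using neg[OF ar] neg[of 0] r by (auto simp: abs_if split: if_splits)
  have sq: "(M * exp x)\<^sup>2 \<le> M * (M * exp y)" if "2 * x \<le> y" for x y
  proof -
    have "exp x * exp x \<le> exp y" using that by (simp flip: exp_add)
    then have "(M * M) * (exp x * exp x) \<le> (M * M) * exp y" using Mpos by (intro mult_left_mono) auto
    then show ?thesis by (simp add: power2_eq_square mult_ac)
  qed
  show "(cmod (d a))\<^sup>2 \<le> M * cmod (d 0)" "(cmod (d 0))\<^sup>2 \<le> M * cmod (d a)"
    using dg[OF ar] dg[of 0] r sq[OF *(1)] sq[OF *(2)] by simp_all
qed

context henon_leaves
begin

lemma leaf_bound0: "leaf n T f \<Longrightarrow> cmod y < R \<Longrightarrow> cmod a < \<delta> \<Longrightarrow> cmod (f (y, a)) \<le> 2"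
  using leaf_bound[of n T f y a 0] by simp

text \<open>Two leaves meet everywhere or nowhere, so for fixed \<open>y\<close> their difference is
  identically 0 or has no zero in \<open>a\<close>. It is at most 4 in modulus; 5 gives the strict
  bound needed for Harnack.\<close>

lemma leaf_hoelder:
  assumes f: "leaf n T f" and g: "leaf m T' g" and y: "cmod y < R" and a: "cmod a \<le> \<delta> / 3"
  shows "(cmod (f (y, a) - g (y, a)))\<^sup>2 \<le> 5 * cmod (f (0, 0) - g (0, 0))"
    and "(cmod (f (0, 0) - g (0, 0)))\<^sup>2 \<le> 5 * cmod (f (y, a) - g (y, a))"
proof -
  have y0: "f (y, 0) = f (0, 0)" "g (y, 0) = g (0, 0)" using leaf_a0[OF f y] leaf_a0[OF g y] by auto
  have a\<delta>: "cmod a < \<delta>" using a \<delta> by simp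
  have "(cmod (f (y, a) - g (y, a)))\<^sup>2 \<le> 5 * cmod (f (0, 0) - g (0, 0)) \<and>
    (cmod (f (0, 0) - g (0, 0)))\<^sup>2 \<le> 5 * cmod (f (y, a) - g (y, a))"
  proof (cases "\<exists>b. cmod b < \<delta> \<and> f (y, b) = g (y, b)")
    case True
    then obtain b where b: "cmod b < \<delta>" "f (y, b) = g (y, b)" by blast
    have "f (y, a) = g (y, a)" using leaf_unique[OF f g y b y a\<delta>] .
    moreover have "f (0, 0) = g (0, 0)" using leaf_unique[OF f g y b, of 0 0] R_pos \<delta> by simp
    ultimately show ?thesis by simp
  next
    case False
    define d where "d = (\<lambda>b. f (y, b) - g (y, b))"
    have "d holomorphic_on ball 0 \<delta>" unfolding d_def
      by (intro holomorphic_intros leaf_holomorphic_a[OF f y] leaf_holomorphic_a[OF g y])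
    moreover have "d b \<noteq> 0" if "cmod b < \<delta>" for b using False that by (auto simp: d_def)
    moreover have "cmod (d b) < 5" if "cmod b < \<delta>" for b
      using norm_triangle_ineq4[of "f (y, b)" "g (y, b)"] leaf_bound0[OF f y that] leaf_bound0[OF g y that]
      by (simp add: d_def)
    ultimately show ?thesis
      using harnack_nonvanishing[OF \<delta>(1), of d 5 a] a by (simp add: d_def y0)
  qed
  then show "(cmod (f (y, a) - g (y, a)))\<^sup>2 \<le> 5 * cmod (f (0, 0) - g (0, 0))"
    and "(cmod (f (0, 0) - g (0, 0)))\<^sup>2 \<le> 5 * cmod (f (y, a) - g (y, a))" by blast+
qed

lemma bounded_holomorphic_lipschitz:
  assumes hol: "f holomorphic_on ball 0 r" and b: "\<And>z. cmod z < r \<Longrightarrow> cmod (f z) \<le> B" and s: "0 < s" "s < r"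
    and z: "cmod z \<le> r - s" "cmod z' \<le> r - s"
  shows "cmod (f z - f z') \<le> 2 * B / s * cmod (z - z')"
proof (rule field_differentiable_bound)
  show "convex (cball 0 (r - s) :: complex set)" by simp
  show "z \<in> cball 0 (r - s)" "z' \<in> cball 0 (r - s)" using z by auto
  fix w :: complex assume w: "w \<in> cball 0 (r - s)"
  have cb: "cball w (s / 2) \<subseteq> ball 0 r"
  proof
    fix v assume "v \<in> cball w (s / 2)"
    then have "cmod v \<le> cmod w + s / 2" using norm_triangle_sub[of v w] by (simp add: dist_norm norm_minus_commute)
    then show "v \<in> ball 0 r" using w s by simp
  qed
  have "w \<in> ball 0 r" using w s by simp
  then show "(f has_field_derivative deriv f w) (at w within cball 0 (r - s))"
    using hol by (meson holomorphic_derivI has_field_derivative_at_within open_ball)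
  have "cmod ((deriv ^^ 1) f w) \<le> fact 1 * B / (s / 2) ^ 1"
  proof (rule Cauchy_inequality)
    show "f holomorphic_on ball w (s / 2)" using cb by (intro holomorphic_on_subset[OF hol]) auto
    show "continuous_on (cball w (s / 2)) f"
      using cb by (intro continuous_on_subset[OF holomorphic_on_imp_continuous_on[OF hol]]) auto
    show "cmod (f x) \<le> B" if "cmod (w - x) = s / 2" for x
      using cb that by (intro b) (auto simp: dist_norm subset_iff)
  qed (use s in auto)
  then show "cmod (deriv f w) \<le> 2 * B / s" by (simp add: mult.commute)
qed

lemma leaf_lipschitz_y:
  assumes f: "leaf n T f" and a: "cmod a < \<delta>" and y: "cmod y \<le> R / 2" "cmod y' \<le> R / 2"
  shows "cmod (f (y, a) - f (y', a)) \<le> 8 / R * cmod (y - y')"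
proof -
  have "cmod (f (y, a) - f (y', a)) \<le> 2 * 2 / (R / 2) * cmod (y - y')"
    by (rule bounded_holomorphic_lipschitz[OF leaf_holomorphic_y[OF f a] leaf_bound0[OF f _ a]]) (use y R_pos in auto)
  then show ?thesis by simp
qed

lemma leaf_displacement:
  assumes f: "leaf n T f" and y: "cmod y < R" and a: "cmod a \<le> \<delta> / 3"
  shows "cmod (f (y, a) - f (0, 0)) \<le> 8 / \<delta> * cmod a"
proof -
  have "cmod (f (y, a) - f (y, 0)) \<le> 2 * 2 / (\<delta> / 2) * cmod (a - 0)"
    by (rule bounded_holomorphic_lipschitz[OF leaf_holomorphic_a[OF f y] leaf_bound0[OF f y]]) (use a \<delta> in auto)
  then show ?thesis by (simp add: leaf_a0[OF f y])
qed

section \<open>The Julia set and the lamination\<close>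

definition P0 :: "complex \<Rightarrow> complex" where
  "P0 x = x\<^sup>2 + c 0"

definition J :: "complex set" where
  "J = julia_set P0"

lemma X_a0: "X 0 y x n = (P0 ^^ n) x"
  by (induction n) (simp_all add: X_Suc P0_def prev_term_def split: nat.splits)

lemma henon_iterate:
  "(henon (c a) a ^^ n) (x, y) = (X a y x n, case n of 0 \<Rightarrow> y | Suc m \<Rightarrow> a * X a y x m)"
proof (induction n)
  case (Suc n)
  then show ?case
    by (cases n) (simp_all add: henon_def X_Suc prev_term_def X_def power2_eq_square)
qed simp

definition trapped :: "complex \<Rightarrow> complex \<Rightarrow> complex \<Rightarrow> bool" where
  "trapped a y x \<longleftrightarrow> (\<forall>n. cmod (X a y x n) \<le> 2)"

text \<open>Modulus 2 forces strict growth at the next step. The strictness survives small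
  perturbation and so drives the escape times of approximating leaves to infinity.\<close>

lemma trapped_less:
  assumes "cmod a < \<delta>" "cmod y < R" "trapped a y x"
  shows "cmod (X a y x n) < 2"
proof (rule ccontr)
  assume "\<not> ?thesis"
  then have "cmod (X a y x (Suc n)) > 2" using X_escape[OF assms(1,2), of x n "Suc n"] by simp
  moreover have "cmod (X a y x (Suc n)) \<le> 2" using assms(3) unfolding trapped_def by blast
  ultimately show False by simp
qed

lemma bounded_imp_trapped:
  assumes "cmod a < \<delta>" "cmod y < R" "\<And>n. cmod (X a y x n) \<le> B"
  shows "trapped a y x"
  unfolding trapped_def
proof (intro allI, rule ccontr)
  fix n assume "\<not> cmod (X a y x n) \<le> 2"
  then obtain m where "cmod (X a y x m) > B" using X_escape_unbounded[OF assms(1,2), of x n B] by auto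
  then show False using assms(3)[of m] by simp
qed

lemma K_plus_iff:
  assumes a: "cmod a < \<delta>" and y: "cmod y < R"
  shows "(x, y) \<in> K_plus (c a) a \<longleftrightarrow> trapped a y x"
proof
  assume "(x, y) \<in> K_plus (c a) a"
  then obtain B where B: "\<And>n. norm ((henon (c a) a ^^ n) (x, y)) \<le> B"
    by (auto simp: K_plus_def bounded_orbits_def bounded_iff)
  have "cmod (X a y x n) \<le> B" for n
    using order_trans[OF norm_fst_le B[of n, unfolded henon_iterate]] .
  then show "trapped a y x" by (rule bounded_imp_trapped[OF a y])
next
  assume tr: "trapped a y x"
  have "norm ((henon (c a) a ^^ n) (x, y)) \<le> 2 + (R + 2)" for n
  proof -
    have "cmod (case n of 0 \<Rightarrow> y | Suc m \<Rightarrow> a * X a y x m) \<le> R + 2"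
    proof (cases n)
      case (Suc m)
      have "cmod a * cmod (X a y x m) \<le> 1 * 2" using a \<delta> tr by (intro mult_mono) (auto simp: trapped_def)
      then show ?thesis using R_pos by (simp add: Suc norm_mult)
    qed (use y in simp)
    then show ?thesis
      unfolding henon_iterate using tr by (intro order_trans[OF norm_Pair_le] add_mono) (auto simp: trapped_def)
  qed
  then show "(x, y) \<in> K_plus (c a) a"
    unfolding K_plus_def bounded_orbits_def bounded_iff by blast
qed

lemma bounded_orbits_P0: "bounded_orbits P0 = {x. trapped 0 0 x}"
proof -
  have "trapped 0 0 x \<longleftrightarrow> bounded (range (\<lambda>n. (P0 ^^ n) x))" for x
  proof
    assume "trapped 0 0 x"
    then show "bounded (range (\<lambda>n. (P0 ^^ n) x))" by (auto simp: bounded_iff trapped_def X_a0)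
  next
    assume "bounded (range (\<lambda>n. (P0 ^^ n) x))"
    then obtain B where "\<And>n. cmod (X 0 0 x n) \<le> B" by (auto simp: bounded_iff X_a0)
    then show "trapped 0 0 x" by (intro bounded_imp_trapped) (use \<delta> R_pos in auto)
  qed
  then show ?thesis by (auto simp: bounded_orbits_def)
qed

lemma continuous_P0_iter: "continuous_on S (\<lambda>x. (P0 ^^ n) x)"
  unfolding X_a0[of 0, symmetric] by (intro continuous_on_X continuous_intros) (use \<delta> in auto)

lemma closed_bounded_orbits_P0: "closed (bounded_orbits P0)"
proof -
  have "bounded_orbits P0 = (\<Inter>n. {x. cmod ((P0 ^^ n) x) \<le> 2})"
    by (auto simp: bounded_orbits_P0 trapped_def X_a0)
  moreover have "closed {x. cmod ((P0 ^^ n) x) \<le> 2}" for n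
    using continuous_P0_iter by (intro closed_Collect_le continuous_intros) auto
  ultimately show ?thesis by (simp add: closed_INT)
qed

lemma J_iff: "\<zeta> \<in> J \<longleftrightarrow> trapped 0 0 \<zeta> \<and> \<zeta> \<in> closure {x. \<not> trapped 0 0 x}"
proof -
  have "J = closure (bounded_orbits P0) \<inter> closure (- bounded_orbits P0)"
    unfolding J_def julia_set_def by (rule frontier_closures)
  then show ?thesis
    using closed_bounded_orbits_P0 by (auto simp: bounded_orbits_P0 Collect_neg_eq[symmetric])
qed

lemma J_trapped: "\<zeta> \<in> J \<Longrightarrow> trapped 0 0 \<zeta>"
  by (simp add: J_iff)

lemma J_less: "\<zeta> \<in> J \<Longrightarrow> cmod ((P0 ^^ n) \<zeta>) < 2"
  using trapped_less[of 0 0 \<zeta> n] \<delta> R_pos J_trapped by (simp add: X_a0)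

lemma compact_J: "compact J"
proof -
  have "closed J" by (simp add: J_def julia_set_def)
  moreover have "cmod \<zeta> \<le> 2" if "\<zeta> \<in> J" for \<zeta> using J_less[OF that, of 0] by simp
  then have "bounded J" unfolding bounded_iff by blast
  ultimately show ?thesis by (simp add: compact_eq_bounded_closed)
qed

lemma trapped_near_0:
  assumes "cmod x < \<kappa>"
  shows "trapped 0 0 x"
  unfolding trapped_def
proof (intro allI, rule ccontr)
  fix n assume "\<not> cmod (X 0 0 x n) \<le> 2"
  then have "cmod (X 0 0 x n) \<ge> 2" by simp
  from X_lower[OF _ _ this, of 0] show False using assms \<delta> R_pos by simp
qed

lemma J_lower:
  assumes "\<zeta> \<in> J"
  shows "cmod \<zeta> \<ge> \<kappa>"
proof (rule ccontr)
  assume "\<not> ?thesis"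
  have "ball 0 \<kappa> \<subseteq> bounded_orbits P0" using trapped_near_0 by (auto simp: bounded_orbits_P0)
  then have "ball 0 \<kappa> \<subseteq> interior (bounded_orbits P0)" by (simp add: interior_maximal)
  moreover have "\<zeta> \<notin> interior (bounded_orbits P0)" using assms by (simp add: J_def julia_set_def frontier_def)
  ultimately show False using \<open>\<not> \<kappa> \<le> cmod \<zeta>\<close> by (metis mem_ball_0 not_le subsetD)
qed

lemma J_nonzero: "\<zeta> \<in> J \<Longrightarrow> \<zeta> \<noteq> 0"
  using J_lower \<kappa> by fastforce

lemma trapped_P0: "trapped 0 0 (P0 x) \<longleftrightarrow> trapped 0 0 x"
proof
  assume tr: "trapped 0 0 (P0 x)"
  have s: "(P0 ^^ n) (P0 x) = (P0 ^^ Suc n) x" for n by (simp add: funpow_swap1)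
  have "cmod (X 0 0 x n) \<le> 2" for n
  proof (rule ccontr)
    assume "\<not> cmod (X 0 0 x n) \<le> 2"
    then have "cmod (X 0 0 x (Suc n)) > 2" using X_escape[of 0 0 x n "Suc n"] \<delta> R_pos by simp
    moreover have "cmod (X 0 0 (P0 x) n) \<le> 2" using tr unfolding trapped_def by blast
    ultimately show False using s[of n] by (simp add: X_a0)
  qed
  then show "trapped 0 0 x" by (simp add: trapped_def)
next
  assume "trapped 0 0 x"
  then have "cmod (X 0 0 x (Suc n)) \<le> 2" for n unfolding trapped_def by blast
  then show "trapped 0 0 (P0 x)" by (simp add: trapped_def X_a0 funpow_swap1)
qed

lemma P0_in_J:
  assumes "\<zeta> \<in> J"
  shows "P0 \<zeta> \<in> J"
proof -
  obtain z where z: "\<And>k :: nat. \<not> trapped 0 0 (z k)" "z \<longlonglongrightarrow> \<zeta>"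
    using assms by (auto simp: J_iff closure_sequential)
  have "(\<lambda>k. P0 (z k)) \<longlonglongrightarrow> P0 \<zeta>" unfolding P0_def by (intro tendsto_intros z)
  then have "P0 \<zeta> \<in> closure {x. \<not> trapped 0 0 x}"
    unfolding closure_sequential using z(1) trapped_P0 by (intro exI[of _ "\<lambda>k. P0 (z k)"]) auto
  then show ?thesis using assms by (simp add: J_iff trapped_P0)
qed

text \<open>Escaping points near \<open>P0 \<zeta>\<close> are pulled back by the branch
  \<open>\<zeta> * csqrt ((z - c 0) / \<zeta>\<^sup>2)\<close> of the inverse, which takes the value
  \<open>\<zeta>\<close> at \<open>P0 \<zeta>\<close> and is continuous there.\<close>

lemma J_preimage:
  assumes "P0 \<zeta> \<in> J" "\<zeta> \<noteq> 0"
  shows "\<zeta> \<in> J"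
proof -
  obtain z where z: "\<And>k :: nat. \<not> trapped 0 0 (z k)" "z \<longlonglongrightarrow> P0 \<zeta>"
    using assms by (auto simp: J_iff closure_sequential)
  define u where "u = (\<lambda>k. \<zeta> * csqrt ((z k - c 0) / \<zeta>\<^sup>2))"
  have P0u: "P0 (u k) = z k" for k
    using assms(2) by (simp add: P0_def u_def power_mult_distrib)
  have "(\<lambda>k. (z k - c 0) / \<zeta>\<^sup>2) \<longlonglongrightarrow> (P0 \<zeta> - c 0) / \<zeta>\<^sup>2"
    using assms(2) by (intro tendsto_intros z) auto
  then have "(\<lambda>k. (z k - c 0) / \<zeta>\<^sup>2) \<longlonglongrightarrow> 1" using assms(2) by (simp add: P0_def)
  moreover have "isCont csqrt 1" by (rule continuous_at_csqrt) auto
  ultimately have "(\<lambda>k. csqrt ((z k - c 0) / \<zeta>\<^sup>2)) \<longlonglongrightarrow> csqrt 1" by (rule isCont_tendsto_compose[rotated])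
  then have "u \<longlonglongrightarrow> \<zeta> * csqrt 1" unfolding u_def by (intro tendsto_intros)
  then have "u \<longlonglongrightarrow> \<zeta>" by simp
  moreover have "\<not> trapped 0 0 (u k)" for k using z(1)[of k] trapped_P0[of "u k"] P0u by simp
  ultimately have "\<zeta> \<in> closure {x. \<not> trapped 0 0 x}" unfolding closure_sequential by blast
  then show ?thesis using assms by (simp add: J_iff trapped_P0)
qed

lemma J_surjective:
  assumes "\<zeta>' \<in> J"
  shows "\<exists>\<zeta>\<in>J. P0 \<zeta> = \<zeta>'"
proof -
  have eq: "P0 (csqrt (w - c 0)) = w" for w by (simp add: P0_def)
  \<comment> \<open>Points near the critical value are images of points near 0 and hence have
    bounded orbits, so the critical value is not in \<open>J\<close>.\<close>
  have "\<zeta>' \<noteq> c 0"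
  proof
    assume "\<zeta>' = c 0"
    then have "c 0 \<in> closure {x. \<not> trapped 0 0 x}" using assms by (simp add: J_iff)
    moreover have "\<kappa>\<^sup>2 > 0" using \<kappa> by simp
    ultimately obtain x where x: "\<not> trapped 0 0 x" "dist x (c 0) < \<kappa>\<^sup>2"
      unfolding closure_approachable mem_Collect_eq by blast
    have "(cmod (csqrt (x - c 0)))\<^sup>2 < \<kappa>\<^sup>2" using x(2) by (simp add: dist_norm flip: norm_power)
    then have "cmod (csqrt (x - c 0)) < \<kappa>" by (rule power_less_imp_less_base) (use \<kappa> in simp)
    from trapped_near_0[OF this] show False using x(1) trapped_P0[of "csqrt (x - c 0)"] by (simp add: eq)
  qed
  then have "csqrt (\<zeta>' - c 0) \<in> J" using J_preimage[of "csqrt (\<zeta>' - c 0)"] assms by (simp add: eq)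
  then show ?thesis using eq by blast
qed

lemma trapped_closed:
  assumes a: "cmod a < \<delta>" and y: "cmod y < R" and z: "(\<lambda>k. (x' k, y' k)) \<longlonglongrightarrow> (x, y)"
  shows "(\<lambda>k. X a (y' k) (x' k) n) \<longlonglongrightarrow> X a y x n"
proof -
  have "x' \<longlonglongrightarrow> x" "y' \<longlonglongrightarrow> y" using tendsto_fst[OF z] tendsto_snd[OF z] by auto
  then show ?thesis unfolding X_def by (intro tendsto_henon_x tendsto_intros)
qed

text \<open>On the segment from a bounded to an escaping point the modulus of some iterate passes
  through 2, and a leaf goes through that point.\<close>

lemma leaf_between:
  assumes a: "cmod a < \<delta>" and y: "cmod y < R" "cmod y1 < R" and tr: "trapped a y x" and ntr: "\<not> trapped a y1 x1"
  shows "\<exists>n T f w. leaf n T f \<and> w \<in> closed_segment (x, y) (x1, y1) \<and> cmod (snd w) < R \<and> fst w = f (snd w, a)"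
proof -
  obtain n where n: "cmod (X a y1 x1 n) > 2" using ntr by (auto simp: trapped_def not_le)
  define w where "w = (\<lambda>s :: real. ((1 - s) *\<^sub>R (x, y) + s *\<^sub>R (x1, y1)))"
  have w: "continuous_on {0..1} w" unfolding w_def by (intro continuous_intros)
  have wR: "cmod (snd (w s)) < R" if "s \<in> {0..1}" for s
  proof -
    have "snd (w s) \<in> closed_segment y y1" using that by (auto simp: w_def closed_segment_def)
    moreover have "closed_segment y y1 \<subseteq> ball 0 R" using y by (intro closed_segment_subset) auto
    ultimately show ?thesis by auto
  qed
  define g where "g = (\<lambda>s. cmod (X a (snd (w s)) (fst (w s)) n))"
  have "continuous_on {0..1} g" unfolding g_def
    by (intro continuous_intros continuous_on_X w) (use a in auto)
  moreover have "g 0 \<le> 2" "g 1 \<ge> 2" using tr n by (auto simp: g_def w_def trapped_def)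
  ultimately obtain s where s: "s \<in> {0..1}" "g s = 2"
    using IVT'[of g 0 2 1] by auto
  define T where "T = X a (snd (w s)) (fst (w s)) n"
  have "cmod T = 2" using s(2) by (simp add: T_def g_def)
  then obtain f where "leaf n T f" "f (snd (w s), a) = fst (w s)"
    using leaf_exists[OF _ wR[OF s(1)] a T_def[symmetric]] by blast
  moreover have "w s \<in> closed_segment (x, y) (x1, y1)"
    using s(1) by (auto simp: w_def closed_segment_def)
  ultimately show ?thesis using wR[OF s(1)] by (intro exI[of _ n] exI[of _ T] exI[of _ f] exI[of _ "w s"]) auto
qed

section \<open>Limits of leaves\<close>

definition leaf_seq :: "(nat \<Rightarrow> complex \<times> complex \<Rightarrow> complex) \<Rightarrow> complex \<Rightarrow> bool" where
  "leaf_seq F \<zeta> \<longleftrightarrow> (\<forall>k. \<exists>n T. leaf n T (F k)) \<and> (\<lambda>k. F k (0, 0)) \<longlonglongrightarrow> \<zeta>"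

lemma leaf_seq_exists:
  assumes "\<zeta> \<in> J"
  shows "\<exists>F. leaf_seq F \<zeta>"
proof -
  have "\<exists>f. (\<exists>n T. leaf n T f) \<and> dist (f (0, 0)) \<zeta> < 1 / Suc k" for k
  proof -
    obtain z where z: "\<not> trapped 0 0 z" "dist z \<zeta> < 1 / Suc k"
      using assms by (auto simp: J_iff closure_approachable dest!: spec[of _ "1 / Suc k"])
    obtain n T f w where w: "leaf n T f" "w \<in> closed_segment (\<zeta>, 0) (z, 0)" "cmod (snd w) < R" "fst w = f (snd w, 0)"
      using leaf_between[of 0 0 0 \<zeta> z] z(1) J_trapped[OF assms] \<delta> R_pos by auto
    have "f (0, 0) = fst w" using leaf_a0[OF w(1,3)] w(4) by simp
    moreover have "fst w \<in> closed_segment \<zeta> z" using w(2) by (auto simp: closed_segment_def)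
    then have "dist (fst w) \<zeta> \<le> dist z \<zeta>" using dist_in_closed_segment[of "fst w" \<zeta> z] by (simp add: dist_commute)
    ultimately show ?thesis using z(2) w(1) by (intro exI[of _ f]) auto
  qed
  then obtain F where F: "\<And>k. \<exists>n T. leaf n T (F k)" "\<And>k. dist (F k (0, 0)) \<zeta> < 1 / Suc k" by metis
  have "(\<lambda>k. F k (0, 0)) \<longlonglongrightarrow> \<zeta>"
  proof (rule tendstoI)
    fix e :: real assume "e > 0"
    then obtain N :: nat where "1 / Suc N < e" using nat_approx_posE by blast
    have "dist (F k (0, 0)) \<zeta> < e" if "k \<ge> N" for k
      proof -
      have "1 / real (Suc k) \<le> 1 / real (Suc N)" using that by (intro divide_left_mono) auto
      then show ?thesis using F(2)[of k] \<open>1 / Suc N < e\<close> by linarith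
    qed

    then show "eventually (\<lambda>k. dist (F k (0, 0)) \<zeta> < e) sequentially" by (auto simp: eventually_sequentially)
  qed
  then show ?thesis using F(1) by (auto simp: leaf_seq_def)
qed

end

lemma tendsto_0_of_power2:
  fixes d :: "nat \<Rightarrow> complex"
  assumes "b \<longlonglongrightarrow> 0" "\<And>k. (cmod (d k))\<^sup>2 \<le> b k"
  shows "d \<longlonglongrightarrow> 0"
proof -
  have "(\<lambda>k. (cmod (d k))\<^sup>2) \<longlonglongrightarrow> 0"
    by (rule tendsto_sandwich[OF _ _ tendsto_const assms(1)]) (use assms(2) in auto)
  then have "(\<lambda>k. sqrt ((cmod (d k))\<^sup>2)) \<longlonglongrightarrow> sqrt 0" by (rule tendsto_real_sqrt)
  then show ?thesis by (simp add: tendsto_norm_zero_iff)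
qed

context henon_leaves
begin

text \<open>The limit does not depend on the chosen sequence of leaves, see \<open>phi_lim\<close>.\<close>

definition phi :: "complex \<Rightarrow> complex \<Rightarrow> complex \<Rightarrow> complex" where
  "phi a \<zeta> y = lim (\<lambda>k. (SOME F. leaf_seq F \<zeta>) k (y, a))"

lemma leaf_seq_convergent:
  assumes F: "leaf_seq F \<zeta>" and y: "cmod y < R" and a: "cmod a \<le> \<delta> / 3"
  shows "convergent (\<lambda>k. F k (y, a))"
proof -
  have "Cauchy (\<lambda>k. F k (y, a))"
  proof (rule metric_CauchyI)
    fix e :: real assume e: "e > 0"
    have "Cauchy (\<lambda>k. F k (0, 0))" using F by (auto simp: leaf_seq_def intro: LIMSEQ_imp_Cauchy)
    then obtain N where N: "\<And>k j. k \<ge> N \<Longrightarrow> j \<ge> N \<Longrightarrow> dist (F k (0, 0)) (F j (0, 0)) < e\<^sup>2 / 5"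
      using e unfolding Cauchy_def by (metis divide_pos_pos zero_less_numeral zero_less_power)
    have "dist (F k (y, a)) (F j (y, a)) < e" if "k \<ge> N" "j \<ge> N" for k j
    proof -
      obtain n T m T' where "leaf n T (F k)" "leaf m T' (F j)" using F unfolding leaf_seq_def by blast
      from leaf_hoelder(1)[OF this y a] have "(cmod (F k (y, a) - F j (y, a)))\<^sup>2 < e\<^sup>2"
        using N[OF that] by (simp add: dist_norm)
      then show ?thesis using e by (simp add: dist_norm power_less_imp_less_base)
    qed
    then show "\<exists>N. \<forall>k\<ge>N. \<forall>j\<ge>N. dist (F k (y, a)) (F j (y, a)) < e" by blast
  qed
  then show ?thesis by (rule Cauchy_convergent)
qed

lemma phi_lim:
  assumes F: "leaf_seq F \<zeta>" and y: "cmod y < R" and a: "cmod a \<le> \<delta> / 3"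
  shows "(\<lambda>k. F k (y, a)) \<longlonglongrightarrow> phi a \<zeta> y"
proof -
  define G where "G = (SOME F. leaf_seq F \<zeta>)"
  have G: "leaf_seq G \<zeta>" unfolding G_def using F by (rule someI[of "\<lambda>F. leaf_seq F \<zeta>"])
  have lim: "(\<lambda>k. G k (y, a)) \<longlonglongrightarrow> phi a \<zeta> y"
    using leaf_seq_convergent[OF G y a] by (simp add: phi_def convergent_LIMSEQ_iff flip: G_def)
  have "(\<lambda>k. F k (y, a) - G k (y, a)) \<longlonglongrightarrow> 0"
  proof (rule tendsto_0_of_power2)
    have "(\<lambda>k. 5 * cmod (F k (0, 0) - G k (0, 0))) \<longlonglongrightarrow> 5 * cmod (\<zeta> - \<zeta>)"
      using F G by (intro tendsto_intros) (auto simp: leaf_seq_def)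
    then show "(\<lambda>k. 5 * cmod (F k (0, 0) - G k (0, 0))) \<longlonglongrightarrow> 0" by simp
    show "(cmod (F k (y, a) - G k (y, a)))\<^sup>2 \<le> 5 * cmod (F k (0, 0) - G k (0, 0))" for k
    proof -
      obtain n T m T' where "leaf n T (F k)" "leaf m T' (G k)" using F G unfolding leaf_seq_def by blast
      from leaf_hoelder(1)[OF this y a] show ?thesis .
    qed
  qed
  from tendsto_add[OF this lim] show ?thesis by simp
qed

text \<open>The first bound gives continuity in \<open>\<zeta>\<close>, the second disjointness of
  the graphs over different points of \<open>J\<close>.\<close>

lemma phi_hoelder:
  assumes z: "\<zeta> \<in> J" "\<zeta>' \<in> J" and y: "cmod y < R" and a: "cmod a \<le> \<delta> / 3"
  shows "(cmod (phi a \<zeta> y - phi a \<zeta>' y))\<^sup>2 \<le> 5 * cmod (\<zeta> - \<zeta>')"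
    and "(cmod (\<zeta> - \<zeta>'))\<^sup>2 \<le> 5 * cmod (phi a \<zeta> y - phi a \<zeta>' y)"
proof -
  obtain F G where F: "leaf_seq F \<zeta>" and G: "leaf_seq G \<zeta>'" using leaf_seq_exists z by blast
  have ex: "\<exists>n T m T'. leaf n T (F k) \<and> leaf m T' (G k)" for k using F G unfolding leaf_seq_def by blast
  have 0: "(\<lambda>k. F k (0, 0)) \<longlonglongrightarrow> \<zeta>" "(\<lambda>k. G k (0, 0)) \<longlonglongrightarrow> \<zeta>'" using F G by (auto simp: leaf_seq_def)
  have 1: "(\<lambda>k. (cmod (F k (y, a) - G k (y, a)))\<^sup>2) \<longlonglongrightarrow> (cmod (phi a \<zeta> y - phi a \<zeta>' y))\<^sup>2"
    "(\<lambda>k. 5 * cmod (F k (y, a) - G k (y, a))) \<longlonglongrightarrow> 5 * cmod (phi a \<zeta> y - phi a \<zeta>' y)"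
    by (intro tendsto_intros phi_lim F G y a)+
  have 2: "(\<lambda>k. 5 * cmod (F k (0, 0) - G k (0, 0))) \<longlonglongrightarrow> 5 * cmod (\<zeta> - \<zeta>')"
    "(\<lambda>k. (cmod (F k (0, 0) - G k (0, 0)))\<^sup>2) \<longlonglongrightarrow> (cmod (\<zeta> - \<zeta>'))\<^sup>2"
    by (intro tendsto_intros 0)+
  show "(cmod (phi a \<zeta> y - phi a \<zeta>' y))\<^sup>2 \<le> 5 * cmod (\<zeta> - \<zeta>')"
    by (rule LIMSEQ_le[OF 1(1) 2(1)]) (use ex leaf_hoelder(1)[OF _ _ y a] in blast)
  show "(cmod (\<zeta> - \<zeta>'))\<^sup>2 \<le> 5 * cmod (phi a \<zeta> y - phi a \<zeta>' y)"
    by (rule LIMSEQ_le[OF 2(2) 1(2)]) (use ex leaf_hoelder(2)[OF _ _ y a] in blast)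
qed

lemma phi_lipschitz_y:
  assumes z: "\<zeta> \<in> J" and a: "cmod a \<le> \<delta> / 3" and y: "cmod y \<le> R / 2" "cmod y' \<le> R / 2"
  shows "cmod (phi a \<zeta> y - phi a \<zeta> y') \<le> 8 / R * cmod (y - y')"
proof -
  obtain F where F: "leaf_seq F \<zeta>" using leaf_seq_exists z by blast
  have lim: "(\<lambda>k. cmod (F k (y, a) - F k (y', a))) \<longlonglongrightarrow> cmod (phi a \<zeta> y - phi a \<zeta> y')"
    by (intro tendsto_intros phi_lim F a) (use y R_pos in auto)
  have "cmod (F k (y, a) - F k (y', a)) \<le> 8 / R * cmod (y - y')" for k
  proof -
    obtain n T where "leaf n T (F k)" using F unfolding leaf_seq_def by blast
    from leaf_lipschitz_y[OF this _ y] show ?thesis using a \<delta> by simp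
  qed
  then show ?thesis by (intro LIMSEQ_le_const2[OF lim]) auto
qed

lemma phi_displacement:
  assumes z: "\<zeta> \<in> J" and a: "cmod a \<le> \<delta> / 3" and y: "cmod y < R"
  shows "cmod (phi a \<zeta> y - \<zeta>) \<le> 8 / \<delta> * cmod a"
proof -
  obtain F where F: "leaf_seq F \<zeta>" using leaf_seq_exists z by blast
  then have "(\<lambda>k. F k (0, 0)) \<longlonglongrightarrow> \<zeta>" by (simp add: leaf_seq_def)
  then have lim: "(\<lambda>k. cmod (F k (y, a) - F k (0, 0))) \<longlonglongrightarrow> cmod (phi a \<zeta> y - \<zeta>)"
    by (intro tendsto_intros phi_lim F a y)
  have "cmod (F k (y, a) - F k (0, 0)) \<le> 8 / \<delta> * cmod a" for k
  proof -
    obtain n T where "leaf n T (F k)" using F unfolding leaf_seq_def by blast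
    from leaf_displacement[OF this y a] show ?thesis .
  qed
  then show ?thesis by (intro LIMSEQ_le_const2[OF lim]) auto
qed

text \<open>On \<open>J\<close> each iterate has modulus strictly below 2, so leaves reaching
  modulus 2 at a bounded time cannot have base points converging to a point of
  \<open>J\<close>.\<close>

lemma leaf_seq_escape_time:
  assumes F: "leaf_seq F \<zeta>" and z: "\<zeta> \<in> J"
  shows "eventually (\<lambda>k. \<forall>n T. leaf n T (F k) \<longrightarrow> N < n) sequentially"
proof -
  have lim: "(\<lambda>k. cmod ((P0 ^^ n) (F k (0, 0)))) \<longlonglongrightarrow> cmod ((P0 ^^ n) \<zeta>)" for n
  proof -
    have "isCont (P0 ^^ n) \<zeta>"
      using continuous_P0_iter[of UNIV n] by (simp add: continuous_on_eq_continuous_at)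
    then show ?thesis using F by (intro tendsto_norm isCont_tendsto_compose[of _ "P0 ^^ n"]) (auto simp: leaf_seq_def)
  qed
  have "eventually (\<lambda>k. \<forall>n\<in>{..N}. cmod ((P0 ^^ n) (F k (0, 0))) < 2) sequentially"
    by (intro eventually_ball_finite ballI order_tendstoD(2)[OF lim] J_less z) auto
  then show ?thesis
  proof eventually_elim
    case (elim k)
    show ?case
    proof (intro allI impI)
      fix n T assume f: "leaf n T (F k)"
      have "cmod ((P0 ^^ n) (F k (0, 0))) = 2"
        using leaf_root[OF f, of 0 0] f \<delta> R_pos by (simp add: X_a0 leaf_def)
      then have "n \<notin> {..N}" using elim by (metis less_irrefl)
      then show "N < n" by simp
    qed
  qed
qed

lemma phi_trapped:
  assumes z: "\<zeta> \<in> J" and a: "cmod a \<le> \<delta> / 3" and y: "cmod y < R"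
  shows "trapped a y (phi a \<zeta> y)"
  unfolding trapped_def
proof
  fix N
  have a\<delta>: "cmod a < \<delta>" using a \<delta> by simp
  obtain F where F: "leaf_seq F \<zeta>" using leaf_seq_exists z by blast
  have "(\<lambda>k. X a y (F k (y, a)) N) \<longlonglongrightarrow> X a y (phi a \<zeta> y) N"
    unfolding X_def by (intro tendsto_henon_x tendsto_const phi_lim F y a)
  then have lim: "(\<lambda>k. cmod (X a y (F k (y, a)) N)) \<longlonglongrightarrow> cmod (X a y (phi a \<zeta> y) N)" by (rule tendsto_norm)
  have "eventually (\<lambda>k. cmod (X a y (F k (y, a)) N) \<le> 2) sequentially"
    using leaf_seq_escape_time[OF F z, of N]
  proof eventually_elim
    case (elim k)
    obtain n T where f: "leaf n T (F k)" using F unfolding leaf_seq_def by blast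
    then have "N \<le> n" using elim by fastforce
    then show ?case by (rule leaf_bound[OF f y a\<delta>])
  qed
  then show "cmod (X a y (phi a \<zeta> y) N) \<le> 2" by (rule tendsto_upperbound[OF lim]) simp
qed

lemma phi_less: "\<zeta> \<in> J \<Longrightarrow> cmod a \<le> \<delta> / 3 \<Longrightarrow> cmod y < R \<Longrightarrow> cmod (phi a \<zeta> y) < 2"
  using trapped_less[OF _ _ phi_trapped, of a y \<zeta> 0] \<delta> by simp

text \<open>The image of a leaf is compared with a leaf of the next lower time along the disc of all
  \<open>a\<close> with \<open>y\<close> fixed. At \<open>a = 0\<close> both are independent of
  \<open>y\<close>, so a single value at the origin decides.\<close>

lemma leaf_image:
  assumes f: "leaf (Suc n) T f"
  shows "\<exists>g. leaf n T g \<and> (\<forall>y a. cmod y < R \<and> cmod a < \<delta> \<longrightarrow> g (a * f (y, a), a) = (f (y, a))\<^sup>2 + c a + a * y)"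
proof -
  have T: "cmod T = 2" using f by (simp add: leaf_def)
  have step: "X a (a * x) (x\<^sup>2 + c a + a * y) n = X a y x (Suc n)" for a x y
    using henon_x_shift[of "c a" "a\<^sup>2" x "a * y" 1 n] by (simp add: X_def prev_term_def power2_eq_square mult.assoc)
  have z: "cmod (0 :: complex) < R" "cmod (0 :: complex) < \<delta>" using \<delta> R_pos by auto
  define b where "b = (\<lambda>y a. (f (y, a))\<^sup>2 + c a + a * y)"
  have b: "X a (a * f (y, a)) (b y a) n = T" if "cmod y < R" "cmod a < \<delta>" for y a
    unfolding b_def step using leaf_root[OF f that] .
  have fR: "cmod (a * f (y, a)) < R" if "cmod y < R" "cmod a < \<delta>" for y a
  proof -
    have "cmod (a * f (y, a)) \<le> \<delta> * 2" unfolding norm_mult using leaf_bound0[OF f that] that \<delta> by (intro mult_mono) auto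
    then show ?thesis using \<delta> by linarith
  qed
  obtain g where g: "leaf n T g" "g (0, 0) = b 0 0" using leaf_exists[OF T z b[OF z, simplified]] by blast
  have "g (a * f (y, a), a) = b y a" if y: "cmod y < R" and a: "cmod a < \<delta>" for y a
  proof (rule root_section_unique[OF T, where S = "ball 0 \<delta>" and u = "\<lambda>a. (a * f (y, a), a)" and r = 0 and s = a
      and f = "\<lambda>a. g (a * f (y, a), a)" and g = "b y" and n = n])
    have cf: "continuous_on (ball 0 \<delta>) (\<lambda>a. f (y, a))"
      by (rule holomorphic_on_imp_continuous_on[OF leaf_holomorphic_a[OF f y]])
    then show u: "continuous_on (ball 0 \<delta>) (\<lambda>a. (a * f (y, a), a))" by (intro continuous_intros)
    show sub: "(\<lambda>a. (a * f (y, a), a)) ` ball 0 \<delta> \<subseteq> U" using fR[OF y] by (auto simp: mem_U)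
    show "continuous_on (ball 0 \<delta>) (\<lambda>a. g (a * f (y, a), a))"
      by (rule continuous_on_compose2[OF _ u sub]) (use g in \<open>simp add: leaf_def\<close>)
    show "continuous_on (ball 0 \<delta>) (b y)"
      unfolding b_def by (intro continuous_intros cf holomorphic_on_imp_continuous_on[OF c_hol])
    show "X (snd (a * f (y, a), a)) (fst (a * f (y, a), a)) (g (a * f (y, a), a)) n = T" if "a \<in> ball 0 \<delta>" for a
      using leaf_root[OF g(1) fR[OF y]] that by simp
    show "X (snd (a * f (y, a), a)) (fst (a * f (y, a), a)) (b y a) n = T" if "a \<in> ball 0 \<delta>" for a
      using b[OF y] that by simp
    show "g (0 * f (y, 0), 0) = b y 0" using g(2) leaf_a0[OF f y] by (simp add: b_def)
  qed (use a \<delta> in auto)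
  then show ?thesis using g(1) unfolding b_def by blast
qed

text \<open>Invariance of leaves in the limit. The argument \<open>a * F k (y, a)\<close> of the
  image leaf moves with \<open>k\<close>; the uniform Lipschitz bound in \<open>y\<close> absorbs
  this.\<close>

lemma phi_functional_equation:
  assumes z: "\<zeta> \<in> J" and a: "cmod a \<le> \<delta> / 3" and y: "cmod y < R"
  shows "phi a (P0 \<zeta>) (a * phi a \<zeta> y) = (phi a \<zeta> y)\<^sup>2 + c a + a * y"
proof -
  have a\<delta>: "cmod a < \<delta>" using a \<delta> by simp
  obtain F where F: "leaf_seq F \<zeta>" using leaf_seq_exists z by blast
  \<comment> \<open>Leaves of time 0 have no image leaf, so finitely many members of the sequence
    are discarded.\<close>
  obtain k0 where k0: "\<And>k n T. k \<ge> k0 \<Longrightarrow> leaf n T (F k) \<Longrightarrow> 0 < n"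
    using leaf_seq_escape_time[OF F z, of 0] by (auto simp: eventually_sequentially)
  have "\<exists>g. (\<exists>n T. leaf n T g) \<and> (\<forall>y a. cmod y < R \<and> cmod a < \<delta> \<longrightarrow> g (a * F (k + k0) (y, a), a) = (F (k + k0) (y, a))\<^sup>2 + c a + a * y)" for k
  proof -
    obtain n T where f: "leaf n T (F (k + k0))" using F unfolding leaf_seq_def by blast
    then obtain m where "n = Suc m" using k0[of "k + k0"] by (cases n) auto
    then show ?thesis using leaf_image f by blast
  qed
  then obtain G where G: "\<And>k. \<exists>n T. leaf n T (G k)"
    "\<And>k y a. cmod y < R \<Longrightarrow> cmod a < \<delta> \<Longrightarrow> G k (a * F (k + k0) (y, a), a) = (F (k + k0) (y, a))\<^sup>2 + c a + a * y" by metis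
  have F0: "(\<lambda>k. F (k + k0) (0, 0)) \<longlonglongrightarrow> \<zeta>" using F by (auto simp: leaf_seq_def intro: LIMSEQ_ignore_initial_segment)
  have "G k (0, 0) = P0 (F (k + k0) (0, 0))" for k using G(2)[of 0 0 k] \<delta> R_pos by (simp add: P0_def)
  moreover have "(\<lambda>k. P0 (F (k + k0) (0, 0))) \<longlonglongrightarrow> P0 \<zeta>" unfolding P0_def by (intro tendsto_intros F0)
  ultimately have GP: "leaf_seq G (P0 \<zeta>)" using G(1) by (simp add: leaf_seq_def)
  define w where "w = a * phi a \<zeta> y"
  define w' where "w' = (\<lambda>k. a * F (k + k0) (y, a))"
  have Fl: "(\<lambda>k. F (k + k0) (y, a)) \<longlonglongrightarrow> phi a \<zeta> y" by (rule LIMSEQ_ignore_initial_segment[OF phi_lim[OF F y a]])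
  have w'_lim: "w' \<longlonglongrightarrow> w" unfolding w'_def w_def by (intro tendsto_intros Fl)
  have small: "cmod (a * x) \<le> R / 2" if "cmod x \<le> 2" for x
  proof -
    have "cmod (a * x) \<le> \<delta> * 2" unfolding norm_mult using a\<delta> that \<delta> by (intro mult_mono) auto
    then show ?thesis using \<delta> by linarith
  qed
  have w2: "cmod w \<le> R / 2" unfolding w_def using phi_less[OF z a y] by (intro small) simp
  have w'2: "cmod (w' k) \<le> R / 2" for k
  proof -
    obtain n T where f: "leaf n T (F (k + k0))" using F unfolding leaf_seq_def by blast
    show ?thesis unfolding w'_def by (rule small[OF leaf_bound0[OF f y a\<delta>]])
  qed
  have wR: "cmod w < R" using w2 R_pos by simp
  have "(\<lambda>k. G k (w' k, a) - G k (w, a)) \<longlonglongrightarrow> 0"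
  proof (rule Lim_null_comparison)
    show "eventually (\<lambda>k. norm (G k (w' k, a) - G k (w, a)) \<le> 8 / R * cmod (w' k - w)) sequentially"
    proof (intro always_eventually allI)
      fix k
      obtain n T where g: "leaf n T (G k)" using G(1) by blast
      show "norm (G k (w' k, a) - G k (w, a)) \<le> 8 / R * cmod (w' k - w)"
        by (rule leaf_lipschitz_y[OF g a\<delta> w'2 w2])
    qed
    have "(\<lambda>k. 8 / R * cmod (w' k - w)) \<longlonglongrightarrow> 8 / R * cmod (w - w)" by (intro tendsto_intros w'_lim) 
    then show "(\<lambda>k. 8 / R * cmod (w' k - w)) \<longlonglongrightarrow> 0" by simp
  qed
  from tendsto_add[OF this phi_lim[OF GP wR a]] have "(\<lambda>k. G k (w' k, a)) \<longlonglongrightarrow> phi a (P0 \<zeta>) w" by simp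
  moreover have "G k (w' k, a) = (F (k + k0) (y, a))\<^sup>2 + c a + a * y" for k
    unfolding w'_def by (rule G(2)[OF y a\<delta>])
  moreover have "(\<lambda>k. (F (k + k0) (y, a))\<^sup>2 + c a + a * y) \<longlonglongrightarrow> (phi a \<zeta> y)\<^sup>2 + c a + a * y"
    by (intro tendsto_intros Fl)
  ultimately show ?thesis unfolding w_def using LIMSEQ_unique by fastforce
qed

lemma J_plus_iff:
  assumes a: "cmod a < \<delta>" and y: "cmod y < R"
  shows "(x, y) \<in> J_plus (c a) a \<longleftrightarrow> trapped a y x \<and> (x, y) \<in> closure (- K_plus (c a) a)"
proof
  assume "(x, y) \<in> J_plus (c a) a"
  then have cl: "(x, y) \<in> closure (K_plus (c a) a)" "(x, y) \<in> closure (- K_plus (c a) a)"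
    by (auto simp: J_plus_def frontier_closures)
  obtain z where z: "\<And>k :: nat. z k \<in> K_plus (c a) a" "z \<longlonglongrightarrow> (x, y)" using cl(1) by (auto simp: closure_sequential)
  have "eventually (\<lambda>k. cmod (snd (z k)) < R) sequentially"
    using tendsto_snd[OF z(2)] y by (intro order_tendstoD(2)[OF tendsto_norm]) auto
  then have ev: "eventually (\<lambda>k. trapped a (snd (z k)) (fst (z k))) sequentially"
    by eventually_elim (use K_plus_iff[OF a] z(1) in \<open>metis prod.collapse\<close>)
  have "cmod (X a y x n) \<le> 2" for n
  proof -
    have "(\<lambda>k. X a (snd (z k)) (fst (z k)) n) \<longlonglongrightarrow> X a y x n"
      by (rule trapped_closed[OF a y]) (use z(2) in simp)
    then have "(\<lambda>k. cmod (X a (snd (z k)) (fst (z k)) n)) \<longlonglongrightarrow> cmod (X a y x n)" by (rule tendsto_norm)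
    then show ?thesis
      by (rule tendsto_upperbound) (use ev in \<open>auto simp: trapped_def elim: eventually_mono\<close>)
  qed
  then show "trapped a y x \<and> (x, y) \<in> closure (- K_plus (c a) a)" using cl(2) by (simp add: trapped_def)
next
  assume "trapped a y x \<and> (x, y) \<in> closure (- K_plus (c a) a)"
  then show "(x, y) \<in> J_plus (c a) a"
    using K_plus_iff[OF a y] closure_subset[of "K_plus (c a) a"] by (auto simp: J_plus_def frontier_closures)
qed

text \<open>Graphs over \<open>J\<close> are limits of leaves, and leaves lie outside
  \<open>K_plus\<close>. Conversely, escaping points near a point of \<open>J_plus\<close> provide
  leaves passing close to it; a subsequence of their base points converges, the limit lies in
  \<open>J\<close> since the escape times tend to infinity, and its graph passes through the
  point.\<close>

theorem J_plus_lamination: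
  assumes a: "cmod a \<le> \<delta> / 3" and y: "cmod y < R / 2"
  shows "(x, y) \<in> J_plus (c a) a \<longleftrightarrow> (\<exists>\<zeta>\<in>J. x = phi a \<zeta> y)"
proof
  have a\<delta>: "cmod a < \<delta>" using a \<delta> by simp
  have yR: "cmod y < R" using y R_pos by simp
  {
    assume "\<exists>\<zeta>\<in>J. x = phi a \<zeta> y"
    then obtain \<zeta> where z: "\<zeta> \<in> J" "x = phi a \<zeta> y" by blast
    obtain F where F: "leaf_seq F \<zeta>" using leaf_seq_exists z by blast
    have "(F k (y, a), y) \<notin> K_plus (c a) a" for k
    proof -
      obtain n T where f: "leaf n T (F k)" using F unfolding leaf_seq_def by blast
      have "cmod (X a y (F k (y, a)) n) = 2" using leaf_root[OF f yR a\<delta>] f by (simp add: leaf_def)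
      then show ?thesis using trapped_less[OF a\<delta> yR, of "F k (y, a)" n] K_plus_iff[OF a\<delta> yR, of "F k (y, a)"] by linarith
    qed
    moreover have "(\<lambda>k. (F k (y, a), y)) \<longlonglongrightarrow> (x, y)" unfolding z(2) by (intro tendsto_intros phi_lim F yR a)
    ultimately have "(x, y) \<in> closure (- K_plus (c a) a)"
      unfolding closure_sequential by (intro exI[of _ "\<lambda>k. (F k (y, a), y)"]) auto
    then show "(x, y) \<in> J_plus (c a) a"
      using phi_trapped[OF z(1) a yR] z(2) J_plus_iff[OF a\<delta> yR] by simp
  }
  assume "(x, y) \<in> J_plus (c a) a"
  then have tr: "trapped a y x" and cl: "(x, y) \<in> closure (- K_plus (c a) a)" using J_plus_iff[OF a\<delta> yR] by auto
  have "\<exists>f w. (\<exists>n T. leaf n T f) \<and> dist w (x, y) < 1 / Suc k \<and> cmod (snd w) < R / 2 \<and> fst w = f (snd w, a)" for k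
  proof -
    \<comment> \<open>The margin keeps the crossing points in the half disc on which the leaves are
      uniformly Lipschitz in \<open>y\<close>.\<close>
    define e where "e = min (1 / real (Suc k)) (R / 2 - cmod y)"
    have e: "e > 0" using y by (simp add: e_def)
    obtain z1 where z1: "z1 \<notin> K_plus (c a) a" "dist z1 (x, y) < e"
      using cl e by (auto simp: closure_approachable)
    have close: "cmod (snd v) < R / 2" if "dist v (x, y) < e" for v :: "complex \<times> complex"
    proof -
      have "cmod (snd v - y) \<le> dist v (x, y)" using dist_snd_le[of v "(x, y)"] by (simp add: dist_norm)
      then have "cmod (snd v - y) < R / 2 - cmod y" using that by (simp add: e_def)
      then show ?thesis using norm_triangle_sub[of "snd v" y] by simp
    qed
    have z1R: "cmod (snd z1) < R" using close[OF z1(2)] R_pos by simp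
    have "\<not> trapped a (snd z1) (fst z1)" using K_plus_iff[OF a\<delta> z1R, of "fst z1"] z1(1) by simp
    then obtain n T f w where w: "leaf n T f" "w \<in> closed_segment (x, y) z1" "fst w = f (snd w, a)"
      using leaf_between[OF a\<delta> yR z1R tr] by (metis prod.collapse)
    have "dist w (x, y) \<le> dist z1 (x, y)" using dist_in_closed_segment[OF w(2)] by (simp add: dist_commute)
    then have "dist w (x, y) < e" using z1(2) by simp
    then show ?thesis using w close[of w] by (intro exI[of _ f] exI[of _ w]) (auto simp: e_def)
  qed
  then obtain F w where F: "\<And>k. \<exists>n T. leaf n T (F k)" and w: "\<And>k. dist (w k) (x, y) < 1 / Suc k" "\<And>k. cmod (snd (w k)) < R / 2"
    "\<And>k. fst (w k) = F k (snd (w k), a)" by metis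
  have w_lim: "w \<longlonglongrightarrow> (x, y)"
  proof (rule metric_tendsto_imp_tendsto[of "\<lambda>n. inverse (real (Suc n))" 0])
    show "eventually (\<lambda>k. dist (w k) (x, y) \<le> dist (inverse (real (Suc k))) 0) sequentially"
      using w(1) by (auto intro!: always_eventually less_imp_le simp: inverse_eq_divide)
  qed (rule LIMSEQ_inverse_real_of_nat)
  have "bounded (range (\<lambda>k. F k (0, 0)))"
    unfolding bounded_iff
  proof (intro exI ballI)
    fix v assume "v \<in> range (\<lambda>k. F k (0, 0))"
    then obtain k where v: "v = F k (0, 0)" by blast
    obtain n T where f: "leaf n T (F k)" using F by blast
    show "norm v \<le> 2" unfolding v using leaf_bound0[OF f, of 0 0] \<delta> R_pos by simp
  qed
  then obtain \<zeta> r where r: "strict_mono r" "((\<lambda>k. F k (0, 0)) \<circ> r) \<longlonglongrightarrow> \<zeta>"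
    using bounded_imp_convergent_subsequence by blast
  then have sq: "leaf_seq (F \<circ> r) \<zeta>" using F by (simp add: leaf_seq_def o_def)
  have zJ: "\<zeta> \<in> J"
  proof -
    have "cmod ((P0 ^^ N) \<zeta>) \<le> 2" for N
    proof -
      have "eventually (\<lambda>k. \<forall>n\<in>{..N}. cmod (X a (snd (w (r k))) (fst (w (r k))) n) < 2) sequentially"
      proof (intro eventually_ball_finite ballI)
        fix n
        have "(\<lambda>k. X a (snd (w k)) (fst (w k)) n) \<longlonglongrightarrow> X a y x n"
          by (rule trapped_closed[OF a\<delta> yR]) (use w_lim in simp)
        then have "(\<lambda>k. cmod (X a (snd (w (r k))) (fst (w (r k))) n)) \<longlonglongrightarrow> cmod (X a y x n)"
          using LIMSEQ_subseq_LIMSEQ[OF _ r(1)] by (force simp: o_def intro: tendsto_norm)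
        then show "eventually (\<lambda>k. cmod (X a (snd (w (r k))) (fst (w (r k))) n) < 2) sequentially"
          using trapped_less[OF a\<delta> yR tr] by (rule order_tendstoD(2))
      qed simp
      then have "eventually (\<lambda>k. cmod ((P0 ^^ N) (F (r k) (0, 0))) \<le> 2) sequentially"
      proof eventually_elim
        case (elim k)
        obtain n T where f: "leaf n T (F (r k))" using F by blast
        have "cmod (snd (w (r k))) < R" using w(2)[of "r k"] R_pos by linarith
        from leaf_root[OF f this a\<delta>] have "cmod (X a (snd (w (r k))) (fst (w (r k))) n) = 2"
          using f by (simp add: w(3) leaf_def)
        \<comment> \<open>At the point \<open>w (r k)\<close> all iterates up to time
          \<open>N\<close> are below 2, whereas the leaf through it attains modulus 2 at time
          \<open>n\<close>.\<close>
        then have "N \<le> n" using elim by (metis atMost_iff less_irrefl nle_le)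
        then show ?case using leaf_bound[OF f, of 0 0 N] \<delta> R_pos by (simp add: X_a0)
      qed
      moreover have "(\<lambda>k. cmod ((P0 ^^ N) (F (r k) (0, 0)))) \<longlonglongrightarrow> cmod ((P0 ^^ N) \<zeta>)"
      proof -
        have "isCont (P0 ^^ N) \<zeta>" using continuous_P0_iter[of UNIV N] by (simp add: continuous_on_eq_continuous_at)
        then show ?thesis using r(2) by (intro tendsto_norm isCont_tendsto_compose[of _ "P0 ^^ N"]) (auto simp: o_def)
      qed
      ultimately show ?thesis by (intro tendsto_upperbound) auto
    qed
    then have "trapped 0 0 \<zeta>" by (simp add: trapped_def X_a0)
    moreover have "\<not> trapped 0 0 (F (r k) (0, 0))" for k
    proof -
      obtain n T where f: "leaf n T (F (r k))" using F by blast
      have "cmod (X 0 0 (F (r k) (0, 0)) n) = 2" using leaf_root[OF f, of 0 0] f \<delta> R_pos by (simp add: leaf_def)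
      then show ?thesis using trapped_less[of 0 0 "F (r k) (0, 0)" n] \<delta> R_pos by auto
    qed
    then have "\<zeta> \<in> closure {x. \<not> trapped 0 0 x}"
      unfolding closure_sequential using r(2) by (intro exI[of _ "(\<lambda>k. F k (0, 0)) \<circ> r"]) auto
    ultimately show ?thesis by (simp add: J_iff)
  qed
  have wr: "(\<lambda>k. w (r k)) \<longlonglongrightarrow> (x, y)" using LIMSEQ_subseq_LIMSEQ[OF w_lim r(1)] by (simp add: o_def)
  have "(\<lambda>k. F (r k) (snd (w (r k)), a) - F (r k) (y, a)) \<longlonglongrightarrow> 0"
  proof (rule Lim_null_comparison)
    show "eventually (\<lambda>k. norm (F (r k) (snd (w (r k)), a) - F (r k) (y, a)) \<le> 8 / R * cmod (snd (w (r k)) - y)) sequentially"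
    proof (intro always_eventually allI)
      fix k
      obtain n T where f: "leaf n T (F (r k))" using F by blast
      show "norm (F (r k) (snd (w (r k)), a) - F (r k) (y, a)) \<le> 8 / R * cmod (snd (w (r k)) - y)"
        using w(2)[of "r k"] y by (intro leaf_lipschitz_y[OF f a\<delta>]) auto
    qed
    have "(\<lambda>k. snd (w (r k))) \<longlonglongrightarrow> y" using tendsto_snd[OF wr] by simp
    then have "(\<lambda>k. 8 / R * cmod (snd (w (r k)) - y)) \<longlonglongrightarrow> 8 / R * cmod (y - y)" by (intro tendsto_intros)
    then show "(\<lambda>k. 8 / R * cmod (snd (w (r k)) - y)) \<longlonglongrightarrow> 0" by simp
  qed
  from tendsto_add[OF this phi_lim[OF sq yR a]] have "(\<lambda>k. fst (w (r k))) \<longlonglongrightarrow> phi a \<zeta> y" by (simp add: w(3))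
  moreover have "(\<lambda>k. fst (w (r k))) \<longlonglongrightarrow> x" using tendsto_fst[OF wr] by simp
  ultimately have "x = phi a \<zeta> y" using LIMSEQ_unique by blast
  then show "\<exists>\<zeta>\<in>J. x = phi a \<zeta> y" using zJ by blast
qed

end

section \<open>Conjugacy with the model map\<close>

text \<open>The conjugacy is built on the complement of the image of \<open>\<psi>\<close> by \<open>h0\<close> and transported by the
  dynamics; the fibrewise contraction makes the construction converge.\<close>

lemma fibered_contraction_semiconjugacy:
  fixes J :: "complex set" and \<psi> \<psi>' \<psi>i h0 :: "complex \<times> complex \<Rightarrow> complex \<times> complex"
  assumes X_def: "X = J \<times> ball 0 r" and J: "compact J" and r: "0 < s" "s < \<rho>" "\<rho> < r"
    and hom: "homeomorphism X (\<psi> ` X) \<psi> \<psi>i" and op: "openin (top_of_set X) (\<psi> ` X)"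
    and im: "\<psi> ` X \<subseteq> J \<times> cball 0 s" "\<psi>' ` X \<subseteq> J \<times> cball 0 s"
    and fst_\<psi>: "\<And>w. w \<in> X \<Longrightarrow> fst (\<psi>' w) = fst (\<psi> w)"
    and base: "\<And>v w. v \<in> X \<Longrightarrow> w \<in> X \<Longrightarrow> fst v = fst w \<Longrightarrow> fst (\<psi> v) = fst (\<psi> w)"
    and cont: "continuous_on X \<psi>'"
    and contr: "\<And>v w. v \<in> X \<Longrightarrow> w \<in> X \<Longrightarrow> fst v = fst w \<Longrightarrow> cmod (snd (\<psi>' v) - snd (\<psi>' w)) \<le> cmod (snd v - snd w) / 2"
    and h0: "continuous_on X h0" "h0 ` X \<subseteq> X" "\<And>w. w \<in> X \<Longrightarrow> fst (h0 w) = fst w"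
    and h0_\<psi>: "\<And>w. w \<in> X \<Longrightarrow> h0 (\<psi> w) = \<psi>' w"
    and h0_id: "\<And>w. w \<in> X \<Longrightarrow> cmod (snd w) \<ge> \<rho> \<Longrightarrow> h0 w = w"
  shows "\<exists>h. continuous_on X h \<and> h ` X \<subseteq> X \<and> (\<forall>w\<in>X. fst (h w) = fst w) \<and>
    (\<forall>w\<in>X. h (\<psi> w) = \<psi>' (h w)) \<and> (\<forall>w\<in>X - \<psi> ` X. h w = h0 w)"
proof -
  have rpos: "r > 0" using r by simp
  have c\<psi>: "continuous_on X \<psi>" using hom by (simp add: homeomorphism_def)
  have \<psi>i: "\<psi>i (\<psi> w) = w" if "w \<in> X" for w using hom that by (auto simp: homeomorphism_def)
  have im_X: "\<psi> w \<in> X" "\<psi>' w \<in> X" if "w \<in> X" for w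
    using im r that by (force simp: X_def)+
  \<comment> \<open>\<open>H n\<close> carries \<open>h0\<close> back along at most \<open>n\<close>
    preimages. Successive approximations differ only deep in the image of \<open>\<psi>\<close>,
    where the contraction of \<open>\<psi>'\<close> has halved the difference once per
    level.\<close>
  define H where "H = rec_nat h0 (\<lambda>_ h w. if w \<in> \<psi> ` X then \<psi>' (h (\<psi>i w)) else h0 w)"
  have H0: "H 0 = h0" and HS: "H (Suc n) = (\<lambda>w. if w \<in> \<psi> ` X then \<psi>' (H n (\<psi>i w)) else h0 w)" for n
    unfolding H_def by simp_all
  have H\<psi>: "H (Suc n) (\<psi> w) = \<psi>' (H n w)" if "w \<in> X" for n w
    using that \<psi>i by (auto simp: HS)
  have inv: "(\<forall>w\<in>X. H n w \<in> X \<and> fst (H n w) = fst w \<and> (cmod (snd w) \<ge> \<rho> \<longrightarrow> H n w = w)) \<and> continuous_on X (H n)" for n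
  proof (induction n)
    case 0
    show ?case using h0 h0_id by (auto simp: H0)
  next
    case (Suc n)
    have "H (Suc n) w \<in> X \<and> fst (H (Suc n) w) = fst w \<and> (cmod (snd w) \<ge> \<rho> \<longrightarrow> H (Suc n) w = w)" if w: "w \<in> X" for w
    proof (cases "w \<in> \<psi> ` X")
      case True
      then obtain v where v: "v \<in> X" "w = \<psi> v" by blast
      have "cmod (snd w) < \<rho>" using im(1) v r by force
      moreover have "fst (\<psi>' (H n v)) = fst (\<psi> v)"
        using fst_\<psi>[of "H n v"] base[of "H n v" v] Suc v by auto
      ultimately show ?thesis using Suc v im_X by (auto simp: H\<psi>)
    next
      case False
      then show ?thesis using w h0 h0_id by (auto simp: HS)
    qed
    moreover have "continuous_on X (H (Suc n))"
    proof -
      define T where "T = X - \<psi> ` (J \<times> cball 0 \<rho>)"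
      have sub: "J \<times> cball 0 \<rho> \<subseteq> X" using r by (auto simp: X_def)
      have "compact (\<psi> ` (J \<times> cball 0 \<rho>))"
        by (intro compact_continuous_image compact_Times J continuous_on_subset[OF c\<psi> sub] compact_cball)
      then have "closed (\<psi> ` (J \<times> cball 0 \<rho>))" by (rule compact_imp_closed)
      then have opT: "openin (top_of_set X) T" unfolding T_def by (metis Diff_eq open_Compl openin_open_Int)
      have un: "\<psi> ` X \<union> T = X" using sub im_X by (auto simp: T_def)
      have "continuous_on (\<psi> ` X \<union> T) (\<lambda>w. if w \<in> \<psi> ` X then \<psi>' (H n (\<psi>i w)) else h0 w)"
      proof (rule continuous_on_cases_local_open)
        have ci: "continuous_on (\<psi> ` X) \<psi>i" "\<psi>i ` \<psi> ` X = X" using hom by (auto simp: homeomorphism_def)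
        have "continuous_on (\<psi> ` X) (\<lambda>w. H n (\<psi>i w))"
          using Suc ci by (intro continuous_on_compose2[of "X" "H n" _ \<psi>i]) auto
        moreover have "H n (\<psi>i w) \<in> X" if "w \<in> \<psi> ` X" for w
        proof -
          have "\<psi>i w \<in> X" using ci(2) that by blast
          then show ?thesis using Suc by blast
        qed
        ultimately show "continuous_on (\<psi> ` X) (\<lambda>w. \<psi>' (H n (\<psi>i w)))"
          by (intro continuous_on_compose2[OF cont] image_subsetI)
        show "continuous_on T h0" using h0(1) by (rule continuous_on_subset) (auto simp: T_def)
        fix w assume "w \<in> \<psi> ` X \<and> w \<notin> \<psi> ` X \<or> w \<in> T \<and> w \<in> \<psi> ` X"
        then obtain v where v: "v \<in> X" "w = \<psi> v" "w \<in> T" by blast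
        then have "cmod (snd v) \<ge> \<rho>" by (force simp: T_def X_def)
        then have "H n v = v" using Suc v by blast
        then show "\<psi>' (H n (\<psi>i w)) = h0 w" using v \<psi>i h0_\<psi> by simp
      qed (use un op opT in simp_all)
      then show ?thesis by (simp add: un HS)
    qed
    ultimately show ?case by blast
  qed
  define f where "f = (\<lambda>n w. snd (H (Suc n) w) - snd (H n w))"
  have fb: "norm (f n w) \<le> 2 * r * (1 / 2) ^ n" if w: "w \<in> X" for n w
    using w
  proof (induction n arbitrary: w)
    case 0
    have "H 1 w \<in> X" "H 0 w \<in> X" using inv 0 by blast+
    then have "cmod (snd (H 1 w)) < r" "cmod (snd (H 0 w)) < r" by (auto simp: X_def)
    then show ?case using norm_triangle_ineq4[of "snd (H 1 w)" "snd (H 0 w)"] by (simp add: f_def)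
  next
    case (Suc n)
    show ?case
    proof (cases "w \<in> \<psi> ` X")
      case True
      then obtain v where v: "v \<in> X" "w = \<psi> v" by blast
      have "norm (f (Suc n) w) = cmod (snd (\<psi>' (H (Suc n) v)) - snd (\<psi>' (H n v)))"
        by (simp add: f_def v H\<psi>)
      also have "\<dots> \<le> cmod (snd (H (Suc n) v) - snd (H n v)) / 2"
        using inv v by (intro contr) auto
      also have "\<dots> \<le> 2 * r * (1 / 2) ^ n / 2" using Suc.IH[OF v(1)] by (simp add: f_def)
      finally show ?thesis by simp
    next
      case False
      then show ?thesis using rpos by (simp add: f_def HS)
    qed
  qed
  define L where "L = (\<lambda>w. snd (h0 w) + (\<Sum>n. f n w))"
  have "summable (\<lambda>n. 2 * r * (1 / 2 :: real) ^ n)" by (intro summable_mult summable_geometric) simp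
  then have "uniform_limit X (\<lambda>n w. \<Sum>i<n. f i w) (\<lambda>w. \<Sum>n. f n w) sequentially"
    using fb by (intro Weierstrass_m_test) auto
  then have "uniform_limit X (\<lambda>n w. snd (h0 w) + (\<Sum>i<n. f i w)) L sequentially"
    unfolding L_def by (intro uniform_limit_intros)
  moreover have "snd (h0 w) + (\<Sum>i<n. f i w) = snd (H n w)" for n w
    using sum_lessThan_telescope[of "\<lambda>n. snd (H n w)" n] by (simp add: f_def H0)
  ultimately have ul: "uniform_limit X (\<lambda>n w. snd (H n w)) L sequentially" by simp
  have contL: "continuous_on X L"
    using inv by (intro uniform_limit_theorem[OF _ ul] always_eventually allI continuous_on_snd) auto
  define h where "h = (\<lambda>w. (fst w, L w))"
  have lim: "(\<lambda>n. H n w) \<longlonglongrightarrow> h w" if w: "w \<in> X" for w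
  proof -
    have "(\<lambda>n. snd (H n w)) \<longlonglongrightarrow> L w" by (rule tendsto_uniform_limitI[OF ul w])
    then have "(\<lambda>n. (fst w, snd (H n w))) \<longlonglongrightarrow> h w" unfolding h_def by (intro tendsto_intros)
    moreover have "(fst w, snd (H n w)) = H n w" for n using inv w by (metis prod.collapse)
    ultimately show ?thesis by simp
  qed
  have off: "h w = h0 w" if w: "w \<in> X - \<psi> ` X" for w
  proof -
    have "H n w = h0 w" for n using w by (cases n) (auto simp: H0 HS)
    then show ?thesis using lim[of w] w LIMSEQ_unique[of "\<lambda>n. h0 w"] by auto
  qed
  have hX: "h w \<in> X" if w: "w \<in> X" for w
  proof (cases "w \<in> \<psi> ` X")
    case True
    then obtain v where v: "v \<in> X" "w = \<psi> v" by blast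
    have "(\<lambda>n. H (Suc n) w) \<longlonglongrightarrow> h w" using lim[OF w] by (rule LIMSEQ_Suc)
    moreover have "H (Suc n) w \<in> J \<times> cball 0 s" for n using inv v im(2) by (auto simp: H\<psi>)
    moreover have "closed (J \<times> cball (0 :: complex) s)" using J by (intro closed_Times) (auto simp: compact_imp_closed)
    ultimately have "h w \<in> J \<times> cball 0 s" using closed_sequentially[of "J \<times> cball 0 s" "\<lambda>n. H (Suc n) w" "h w"] by blast
    then show ?thesis using r by (auto simp: X_def)
  next
    case False
    then show ?thesis using off[of w] h0 w by auto
  qed
  have h\<psi>: "h (\<psi> w) = \<psi>' (h w)" if w: "w \<in> X" for w
  proof -
    have "(\<lambda>n. \<psi>' (H n w)) \<longlonglongrightarrow> \<psi>' (h w)"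
      using inv w by (intro continuous_on_tendsto_compose[OF cont lim[OF w] hX[OF w]]) auto
    moreover have "(\<lambda>n. H (Suc n) (\<psi> w)) \<longlonglongrightarrow> h (\<psi> w)" by (rule LIMSEQ_Suc[OF lim[OF im_X(1)[OF w]]])
    ultimately show ?thesis using H\<psi>[OF w] LIMSEQ_unique by (metis (no_types, lifting) ext)
  qed
  have "continuous_on X h" unfolding h_def by (intro continuous_intros contL)
  then show ?thesis using hX h\<psi> off by (intro exI[of _ h]) (auto simp: h_def)
qed

text \<open>Pulling a point back \<open>n\<close> times along \<open>\<psi>\<close>, or fewer times
  until it leaves the image, bounds its displacement by \<open>2 r / 2^n\<close>. Applied to the two
  compositions of opposite semiconjugacies, it shows that they are mutually inverse.\<close>

lemma fibered_contraction_rigidity: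
  fixes J :: "complex set" and \<psi> k :: "complex \<times> complex \<Rightarrow> complex \<times> complex"
  assumes X_def: "X = J \<times> ball 0 r" and contr: "\<And>v w. v \<in> X \<Longrightarrow> w \<in> X \<Longrightarrow> fst v = fst w \<Longrightarrow> cmod (snd (\<psi> v) - snd (\<psi> w)) \<le> cmod (snd v - snd w) / 2"
    and k: "\<And>w. w \<in> X \<Longrightarrow> k w \<in> X \<and> fst (k w) = fst w"
    and k\<psi>: "\<And>w. w \<in> X \<Longrightarrow> k (\<psi> w) = \<psi> (k w)"
    and off: "\<And>w. w \<in> X \<Longrightarrow> w \<notin> \<psi> ` X \<Longrightarrow> k w = w"
    and w: "w \<in> X"
  shows "k w = w"
proof -
  have *: "cmod (snd (k w) - snd w) \<le> 2 * r * (1 / 2) ^ n" if "w \<in> X" for n w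
    using that
  proof (induction n arbitrary: w)
    case 0
    have "cmod (snd (k w)) < r" "cmod (snd w) < r" using k[OF 0] 0 by (auto simp: X_def)
    then show ?case using norm_triangle_ineq4[of "snd (k w)" "snd w"] by simp
  next
    case (Suc n)
    show ?case
    proof (cases "w \<in> \<psi> ` X")
      case True
      then obtain v where v: "v \<in> X" "w = \<psi> v" by blast
      have "cmod (snd (k w) - snd w) \<le> cmod (snd (k v) - snd v) / 2"
        unfolding v(2) k\<psi>[OF v(1)] using k[OF v(1)] v(1) by (intro contr) auto
      also have "\<dots> \<le> 2 * r * (1 / 2) ^ n / 2" using Suc.IH[OF v(1)] by simp
      finally show ?thesis by simp
    next
      case False
      have "r > 0" using Suc.prems by (auto simp: X_def intro: le_less_trans[OF norm_ge_zero])
      then show ?thesis using off[OF Suc.prems False] by simp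
    qed
  qed
  have "(\<lambda>n. 2 * r * (1 / 2 :: real) ^ n) \<longlonglongrightarrow> 2 * r * 0"
    by (intro tendsto_intros LIMSEQ_power_zero) simp
  then have "cmod (snd (k w) - snd w) \<le> 0"
    by (intro LIMSEQ_le_const[of _ 0]) (use *[OF w] in auto)
  then show ?thesis using k[OF w] by (simp add: prod_eq_iff)
qed

text \<open>The semiconjugacy construction is run from \<open>\<psi>\<close> to
  \<open>\<psi>'\<close> with \<open>h0\<close> and back with its inverse; rigidity shows that both
  compositions are the identity.\<close>

lemma fibered_contraction_conjugacy:
  fixes J :: "complex set" and \<psi> \<psi>' \<psi>i h0 h0' :: "complex \<times> complex \<Rightarrow> complex \<times> complex"
  assumes X_def: "X = J \<times> ball 0 r" and J: "compact J" and r: "0 < s" "s < \<rho>" "\<rho> < r"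
    and hom: "homeomorphism X (\<psi> ` X) \<psi> \<psi>i" and op: "openin (top_of_set X) (\<psi> ` X)"
    and im: "\<psi> ` X \<subseteq> J \<times> cball 0 s" "\<psi>' ` X \<subseteq> J \<times> cball 0 s"
    and fst_\<psi>: "\<And>w. w \<in> X \<Longrightarrow> fst (\<psi>' w) = fst (\<psi> w)"
    and base: "\<And>v w. v \<in> X \<Longrightarrow> w \<in> X \<Longrightarrow> fst v = fst w \<Longrightarrow> fst (\<psi> v) = fst (\<psi> w)"
    and contr: "\<And>v w. v \<in> X \<Longrightarrow> w \<in> X \<Longrightarrow> fst v = fst w \<Longrightarrow> cmod (snd (\<psi> v) - snd (\<psi> w)) \<le> cmod (snd v - snd w) / 2"
    and contr': "\<And>v w. v \<in> X \<Longrightarrow> w \<in> X \<Longrightarrow> fst v = fst w \<Longrightarrow> cmod (snd (\<psi>' v) - snd (\<psi>' w)) \<le> cmod (snd v - snd w) / 2"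
    and h0: "homeomorphism X X h0 h0'" "\<And>w. w \<in> X \<Longrightarrow> fst (h0 w) = fst w"
    and h0_\<psi>: "\<And>w. w \<in> X \<Longrightarrow> h0 (\<psi> w) = \<psi>' w"
    and h0_id: "\<And>w. w \<in> X \<Longrightarrow> cmod (snd w) \<ge> \<rho> \<Longrightarrow> h0 w = w"
  shows "\<exists>h h'. homeomorphism X X h h' \<and> (\<forall>w\<in>X. h (\<psi> w) = \<psi>' (h w))"
proof -
  have hh: "continuous_on X h0" "continuous_on X h0'" "h0 ` X = X" "h0' ` X = X"
    "\<And>w. w \<in> X \<Longrightarrow> h0' (h0 w) = w" "\<And>w. w \<in> X \<Longrightarrow> h0 (h0' w) = w"
    using h0(1) by (auto simp: homeomorphism_def)
  have pp: "continuous_on X \<psi>" "continuous_on (\<psi> ` X) \<psi>i" "\<And>w. w \<in> X \<Longrightarrow> \<psi>i (\<psi> w) = w"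
    using hom by (auto simp: homeomorphism_def)
  have \<psi>X: "\<psi> ` X \<subseteq> X" "\<psi>' ` X \<subseteq> X" using im r by (force simp: X_def)+
  have imeq: "\<psi>' ` X = h0 ` \<psi> ` X" using h0_\<psi> by force
  have cont': "continuous_on X \<psi>'"
    by (rule continuous_on_eq[OF continuous_on_compose2[OF hh(1) pp(1) \<psi>X(1)] h0_\<psi>])
  have op': "openin (top_of_set X) (\<psi>' ` X)"
    unfolding imeq by (rule homeomorphism_imp_open_map[OF h0(1) op])
  \<comment> \<open>As \<open>\<psi>' = h0 \<circ> \<psi>\<close>, everything the reverse direction
    requires of \<open>\<psi>'\<close> is transported from \<open>\<psi>\<close>.\<close>
  have hom': "homeomorphism X (\<psi>' ` X) \<psi>' (\<psi>i \<circ> h0')"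
  proof (rule homeomorphismI[OF cont'])
    have sub: "h0' ` \<psi>' ` X \<subseteq> \<psi> ` X"
    proof (intro image_subsetI)
      fix v assume "v \<in> \<psi>' ` X"
      then obtain u where u: "u \<in> X" "v = h0 (\<psi> u)" unfolding imeq by blast
      then have "h0' v = \<psi> u" using hh(5)[of "\<psi> u"] \<psi>X(1) by blast
      then show "h0' v \<in> \<psi> ` X" using u(1) by simp
    qed
    show "continuous_on (\<psi>' ` X) (\<psi>i \<circ> h0')"
      by (intro continuous_on_compose continuous_on_subset[OF hh(2) \<psi>X(2)] continuous_on_subset[OF pp(2) sub])
    have inv: "(\<psi>i \<circ> h0') (\<psi>' w) = w" if "w \<in> X" for w
    proof -
      have "\<psi> w \<in> X" using \<psi>X(1) that by blast
      then show ?thesis unfolding o_apply h0_\<psi>[OF that, symmetric] by (simp only: hh(5) pp(3)[OF that])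
    qed
    show "(\<psi>i \<circ> h0') ` \<psi>' ` X \<subseteq> X" using inv by (intro image_subsetI) (metis imageE)
    show "(\<psi>i \<circ> h0') (\<psi>' w) = w" if "w \<in> X" for w using inv that .
    show "\<psi>' ((\<psi>i \<circ> h0') v) = v" if "v \<in> \<psi>' ` X" for v using that inv by (metis imageE)
  qed simp
  have fst_h0': "fst (h0' w) = fst w" if "w \<in> X" for w
    using h0(2)[of "h0' w"] hh(4,6) that by (metis image_eqI)
  have h0'_\<psi>: "h0' (\<psi>' w) = \<psi> w" if "w \<in> X" for w
  proof -
    have "\<psi> w \<in> X" using \<psi>X(1) that by blast
    then show ?thesis unfolding h0_\<psi>[OF that, symmetric] by (rule hh(5))
  qed
  have h0'_id: "h0' w = w" if "w \<in> X" "cmod (snd w) \<ge> \<rho>" for w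
    using h0_id[OF that] hh(5)[OF that(1)] by simp
  have "\<exists>h. continuous_on X h \<and> h ` X \<subseteq> X \<and> (\<forall>w\<in>X. fst (h w) = fst w) \<and>
      (\<forall>w\<in>X. h (\<psi> w) = \<psi>' (h w)) \<and> (\<forall>w\<in>X - \<psi> ` X. h w = h0 w)"
    by (rule fibered_contraction_semiconjugacy[OF X_def J r hom op im fst_\<psi> base cont' contr' hh(1) equalityD1[OF hh(3)] h0(2) h0_\<psi> h0_id])
  then obtain h where h: "continuous_on X h" "h ` X \<subseteq> X" "\<forall>w\<in>X. fst (h w) = fst w"
    "\<forall>w\<in>X. h (\<psi> w) = \<psi>' (h w)" "\<forall>w\<in>X - \<psi> ` X. h w = h0 w"
    by (elim exE conjE) (rule that)
  have base': "fst (\<psi>' v) = fst (\<psi>' w)" if "v \<in> X" "w \<in> X" "fst v = fst w" for v w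
    using base[OF that] unfolding fst_\<psi>[OF that(1)] fst_\<psi>[OF that(2)] .
  have "\<exists>g. continuous_on X g \<and> g ` X \<subseteq> X \<and> (\<forall>w\<in>X. fst (g w) = fst w) \<and>
      (\<forall>w\<in>X. g (\<psi>' w) = \<psi> (g w)) \<and> (\<forall>w\<in>X - \<psi>' ` X. g w = h0' w)"
    by (rule fibered_contraction_semiconjugacy[OF X_def J r hom' op' im(2,1) fst_\<psi>[symmetric] base' pp(1) contr hh(2) equalityD1[OF hh(4)] fst_h0' h0'_\<psi> h0'_id])
  then obtain g where g: "continuous_on X g" "g ` X \<subseteq> X" "\<forall>w\<in>X. fst (g w) = fst w"
    "\<forall>w\<in>X. g (\<psi>' w) = \<psi> (g w)" "\<forall>w\<in>X - \<psi>' ` X. g w = h0' w"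
    by (elim exE conjE) (rule that)
  have "g (h w) = w" if "w \<in> X" for w
  proof (rule fibered_contraction_rigidity[where J = J and r = r and X = X and \<psi> = \<psi> and k = "\<lambda>w. g (h w)", OF X_def contr _ _ _ that])
    fix w assume w: "w \<in> X"
    show "g (h w) \<in> X \<and> fst (g (h w)) = fst w" using g h w by (auto simp: image_subset_iff)
    show "g (h (\<psi> w)) = \<psi> (g (h w))" using g h w by (auto simp: image_subset_iff)
    assume w': "w \<notin> \<psi> ` X"
    then have "h w = h0 w" using h w by blast
    moreover have "h0 w \<notin> \<psi>' ` X"
    proof
      assume "h0 w \<in> \<psi>' ` X"
      then obtain v where "v \<in> X" "h0 w = h0 (\<psi> v)" unfolding imeq by blast
      then have "w = \<psi> v" using hh(5) w \<psi>X by (metis image_subset_iff)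
      then show False using w' \<open>v \<in> X\<close> by blast
    qed
    moreover have "h0 w \<in> X" using hh w by blast
    ultimately show "g (h w) = w" using g(5) hh(5)[OF w] by simp
  qed
  moreover have "h (g w) = w" if "w \<in> X" for w
  proof (rule fibered_contraction_rigidity[where J = J and r = r and X = X and \<psi> = \<psi>' and k = "\<lambda>w. h (g w)", OF X_def contr' _ _ _ that])
    fix w assume w: "w \<in> X"
    show "h (g w) \<in> X \<and> fst (h (g w)) = fst w" using g h w by (auto simp: image_subset_iff)
    show "h (g (\<psi>' w)) = \<psi>' (h (g w))" using g h w by (auto simp: image_subset_iff)
    assume w': "w \<notin> \<psi>' ` X"
    then have "g w = h0' w" using g w by blast
    moreover have "h0' w \<notin> \<psi> ` X"
    proof
      assume "h0' w \<in> \<psi> ` X"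
      then have "h0 (h0' w) \<in> \<psi>' ` X" unfolding imeq by blast
      then show False using w' hh(6)[OF w] by simp
    qed
    moreover have "h0' w \<in> X" using hh w by blast
    ultimately show "h (g w) = w" using h(5) hh(6)[OF w] by simp
  qed
  ultimately have "homeomorphism X X h g" using h g by (intro homeomorphismI) auto
  then show ?thesis using h(4) by blast
qed

text \<open>On each fibre the map is the identity plus a contraction, hence bijective by Banach's
  fixed point theorem, and it is the identity beyond radius \<open>\<rho>\<close>, which keeps the
  disc in place. Compactness of \<open>J\<close> times the closed disc makes the inverse
  continuous.\<close>

lemma fibered_perturbation_homeomorphism:
  fixes J :: "complex set" and D :: "complex \<times> complex \<Rightarrow> complex"
  assumes J: "compact J" and r: "0 < \<rho>" "\<rho> < r" and cont: "continuous_on (J \<times> UNIV) D"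
    and lip: "\<And>\<zeta> z z'. \<zeta> \<in> J \<Longrightarrow> cmod (D (\<zeta>, z) - D (\<zeta>, z')) \<le> cmod (z - z') / 2"
    and supp: "\<And>\<zeta> z. \<zeta> \<in> J \<Longrightarrow> cmod z \<ge> \<rho> \<Longrightarrow> D (\<zeta>, z) = 0"
  shows "\<exists>h'. homeomorphism (J \<times> ball 0 r) (J \<times> ball 0 r) (\<lambda>w. (fst w, snd w + D w)) h'"
proof -
  define h where "h = (\<lambda>w. (fst w, snd w + D w))"
  have inj: "z = z'" if "\<zeta> \<in> J" "z + D (\<zeta>, z) = z' + D (\<zeta>, z')" for \<zeta> z z'
  proof -
    have "z - z' = - (D (\<zeta>, z) - D (\<zeta>, z'))" using that(2) by (simp add: algebra_simps)
    then have "cmod (z - z') \<le> cmod (z - z') / 2" using lip[OF that(1), of z z'] by (metis norm_minus_cancel)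
    then show ?thesis by simp
  qed
  \<comment> \<open>Were the image of modulus at least \<open>t\<close>, it would be fixed, since
    \<open>D\<close> vanishes there, and so have a second preimage.\<close>
  have stay: "cmod (z + D (\<zeta>, z)) < t" if "\<zeta> \<in> J" "\<rho> \<le> t" "cmod z < t" for \<zeta> z t
  proof (rule ccontr)
    assume "\<not> ?thesis"
    then have *: "t \<le> cmod (z + D (\<zeta>, z))" by simp
    have D0: "D (\<zeta>, z + D (\<zeta>, z)) = 0" by (rule supp[OF that(1)]) (use that(2) * in linarith)
    have "z + D (\<zeta>, z) = z" by (rule inj[OF that(1)]) (simp only: D0 add_0_right)
    then show False using * that by simp
  qed
  have surj: "\<exists>z. cmod z < r \<and> z + D (\<zeta>, z) = w" if "\<zeta> \<in> J" "cmod w < r" for \<zeta> w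
  proof -
    have "\<exists>!z. w - D (\<zeta>, z) = z"
    proof (rule banach_fix_type[of "1 / 2"]; (intro allI)?)
      fix x y show "dist (w - D (\<zeta>, x)) (w - D (\<zeta>, y)) \<le> 1 / 2 * dist x y"
        using lip[OF that(1), of y x] by (simp add: dist_norm norm_minus_commute)
    qed auto
    then obtain z where z: "w - D (\<zeta>, z) = z" by blast
    have "cmod z < r"
    proof (rule ccontr)
      assume "\<not> ?thesis"
      then have "D (\<zeta>, z) = 0" using that r by (intro supp) auto
      then show False using z that \<open>\<not> cmod z < r\<close> by simp
    qed
    then show ?thesis using z by (intro exI[of _ z]) (auto simp: algebra_simps)
  qed
  have conth: "continuous_on (J \<times> cball 0 r) h"
    unfolding h_def by (intro continuous_intros continuous_on_subset[OF cont]) auto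
  have "inj_on h (J \<times> cball 0 r)"
  proof (rule inj_onI)
    fix v w assume v: "v \<in> J \<times> cball 0 r" and w: "w \<in> J \<times> cball 0 r" and e: "h v = h w"
    have f: "fst v = fst w" and s: "snd v + D v = snd w + D w" using e by (simp_all add: h_def)
    have "fst v \<in> J" using v by (rule mem_Times_iff[THEN iffD1, THEN conjunct1])
    then have "snd v = snd w" by (rule inj) (use f s in \<open>metis prod.collapse\<close>)
    then show "v = w" using f by (rule prod_eqI[rotated])
  qed
  then obtain h' where h': "homeomorphism (J \<times> cball 0 r) (h ` (J \<times> cball 0 r)) h h'"
    using homeomorphism_compact[OF compact_Times[OF J compact_cball] conth refl] by blast
  have im: "h ` (J \<times> ball 0 r) = J \<times> ball 0 r"
  proof
    show "h ` (J \<times> ball 0 r) \<subseteq> J \<times> ball 0 r" using stay r by (auto simp: h_def)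
    show "J \<times> ball 0 r \<subseteq> h ` (J \<times> ball 0 r)"
    proof (clarify)
      fix \<zeta> w assume w: "\<zeta> \<in> J" "w \<in> ball (0 :: complex) r"
      then obtain z where z: "cmod z < r" "z + D (\<zeta>, z) = w" using surj[of \<zeta> w] by auto
      show "(\<zeta>, w) \<in> h ` (J \<times> ball 0 r)"
        by (rule image_eqI[of _ _ "(\<zeta>, z)"]) (use z w in \<open>auto simp: h_def\<close>)
    qed
  qed
  have "homeomorphism (J \<times> ball 0 r) (J \<times> ball 0 r) h h'"
    by (rule homeomorphism_of_subsets[OF h' _ subset_refl im]) auto
  then show ?thesis unfolding h_def by blast
qed

section \<open>The model map over a compact invariant set of a quadratic polynomial\<close>

locale quadratic_invariant_set =
  fixes J :: "complex set" and c0 :: complex and \<kappa> :: real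
  assumes compact_J: "compact J" and \<kappa>_pos: "0 < \<kappa>" "\<kappa> \<le> 1"
    and J_lower: "\<zeta> \<in> J \<Longrightarrow> \<kappa> \<le> cmod \<zeta>" and J_upper: "\<zeta> \<in> J \<Longrightarrow> cmod \<zeta> < 2"
    and invariant: "\<zeta> \<in> J \<Longrightarrow> \<zeta>\<^sup>2 + c0 \<in> J"
    and surjective: "\<zeta>' \<in> J \<Longrightarrow> \<exists>\<zeta>\<in>J. \<zeta>\<^sup>2 + c0 = \<zeta>'"
    and symmetric: "\<zeta> \<in> J \<Longrightarrow> - \<zeta> \<in> J"
begin

lemma J_nz: "\<zeta> \<in> J \<Longrightarrow> \<zeta> \<noteq> 0"
  using J_lower[of 0] \<kappa>_pos by auto

text \<open>Compactness of \<open>J\<close> makes the map proper: preimages of a convergent sequence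
  subconverge in the first coordinate.\<close>

lemma closed_root_image:
  assumes S: "closed S" "S \<subseteq> J \<times> (UNIV :: complex set)"
  shows "closed ((\<lambda>w. ((fst w)\<^sup>2 + c0, snd w)) ` S)"
  unfolding closed_sequential_limits
proof (intro allI impI, elim conjE)
  fix x l assume "\<forall>n. x n \<in> (\<lambda>w. ((fst w)\<^sup>2 + c0, snd w)) ` S" and l: "x \<longlonglongrightarrow> l"
  then have "\<forall>n. \<exists>w. w \<in> S \<and> x n = ((fst w)\<^sup>2 + c0, snd w)" by blast
  then obtain s where s: "\<And>n. s n \<in> S" "\<And>n. x n = ((fst (s n))\<^sup>2 + c0, snd (s n))" by metis
  have "\<forall>n. fst (s n) \<in> J" using subsetD[OF S(2) s(1)] by (simp add: mem_Times_iff)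
  then obtain \<zeta> k where k: "strict_mono k" "((\<lambda>n. fst (s n)) \<circ> k) \<longlonglongrightarrow> \<zeta>"
    using compact_imp_seq_compact[OF compact_J] unfolding seq_compact_def by metis
  have lk: "(x \<circ> k) \<longlonglongrightarrow> l" using LIMSEQ_subseq_LIMSEQ[OF l k(1)] .
  have snd: "(\<lambda>n. snd (s (k n))) \<longlonglongrightarrow> snd l" using tendsto_snd[OF lk] by (simp add: o_def s(2))
  have fst: "(\<lambda>n. fst (s (k n))) \<longlonglongrightarrow> \<zeta>" using k(2) by (simp add: o_def)
  have "(\<lambda>n. s (k n)) \<longlonglongrightarrow> (\<zeta>, snd l)" using tendsto_Pair[OF fst snd] by simp
  then have mem: "(\<zeta>, snd l) \<in> S" using S(1) s(1) closed_sequentially[of S "\<lambda>n. s (k n)"] by blast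
  have "(\<lambda>n. fst (x (k n))) \<longlonglongrightarrow> \<zeta>\<^sup>2 + c0" unfolding s(2) fst_conv by (intro tendsto_intros fst)
  moreover have "(\<lambda>n. fst (x (k n))) \<longlonglongrightarrow> fst l" using tendsto_fst[OF lk] by (simp add: o_def)
  ultimately have "fst l = \<zeta>\<^sup>2 + c0" by (rule LIMSEQ_unique[symmetric])
  then show "l \<in> (\<lambda>w. ((fst w)\<^sup>2 + c0, snd w)) ` S"
    by (intro image_eqI[OF _ mem]) (simp add: prod_eq_iff)
qed

text \<open>\<open>(\<zeta>, t) \<mapsto> (\<zeta>\<^sup>2 + c0, t)\<close> is a closed surjection
  of \<open>J \<times> UNIV\<close> onto itself, so a function that factors through it is continuous
  on the quotient.\<close>

lemma continuous_on_descend: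
  fixes f g :: "complex \<times> complex \<Rightarrow> complex"
  assumes f: "continuous_on (J \<times> UNIV) f" and g: "\<And>\<zeta> t. \<zeta> \<in> J \<Longrightarrow> g (\<zeta>\<^sup>2 + c0, t) = f (\<zeta>, t)"
  shows "continuous_on (J \<times> UNIV) g"
proof -
  have cl: "closed (J \<times> (UNIV :: complex set))" using compact_J by (intro closed_Times) (auto simp: compact_imp_closed)
  show ?thesis
    unfolding continuous_on_closed_vimage[OF cl]
  proof (intro allI impI)
    fix B :: "complex set" assume B: "closed B"
    have "closed (f -` B \<inter> (J \<times> UNIV))" using f B unfolding continuous_on_closed_vimage[OF cl] by blast
    then have "closed ((\<lambda>w. ((fst w)\<^sup>2 + c0, snd w)) ` (f -` B \<inter> (J \<times> UNIV)))" by (rule closed_root_image) auto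
    moreover have "(\<lambda>w. ((fst w)\<^sup>2 + c0, snd w)) ` (f -` B \<inter> (J \<times> UNIV)) = g -` B \<inter> (J \<times> UNIV)"
    proof
      show "(\<lambda>w. ((fst w)\<^sup>2 + c0, snd w)) ` (f -` B \<inter> (J \<times> UNIV)) \<subseteq> g -` B \<inter> (J \<times> UNIV)"
        using g invariant by auto
      show "g -` B \<inter> (J \<times> UNIV) \<subseteq> (\<lambda>w. ((fst w)\<^sup>2 + c0, snd w)) ` (f -` B \<inter> (J \<times> UNIV))"
      proof
        fix w assume w: "w \<in> g -` B \<inter> (J \<times> UNIV)"
        then obtain \<zeta> where \<zeta>: "\<zeta> \<in> J" "\<zeta>\<^sup>2 + c0 = fst w" using surjective[of "fst w"] by auto
        show "w \<in> (\<lambda>w. ((fst w)\<^sup>2 + c0, snd w)) ` (f -` B \<inter> (J \<times> UNIV))"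
          by (rule image_eqI[of _ _ "(\<zeta>, snd w)"]) (use w \<zeta> g[OF \<zeta>(1), of "snd w"] in auto)
      qed
    qed
    ultimately show "closed (g -` B \<inter> (J \<times> UNIV))" by simp
  qed
qed

definition psi :: "complex \<Rightarrow> complex \<times> complex \<Rightarrow> complex \<times> complex" where
  "psi a w = ((fst w)\<^sup>2 + c0, a * fst w - a\<^sup>2 * snd w / (2 * fst w))"

lemma psi_eq_iff:
  assumes "\<zeta> \<in> J" "a \<noteq> 0"
  shows "psi a (\<zeta>, z) = (\<zeta>', z') \<longleftrightarrow> \<zeta>\<^sup>2 + c0 = \<zeta>' \<and> z = 2 * \<zeta> / a * (\<zeta> - z' / a)"
  using assms J_nz[of \<zeta>] by (auto simp: psi_def field_simps power2_eq_square)

lemma psi_homeomorphism: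
  assumes a: "a \<noteq> 0" "cmod a * r < \<kappa>\<^sup>2"
  shows "\<exists>g. homeomorphism (J \<times> ball 0 r) (psi a ` (J \<times> ball 0 r)) (psi a) g"
proof -
  have cont: "continuous_on (J \<times> cball 0 r) (psi a)"
    unfolding psi_def using J_nz by (intro continuous_intros) auto
  have "inj_on (psi a) (J \<times> cball 0 r)"
  proof (rule inj_onI)
    fix v w assume v: "v \<in> J \<times> cball 0 r" and w: "w \<in> J \<times> cball 0 r" and eq: "psi a v = psi a w"
    obtain \<zeta> z where vz: "v = (\<zeta>, z)" by force
    obtain \<xi> x where wx: "w = (\<xi>, x)" by force
    have J: "\<zeta> \<in> J" "\<xi> \<in> J" using v w vz wx by auto
    note nz = J[THEN J_nz]
    have sq: "\<zeta>\<^sup>2 = \<xi>\<^sup>2" and e2: "a * \<zeta> - a\<^sup>2 * z / (2 * \<zeta>) = a * \<xi> - a\<^sup>2 * x / (2 * \<xi>)"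
      using eq by (auto simp: psi_def vz wx)
    show "v = w"
    proof (cases "\<zeta> = \<xi>")
      case True
      then show ?thesis using e2 a nz by (simp add: vz wx)
    next
      case False
      then have "\<xi> = - \<zeta>" using sq by (simp add: power2_eq_iff)
      \<comment> \<open>The fibres over the two roots \<open>\<zeta>\<close> and
        \<open>- \<zeta>\<close> land in discs around \<open>a \<zeta>\<close> and
        \<open>- a \<zeta>\<close>; an overlap needs \<open>4 \<zeta>^2 = a (z + x)\<close>, too
        large for small \<open>a\<close>.\<close>
      then have "a * (4 * \<zeta>\<^sup>2) = a * (a * (z + x))" using e2 nz by (simp add: field_simps power2_eq_square)
      then have "4 * \<zeta>\<^sup>2 = a * (z + x)" using a by simp
      then have "cmod (4 * \<zeta>\<^sup>2) = cmod (a * (z + x))" by (rule arg_cong)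
      then have "4 * (cmod \<zeta>)\<^sup>2 = cmod a * cmod (z + x)" by (simp add: norm_mult norm_power)
      moreover have "cmod (z + x) \<le> 2 * r" using v w vz wx norm_triangle_ineq[of z x] by auto
      then have "cmod a * cmod (z + x) \<le> cmod a * (2 * r)" by (rule mult_left_mono) simp
      moreover have "\<kappa>\<^sup>2 \<le> (cmod \<zeta>)\<^sup>2" using J_lower[OF J(1)] \<kappa>_pos by (intro power_mono) auto
      moreover have "\<kappa>\<^sup>2 > 0" using \<kappa>_pos by simp
      ultimately have False using a(2) by linarith
      then show ?thesis ..
    qed
  qed
  then obtain g where g: "homeomorphism (J \<times> cball 0 r) (psi a ` (J \<times> cball 0 r)) (psi a) g"
    using homeomorphism_compact[OF compact_Times[OF compact_J compact_cball] cont refl] by blast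
  have "homeomorphism (J \<times> ball 0 r) (psi a ` (J \<times> ball 0 r)) (psi a) g"
    by (rule homeomorphism_of_subsets[OF g _ subset_refl refl]) auto
  then show ?thesis by blast
qed

text \<open>A point is missed by the image exactly if the candidate preimages over both roots have
  modulus at least \<open>r\<close>. This is a closed condition upstairs, and it descends to a
  closed set.\<close>

lemma psi_openin:
  assumes a: "a \<noteq> 0" and sub: "psi a ` (J \<times> ball 0 r) \<subseteq> J \<times> ball 0 r"
  shows "openin (top_of_set (J \<times> ball 0 r)) (psi a ` (J \<times> ball 0 r))"
proof -
  define A where "A = (J \<times> (UNIV :: complex set)) \<inter> {w. r \<le> cmod (2 * fst w / a * (fst w - snd w / a))}
    \<inter> {w. r \<le> cmod (2 * fst w / a * (fst w + snd w / a))}"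
  define q where "q = (\<lambda>w. ((fst w)\<^sup>2 + c0, snd w :: complex))"
  have "closed A" unfolding A_def
    using compact_J a by (intro closed_Int closed_Times closed_Collect_le continuous_intros) (auto simp: compact_imp_closed)
  then have "closed (q ` A)" unfolding q_def by (rule closed_root_image) (auto simp: A_def)
  moreover have "psi a ` (J \<times> ball 0 r) = (J \<times> ball 0 r) \<inter> - (q ` A)"
  proof (intro equalityI subsetI IntI)
    fix w assume w: "w \<in> psi a ` (J \<times> ball 0 r)"
    then show "w \<in> J \<times> ball 0 r" using sub by blast
    obtain \<zeta> z where z: "\<zeta> \<in> J" "cmod z < r" "psi a (\<zeta>, z) = (fst w, snd w)" using w by auto
    then have e: "\<zeta>\<^sup>2 + c0 = fst w" "z = 2 * \<zeta> / a * (\<zeta> - snd w / a)" using psi_eq_iff a by blast+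
    show "w \<in> - q ` A"
    proof (intro ComplI notI)
      assume "w \<in> q ` A"
      then obtain \<xi> where x: "(\<xi>, snd w) \<in> A" "\<xi>\<^sup>2 + c0 = fst w" by (auto simp: q_def)
      then have "\<xi>\<^sup>2 = \<zeta>\<^sup>2" using e by (metis add_right_cancel)
      then consider "\<xi> = \<zeta>" | "\<xi> = - \<zeta>" by (auto simp: power2_eq_iff)
      then show False
      proof cases
        case 1
        then show ?thesis using x(1) z(2) e(2) by (auto simp: A_def)
      next
        case 2
        have "2 * \<xi> / a * (\<xi> + snd w / a) = z" unfolding e(2) 2 using a by (simp add: field_simps)
        then show ?thesis using x(1) z(2) by (simp add: A_def)
      qed
    qed
  next
    fix w assume w: "w \<in> (J \<times> ball 0 r) \<inter> - (q ` A)"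
    then obtain \<zeta> where \<zeta>: "\<zeta> \<in> J" "\<zeta>\<^sup>2 + c0 = fst w" using surjective[of "fst w"] by auto
    have "(\<zeta>, snd w) \<notin> A"
    proof
      assume "(\<zeta>, snd w) \<in> A"
      then have "q (\<zeta>, snd w) \<in> q ` A" by blast
      then show False using w \<zeta> by (simp add: q_def)
    qed
    then have "\<exists>\<xi>. (\<xi> = \<zeta> \<or> \<xi> = - \<zeta>) \<and> cmod (2 * \<xi> / a * (\<xi> - snd w / a)) < r"
    proof -
      have eq: "2 * (- \<zeta>) / a * (- \<zeta> - snd w / a) = 2 * \<zeta> / a * (\<zeta> + snd w / a)"
        using a by (simp add: field_simps)
      show ?thesis using \<open>(\<zeta>, snd w) \<notin> A\<close> \<zeta>(1) eq unfolding A_def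
        by (cases "cmod (2 * \<zeta> / a * (\<zeta> - snd w / a)) < r") (auto intro: exI[of _ \<zeta>] exI[of _ "- \<zeta>"])
    qed
    then obtain \<xi> where x: "\<xi> = \<zeta> \<or> \<xi> = - \<zeta>" "cmod (2 * \<xi> / a * (\<xi> - snd w / a)) < r" by blast
    then have \<xi>: "\<xi> \<in> J" "\<xi>\<^sup>2 = \<zeta>\<^sup>2" "cmod (2 * \<xi> / a * (\<xi> - snd w / a)) < r"
      using symmetric[OF \<zeta>(1)] \<zeta>(1) by auto
    then have "psi a (\<xi>, 2 * \<xi> / a * (\<xi> - snd w / a)) = (fst w, snd w)"
      unfolding psi_eq_iff[OF \<xi>(1) a] using \<zeta>(2) by simp
    then show "w \<in> psi a ` (J \<times> ball 0 r)"
      using \<xi> by (intro image_eqI[of _ _ "(\<xi>, 2 * \<xi> / a * (\<xi> - snd w / a))"]) auto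
  qed
  ultimately show ?thesis by (auto simp: openin_open)
qed

lemma psi_image:
  assumes r: "r > 3" and small: "cmod a * r \<le> \<kappa>\<^sup>2 / 2" and w: "w \<in> J \<times> ball 0 r"
  shows "psi a w \<in> J \<times> cball 0 (3 * cmod a)"
proof -
  have w: "fst w \<in> J" "cmod (snd w) \<le> r" using w by auto
  have nz: "fst w \<noteq> 0" using w J_nz by blast
  have \<kappa>2: "\<kappa>\<^sup>2 \<le> \<kappa>" using \<kappa>_pos by (simp add: power2_eq_square mult_left_le)
  have "cmod a * cmod (snd w) \<le> cmod a * r" using w by (intro mult_left_mono) auto
  also have "\<dots> \<le> 1 / 2 * \<kappa>" using small \<kappa>2 by simp
  also have "\<dots> \<le> 2 * cmod (fst w)" using J_lower[OF w(1)] \<kappa>_pos by simp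
  finally have "cmod (a * snd w / (2 * fst w)) \<le> 1" using nz by (simp add: norm_mult norm_divide field_simps)
  then have "cmod (fst w - a * snd w / (2 * fst w)) \<le> 3"
    using norm_triangle_ineq4[of "fst w" "a * snd w / (2 * fst w)"] J_upper[OF w(1)] by linarith
  then have "cmod a * cmod (fst w - a * snd w / (2 * fst w)) \<le> cmod a * 3" by (rule mult_left_mono) simp
  moreover have "a * fst w - a\<^sup>2 * snd w / (2 * fst w) = a * (fst w - a * snd w / (2 * fst w))"
    by (simp add: algebra_simps power2_eq_square)
  ultimately show ?thesis using invariant[OF w(1)] by (simp add: psi_def norm_mult)
qed

lemma small_parameter:
  assumes r: "r > 3" and small: "cmod a * r \<le> \<kappa>\<^sup>2 / 2"
  shows "cmod a \<le> \<kappa> / 6" "3 * cmod a < r" "4 * cmod a < r" "cmod a * r < \<kappa>\<^sup>2"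
proof -
  have \<kappa>2: "\<kappa>\<^sup>2 \<le> \<kappa>" using \<kappa>_pos by (simp add: power2_eq_square mult_left_le)
  have "cmod a * 3 \<le> cmod a * r" using r by (intro mult_left_mono) auto
  then show a6: "cmod a \<le> \<kappa> / 6" using small \<kappa>2 by linarith
  show "3 * cmod a < r" "4 * cmod a < r" using a6 \<kappa>_pos r by linarith+
  have "\<kappa>\<^sup>2 > 0" using \<kappa>_pos by simp
  then show "cmod a * r < \<kappa>\<^sup>2" using small by linarith
qed

lemma psi_image_subset:
  assumes r: "r > 3" and small: "cmod a * r \<le> \<kappa>\<^sup>2 / 2"
  shows "psi a ` (J \<times> ball 0 r) \<subseteq> J \<times> ball 0 r"
proof -
  have "cball (0 :: complex) (3 * cmod a) \<subseteq> ball 0 r"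
    unfolding cball_subset_ball_iff using small_parameter(2)[OF assms] by simp
  then have "J \<times> cball (0 :: complex) (3 * cmod a) \<subseteq> J \<times> ball 0 r" by (intro Sigma_mono[OF subset_refl])
  then show ?thesis using psi_image[OF assms] by (intro image_subsetI) (rule subsetD)
qed

text \<open>Near a root \<open>\<zeta>\<close> of \<open>\<zeta>\<^sup>2 + c0 = \<zeta>'\<close> the fibre of the image of \<open>\<psi>\<close> over \<open>\<zeta>'\<close> is a disc around \<open>a \<zeta>\<close>.
  The initial conjugacy is the identity plus the displacement between the two maps, extended from
  these discs by the nearest point projection and cut off before the two roots interfere.\<close>

theorem model_conjugacy:
  fixes \<phi> :: "complex \<Rightarrow> complex \<Rightarrow> complex"
  assumes a: "a \<noteq> 0" and r: "r > 3" and small: "cmod a * r \<le> \<kappa>\<^sup>2 / 2"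
    and cont: "continuous_on (J \<times> cball 0 r) (\<lambda>w. \<phi> (fst w) (snd w))"
    and bound: "\<And>\<zeta> z. \<zeta> \<in> J \<Longrightarrow> cmod z \<le> r \<Longrightarrow> cmod (\<phi> \<zeta> z) \<le> 2"
    and contr: "\<And>\<zeta> z z'. \<zeta> \<in> J \<Longrightarrow> cmod z \<le> r \<Longrightarrow> cmod z' \<le> r \<Longrightarrow> cmod a * cmod (\<phi> \<zeta> z - \<phi> \<zeta> z') \<le> cmod (z - z') / 2"
    and G: "\<And>\<zeta> z. \<zeta> \<in> J \<Longrightarrow> cmod z \<le> r \<Longrightarrow> cmod (\<phi> \<zeta> z - \<zeta> + a * z / (2 * \<zeta>)) \<le> G"
    and M: "\<And>\<zeta> z z'. \<zeta> \<in> J \<Longrightarrow> cmod z \<le> r \<Longrightarrow> cmod z' \<le> r \<Longrightarrow>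
      cmod ((\<phi> \<zeta> z - \<zeta> + a * z / (2 * \<zeta>)) - (\<phi> \<zeta> z' - \<zeta> + a * z' / (2 * \<zeta>))) \<le> M * cmod (z - z')"
    and GM: "0 \<le> M" "2 * G / \<kappa> + 4 * M / cmod a \<le> 1 / 4"
  shows "\<exists>h h'. homeomorphism (J \<times> ball 0 r) (J \<times> ball 0 r) h h' \<and>
    (\<forall>w\<in>J \<times> ball 0 r. h (psi a w) = ((fst (h w))\<^sup>2 + c0, a * \<phi> (fst (h w)) (snd (h w))))"
proof (cases "J = {}")
  case False
  then obtain \<zeta>0 where \<zeta>0: "\<zeta>0 \<in> J" by blast
  have apos: "cmod a > 0" using a by simp
  note a6 = small_parameter(1)[OF r small] and ar = small_parameter(3)[OF r small]
  have G0: "G \<ge> 0" using order_trans[OF norm_ge_zero G[OF \<zeta>0, of 0]] r by simp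
  define C where "C = cball (0 :: complex) r"
  \<comment> \<open>\<open>t\<close> is the second coordinate of a point divided by
    \<open>a\<close>, \<open>u \<zeta> t\<close> the fibre coordinate of its preimage under
    \<open>psi\<close> over the root \<open>\<zeta>\<close>, and \<open>g\<close> the displacement
    to be realised. \<open>clip\<close> extends \<open>g\<close> without enlarging Lipschitz
    constants. The cut-off is 1 for \<open>cmod (t - \<zeta>) \<le> \<kappa> / 2\<close> and 0 from
    \<open>\<kappa>\<close> on.\<close>
  define clip where "clip = closest_point C"
  define \<theta> where "\<theta> = (\<lambda>x :: real. max 0 (min 1 (2 - x)))"
  define g where "g = (\<lambda>\<zeta> z. \<phi> \<zeta> z - \<zeta> + a * z / (2 * \<zeta>))"
  define u where "u = (\<lambda>\<zeta> t. 2 * \<zeta> / a * (\<zeta> - t))"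
  define E where "E = (\<lambda>w. of_real (\<theta> (2 * cmod (snd w - fst w) / \<kappa>)) * g (fst w) (clip (u (fst w) (snd w))))"
  have C: "closed C" "convex C" "C \<noteq> {}" unfolding C_def using r by auto
  have clip: "cmod (clip z) \<le> r" for z
    using closest_point_in_set[OF C(1,3), of z] by (simp add: clip_def C_def)
  have clip_lip: "cmod (clip z - clip z') \<le> cmod (z - z')" for z z'
    using closest_point_lipschitz[OF C(2,1,3), of z z'] by (simp add: clip_def dist_norm)
  have \<theta>01: "\<bar>\<theta> x\<bar> \<le> 1" for x by (auto simp: \<theta>_def)
  have \<theta>_lip: "\<bar>\<theta> x - \<theta> y\<bar> \<le> \<bar>x - y\<bar>" for x y by (auto simp: \<theta>_def max_def min_def)
  have contE: "continuous_on (J \<times> UNIV) E"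
  proof -
    have "continuous_on (J \<times> cball 0 r) (\<lambda>w. g (fst w) (snd w))"
      unfolding g_def using J_nz by (intro continuous_intros cont) auto
    moreover have "continuous_on (J \<times> UNIV) (\<lambda>w. (fst w, clip (u (fst w) (snd w))))"
      unfolding u_def clip_def using a
      by (intro continuous_intros continuous_on_compose2[OF continuous_on_closest_point[OF C(2,1,3), of UNIV]]) auto
    ultimately have "continuous_on (J \<times> UNIV) (\<lambda>w. g (fst (fst w, clip (u (fst w) (snd w)))) (snd (fst w, clip (u (fst w) (snd w)))))"
      by (rule continuous_on_compose2) (use clip in auto)
    then show ?thesis unfolding E_def \<theta>_def using \<kappa>_pos by (intro continuous_intros) auto
  qed
  \<comment> \<open>\<open>u\<close> stretches by \<open>2 * cmod \<zeta> / cmod a\<close>, which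
    turns \<open>M\<close> into at most \<open>4 * M / cmod a\<close>; the slope
    \<open>2 / \<kappa>\<close> of the cut-off meets the bound \<open>G\<close>.\<close>
  have lipE: "cmod (E (\<zeta>, t) - E (\<zeta>, t')) \<le> 1 / 4 * cmod (t - t')" if z: "\<zeta> \<in> J" for \<zeta> t t'
  proof -
    define x x' where "x = \<theta> (2 * cmod (t - \<zeta>) / \<kappa>)" and "x' = \<theta> (2 * cmod (t' - \<zeta>) / \<kappa>)"
    define b b' where "b = g \<zeta> (clip (u \<zeta> t))" and "b' = g \<zeta> (clip (u \<zeta> t'))"
    have "cmod (b - b') \<le> M * cmod (clip (u \<zeta> t) - clip (u \<zeta> t'))"
      unfolding b_def b'_def g_def by (rule M[OF z clip clip])
    also have "\<dots> \<le> M * cmod (u \<zeta> t - u \<zeta> t')" by (rule mult_left_mono[OF clip_lip GM(1)])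
    also have "u \<zeta> t - u \<zeta> t' = 2 * \<zeta> / a * (t' - t)" by (simp add: u_def algebra_simps diff_divide_distrib)
    also have "cmod \<dots> = 2 * cmod \<zeta> / cmod a * cmod (t - t')"
      by (simp add: norm_mult norm_divide norm_minus_commute)
    also have "\<dots> \<le> 4 / cmod a * cmod (t - t')"
      using J_upper[OF z] by (intro mult_right_mono divide_right_mono) auto
    finally have bb: "cmod (b - b') \<le> 4 * M / cmod a * cmod (t - t')" using GM(1) by (simp add: mult_left_mono mult.left_commute mult.assoc)
    have "\<bar>cmod (t - \<zeta>) - cmod (t' - \<zeta>)\<bar> \<le> cmod (t - t')" using norm_triangle_ineq3[of "t - \<zeta>" "t' - \<zeta>"] by simp
    then have "2 / \<kappa> * \<bar>cmod (t - \<zeta>) - cmod (t' - \<zeta>)\<bar> \<le> 2 / \<kappa> * cmod (t - t')"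
      using \<kappa>_pos by (intro mult_left_mono) auto
    moreover have "\<bar>x - x'\<bar> \<le> \<bar>2 * cmod (t - \<zeta>) / \<kappa> - 2 * cmod (t' - \<zeta>) / \<kappa>\<bar>"
      unfolding x_def x'_def by (rule \<theta>_lip)
    moreover have "2 * cmod (t - \<zeta>) / \<kappa> - 2 * cmod (t' - \<zeta>) / \<kappa> = 2 / \<kappa> * (cmod (t - \<zeta>) - cmod (t' - \<zeta>))"
      by (simp add: algebra_simps diff_divide_distrib)
    moreover have "\<bar>2 / \<kappa>\<bar> = 2 / \<kappa>" using \<kappa>_pos by simp
    ultimately have xx: "\<bar>x - x'\<bar> \<le> 2 / \<kappa> * cmod (t - t')" by (simp only: abs_mult)
    have b'G: "cmod b' \<le> G" unfolding b'_def g_def by (rule G[OF z clip])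
    have "E (\<zeta>, t) - E (\<zeta>, t') = of_real x * (b - b') + of_real (x - x') * b'"
      by (simp add: E_def x_def x'_def b_def b'_def algebra_simps)
    then have "cmod (E (\<zeta>, t) - E (\<zeta>, t')) \<le> cmod (of_real x * (b - b')) + cmod (of_real (x - x') * b')"
      by (simp only: norm_triangle_ineq)
    also have "\<dots> = \<bar>x\<bar> * cmod (b - b') + \<bar>x - x'\<bar> * cmod b'" by (simp only: norm_mult norm_of_real)
    also have "\<dots> \<le> 1 * (4 * M / cmod a * cmod (t - t')) + (2 / \<kappa> * cmod (t - t')) * G"
      using bb xx b'G \<theta>01[of "2 * cmod (t - \<zeta>) / \<kappa>"] \<kappa>_pos by (intro add_mono mult_mono) (auto simp: x_def)
    also have "\<dots> = (2 * G / \<kappa> + 4 * M / cmod a) * cmod (t - t')" by (simp add: algebra_simps)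
    also have "\<dots> \<le> 1 / 4 * cmod (t - t')" by (rule mult_right_mono[OF GM(2)]) simp
    finally show ?thesis .
  qed
  \<comment> \<open>Summing over both roots makes the displacement even in \<open>\<zeta>\<close>,
    hence a function of \<open>\<zeta>\<^sup>2 + c0\<close>; the choice made by \<open>root\<close>
    below is immaterial. The two Lipschitz constants \<open>1 / 4\<close> add up to
    \<open>1 / 2\<close>.\<close>
  define S where "S = (\<lambda>w. E w + E (- fst w, snd w))"
  have contS: "continuous_on (J \<times> UNIV) S" unfolding S_def
    by (intro continuous_intros contE continuous_on_compose2[OF contE, of _ "\<lambda>w. (- fst w, snd w)"]) (auto simp: symmetric)
  have lipS: "cmod (S (\<zeta>, t) - S (\<zeta>, t')) \<le> 1 / 2 * cmod (t - t')" if z: "\<zeta> \<in> J" for \<zeta> t t'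
  proof -
    have "S (\<zeta>, t) - S (\<zeta>, t') = (E (\<zeta>, t) - E (\<zeta>, t')) + (E (- \<zeta>, t) - E (- \<zeta>, t'))" by (simp add: S_def)
    then show ?thesis using norm_triangle_ineq[of "E (\<zeta>, t) - E (\<zeta>, t')" "E (- \<zeta>, t) - E (- \<zeta>, t')"]
        lipE[OF z, of t t'] lipE[OF symmetric[OF z], of t t'] by simp
  qed
  define root where "root = (\<lambda>\<zeta>'. SOME \<zeta>. \<zeta> \<in> J \<and> \<zeta>\<^sup>2 + c0 = \<zeta>')"
  have root: "root \<zeta>' \<in> J" "(root \<zeta>')\<^sup>2 + c0 = \<zeta>'" if "\<zeta>' \<in> J" for \<zeta>'
    using someI_ex[of "\<lambda>\<zeta>. \<zeta> \<in> J \<and> \<zeta>\<^sup>2 + c0 = \<zeta>'"] surjective[OF that] unfolding root_def by blast+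
  define D where "D = (\<lambda>w. a * S (root (fst w), snd w / a))"
  have D_image: "D (\<zeta>\<^sup>2 + c0, z) = a * S (\<zeta>, z / a)" if "\<zeta> \<in> J" for \<zeta> z
  proof -
    have "(root (\<zeta>\<^sup>2 + c0))\<^sup>2 = \<zeta>\<^sup>2" using root(2)[OF invariant[OF that]] by simp
    then have "root (\<zeta>\<^sup>2 + c0) = \<zeta> \<or> root (\<zeta>\<^sup>2 + c0) = - \<zeta>" by (simp add: power2_eq_iff)
    then show ?thesis by (auto simp: D_def S_def add.commute)
  qed
  have contD: "continuous_on (J \<times> UNIV) D"
  proof (rule continuous_on_descend[where f = "\<lambda>w. a * S (fst w, snd w / a)"])
    show "continuous_on (J \<times> UNIV) (\<lambda>w. a * S (fst w, snd w / a))"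
      using a by (intro continuous_intros continuous_on_compose2[OF contS, of _ "\<lambda>w. (fst w, snd w / a)"]) auto
  qed (simp add: D_image)
  have lipD: "cmod (D (\<zeta>, z) - D (\<zeta>, z')) \<le> cmod (z - z') / 2" if "\<zeta> \<in> J" for \<zeta> z z'
  proof -
    have "cmod (D (\<zeta>, z) - D (\<zeta>, z')) = cmod a * cmod (S (root \<zeta>, z / a) - S (root \<zeta>, z' / a))"
      by (simp add: D_def norm_mult flip: right_diff_distrib)
    also have "\<dots> \<le> cmod a * (1 / 2 * cmod (z / a - z' / a))"
      by (intro mult_left_mono lipS root that) simp
    also have "cmod (z / a - z' / a) = cmod (z - z') / cmod a" by (simp flip: diff_divide_distrib norm_divide)
    finally show ?thesis using apos by simp
  qed
  have E_0: "E (\<zeta>, t) = 0" if "cmod (t - \<zeta>) \<ge> \<kappa>" for \<zeta> t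
  proof -
    have "2 * cmod (t - \<zeta>) / \<kappa> \<ge> 2" using that \<kappa>_pos by (simp add: field_simps)
    then have "\<theta> (2 * cmod (t - \<zeta>) / \<kappa>) = 0" by (simp add: \<theta>_def)
    then show ?thesis by (simp add: E_def)
  qed
  have suppD: "D (\<zeta>, z) = 0" if "\<zeta> \<in> J" "cmod z \<ge> 4 * cmod a" for \<zeta> z
  proof -
    have "cmod (z / a) \<ge> 4" using that(2) apos by (simp add: norm_divide field_simps)
    moreover have "cmod (root \<zeta>) < 2" using J_upper root(1)[OF that(1)] by blast
    ultimately have "cmod (z / a - root \<zeta>) \<ge> \<kappa>" "cmod (z / a - - root \<zeta>) \<ge> \<kappa>"
      using norm_triangle_ineq2[of "z / a" "root \<zeta>"] norm_triangle_ineq2[of "z / a" "- root \<zeta>"] \<kappa>_pos by auto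
    then show ?thesis by (simp add: D_def S_def E_0)
  qed
  have S_disc: "S (\<zeta>, \<zeta> - a * z / (2 * \<zeta>)) = g \<zeta> z" if z: "\<zeta> \<in> J" "cmod z \<le> r" for \<zeta> z
  proof -
    define d where "d = a * z / (2 * \<zeta>)"
    have nz: "\<zeta> \<noteq> 0" using J_nz z by blast
    have "cmod a * cmod z \<le> cmod a * r" using z by (intro mult_left_mono) auto
    moreover have "\<kappa>\<^sup>2 \<le> \<kappa> * cmod \<zeta>" using J_lower[OF z(1)] \<kappa>_pos by (simp add: power2_eq_square mult_left_mono)
    ultimately have "cmod a * cmod z \<le> \<kappa> * cmod \<zeta> / 2" using small by linarith
    then have d: "cmod d \<le> \<kappa> / 4" using nz by (simp add: d_def norm_mult norm_divide field_simps)
    have "2 * cmod (\<zeta> - d - \<zeta>) / \<kappa> \<le> 1" using d \<kappa>_pos by (simp add: field_simps)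
    then have 1: "\<theta> (2 * cmod (\<zeta> - d - \<zeta>) / \<kappa>) = 1" by (simp add: \<theta>_def)
    have "u \<zeta> (\<zeta> - d) = z" using nz a by (simp add: u_def d_def)
    then have "clip (u \<zeta> (\<zeta> - d)) = z" using z closest_point_self[of z C] by (simp add: clip_def C_def)
    then have e1: "E (\<zeta>, \<zeta> - d) = g \<zeta> z" using 1 by (simp add: E_def)
    \<comment> \<open>The disc belonging to \<open>\<zeta>\<close> is beyond the cut-off of the
      opposite root, so only one summand of \<open>S\<close> acts on it.\<close>
    have "cmod (\<zeta> - d - - \<zeta>) \<ge> cmod (2 * \<zeta>) - cmod d" using norm_triangle_ineq2[of "2 * \<zeta>" d] by (simp add: algebra_simps)
    then have "cmod (\<zeta> - d - - \<zeta>) \<ge> \<kappa>" using d J_lower[OF z(1)] \<kappa>_pos by (simp add: norm_mult)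
    then have "E (- \<zeta>, \<zeta> - d) = 0" by (rule E_0)
    then show ?thesis using e1 by (simp add: S_def d_def)
  qed
  define X where "X = J \<times> ball (0 :: complex) r"
  define h0 where "h0 = (\<lambda>w. (fst w, snd w + D w))"
  define \<psi>' where "\<psi>' = (\<lambda>w. ((fst w)\<^sup>2 + c0, a * \<phi> (fst w) (snd w)))"
  have "0 < 4 * cmod a" using apos by simp
  then obtain h0' where h0': "homeomorphism X X h0 h0'"
    using fibered_perturbation_homeomorphism[OF compact_J _ ar contD lipD suppD] unfolding X_def h0_def by blast
  have im\<psi>: "psi a w \<in> J \<times> cball 0 (3 * cmod a)" if "w \<in> X" for w
    using psi_image[OF r small] that unfolding X_def .
  have im\<psi>': "\<psi>' w \<in> J \<times> cball 0 (3 * cmod a)" if "w \<in> X" for w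
  proof -
    have w: "fst w \<in> J" "cmod (snd w) \<le> r" using that by (auto simp: X_def)
    have "cmod a * cmod (\<phi> (fst w) (snd w)) \<le> cmod a * 3" using bound[OF w] by (intro mult_left_mono) auto
    then show ?thesis using invariant[OF w(1)] by (simp add: \<psi>'_def norm_mult)
  qed
  have sub: "psi a ` X \<subseteq> X" using psi_image_subset[OF r small] unfolding X_def .
  obtain \<psi>i where \<psi>i: "homeomorphism X (psi a ` X) (psi a) \<psi>i" using psi_homeomorphism[OF a small_parameter(4)[OF r small]] unfolding X_def by blast
  have op: "openin (top_of_set X) (psi a ` X)" using psi_openin[OF a] sub unfolding X_def by blast
  have contr\<psi>: "cmod (snd (psi a v) - snd (psi a w)) \<le> cmod (snd v - snd w) / 2"
    if "v \<in> X" "w \<in> X" "fst v = fst w" for v w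
  proof -
    have z: "fst w \<in> J" using that by (auto simp: X_def)
    have nz: "fst w \<noteq> 0" using z J_nz by blast
    have e: "snd (psi a v) - snd (psi a w) = a\<^sup>2 / (2 * fst w) * (snd w - snd v)"
      by (simp add: psi_def that(3) algebra_simps diff_divide_distrib)
    have "(cmod a)\<^sup>2 \<le> 1 * cmod a" unfolding power2_eq_square using a6 \<kappa>_pos by (intro mult_right_mono) auto
    then have "cmod (a\<^sup>2 / (2 * fst w)) \<le> 1 / 2"
      using a6 J_lower[OF z] \<kappa>_pos nz by (simp add: norm_divide norm_mult norm_power field_simps)
    then have "cmod (a\<^sup>2 / (2 * fst w)) * cmod (snd w - snd v) \<le> 1 / 2 * cmod (snd w - snd v)"
      by (rule mult_right_mono) simp
    then show ?thesis unfolding e norm_mult by (simp add: norm_minus_commute)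
  qed
  have contr\<psi>': "cmod (snd (\<psi>' v) - snd (\<psi>' w)) \<le> cmod (snd v - snd w) / 2"
    if "v \<in> X" "w \<in> X" "fst v = fst w" for v w
    using contr[of "fst w" "snd v" "snd w"] that by (auto simp: \<psi>'_def X_def norm_mult simp flip: right_diff_distrib)
  have h0\<psi>: "h0 (psi a w) = \<psi>' w" if "w \<in> X" for w
  proof -
    have w: "fst w \<in> J" "cmod (snd w) \<le> r" using that by (auto simp: X_def)
    define t where "t = fst w - a * snd w / (2 * fst w)"
    have p: "psi a w = ((fst w)\<^sup>2 + c0, a * t)" by (simp add: psi_def t_def algebra_simps power2_eq_square)
    have "D (psi a w) = a * g (fst w) (snd w)"
      unfolding p D_image[OF w(1)] using S_disc[OF w] a by (simp add: t_def)
    then have "snd (h0 (psi a w)) = a * (t + g (fst w) (snd w))" by (simp add: h0_def p algebra_simps)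
    also have "t + g (fst w) (snd w) = \<phi> (fst w) (snd w)" by (simp add: t_def g_def)
    finally show ?thesis by (simp add: h0_def p \<psi>'_def)
  qed
  have "\<exists>h h'. homeomorphism X X h h' \<and> (\<forall>w\<in>X. h (psi a w) = \<psi>' (h w))"
  proof (rule fibered_contraction_conjugacy[OF X_def compact_J _ _ ar \<psi>i op])
    show "psi a ` X \<subseteq> J \<times> cball 0 (3 * cmod a)" "\<psi>' ` X \<subseteq> J \<times> cball 0 (3 * cmod a)"
      using im\<psi> im\<psi>' by blast+
    show "homeomorphism X X h0 h0'" by (rule h0')
    show "h0 w = w" if "w \<in> X" "cmod (snd w) \<ge> 4 * cmod a" for w
      using suppD[of "fst w" "snd w"] that by (auto simp: h0_def X_def)
  qed (use apos contr\<psi> contr\<psi>' h0\<psi> in \<open>auto simp: psi_def \<psi>'_def h0_def\<close>)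
  then show ?thesis unfolding X_def \<psi>'_def .
qed (auto intro: homeomorphism_empty)

end

section \<open>Extension to the inductive limit\<close>

lemma openin_prod_discrete:
  "openin (prod_topology X (discrete_topology UNIV)) W \<longleftrightarrow>
    (W \<subseteq> topspace X \<times> UNIV \<and> (\<forall>n. openin X {x. (x, n) \<in> W}))"
proof
  assume W: "openin (prod_topology X (discrete_topology UNIV)) W"
  have sub: "W \<subseteq> topspace X \<times> UNIV" using openin_subset[OF W] by simp
  have "openin X {x. (x, n) \<in> W}" for n
  proof -
    have "continuous_map X (prod_topology X (discrete_topology UNIV)) (\<lambda>x. (x, n))"
      by (simp add: continuous_map_paired)
    then have "openin X {x \<in> topspace X. (x, n) \<in> W}" using W by (rule openin_continuous_map_preimage)
    moreover have "{x \<in> topspace X. (x, n) \<in> W} = {x. (x, n) \<in> W}" using sub by auto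
    ultimately show ?thesis by simp
  qed
  then show "W \<subseteq> topspace X \<times> UNIV \<and> (\<forall>n. openin X {x. (x, n) \<in> W})" using sub by blast
next
  assume W: "W \<subseteq> topspace X \<times> UNIV \<and> (\<forall>n. openin X {x. (x, n) \<in> W})"
  have "W = (\<Union>n. {x. (x, n) \<in> W} \<times> {n})" by auto
  moreover have "openin (prod_topology X (discrete_topology UNIV)) (\<Union>n. {x. (x, n) \<in> W} \<times> {n})"
    using W by (intro openin_Union) (auto simp: openin_prod_Times_iff)
  ultimately show "openin (prod_topology X (discrete_topology UNIV)) W" by simp
qed

text \<open>The class of \<open>(x, n)\<close> must go to \<open>G^n(\<Phi> x)\<close>, with
  \<open>G\<close> the inverse of \<open>H\<close>. This map is continuous and open, onto by
  \<open>absorb\<close>, and identifies just the equivalent pairs: if two images agree, applying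
  powers of \<open>H\<close> yields points of \<open>X\<close> related by an iterate of
  \<open>f\<close>, as \<open>\<Phi>\<close> is injective. Two quotient maps with the same fibres
  have homeomorphic targets.\<close>

theorem ind_lim_extension:
  assumes f: "f ` topspace X \<subseteq> topspace X"
    and HG: "homeomorphic_maps Y Y H G"
    and \<Phi>: "continuous_map X Y \<Phi>" "open_map X Y \<Phi>" "inj_on \<Phi> (topspace X)"
    and conj: "\<And>x. x \<in> topspace X \<Longrightarrow> H (\<Phi> x) = \<Phi> (f x)"
    and absorb: "\<And>y. y \<in> topspace Y \<Longrightarrow> \<exists>n. (H ^^ n) y \<in> \<Phi> ` topspace X"
  shows "\<exists>\<Phi>'. homeomorphic_map (ind_lim X f) Y \<Phi>' \<and>
    (\<forall>x\<in>topspace X. \<Phi>' (ind_lim_class X f (x, 0)) = \<Phi> x) \<and>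
    (\<forall>C\<in>topspace (ind_lim X f). H (\<Phi>' C) = \<Phi>' (ind_lim_map X f C))"
proof -
  have HGY: "H (G y) = y" "G (H y) = y" "H y \<in> topspace Y" "G y \<in> topspace Y" if "y \<in> topspace Y" for y
    using HG that by (auto simp: homeomorphic_maps_def continuous_map_def)
  have iter: "(G ^^ n) y \<in> topspace Y" "(H ^^ n) y \<in> topspace Y" if "y \<in> topspace Y" for n y
    using that HGY by (induction n) auto
  have HGn: "(H ^^ n) ((G ^^ n) y) = y" if "y \<in> topspace Y" for n y
    using that
  proof (induction n arbitrary: y)
    case (Suc n)
    have "(H ^^ Suc n) ((G ^^ Suc n) y) = (H ^^ n) (H (G ((G ^^ n) y)))" by (simp add: funpow_swap1)
    then show ?case using Suc iter(1)[OF Suc.prems] HGY(1) by simp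
  qed simp
  have GHn: "(G ^^ n) ((H ^^ n) y) = y" if "y \<in> topspace Y" for n y
    using that
  proof (induction n arbitrary: y)
    case (Suc n)
    have "(G ^^ Suc n) ((H ^^ Suc n) y) = (G ^^ n) (G (H ((H ^^ n) y)))" by (simp add: funpow_swap1)
    then show ?case using Suc iter(2)[OF Suc.prems] HGY(2) by simp
  qed simp
  have GnH: "(G ^^ n) (H y) = H ((G ^^ n) y)" if "y \<in> topspace Y" for n y
  proof (induction n)
    case (Suc n)
    then show ?case using iter(1)[OF that, of n] HGY by simp
  qed simp
  have \<Phi>Y: "\<Phi> x \<in> topspace Y" if "x \<in> topspace X" for x using \<Phi>(1) that by (auto simp: continuous_map_def)
  have fn: "(f ^^ n) x \<in> topspace X \<and> (H ^^ n) (\<Phi> x) = \<Phi> ((f ^^ n) x)" if "x \<in> topspace X" for x n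
    using that f conj by (induction n) auto
  define \<Psi> where "\<Psi> = (\<lambda>p. (G ^^ snd p) (\<Phi> (fst p)))"
  have homG: "homeomorphic_map Y Y (G ^^ n)" for n
  proof (induction n)
    case 0
    show ?case unfolding funpow.simps homeomorphic_map_id ..
  next
    case (Suc n)
    moreover have "homeomorphic_map Y Y G" using HG homeomorphic_maps_map homeomorphic_maps_sym by blast
    ultimately show ?case unfolding funpow.simps by (rule homeomorphic_map_compose)
  qed
  have ts: "topspace (ind_lim_pre X) = topspace X \<times> UNIV" by (rule topspace_ind_lim_pre)
  have c\<Psi>: "continuous_map (ind_lim_pre X) Y \<Psi>"
    unfolding continuous_map_def ts
  proof (intro conjI funcsetI allI impI)
    fix p assume "p \<in> topspace X \<times> (UNIV :: nat set)"
    then show "\<Psi> p \<in> topspace Y" using iter(1)[OF \<Phi>Y] by (auto simp: \<Psi>_def)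
  next
    fix U assume U: "openin Y U"
    have "openin X {x \<in> topspace X. (G ^^ n) (\<Phi> x) \<in> U}" for n
    proof -
      have "continuous_map X Y ((G ^^ n) \<circ> \<Phi>)"
        using \<Phi>(1) homeomorphic_imp_continuous_map[OF homG] by (rule continuous_map_compose)
      from openin_continuous_map_preimage[OF this U] show ?thesis by simp
    qed
    then show "openin (ind_lim_pre X) {p \<in> topspace X \<times> UNIV. \<Psi> p \<in> U}"
      unfolding ind_lim_pre_def openin_prod_discrete by (auto simp: \<Psi>_def)
  qed
  have "open_map (ind_lim_pre X) Y \<Psi>"
    unfolding open_map_def
  proof (intro allI impI)
    fix W assume "openin (ind_lim_pre X) W"
    then have W: "openin X {x. (x, n) \<in> W}" for n unfolding ind_lim_pre_def openin_prod_discrete by blast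
    have "open_map X Y ((G ^^ n) \<circ> \<Phi>)" for n
      using \<Phi>(2) homeomorphic_imp_open_map[OF homG] by (rule open_map_compose)
    then have "openin Y (((G ^^ n) \<circ> \<Phi>) ` {x. (x, n) \<in> W})" for n using W unfolding open_map_def by blast
    then have "openin Y (\<Union>n. ((G ^^ n) \<circ> \<Phi>) ` {x. (x, n) \<in> W})" by blast
    moreover have "\<Psi> ` W = (\<Union>n. ((G ^^ n) \<circ> \<Phi>) ` {x. (x, n) \<in> W})" by (force simp: \<Psi>_def)
    ultimately show "openin Y (\<Psi> ` W)" by simp
  qed
  moreover have "\<Psi> ` topspace (ind_lim_pre X) = topspace Y"
  proof
    show "\<Psi> ` topspace (ind_lim_pre X) \<subseteq> topspace Y" using c\<Psi> by (auto simp: continuous_map_def)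
    show "topspace Y \<subseteq> \<Psi> ` topspace (ind_lim_pre X)"
    proof
      fix y assume y: "y \<in> topspace Y"
      then obtain n x where x: "x \<in> topspace X" "(H ^^ n) y = \<Phi> x" using absorb by blast
      have "y = \<Psi> (x, n)" using GHn[OF y, of n] x(2) by (simp add: \<Psi>_def)
      then show "y \<in> \<Psi> ` topspace (ind_lim_pre X)" using x(1) unfolding ts by blast
    qed
  qed
  ultimately have q\<Psi>: "quotient_map (ind_lim_pre X) Y \<Psi>" using c\<Psi> by (intro continuous_open_imp_quotient_map)
  let ?c = "ind_lim_class X f"
  let ?b = "\<lambda>(x, n) (y, m). x \<in> topspace X \<and> y = f x \<and> m = Suc n"
  have q: "quotient_map (ind_lim_pre X) (ind_lim X f) ?c" by (rule quotient_map_ind_lim)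
  have shift: "?c ((f ^^ k) x, n + k) = ?c (x, n)" if "x \<in> topspace X" for x n k
  proof (induction k)
    case (Suc k)
    have "?c ((f ^^ Suc k) x, n + Suc k) = ?c ((f ^^ k) x, n + k)"
      using ind_lim_class_shift[OF f, of "(f ^^ k) x" "n + k"] fn[OF that, of k] by simp
    then show ?case using Suc by simp
  qed simp
  have \<Psi>b: "\<Psi> p = \<Psi> s" if "?b p s" for p s
  proof -
    obtain x n where p: "p = (x, n)" by (cases p)
    with that have s: "s = (f x, Suc n)" and x: "x \<in> topspace X" by (auto split: prod.splits)
    have "(G ^^ Suc n) (\<Phi> (f x)) = (G ^^ n) (G (H (\<Phi> x)))" using conj[OF x] by (simp add: funpow_swap1)
    then show ?thesis using HGY(2)[OF \<Phi>Y[OF x]] by (simp add: \<Psi>_def p s)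
  qed
  have eq1: "\<Psi> p = \<Psi> s" if p: "p \<in> topspace (ind_lim_pre X)" "s \<in> topspace (ind_lim_pre X)" "?c p = ?c s" for p s
  proof -
    have "(p, s) \<in> ind_lim_rel X f"
      using eq_equiv_class[OF p(3)[unfolded ind_lim_class_def] equiv_ind_lim_rel p(2)] .
    then have "equivclp ?b p s" by (simp add: ind_lim_rel_def)
    then show ?thesis
    proof (induction rule: equivclp_induct)
      case (step y z)
      then show ?case using \<Psi>b[of y z] \<Psi>b[of z y] by argo
    qed simp
  qed
  have aux: "?c (x, n) = ?c (y, m)"
    if "x \<in> topspace X" "y \<in> topspace X" "\<Psi> (x, n) = \<Psi> (y, m)" and nm: "n \<le> m" for x y n m
  proof -
    obtain k where k: "m = n + k" using nm le_Suc_ex by blast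
    have "\<Phi> x = (H ^^ n) ((G ^^ n) (\<Phi> x))" using HGn \<Phi>Y that(1) by simp
    also have "\<dots> = (H ^^ n) ((G ^^ n) ((G ^^ k) (\<Phi> y)))" using that(3) by (simp add: \<Psi>_def k funpow_add)
    also have "\<dots> = (G ^^ k) (\<Phi> y)" by (rule HGn) (rule iter(1)[OF \<Phi>Y[OF that(2)]])
    finally have "(H ^^ k) (\<Phi> x) = \<Phi> y" using HGn \<Phi>Y that(2) by simp
    then have "\<Phi> ((f ^^ k) x) = \<Phi> y" using fn[OF that(1)] by simp
    then have "(f ^^ k) x = y" using \<Phi>(3) fn[OF that(1), of k] that(2) by (auto dest: inj_onD)
    then show ?thesis using shift[OF that(1), of k n] k by simp
  qed
  have eq2: "?c p = ?c s" if p: "p \<in> topspace (ind_lim_pre X)" "s \<in> topspace (ind_lim_pre X)" "\<Psi> p = \<Psi> s" for p s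
  proof -
    obtain x n y m where xy: "p = (x, n)" "s = (y, m)" by (cases p, cases s)
    then have X: "x \<in> topspace X" "y \<in> topspace X" using p ts by auto
    show ?thesis
    proof (cases "n \<le> m")
      case True
      then show ?thesis using aux[OF X] p(3) xy by simp
    next
      case False
      then show ?thesis using aux[OF X(2,1), of m n] p(3) xy by simp
    qed
  qed
  obtain \<Phi>' where \<Phi>': "continuous_map (ind_lim X f) Y \<Phi>'"
      "\<And>p. p \<in> topspace (ind_lim_pre X) \<Longrightarrow> \<Phi>' (?c p) = \<Psi> p"
    by (rule quotient_map_lift_exists[OF q c\<Psi> eq1]) (assumption | blast)+
  have img: "?c ` topspace (ind_lim_pre X) = topspace (ind_lim X f)"
    using q by (simp add: quotient_map_def)
  have "quotient_map (ind_lim_pre X) Y (\<Phi>' \<circ> ?c)"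
    using quotient_map_eq[OF q\<Psi>] \<Phi>'(2) by simp
  then have "quotient_map (ind_lim X f) Y \<Phi>'"
    using quotient_map_from_composition[OF quotient_imp_continuous_map[OF q] \<Phi>'(1)] by blast
  moreover have "inj_on \<Phi>' (topspace (ind_lim X f))"
  proof (rule inj_onI)
    fix C D assume C: "C \<in> topspace (ind_lim X f)" and D: "D \<in> topspace (ind_lim X f)" and e: "\<Phi>' C = \<Phi>' D"
    obtain p where p: "p \<in> topspace (ind_lim_pre X)" "C = ?c p" using C unfolding img[symmetric] by blast
    obtain s where s: "s \<in> topspace (ind_lim_pre X)" "D = ?c s" using D unfolding img[symmetric] by blast
    show "C = D" unfolding p(2) s(2)
      by (rule eq2[OF p(1) s(1)]) (use e \<Phi>'(2)[OF p(1)] \<Phi>'(2)[OF s(1)] p(2) s(2) in simp)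
  qed
  ultimately have "homeomorphic_map (ind_lim X f) Y \<Phi>'" unfolding homeomorphic_map_def by (rule conjI)
  moreover have "\<Phi>' (?c (x, 0)) = \<Phi> x" if "x \<in> topspace X" for x
    using \<Phi>'(2)[of "(x, 0)"] that by (simp add: ts \<Psi>_def)
  moreover have "H (\<Phi>' C) = \<Phi>' (ind_lim_map X f C)" if C: "C \<in> topspace (ind_lim X f)" for C
  proof -
    obtain x n where x: "x \<in> topspace X" "C = ?c (x, n)" using C unfolding img[symmetric] ts by blast
    have fx: "f x \<in> topspace X" using x f by blast
    have "\<Phi>' (ind_lim_map X f C) = \<Psi> (f x, n)"
      unfolding x(2) ind_lim_map_class[OF f x(1)] using fx by (intro \<Phi>'(2)) (simp add: ts)
    also have "\<dots> = (G ^^ n) (H (\<Phi> x))" using conj[OF x(1)] by (simp add: \<Psi>_def)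
    also have "\<dots> = H (\<Psi> (x, n))" using GnH[OF \<Phi>Y[OF x(1)]] by (simp add: \<Psi>_def)
    also have "\<Psi> (x, n) = \<Phi>' C" unfolding x(2) using x(1) by (intro \<Phi>'(2)[symmetric]) (simp add: ts)
    finally show ?thesis ..
  qed
  ultimately show ?thesis by blast
qed

section \<open>The Henon map on the forward Julia set\<close>

lemma bounded_orbits_step: "f z \<in> bounded_orbits f \<longleftrightarrow> z \<in> bounded_orbits f"
proof -
  have s: "(f ^^ n) (f z) = (f ^^ Suc n) z" for n by (simp add: funpow_swap1)
  have "range (\<lambda>n. (f ^^ n) z) = insert z (range (\<lambda>n. (f ^^ n) (f z)))"
  proof (intro equalityI subsetI)
    fix w assume "w \<in> range (\<lambda>n. (f ^^ n) z)"
    then obtain n where n: "w = (f ^^ n) z" by blast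
    show "w \<in> insert z (range (\<lambda>n. (f ^^ n) (f z)))" using n s by (cases n) auto
  next
    fix w assume "w \<in> insert z (range (\<lambda>n. (f ^^ n) (f z)))"
    then consider "w = (f ^^ 0) z" | n where "w = (f ^^ Suc n) z" using s by auto
    then show "w \<in> range (\<lambda>n. (f ^^ n) z)" by cases blast+
  qed
  then show ?thesis by (simp add: bounded_orbits_def)
qed

definition henon_inv :: "complex \<Rightarrow> complex \<Rightarrow> complex \<times> complex \<Rightarrow> complex \<times> complex" where
  "henon_inv c a w = (snd w / a, (fst w - (snd w / a)\<^sup>2 - c) / a)"

lemma homeomorphism_henon:
  assumes "a \<noteq> 0"
  shows "homeomorphism UNIV UNIV (henon c a) (henon_inv c a)"
proof (rule homeomorphismI)
  have "henon c a = (\<lambda>w. ((fst w)\<^sup>2 + c + a * snd w, a * fst w))" by (auto simp: henon_def)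
  then show "continuous_on UNIV (henon c a)" by (auto intro!: continuous_intros)
  show "continuous_on UNIV (henon_inv c a)" unfolding henon_inv_def using assms by (intro continuous_intros) auto
qed (use assms in \<open>auto simp: henon_def henon_inv_def\<close>)

lemma henon_J_plus_image:
  assumes a: "a \<noteq> 0"
  shows "henon c a ` J_plus c a = J_plus c a"
proof -
  note h = homeomorphism_henon[OF a, of c]
  have inv: "henon c a (henon_inv c a w) = w" for w using homeomorphism_apply2[OF h UNIV_I] .
  have K: "henon c a ` K_plus c a = K_plus c a"
  proof
    show "henon c a ` K_plus c a \<subseteq> K_plus c a" unfolding K_plus_def using bounded_orbits_step by blast
    show "K_plus c a \<subseteq> henon c a ` K_plus c a"
    proof
      fix w assume "w \<in> K_plus c a"
      then have "henon_inv c a w \<in> K_plus c a"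
        using bounded_orbits_step[of "henon c a" "henon_inv c a w"] unfolding K_plus_def inv by simp
      then show "w \<in> henon c a ` K_plus c a" by (rule rev_image_eqI) (simp add: inv)
    qed
  qed
  have "homeomorphic_maps euclidean euclidean (henon c a) (henon_inv c a)"
    using h by (auto simp: homeomorphic_maps_def homeomorphism_def)
  then have "homeomorphic_map euclidean euclidean (henon c a)" by (rule homeomorphic_maps_imp_map)
  then have "euclidean frontier_of (henon c a ` K_plus c a) = henon c a ` (euclidean frontier_of K_plus c a)"
    by (rule homeomorphic_map_frontier_of) simp
  then show ?thesis by (simp add: K J_plus_def)
qed

lemma homeomorphic_maps_henon_J_plus:
  assumes a: "a \<noteq> 0"
  shows "homeomorphic_maps (top_of_set (J_plus c a)) (top_of_set (J_plus c a)) (henon c a) (henon_inv c a)"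
proof -
  have "homeomorphism (J_plus c a) (J_plus c a) (henon c a) (henon_inv c a)"
    by (rule homeomorphism_of_subsets[OF homeomorphism_henon[OF a] subset_UNIV subset_UNIV henon_J_plus_image[OF a]])
  then show ?thesis by (auto simp: homeomorphic_maps_def homeomorphism_def)
qed

lemma henon_iterate_J_plus: "a \<noteq> 0 \<Longrightarrow> w \<in> J_plus c a \<Longrightarrow> (henon c a ^^ n) w \<in> J_plus c a"
  using henon_J_plus_image by (induction n) auto

text \<open>The region is open, forward invariant, and doubles the first coordinate at each step;
  hence it misses \<open>K_plus\<close> and, being open, also its closure.\<close>

lemma J_plus_no_escape:
  assumes c: "cmod c \<le> 1" and a: "cmod a \<le> 1 / 4" and w: "(x, y) \<in> J_plus c a"
  shows "\<not> (cmod x > 3 \<and> cmod y < 2 * cmod x)"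
proof
  assume esc: "cmod x > 3 \<and> cmod y < 2 * cmod x"
  define W where "W = {w :: complex \<times> complex. cmod (fst w) > 3} \<inter> {w. cmod (snd w) < 2 * cmod (fst w)}"
  have "open W" unfolding W_def by (intro open_Int open_Collect_less continuous_intros)
  have step: "henon c a w \<in> W \<and> cmod (fst (henon c a w)) \<ge> 2 * cmod (fst w)" if w: "w \<in> W" for w
  proof -
    obtain u v where uv: "w = (u, v)" by force
    have u: "cmod u > 3" "cmod v < 2 * cmod u" using w by (auto simp: W_def uv)
    have "cmod (a * v) \<le> 1 / 4 * (2 * cmod u)" unfolding norm_mult using a u by (intro mult_mono) auto
    moreover have "cmod (u\<^sup>2) \<ge> 3 * cmod u" unfolding power2_eq_square norm_mult using u by (intro mult_right_mono) auto
    moreover have "cmod (u\<^sup>2) - cmod (c + a * v) \<le> cmod (u\<^sup>2 + (c + a * v))" by (rule norm_diff_ineq)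
    moreover have "cmod (c + a * v) \<le> cmod c + cmod (a * v)" by (rule norm_triangle_ineq)
    ultimately have big: "cmod (u\<^sup>2 + c + a * v) \<ge> 2 * cmod u" using c u by (simp add: add.assoc)
    have "cmod (a * u) \<le> 1 / 4 * cmod u" unfolding norm_mult using a by (intro mult_right_mono) auto
    then show ?thesis using big u by (simp add: W_def uv henon_def)
  qed
  have "w \<notin> K_plus c a" if w: "w \<in> W" for w
  proof
    have grow: "(henon c a ^^ n) w \<in> W \<and> cmod (fst ((henon c a ^^ n) w)) \<ge> 2 ^ n * cmod (fst w)" for n
    proof (induction n)
      case (Suc n)
      then show ?case using step[of "(henon c a ^^ n) w"] by simp
    qed (use w in simp)
    assume "w \<in> K_plus c a"
    then obtain B where B: "\<And>n. norm ((henon c a ^^ n) w) \<le> B"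
      by (auto simp: K_plus_def bounded_orbits_def bounded_iff)
    obtain n where n: "B < 2 ^ n" using real_arch_pow[of 2 B] by auto
    have "(2 :: real) ^ n * 1 \<le> 2 ^ n * cmod (fst w)" using w by (intro mult_left_mono) (auto simp: W_def)
    then show False using conjunct2[OF grow[of n]] B[of n] n norm_fst_le[of "fst ((henon c a ^^ n) w)" "snd ((henon c a ^^ n) w)"]
      unfolding prod.collapse by linarith
  qed
  then have "W \<inter> K_plus c a = {}" by blast
  then have "W \<inter> closure (K_plus c a) = {}" using open_Int_closure_eq_empty[OF \<open>open W\<close>] by simp
  moreover have "(x, y) \<in> W" using esc by (simp add: W_def)
  moreover have "(x, y) \<in> closure (K_plus c a)" using w by (simp add: J_plus_def frontier_def)
  ultimately show False by blast
qed

section \<open>Second order estimates on the lamination and absorption into the bidisc\<close>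

context henon_leaves
begin

sublocale model: quadratic_invariant_set J "c 0" \<kappa>
proof
  show "cmod \<zeta> < 2" if "\<zeta> \<in> J" for \<zeta> using J_less[OF that, of 0] by simp
  show "- \<zeta> \<in> J" if "\<zeta> \<in> J" for \<zeta>
    using J_preimage[of "- \<zeta>"] P0_in_J[OF that] J_nonzero[OF that] by (simp add: P0_def)
  show "\<zeta>\<^sup>2 + c 0 \<in> J" if "\<zeta> \<in> J" for \<zeta> using P0_in_J[OF that] by (simp add: P0_def)
  show "\<exists>\<zeta>\<in>J. \<zeta>\<^sup>2 + c 0 = \<zeta>'" if "\<zeta>' \<in> J" for \<zeta>' using J_surjective[OF that] by (simp add: P0_def)
qed (use \<kappa> compact_J J_lower in auto)

lemma phi_continuous:
  assumes a: "cmod a \<le> \<delta> / 3" and r: "r < R / 2"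
  shows "continuous_on (J \<times> cball 0 r) (\<lambda>w. phi a (fst w) (snd w))"
  unfolding continuous_on_def
proof
  fix w :: "complex \<times> complex" assume w: "w \<in> J \<times> cball 0 r"
  then have w1: "fst w \<in> J" "cmod (snd w) \<le> r" by auto
  have "((\<lambda>v. phi a (fst v) (snd v) - phi a (fst w) (snd w)) \<longlongrightarrow> 0) (at w within J \<times> cball 0 r)"
  proof (rule Lim_null_comparison)
    show "((\<lambda>v. sqrt (5 * cmod (fst v - fst w)) + 8 / R * cmod (snd v - snd w)) \<longlongrightarrow> 0) (at w within J \<times> cball 0 r)"
    proof -
      have "((\<lambda>v. sqrt (5 * cmod (fst v - fst w)) + 8 / R * cmod (snd v - snd w)) \<longlongrightarrow>
        sqrt (5 * cmod (fst w - fst w)) + 8 / R * cmod (snd w - snd w)) (at w within J \<times> cball 0 r)"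
        by (intro tendsto_intros)
      then show ?thesis by simp
    qed
    have "cmod (phi a (fst v) (snd v) - phi a (fst w) (snd w)) \<le> sqrt (5 * cmod (fst v - fst w)) + 8 / R * cmod (snd v - snd w)"
      if v: "v \<in> J \<times> cball 0 r" for v
    proof -
      have v1: "fst v \<in> J" "cmod (snd v) \<le> r" using v by auto
      have vR: "cmod (snd v) < R" "cmod (snd v) \<le> R / 2" "cmod (snd w) \<le> R / 2" using v1 w1 r R_pos by auto
      have "cmod (phi a (fst v) (snd v) - phi a (fst w) (snd v)) \<le> sqrt (5 * cmod (fst v - fst w))"
        by (rule real_le_rsqrt) (rule phi_hoelder(1)[OF v1(1) w1(1) vR(1) a])
      moreover have "cmod (phi a (fst w) (snd v) - phi a (fst w) (snd w)) \<le> 8 / R * cmod (snd v - snd w)"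
        by (rule phi_lipschitz_y[OF w1(1) a vR(2,3)])
      moreover have "cmod (phi a (fst v) (snd v) - phi a (fst w) (snd w)) \<le>
        cmod (phi a (fst v) (snd v) - phi a (fst w) (snd v)) + cmod (phi a (fst w) (snd v) - phi a (fst w) (snd w))"
        using norm_triangle_ineq[of "phi a (fst v) (snd v) - phi a (fst w) (snd v)" "phi a (fst w) (snd v) - phi a (fst w) (snd w)"] by simp
      ultimately show ?thesis by linarith
    qed
    then show "\<forall>\<^sub>F v in at w within J \<times> cball 0 r. norm (phi a (fst v) (snd v) - phi a (fst w) (snd w))
      \<le> sqrt (5 * cmod (fst v - fst w)) + 8 / R * cmod (snd v - snd w)"
      by (simp add: eventually_at_filter)
  qed
  then show "((\<lambda>v. phi a (fst v) (snd v)) \<longlongrightarrow> phi a (fst w) (snd w)) (at w within J \<times> cball 0 r)"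
    by (rule LIM_zero_cancel)
qed

text \<open>The functional equation exhibits the product of the difference of two values of \<open>phi\<close> with their sum,
  so \<open>phi\<close> is approximated to second order by the leaf \<open>\<zeta> - a z / (2 \<zeta>)\<close> of the model.\<close>

lemma phi_variation:
  assumes z: "\<zeta> \<in> J" and a: "cmod a \<le> \<delta> / 3" "16 / \<delta> * cmod a \<le> \<kappa>" "8 / R * cmod a \<le> \<kappa> / 2"
    and R: "R \<ge> 1" and y: "cmod y \<le> R / 2" "cmod y' \<le> R / 2"
  shows "cmod ((phi a \<zeta> y - \<zeta> + a * y / (2 * \<zeta>)) - (phi a \<zeta> y' - \<zeta> + a * y' / (2 * \<zeta>)))
    \<le> (16 / \<delta> + 8 / R) / \<kappa>\<^sup>2 * (cmod a)\<^sup>2 * cmod (y - y')"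
proof -
  define A B \<theta> where "A = phi a \<zeta> y" and "B = phi a \<zeta> y'" and "\<theta> = phi a (P0 \<zeta>) (a * A) - phi a (P0 \<zeta>) (a * B)"
  have yR: "cmod y < R" "cmod y' < R" using y R_pos by auto
  have a4: "cmod a \<le> 1 / 4" using a(1) \<delta> by simp
  have AB: "cmod A < 2" "cmod B < 2" unfolding A_def B_def using phi_less[OF z a(1)] yR by auto
  have aAB: "cmod (a * u) \<le> R / 2" if "cmod u < 2" for u
  proof -
    have "cmod a * cmod u \<le> 1 / 4 * 2" using a4 that by (intro mult_mono) auto
    then show ?thesis using R by (simp add: norm_mult)
  qed
  have "cmod \<theta> \<le> 8 / R * cmod (a * A - a * B)"
    unfolding \<theta>_def by (rule phi_lipschitz_y[OF P0_in_J[OF z] a(1) aAB[OF AB(1)] aAB[OF AB(2)]])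
  also have "\<dots> = 8 / R * cmod a * cmod (A - B)" by (simp add: norm_mult flip: right_diff_distrib)
  finally have \<theta>: "cmod \<theta> \<le> 8 / R * cmod a * cmod (A - B)" .
  have "phi a (P0 \<zeta>) (a * A) = A\<^sup>2 + c a + a * y" "phi a (P0 \<zeta>) (a * B) = B\<^sup>2 + c a + a * y'"
    unfolding A_def B_def by (rule phi_functional_equation[OF z a(1) yR(1)], rule phi_functional_equation[OF z a(1) yR(2)])
  then have prod: "(A - B) * (A + B) = \<theta> - a * (y - y')" by (simp add: \<theta>_def algebra_simps power2_eq_square)
  have "cmod (A - \<zeta>) \<le> 8 / \<delta> * cmod a" "cmod (B - \<zeta>) \<le> 8 / \<delta> * cmod a"
    unfolding A_def B_def using phi_displacement[OF z a(1)] yR by auto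
  then have "cmod ((A - \<zeta>) + (B - \<zeta>)) \<le> 8 / \<delta> * cmod a + 8 / \<delta> * cmod a" by (rule norm_triangle_le[OF add_mono])
  then have sum: "cmod (2 * \<zeta> - (A + B)) \<le> 16 / \<delta> * cmod a"
    by (simp add: norm_minus_commute algebra_simps)
  have "cmod (2 * \<zeta>) - cmod (2 * \<zeta> - (A + B)) \<le> cmod (A + B)"
    using norm_triangle_ineq2[of "2 * \<zeta>" "2 * \<zeta> - (A + B)"] by simp
  \<comment> \<open>The sum is close to \<open>2 \<zeta>\<close>, so dividing by it is safe. The
    term \<open>\<theta>\<close> contains \<open>A - B\<close> again, but with a factor of at most
    \<open>\<kappa> / 2\<close>, and is absorbed.\<close>
  then have "\<kappa> \<le> cmod (A + B)" using sum a(2) J_lower[OF z] by (simp add: norm_mult)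
  then have "\<kappa> * cmod (A - B) \<le> cmod (A - B) * cmod (A + B)"
    using mult_right_mono[of \<kappa> "cmod (A + B)" "cmod (A - B)"] by (simp only: mult.commute norm_ge_zero)
  also have "\<dots> = cmod (\<theta> - a * (y - y'))" by (simp only: prod flip: norm_mult)
  also have "\<dots> \<le> cmod \<theta> + cmod a * cmod (y - y')" using norm_triangle_ineq4[of \<theta> "a * (y - y')"] by (simp add: norm_mult)
  also have "\<dots> \<le> \<kappa> / 2 * cmod (A - B) + cmod a * cmod (y - y')"
    using \<theta> mult_right_mono[OF a(3), of "cmod (A - B)"] by simp
  finally have "\<kappa> / 2 * cmod (A - B) \<le> cmod a * cmod (y - y')" by (simp add: field_simps)
  then have d: "cmod (A - B) \<le> 2 * cmod a / \<kappa> * cmod (y - y')" using \<kappa> by (simp add: field_simps)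
  have nz: "\<zeta> \<noteq> 0" using J_nonzero z by blast
  define E where "E = (A - \<zeta> + a * y / (2 * \<zeta>)) - (B - \<zeta> + a * y' / (2 * \<zeta>))"
  have "2 * \<zeta> * E = 2 * \<zeta> * (A - B) + a * (y - y')" unfolding E_def using nz by (simp add: field_simps)
  \<comment> \<open>Both terms are \<open>O(a)\<close> times \<open>A - B\<close>, which is itself
    \<open>O(a)\<close> times \<open>y - y'\<close>; this is the second order gain.\<close>
  also have "\<dots> = (A - B) * (2 * \<zeta> - (A + B)) + \<theta>" using prod by (simp add: algebra_simps)
  finally have "cmod (2 * \<zeta> * E) = cmod ((A - B) * (2 * \<zeta> - (A + B)) + \<theta>)" by (rule arg_cong)
  also have "\<dots> \<le> cmod (A - B) * cmod (2 * \<zeta> - (A + B)) + cmod \<theta>"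
    using norm_triangle_ineq[of "(A - B) * (2 * \<zeta> - (A + B))" \<theta>] by (simp add: norm_mult)
  also have "\<dots> \<le> cmod (A - B) * (16 / \<delta> * cmod a) + 8 / R * cmod a * cmod (A - B)"
    using sum \<theta> by (intro add_mono mult_left_mono) auto
  also have "\<dots> = (16 / \<delta> + 8 / R) * cmod a * cmod (A - B)" by (simp add: algebra_simps)
  also have "\<dots> \<le> (16 / \<delta> + 8 / R) * cmod a * (2 * cmod a / \<kappa> * cmod (y - y'))"
    using d \<delta> R_pos by (intro mult_left_mono) auto
  finally have "2 * cmod \<zeta> * cmod E \<le> (16 / \<delta> + 8 / R) * cmod a * (2 * cmod a / \<kappa> * cmod (y - y'))" by (simp add: norm_mult)
  moreover have "2 * \<kappa> * cmod E \<le> 2 * cmod \<zeta> * cmod E" using J_lower[OF z] by (intro mult_right_mono) auto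
  ultimately have "2 * \<kappa> * cmod E \<le> (16 / \<delta> + 8 / R) * cmod a * (2 * cmod a / \<kappa> * cmod (y - y'))" by linarith
  also have "\<dots> = 2 * \<kappa> * ((16 / \<delta> + 8 / R) / \<kappa>\<^sup>2 * (cmod a)\<^sup>2 * cmod (y - y'))"
    using \<kappa> by (simp add: power2_eq_square)
  finally have "cmod E \<le> (16 / \<delta> + 8 / R) / \<kappa>\<^sup>2 * (cmod a)\<^sup>2 * cmod (y - y')"
    by (rule mult_left_le_imp_le) (use \<kappa> in simp)
  then show ?thesis unfolding E_def A_def B_def .
qed

text \<open>If all \<open>y_n\<close> stayed at \<open>r\<close> or above, then
  \<open>y_(n+1) = a x_n\<close> would keep all \<open>x_n\<close> above \<open>3 r\<close>. Being
  in \<open>J_plus\<close> then forces \<open>2 * cmod x_n \<le> cmod y_n\<close>, so that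
  \<open>x_n\<close> decays geometrically, a contradiction. Once \<open>y_n\<close> is small, the
  lamination bounds \<open>x_n\<close> by 2.\<close>

lemma J_plus_absorb:
  assumes a: "a \<noteq> 0" "cmod a \<le> \<delta> / 3" and r: "r > 3" "2 * r < R" and w: "w \<in> J_plus (c a) a"
  shows "\<exists>n. (henon (c a) a ^^ n) w \<in> ball 0 r \<times> ball 0 r"
proof -
  have a\<delta>: "cmod a < \<delta>" using a \<delta> by simp
  have a4: "cmod a \<le> 1 / 12" using a(2) \<delta> by simp
  define x y where "x = (\<lambda>n. fst ((henon (c a) a ^^ n) w))" and "y = (\<lambda>n. snd ((henon (c a) a ^^ n) w))"
  have mem: "(x n, y n) \<in> J_plus (c a) a" for n
    using henon_iterate_J_plus[OF a(1) w, of n] by (simp add: x_def y_def)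
  have ySuc: "y (Suc n) = a * x n" for n by (simp add: x_def y_def henon_def split_beta)
  have xr: "(henon (c a) a ^^ n) w \<in> ball 0 r \<times> ball 0 r" if "cmod (y n) < r" for n
  proof -
    have yR: "cmod (y n) < R / 2" "cmod (y n) < R" using that r by auto
    obtain \<zeta> where "\<zeta> \<in> J" "x n = phi a \<zeta> (y n)" using J_plus_lamination[OF a(2) yR(1)] mem by blast
    then have "cmod (x n) < 2" using phi_less[OF _ a(2) yR(2)] by simp
    then show ?thesis using that r by (simp add: x_def y_def mem_Times_iff)
  qed
  have "\<exists>n. cmod (y n) < r"
  proof (rule ccontr)
    assume "\<not> ?thesis"
    then have large: "cmod (y n) \<ge> r" for n by (simp add: not_less)
    have xlarge: "cmod (x n) \<ge> 3 * r" for n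
    proof -
      have "r \<le> cmod a * cmod (x n)" using large[of "Suc n"] by (simp add: ySuc norm_mult)
      also have "\<dots> \<le> 1 / 12 * cmod (x n)" using a4 by (rule mult_right_mono) simp
      finally show ?thesis using r by simp
    qed
    have "2 * cmod (x n) \<le> cmod (y n)" for n
    proof -
      have "cmod a \<le> 1 / 4" using a4 by simp
      then have "\<not> (cmod (x n) > 3 \<and> cmod (y n) < 2 * cmod (x n))"
        by (rule J_plus_no_escape[OF c_bound[OF a\<delta>] _ mem[of n]])
      then show ?thesis using xlarge[of n] r by linarith
    qed
    then have half: "cmod (x (Suc n)) \<le> 1 / 2 * cmod (x n)" for n
    proof -
      have "2 * cmod (x (Suc n)) \<le> cmod a * cmod (x n)"
        using \<open>\<And>n. 2 * cmod (x n) \<le> cmod (y n)\<close>[of "Suc n"] by (simp add: ySuc norm_mult)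
      also have "\<dots> \<le> 1 * cmod (x n)" using a4 by (intro mult_right_mono) auto
      finally show ?thesis by simp
    qed
    have dec: "cmod (x n) \<le> (1 / 2) ^ n * cmod (x 0)" for n
    proof (induction n)
      case (Suc n)
      then show ?case using half[of n] by simp
    qed simp
    have "(\<lambda>n. (1 / 2 :: real) ^ n * cmod (x 0)) \<longlonglongrightarrow> 0 * cmod (x 0)"
      by (intro tendsto_intros LIMSEQ_power_zero) simp
    then have "(\<lambda>n. (1 / 2 :: real) ^ n * cmod (x 0)) \<longlonglongrightarrow> 0" by simp
    then have "eventually (\<lambda>n. (1 / 2 :: real) ^ n * cmod (x 0) < r) sequentially"
      by (rule order_tendstoD(2)) (use r in simp)
    then obtain n where "(1 / 2 :: real) ^ n * cmod (x 0) < r" by (auto simp: eventually_sequentially)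
    then show False using dec[of n] xlarge[of n] r by linarith
  qed
  then show ?thesis using xr by blast
qed

lemma phi_homeomorphism:
  assumes a: "cmod a \<le> \<delta> / 3" and r: "r > 3" "2 * r < R"
  shows "\<exists>g. homeomorphism (J \<times> ball 0 r) (J_plus (c a) a \<inter> (ball 0 r \<times> ball 0 r)) (\<lambda>w. (phi a (fst w) (snd w), snd w)) g"
proof -
  define F where "F = (\<lambda>w. (phi a (fst w) (snd w), snd w))"
  have rR: "r < R / 2" using r by simp
  have cont: "continuous_on (J \<times> cball 0 r) F"
    unfolding F_def by (intro continuous_intros phi_continuous[OF a rR])
  have "inj_on F (J \<times> cball 0 r)"
  proof (rule inj_onI)
    fix v w assume v: "v \<in> J \<times> cball 0 r" and w: "w \<in> J \<times> cball 0 r" and e: "F v = F w"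
    have s: "snd v = snd w" and p: "phi a (fst v) (snd w) = phi a (fst w) (snd w)" using e by (auto simp: F_def)
    have m: "fst v \<in> J" "fst w \<in> J" "cmod (snd w) < R" using v w r by auto
    have "(cmod (fst v - fst w))\<^sup>2 \<le> 0" using phi_hoelder(2)[OF m a] p by simp
    then show "v = w" using s by (simp add: prod_eq_iff)
  qed
  then obtain g where g: "homeomorphism (J \<times> cball 0 r) (F ` (J \<times> cball 0 r)) F g"
    using homeomorphism_compact[OF compact_Times[OF compact_J compact_cball] cont refl] by blast
  have im: "F ` (J \<times> ball 0 r) = J_plus (c a) a \<inter> (ball 0 r \<times> ball 0 r)"
  proof (intro equalityI subsetI)
    fix u assume "u \<in> F ` (J \<times> ball 0 r)"
    then obtain w where w: "fst w \<in> J" "cmod (snd w) < r" "u = F w" by auto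
    have wR: "cmod (snd w) < R" "cmod (snd w) < R / 2" using w r by auto
    have "(phi a (fst w) (snd w), snd w) \<in> J_plus (c a) a"
      unfolding J_plus_lamination[OF a wR(2)] using w(1) by blast
    moreover have "cmod (phi a (fst w) (snd w)) < r" using phi_less[OF w(1) a wR(1)] r by linarith
    ultimately show "u \<in> J_plus (c a) a \<inter> (ball 0 r \<times> ball 0 r)" using w by (simp add: F_def)
  next
    fix u assume u: "u \<in> J_plus (c a) a \<inter> (ball 0 r \<times> ball 0 r)"
    then have y: "cmod (snd u) < r" "cmod (snd u) < R / 2" using r by auto
    have "(fst u, snd u) \<in> J_plus (c a) a" using u by simp
    then obtain \<zeta> where "\<zeta> \<in> J" "fst u = phi a \<zeta> (snd u)" unfolding J_plus_lamination[OF a y(2)] by blast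
    then show "u \<in> F ` (J \<times> ball 0 r)"
      by (intro image_eqI[of _ _ "(\<zeta>, snd u)"]) (use y in \<open>auto simp: F_def prod_eq_iff\<close>)
  qed
  have "homeomorphism (J \<times> ball 0 r) (J_plus (c a) a \<inter> (ball 0 r \<times> ball 0 r)) F g"
    by (rule homeomorphism_of_subsets[OF g _ subset_refl im]) auto
  then show ?thesis unfolding F_def by blast
qed

end

lemma homeomorphism_imp_homeomorphic_map:
  "homeomorphism S T f g \<Longrightarrow> homeomorphic_map (top_of_set S) (top_of_set T) f"
  by (rule homeomorphic_maps_imp_map[where g = g]) (auto simp: homeomorphic_maps_def homeomorphism_def)

lemma homeomorphism_onto_open_imp_open_map:
  assumes "homeomorphism S T f g" "openin (top_of_set Y) T"
  shows "open_map (top_of_set S) (top_of_set Y) f"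
  unfolding open_map_def using homeomorphism_imp_open_map[OF assms(1)] openin_trans[OF _ assms(2)] by blast

context henon_leaves
begin

theorem henon_model:
  assumes a: "a \<noteq> 0" "cmod a \<le> \<delta> / 3" and r: "r > 3" "2 * r < R"
    and small: "16 / \<delta> * cmod a \<le> \<kappa>" "8 / R * cmod a \<le> \<kappa> / 2" "r * cmod a \<le> \<kappa>\<^sup>2 / 2"
      "(2 * (8 / \<delta> + r / (2 * \<kappa>)) / \<kappa> + 4 * ((16 / \<delta> + 8 / R) / \<kappa>\<^sup>2)) * cmod a \<le> 1 / 4"
  defines "T \<equiv> top_of_set (J \<times> ball (0 :: complex) r)" and "V \<equiv> ball (0 :: complex) r \<times> ball (0 :: complex) r"
  shows "continuous_map T T (model.psi a) \<and> open_map T T (model.psi a) \<and>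
    inj_on (model.psi a) (topspace T) \<and>
    (\<exists>\<Phi>. homeomorphic_map T (top_of_set (J_plus (c a) a \<inter> V)) \<Phi> \<and>
         (\<forall>w\<in>topspace T. henon (c a) a (\<Phi> w) = \<Phi> (model.psi a w)) \<and>
         (\<exists>\<Phi>'. homeomorphic_map (ind_lim T (model.psi a)) (top_of_set (J_plus (c a) a)) \<Phi>' \<and>
               (\<forall>w\<in>topspace T. \<Phi>' (ind_lim_class T (model.psi a) (w, 0)) = \<Phi> w) \<and>
               (\<forall>C\<in>topspace (ind_lim T (model.psi a)).
                  henon (c a) a (\<Phi>' C) = \<Phi>' (ind_lim_map T (model.psi a) C))))"
proof -
  define A where "A = J \<times> ball (0 :: complex) r"
  have T: "T = top_of_set A" "topspace T = A" by (simp_all add: T_def A_def)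
  have ar: "cmod a * r \<le> \<kappa>\<^sup>2 / 2" using small(3) by (simp add: mult.commute)
  have apos: "cmod a > 0" using a by simp
  have sub: "model.psi a ` A \<subseteq> A" unfolding A_def by (rule model.psi_image_subset[OF r(1) ar])
  obtain \<psi>i where \<psi>i: "homeomorphism A (model.psi a ` A) (model.psi a) \<psi>i"
    using model.psi_homeomorphism[OF a(1) model.small_parameter(4)[OF r(1) ar]] unfolding A_def by blast
  have op: "openin (top_of_set A) (model.psi a ` A)" using model.psi_openin[OF a(1)] sub unfolding A_def by blast
  have cont\<psi>: "continuous_map T T (model.psi a)"
    using \<psi>i sub by (auto simp: T homeomorphism_def)
  have open\<psi>: "open_map T T (model.psi a)"
    unfolding T by (rule homeomorphism_onto_open_imp_open_map[OF \<psi>i op])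
  have inj\<psi>: "inj_on (model.psi a) (topspace T)"
    unfolding T(2) by (rule inj_on_inverseI[of _ \<psi>i]) (rule homeomorphism_apply1[OF \<psi>i])
  \<comment> \<open>\<open>G\<close> is of first order: the displacement of the leaf plus the size
    of the linear term of the model. \<open>M\<close> is of second order, so
    \<open>M / cmod a\<close> still tends to 0.\<close>
  define G M where "G = (8 / \<delta> + r / (2 * \<kappa>)) * cmod a" and "M = (16 / \<delta> + 8 / R) / \<kappa>\<^sup>2 * (cmod a)\<^sup>2"
  have "\<exists>h h'. homeomorphism A A h h' \<and>
    (\<forall>w\<in>A. h (model.psi a w) = ((fst (h w))\<^sup>2 + c 0, a * phi a (fst (h w)) (snd (h w))))"
    unfolding A_def
  proof (rule model.model_conjugacy[OF a(1) r(1) ar, where G = G and M = M])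
    show "continuous_on (J \<times> cball 0 r) (\<lambda>w. phi a (fst w) (snd w))"
      by (rule phi_continuous[OF a(2)]) (use r in simp)
    show "0 \<le> M" unfolding M_def using \<delta> R_pos by (intro mult_nonneg_nonneg divide_nonneg_nonneg add_nonneg_nonneg) auto
    have "4 * M / cmod a = 4 * ((16 / \<delta> + 8 / R) / \<kappa>\<^sup>2) * cmod a"
      using apos by (simp add: M_def power2_eq_square[of "cmod a"])
    moreover have "2 * G / \<kappa> = 2 * (8 / \<delta> + r / (2 * \<kappa>)) / \<kappa> * cmod a" by (simp add: G_def)
    ultimately show "2 * G / \<kappa> + 4 * M / cmod a \<le> 1 / 4" using small(4) by (simp only: distrib_right)
    fix \<zeta> z assume z: "\<zeta> \<in> J" "cmod z \<le> r"
    have zR: "cmod z < R" "cmod z \<le> R / 2" using z r by auto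
    show "cmod (phi a \<zeta> z) \<le> 2" using phi_less[OF z(1) a(2) zR(1)] by simp
    have "cmod (a * z / (2 * \<zeta>)) \<le> r / (2 * \<kappa>) * cmod a"
    proof -
      have "cmod (a * z / (2 * \<zeta>)) = cmod a * (cmod z / (2 * cmod \<zeta>))" by (simp add: norm_mult norm_divide)
      also have "\<dots> \<le> cmod a * (r / (2 * \<kappa>))"
        using z J_lower[OF z(1)] \<kappa> r by (intro mult_left_mono frac_le) auto
      finally show ?thesis by (simp only: mult.commute)
    qed
    then show "cmod (phi a \<zeta> z - \<zeta> + a * z / (2 * \<zeta>)) \<le> G"
      unfolding G_def distrib_right by (intro norm_triangle_le add_mono phi_displacement[OF z(1) a(2) zR(1)])
    fix z' assume z': "cmod z' \<le> r"
    have zR': "cmod z' \<le> R / 2" using z' r by auto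
    show "cmod (phi a \<zeta> z - \<zeta> + a * z / (2 * \<zeta>) - (phi a \<zeta> z' - \<zeta> + a * z' / (2 * \<zeta>))) \<le> M * cmod (z - z')"
      unfolding M_def by (rule phi_variation[OF z(1) a(2) small(1,2) _ zR(2) zR']) (use r in simp)
    have "cmod a * cmod (phi a \<zeta> z - phi a \<zeta> z') \<le> cmod a * (8 / R * cmod (z - z'))"
      by (rule mult_left_mono[OF phi_lipschitz_y[OF z(1) a(2) zR(2) zR']]) simp
    also have "\<dots> = (8 / R * cmod a) * cmod (z - z')" by simp
    also have "\<dots> \<le> 1 / 2 * cmod (z - z')" using small(2) \<kappa> by (intro mult_right_mono) auto
    finally show "cmod a * cmod (phi a \<zeta> z - phi a \<zeta> z') \<le> cmod (z - z') / 2" by simp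
  qed
  then obtain h h' where h: "homeomorphism A A h h'"
    "\<And>w. w \<in> A \<Longrightarrow> h (model.psi a w) = ((fst (h w))\<^sup>2 + c 0, a * phi a (fst (h w)) (snd (h w)))" by blast
  define F where "F = (\<lambda>w. (phi a (fst w) (snd w), snd w))"
  obtain g where g: "homeomorphism A (J_plus (c a) a \<inter> V) F g"
    using phi_homeomorphism[OF a(2) r] unfolding A_def F_def V_def by blast
  define \<Phi> where "\<Phi> = F \<circ> h"
  have \<Phi>: "homeomorphism A (J_plus (c a) a \<inter> V) \<Phi> (h' \<circ> g)"
    unfolding \<Phi>_def by (rule homeomorphism_compose[OF h(1) g])
  have conj: "henon (c a) a (\<Phi> w) = \<Phi> (model.psi a w)" if w: "w \<in> A" for w
  proof -
    have "h w \<in> A" using h(1) w by (auto simp: homeomorphism_def)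
    then have m: "fst (h w) \<in> J" "cmod (snd (h w)) < R" using r by (auto simp: A_def)
    show ?thesis
      using phi_functional_equation[OF m(1) a(2) m(2)] by (simp add: \<Phi>_def F_def h(2)[OF w] henon_def P0_def)
  qed
  have opV: "openin (top_of_set (J_plus (c a) a)) (J_plus (c a) a \<inter> V)"
    unfolding V_def by (intro openin_open_Int open_Times open_ball)
  have "\<exists>\<Phi>'. homeomorphic_map (ind_lim T (model.psi a)) (top_of_set (J_plus (c a) a)) \<Phi>' \<and>
    (\<forall>w\<in>topspace T. \<Phi>' (ind_lim_class T (model.psi a) (w, 0)) = \<Phi> w) \<and>
    (\<forall>C\<in>topspace (ind_lim T (model.psi a)). henon (c a) a (\<Phi>' C) = \<Phi>' (ind_lim_map T (model.psi a) C))"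
  proof (rule ind_lim_extension[OF _ homeomorphic_maps_henon_J_plus[OF a(1)]])
    show "model.psi a ` topspace T \<subseteq> topspace T" using sub by (simp add: T)
    show "continuous_map T (top_of_set (J_plus (c a) a)) \<Phi>"
      using \<Phi> by (auto simp: T homeomorphism_def)
    show "open_map T (top_of_set (J_plus (c a) a)) \<Phi>"
      unfolding T by (rule homeomorphism_onto_open_imp_open_map[OF \<Phi> opV])
    show "inj_on \<Phi> (topspace T)"
      unfolding T(2) by (rule inj_on_inverseI[of _ "h' \<circ> g"]) (rule homeomorphism_apply1[OF \<Phi>])
    show "henon (c a) a (\<Phi> w) = \<Phi> (model.psi a w)" if "w \<in> topspace T" for w
      using conj that by (simp add: T)
    fix w assume "w \<in> topspace (top_of_set (J_plus (c a) a))"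
    then have w: "w \<in> J_plus (c a) a" by simp
    obtain n where "(henon (c a) a ^^ n) w \<in> V" using J_plus_absorb[OF a r w] unfolding V_def by (rule exE)
    then have "(henon (c a) a ^^ n) w \<in> \<Phi> ` A"
      using henon_iterate_J_plus[OF a(1) w, of n] homeomorphism_image1[OF \<Phi>] by blast
    then show "\<exists>n. (henon (c a) a ^^ n) w \<in> \<Phi> ` topspace T" unfolding T(2) by blast
  qed
  moreover have "homeomorphic_map T (top_of_set (J_plus (c a) a \<inter> V)) \<Phi>"
    unfolding T by (rule homeomorphism_imp_homeomorphic_map[OF \<Phi>])
  ultimately show ?thesis using cont\<psi> open\<psi> inj\<psi> conj unfolding T(2) by blast
qed

end

section \<open>Choice of the constants and conclusion\<close>

lemma root_of_unity_power:
  fixes p :: int and q :: nat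
  assumes q: "q \<ge> 1" "coprime p (int q)"
  shows "exp (2 * complex_of_real pi * \<i> * of_int p / of_nat q) ^ k = 1 \<longleftrightarrow> q dvd k"
proof -
  have "exp (2 * complex_of_real pi * \<i> * of_int p / of_nat q) ^ k =
    exp (of_nat k * (2 * complex_of_real pi * \<i> * of_int p / of_nat q))" by (rule exp_of_nat_mult[symmetric])
  also have "of_nat k * (2 * complex_of_real pi * \<i> * of_int p / of_nat q) = \<i> * of_real (2 * pi * p * k / q)"
    by simp
  also have "exp (\<i> * of_real (2 * pi * p * k / q)) = 1 \<longleftrightarrow> (\<exists>n::int. 2 * pi * p * k / q = of_int (2 * n) * pi)"
    by (simp add: exp_eq_1)
  also have "\<dots> \<longleftrightarrow> (\<exists>n::int. real_of_int (p * int k) = of_int (n * int q))"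
    using q(1) by (simp add: field_simps)
  also have "\<dots> \<longleftrightarrow> (\<exists>n::int. p * int k = n * int q)" unfolding of_int_eq_iff ..
  also have "\<dots> \<longleftrightarrow> int q dvd p * int k" by (auto simp: dvd_def mult.commute)
  also have "\<dots> \<longleftrightarrow> q dvd k" using q(2) by (simp add: coprime_commute coprime_dvd_mult_right_iff)
  finally show ?thesis .
qed

lemma eventually_cmod_le:
  assumes "m > 0"
  shows "\<forall>\<^sub>F a in at (0 :: complex). k * cmod a \<le> m"
proof -
  have "((\<lambda>a. k * cmod a) \<longlongrightarrow> k * cmod 0) (at (0 :: complex))" by (intro tendsto_intros)
  then have "\<forall>\<^sub>F a in at (0 :: complex). k * cmod a < m" by (rule order_tendstoD(2)) (use assms in simp)
  then show ?thesis by (rule eventually_mono) simp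
qed

lemma curve_c_bounded_near_0:
  assumes l: "cmod l = 1"
  shows "\<exists>d>0. \<forall>a. cmod a < d \<longrightarrow> cmod (curve_c l (a\<^sup>2)) \<le> 1"
proof -
  have lnz: "l \<noteq> 0" using l by auto
  have "cmod (l / 2 - l\<^sup>2 / 4) \<le> cmod (l / 2) + cmod (l\<^sup>2 / 4)" by (rule norm_triangle_ineq4)
  then have lt: "cmod (curve_c l (0\<^sup>2)) < 1" using l by (simp add: curve_c_0 norm_divide norm_power)
  have "((\<lambda>a. cmod (curve_c l (a\<^sup>2))) \<longlongrightarrow> cmod (curve_c l (0\<^sup>2))) (nhds 0)"
    unfolding curve_c_def using lnz by (intro tendsto_intros filterlim_ident) auto
  then have "\<forall>\<^sub>F a in nhds 0. cmod (curve_c l (a\<^sup>2)) < 1" using lt by (rule order_tendstoD(2))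
  then show ?thesis unfolding eventually_nhds_metric by (auto intro: less_imp_le)
qed

lemma henon_leaves_curve:
  assumes q: "q \<ge> 1" and l: "\<And>k. l ^ k = 1 \<longleftrightarrow> q dvd k" and R: "R > 1"
  shows "\<exists>\<kappa> \<delta>. henon_leaves (\<lambda>a. curve_c l (a\<^sup>2)) \<kappa> \<delta> R"
proof -
  have lq: "l ^ q = 1" using l by simp
  then have lnz: "l \<noteq> 0" using q by (auto simp: power_0_left)
  have "cmod l ^ q = 1" using lq by (metis norm_one norm_power)
  then have cl: "cmod l = 1" using q power_eq_1_iff[of "cmod l" q] by simp
  obtain \<kappa>1 B where \<kappa>1: "\<kappa>1 > 0" and
    B: "\<And>e x t n. cmod e < \<kappa>1 \<Longrightarrow> cmod x < \<kappa>1 \<Longrightarrow> cmod t < \<kappa>1 \<Longrightarrow> cmod (henon_x (curve_c l e) e x t n) \<le> B"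
    using semiparabolic_basin[OF q l] by blast
  obtain d where d: "d > 0" "\<And>a. cmod a < d \<Longrightarrow> cmod (curve_c l (a\<^sup>2)) \<le> 1"
    using curve_c_bounded_near_0[OF cl] by blast
  \<comment> \<open>\<open>1 / (4 * R)\<close> bounds \<open>a y\<close> by \<open>1 / 4\<close>,
    \<open>\<kappa>1 / (2 * R)\<close> keeps \<open>t\<close> inside the basin, and \<open>d\<close>
    bounds \<open>c\<close>.\<close>
  define \<kappa> \<delta> where "\<kappa> = min \<kappa>1 1" and "\<delta> = Min {\<kappa>, 1 / (4 * R), \<kappa>1 / (2 * R), d}"
  have \<delta>: "0 < \<delta>" "\<delta> \<le> \<kappa>" "\<delta> \<le> 1 / (4 * R)" "\<delta> \<le> \<kappa>1 / (2 * R)" "\<delta> \<le> d"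
    using \<kappa>1 d R by (auto simp: \<delta>_def \<kappa>_def)
  have \<delta>R: "\<delta> * R \<le> 1 / 4" "\<delta> * R \<le> \<kappa>1 / 2" using \<delta>(3,4) R by (auto simp: field_simps)
  have "1 / (4 * R) \<le> 1 / 4" using R by (simp add: field_simps)
  then have \<delta>4: "\<delta> \<le> 1 / 4" using \<delta>(3) by linarith
  have "henon_leaves (\<lambda>a. curve_c l (a\<^sup>2)) \<kappa> \<delta> R"
  proof
    show "0 < \<kappa>" "\<kappa> \<le> 1" using \<kappa>1 by (auto simp: \<kappa>_def)
    show "0 < \<delta>" "\<delta> \<le> \<kappa>" "\<delta> \<le> 1 / 4" "\<delta> * R \<le> 1 / 4" using \<delta> \<delta>4 \<delta>R by auto
    show "4 * \<delta> < R" using \<delta>4 R by linarith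
    show "cmod (curve_c l (a\<^sup>2)) \<le> 1" if "cmod a < \<delta>" for a using d(2) that \<delta>(5) by simp
    show "(\<lambda>a. curve_c l (a\<^sup>2)) holomorphic_on ball 0 \<delta>"
      unfolding curve_c_def using lnz by (intro holomorphic_intros) auto
    show "\<exists>B. \<forall>a x t n. cmod a < \<delta> \<and> cmod x < \<kappa> \<and> cmod t \<le> \<delta> * R \<longrightarrow>
      cmod (henon_x (curve_c l (a\<^sup>2)) (a\<^sup>2) x t n) \<le> B"
    proof (intro exI[of _ B] allI impI, elim conjE)
      fix a x t n assume a: "cmod a < \<delta>" and x: "cmod x < \<kappa>" and t: "cmod t \<le> \<delta> * R"
      have "cmod (a\<^sup>2) \<le> 1 * cmod a" unfolding power2_eq_square norm_mult using a \<delta>4 by (intro mult_right_mono) auto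
      then have "cmod (a\<^sup>2) < \<kappa>1" using a \<delta>(2) by (simp add: \<kappa>_def)
      moreover have "cmod x < \<kappa>1" using x by (simp add: \<kappa>_def)
      moreover have "cmod t < \<kappa>1" using t \<delta>R(2) \<kappa>1 by linarith
      ultimately show "cmod (henon_x (curve_c l (a\<^sup>2)) (a\<^sup>2) x t n) \<le> B" by (rule B)
    qed
  qed
  then show ?thesis by blast
qed

theorem theorem1p3:
  fixes p :: int and q :: nat and r :: real and l :: complex
  assumes "q \<ge> 1" and "coprime p (int q)"
    and l: "l = exp (2 * complex_of_real pi * \<i> * of_int p / of_nat q)"
    and "r > 3"
  defines "P \<equiv> parabolic_poly l"
    and "X \<equiv> top_of_set (julia_set (parabolic_poly l) \<times> ball (0::complex) r)"
    and "V \<equiv> ball (0::complex) r \<times> ball (0::complex) r"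
  shows "\<exists>\<delta>>0. \<forall>c a. (c, a) \<in> param_curve l \<and> 0 < cmod a \<and> cmod a < \<delta> \<longrightarrow>
    continuous_map X X (model_map P a) \<and> open_map X X (model_map P a) \<and>
    inj_on (model_map P a) (topspace X) \<and>
    (\<exists>\<Phi>. homeomorphic_map X (top_of_set (J_plus c a \<inter> V)) \<Phi> \<and>
         (\<forall>w\<in>topspace X. henon c a (\<Phi> w) = \<Phi> (model_map P a w)) \<and>
         (\<exists>\<Phi>'. homeomorphic_map (ind_lim X (model_map P a)) (top_of_set (J_plus c a)) \<Phi>' \<and>
               (\<forall>w\<in>topspace X. \<Phi>' (ind_lim_class X (model_map P a) (w, 0)) = \<Phi> w) \<and>
               (\<forall>C\<in>topspace (ind_lim X (model_map P a)).
                  henon c a (\<Phi>' C) = \<Phi>' (ind_lim_map X (model_map P a) C))))"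
proof -
  have lk: "l ^ k = 1 \<longleftrightarrow> q dvd k" for k unfolding l by (rule root_of_unity_power) fact+
  \<comment> \<open>The lamination describes \<open>J_plus\<close> only for
    \<open>cmod y < R / 2\<close>, so \<open>R\<close> has to exceed \<open>2 * r\<close>.\<close>
  define R where "R = 2 * r + 1"
  have R: "R > 1" "2 * r < R" using \<open>r > 3\<close> by (simp_all add: R_def)
  obtain \<kappa> \<delta> where "henon_leaves (\<lambda>a. curve_c l (a\<^sup>2)) \<kappa> \<delta> R"
    using henon_leaves_curve[OF \<open>q \<ge> 1\<close> lk R(1)] by blast
  then interpret H: henon_leaves "\<lambda>a. curve_c l (a\<^sup>2)" \<kappa> \<delta> R .
  have "\<forall>\<^sub>F a in at 0. 1 * cmod a \<le> \<delta> / 3 \<and> 16 / \<delta> * cmod a \<le> \<kappa> \<and> 8 / R * cmod a \<le> \<kappa> / 2 \<and>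
    r * cmod a \<le> \<kappa>\<^sup>2 / 2 \<and>
    (2 * (8 / \<delta> + r / (2 * \<kappa>)) / \<kappa> + 4 * ((16 / \<delta> + 8 / R) / \<kappa>\<^sup>2)) * cmod a \<le> 1 / 4"
    using H.\<kappa> H.\<delta> by (intro eventually_conj eventually_cmod_le) auto
  then obtain \<epsilon> where \<epsilon>: "\<epsilon> > 0" and small: "\<And>a. a \<noteq> 0 \<Longrightarrow> cmod a < \<epsilon> \<Longrightarrow>
    1 * cmod a \<le> \<delta> / 3 \<and> 16 / \<delta> * cmod a \<le> \<kappa> \<and> 8 / R * cmod a \<le> \<kappa> / 2 \<and>
    r * cmod a \<le> \<kappa>\<^sup>2 / 2 \<and>
    (2 * (8 / \<delta> + r / (2 * \<kappa>)) / \<kappa> + 4 * ((16 / \<delta> + 8 / R) / \<kappa>\<^sup>2)) * cmod a \<le> 1 / 4"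
    unfolding eventually_at by auto
  have "l \<noteq> 0" by (simp add: l)
  have P0: "H.P0 = parabolic_poly l" by (auto simp: H.P0_def parabolic_poly_def curve_c_0)
  have X: "X = top_of_set (H.J \<times> ball 0 r)" by (simp add: X_def H.J_def P0)
  have psi: "model_map P a = H.model.psi a" for a
  proof
    show "model_map P a w = H.model.psi a w" for w
      unfolding H.model.psi_def
      by (simp add: model_map_def P_def deriv_parabolic_poly parabolic_poly_def curve_c_0 split_beta)
  qed
  show ?thesis
  proof (intro exI[of _ \<epsilon>] conjI[OF \<epsilon>] allI impI)
    fix c a assume *: "(c, a) \<in> param_curve l \<and> 0 < cmod a \<and> cmod a < \<epsilon>"
    then have a: "a \<noteq> 0" "cmod a < \<epsilon>" by auto
    have c: "c = curve_c l (a\<^sup>2)" using * mem_param_curve_iff[OF \<open>l \<noteq> 0\<close>] by (simp add: curve_c_def)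
    show "continuous_map X X (model_map P a) \<and> open_map X X (model_map P a) \<and>
      inj_on (model_map P a) (topspace X) \<and>
      (\<exists>\<Phi>. homeomorphic_map X (top_of_set (J_plus c a \<inter> V)) \<Phi> \<and>
         (\<forall>w\<in>topspace X. henon c a (\<Phi> w) = \<Phi> (model_map P a w)) \<and>
         (\<exists>\<Phi>'. homeomorphic_map (ind_lim X (model_map P a)) (top_of_set (J_plus c a)) \<Phi>' \<and>
               (\<forall>w\<in>topspace X. \<Phi>' (ind_lim_class X (model_map P a) (w, 0)) = \<Phi> w) \<and>
               (\<forall>C\<in>topspace (ind_lim X (model_map P a)).
                  henon c a (\<Phi>' C) = \<Phi>' (ind_lim_map X (model_map P a) C))))"
      unfolding X V_def psi c
      by (rule H.henon_model) (use a small[OF a] \<open>r > 3\<close> R in auto)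
  qed
qed

end
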